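(* Let $V$ be a strongly graded Möbius (or conformal) vertex algebra and let $W_1,W_2,W_3$ be strongly graded generalized $V$-modules. Let $\mathcal{Y}$ be a grading-compatible logarithmic intertwining operator of type $\binom{W_3}{W_1\,W_2}$ and let $r\in\mathbb{Z}$. Define the $r$-contragredient operator $A_r(\mathcal{Y})$ of $\mathcal{Y}$ to be the linear map $$W_1\otimes W_3'\to W_2'\{x\}[[\log x]],\qquad w_{(1)}\otimes w'_{(3)}\mapsto A_r(\mathcal{Y})(w_{(1)},x)w'_{(3)},$$ given by $$\langle A_r(\mathcal{Y})(w_{(1)},x)w'_{(3)},w_{(2)}\rangle_{W_2}=\big\langle w'_{(3)},\mathcal{Y}\big(e^{xL(1)}e^{(2r+1)\pi iL(0)}(x^{-L(0)})^2w_{(1)},x^{-1}\big)w_{(2)}\big\rangle_{W_3}$$ for $w_{(1)}\in W_1$, $w_{(2)}\in W_2$, $w'_{(3)}\in W_3'$. Then $A_r(\mathcal{Y})$ is a grading-compatible logarithmic intertwining operator of type $\binom{W_2'}{W_1\,W_3'}$. Moreover (identifying $W_2''$ with $W_2$ and $W_3''$ with $W_3$), $$A_{-r-1}(A_r(\mathcal{Y}))=A_r(A_{-r-1}(\mathcal{Y}))=\mathcal{Y}.$$ In particular, the correspondence $\mathcal{Y}\mapsto A_r(\mathcal{Y})$ defines a linear isomorphism from $\mathcal{V}^{W_3}_{W_1\,W_2}$ to $\mathcal{V}^{W_2'}_{W_1\,W_3'}$, and $$N^{W_3}_{W_1\,W_2}=N^{W_2'}_{W_1\,W_3'}.$$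
   Context: All vector spaces are over $\mathbb{C}$; $\mathbb{N}=\{0,1,2,\dots\}$. Formal variables: $\mathcal{W}\{x\}$ is the space of formal series $\sum_{n\in\mathbb{C}}w_nx^n$, $w_n\in\mathcal{W}$; $\log x$ is a formal variable independent of $x$; $\mathcal{W}[\log x]\{x\}$ is the space of formal series $\sum_{n\in\mathbb{C}}p_nx^n$ with $p_n\in\mathcal{W}[\log x]$; $\frac{d}{dx}$ acts by $\frac{d}{dx}x^n(\log x)^k=nx^{n-1}(\log x)^k+kx^{n-1}(\log x)^{k-1}$, extended to formal sums. $\delta(x)=\sum_{n\in\mathbb{Z}}x^n$, and powers of binomials are expanded in nonnegative integral powers of the second term. Conformal vertex algebra: a $\mathbb{Z}$-graded space $V=\bigoplus_{n\in\mathbb{Z}}V_{(n)}$ with a linear map $V\otimes V\to V[[x,x^{-1}]]$, $u\otimes v\mapsto Y(u,x)v=\sum_{n\in\mathbb{Z}}u_nv\,x^{-n-1}$, a vacuum $\mathbf{1}\in V_{(0)}$ and a conformal vector $\omega\in V_{(2)}$, such that: $u_nv=0$ for $n$ sufficiently large; $Y(\mathbf{1},x)=1$; $Y(v,x)\mathbf{1}\in V[[x]]$ with constant term $v$; the Jacobi identity holds; the operators $L(n)$ given by $Y(\omega,x)=\sum_nL(n)x^{-n-2}$ satisfy the Virasoro relations (for some central charge); $L(0)v=nv$ for $v\in V_{(n)}$; $Y(L(-1)v,x)=\frac{d}{dx}Y(v,x)$. Möbius vertex algebra: the same, except that instead of $\omega$ one has operators $L(-1),L(0),L(1)$ on $V$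 giving a representation of $\mathfrak{sl}(2)$ ($[L(0),L(\pm1)]=\mp L(\pm1)$, $[L(1),L(-1)]=2L(0)$) with $[L(j),Y(v,x)]=\sum_{i=0}^{j+1}\binom{j+1}{i}x^iY(L(j-i)v,x)$ for $j=-1,0,1$, together with the $L(0)$-grading and $L(-1)$-derivative properties. Generalized $V$-module: a $\mathbb{C}$-graded space $W=\bigoplus_{n\in\mathbb{C}}W_{[n]}$ with a linear map $V\otimes W\to W[[x,x^{-1}]]$, $v\otimes w\mapsto Y_W(v,x)w=\sum_nv_nw\,x^{-n-1}$ (and, in the Möbius case, an $\mathfrak{sl}(2)$-action by $L(-1),L(0),L(1)$ on $W$; in the conformal case $L(n)$ comes from $Y_W(\omega,x)$), satisfying all the axioms above that make sense (lower truncation, $Y_W(\mathbf{1},x)=1$, Jacobi identity, Virasoro relations resp. $\mathfrak{sl}(2)$-bracket relations, $L(-1)$-derivative property), except that the $L(0)$-grading property is: for $w\in W_{[n]}$, $(L(0)-n)^Nw=0$ for $N$ sufficiently large (depending on $w$). Logarithmic intertwining operator of type $\binom{W_3}{W_1\,W_2}$ (for generalized modules $(W_i,Y_i)$): a linear map $\mathcal{Y}(\cdot,x)\cdot:W_1\otimes W_2\to W_3[\log x]\{x\}$, $$\mathcal{Y}(w_{(1)},x)w_{(2)}=\sum_{n\in\mathbb{C}}\sum_{k\in\mathbb{N}}{w_{(1)}}^{\mathcal{Y}}_{n;\,k}w_{(2)}\,x^{-n-1}(\log x)^k,$$ such that: (lower truncation) for all $w_{(1)},w_{(2)}$ and $n\in\mathbb{C}$,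 ${w_{(1)}}^{\mathcal{Y}}_{n+m;\,k}w_{(2)}=0$ for $m\in\mathbb{N}$ sufficiently large, independently of $k$; (Jacobi identity) for $v\in V$, $$x_0^{-1}\delta\Big(\tfrac{x_1-x_2}{x_0}\Big)Y_3(v,x_1)\mathcal{Y}(w_{(1)},x_2)w_{(2)}-x_0^{-1}\delta\Big(\tfrac{x_2-x_1}{-x_0}\Big)\mathcal{Y}(w_{(1)},x_2)Y_2(v,x_1)w_{(2)}=x_2^{-1}\delta\Big(\tfrac{x_1-x_0}{x_2}\Big)\mathcal{Y}(Y_1(v,x_0)w_{(1)},x_2)w_{(2)};$$ ($L(-1)$-derivative property) $\mathcal{Y}(L(-1)w_{(1)},x)=\frac{d}{dx}\mathcal{Y}(w_{(1)},x)$; and ($\mathfrak{sl}(2)$-bracket relations) $[L(j),\mathcal{Y}(w_{(1)},x)]=\sum_{i=0}^{j+1}\binom{j+1}{i}x^i\mathcal{Y}(L(j-i)w_{(1)},x)$ for $j=-1,0,1$. Strong gradedness: let $A$ be an abelian subgroup of an abelian group $\tilde A$. $V$ is strongly graded (with respect to $A$) if it has a second grading $V=\bigoplus_{\alpha\in A}V^{(\alpha)}$ compatible with the first ($V^{(\alpha)}=\bigoplus_nV^{(\alpha)}_{(n)}$, $V^{(\alpha)}_{(n)}=V^{(\alpha)}\cap V_{(n)}$) such that for $\alpha,\beta\in A$: $V^{(\alpha)}_{(n)}=0$ for $n$ sufficiently negative; $\dim V^{(\alpha)}_{(n)}<\infty$; $\mathbf{1}\in V^{(0)}_{(0)}$;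 $v_lV^{(\beta)}\subset V^{(\alpha+\beta)}$ for $v\in V^{(\alpha)}$, $l\in\mathbb{Z}$; and $L(j)V^{(\alpha)}\subset V^{(\alpha)}$ for $j=0,\pm1$ (in the conformal case $\omega\in V^{(0)}_{(2)}$). A generalized module $W$ is strongly graded (with respect to $\tilde A$) if it has a compatible second grading $W=\bigoplus_{\beta\in\tilde A}W^{(\beta)}$, with $W^{(\beta)}_{[n]}=W^{(\beta)}\cap W_{[n]}$, such that for $\alpha\in A,\beta\in\tilde A,n\in\mathbb{C}$: $W^{(\beta)}_{[n+k]}=0$ for $k\in\mathbb{Z}$ sufficiently negative; $\dim W^{(\beta)}_{[n]}<\infty$; $v_lW^{(\beta)}\subset W^{(\alpha+\beta)}$ for $v\in V^{(\alpha)}$, $l\in\mathbb{Z}$; $L(j)W^{(\beta)}\subset W^{(\beta)}$ for $j=0,\pm1$. All of $V,W_1,W_2,W_3$ are strongly graded with the same $A,\tilde A$. A logarithmic intertwining operator $\mathcal{Y}$ is grading-compatible if ${w_{(1)}}^{\mathcal{Y}}_{n;\,k}w_{(2)}\in W_3^{(\beta+\gamma)}$ for all $\beta,\gamma\in\tilde A$, $w_{(1)}\in W_1^{(\beta)}$, $w_{(2)}\in W_2^{(\gamma)}$, $n\in\mathbb{C}$, $k\in\mathbb{N}$. $\mathcal{V}^{W_3}_{W_1\,W_2}$ is the vector space of grading-compatible logarithmic intertwining operators of type $\binom{W_3}{W_1\,W_2}$, and $N^{W_3}_{W_1\,W_2}=\dim\mathcal{V}^{W_3}_{W_1\,W_2}$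 (the fusion rule). Contragredient module: for a strongly graded generalized module $W$, $W'=\bigoplus_{\beta\in\tilde A}\bigoplus_{n\in\mathbb{C}}(W')^{(\beta)}_{[n]}\subset W^*$ with $(W')^{(\beta)}_{[n]}=(W^{(-\beta)}_{[n]})^*$ (functionals extended by zero on the other bigraded components). It is a strongly graded generalized $V$-module with $\langle Y'(v,x)w',w\rangle=\langle w',Y_W(e^{xL(1)}(-x^{-2})^{L(0)}v,x^{-1})w\rangle$ and $\langle L'(j)w',w\rangle=\langle w',L(-j)w\rangle$ for $j=-1,0,1$; the natural map identifies $W''$ with $W$. $\langle\cdot,\cdot\rangle_{W_i}$ is the natural pairing between $W_i'$ and $W_i$. Operators on a generalized module $W$: for $w\in W_{[n]}$, $x^{\pm L(0)}w=x^{\pm n}e^{\pm\log x\,(L(0)-n)}w$ and, for $a\in\mathbb{C}$, $e^{aL(0)}w=e^{an}e^{a(L(0)-n)}w$ (the exponential series in $L(0)-n$ terminate), extended linearly; $e^{xL(1)}=\sum_{k\ge0}\frac{x^k}{k!}L(1)^k$ ($L(1)$ is locally nilpotent on strongly graded modules). For $f(x)=\sum_{n\in\mathbb{C},m\in\mathbb{N}}w_{n,m}x^n(\log x)^m$, $f(x^{-1})=\sum_{n,m}w_{n,m}x^{-n}(-\log x)^m$. *)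

theory Defs
  imports
    Complex_Main
    "HOL-Library.Function_Algebras"
    "HOL-Library.Product_Plus"
    "HOL-Library.Groups_Big_Fun"
begin

class complex_vector = ab_group_add +
  fixes scaleC :: "complex \<Rightarrow> 'a \<Rightarrow> 'a" (infixr "*\<^sub>C" 75)
  assumes scaleC_add_right: "c *\<^sub>C (x + y) = c *\<^sub>C x + c *\<^sub>C y"
    and scaleC_add_left: "(c + d) *\<^sub>C x = c *\<^sub>C x + d *\<^sub>C x"
    and scaleC_scaleC: "c *\<^sub>C d *\<^sub>C x = (c * d) *\<^sub>C x"
    and scaleC_one: "1 *\<^sub>C x = x"

global_interpretation cvec: vector_space "scaleC :: complex \<Rightarrow> 'a \<Rightarrow> 'a::complex_vector"
  by unfold_locales
    (simp_all add: scaleC_add_right scaleC_add_left scaleC_scaleC scaleC_one)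

instantiation complex :: complex_vector
begin
definition scaleC_complex :: "complex \<Rightarrow> complex \<Rightarrow> complex"
  where "scaleC_complex c z = c * z"
instance
  by standard (simp_all add: scaleC_complex_def algebra_simps)
end

instantiation "fun" :: (type, complex_vector) complex_vector
begin
definition scaleC_fun :: "complex \<Rightarrow> ('a \<Rightarrow> 'b) \<Rightarrow> 'a \<Rightarrow> 'b"
  where "scaleC_fun c f = (\<lambda>x. c *\<^sub>C f x)"
instance
  by standard (simp_all add: scaleC_fun_def fun_eq_iff scaleC_add_right scaleC_add_left
      scaleC_scaleC scaleC_one)
end

definition clinear_on :: "'a set \<Rightarrow> 'b set \<Rightarrow> ('a::complex_vector \<Rightarrow> 'b::complex_vector) \<Rightarrow> bool"
  where "clinear_on S T f \<longleftrightarrow>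
    (\<forall>x\<in>S. f x \<in> T) \<and>
    (\<forall>x\<in>S. \<forall>y\<in>S. f (x + y) = f x + f y) \<and>
    (\<forall>c. \<forall>x\<in>S. f (c *\<^sub>C x) = c *\<^sub>C f x)"

definition finite_dimensional :: "'a::complex_vector set \<Rightarrow> bool"
  where "finite_dimensional S \<longleftrightarrow> (\<exists>B. finite B \<and> cvec.span B = S)"

text \<open>The dimension is a cardinal (the cardinality of a basis), so that infinite-dimensional
  spaces are not conflated with the zero space as they would be by \<^const>\<open>cvec.dim\<close>.\<close>

definition cardinal_dim :: "'a::complex_vector set \<Rightarrow> 'a rel"
  where "cardinal_dim S =
    card_of (SOME B. B \<subseteq> S \<and> cvec.independent B \<and> cvec.span B = S)"

definition graded_families :: "'i set \<Rightarrow> ('i \<Rightarrow> 'a::complex_vector set) \<Rightarrow> ('i \<Rightarrow> 'a) set"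
  where "graded_families I G =
    {f. finite {i. f i \<noteq> 0} \<and> (\<forall>i\<in>I. f i \<in> G i) \<and> (\<forall>i. i \<notin> I \<longrightarrow> f i = 0)}"

definition is_direct_sum :: "'i set \<Rightarrow> ('i \<Rightarrow> 'a::complex_vector set) \<Rightarrow> 'a set \<Rightarrow> bool"
  where "is_direct_sum I G S \<longleftrightarrow>
    (\<forall>i\<in>I. cvec.subspace (G i)) \<and> bij_betw Sum_any (graded_families I G) S"

definition homogeneous_component :: "('i \<Rightarrow> 'a::complex_vector set) \<Rightarrow> 'a \<Rightarrow> 'i \<Rightarrow> 'a"
  where "homogeneous_component G = inv_into (graded_families UNIV G) Sum_any"

text \<open>A series in \<open>W[[x, x^(-1)]]\<close> is its coefficient function \<open>int \<Rightarrow> 'w\<close>; a series in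
  \<open>W{x}[[log x]]\<close> is its coefficient function \<open>complex \<times> nat \<Rightarrow> 'w\<close>, the value at \<open>(n, k)\<close> being
  the coefficient of \<open>x^n (log x)^k\<close>. Arguments are exponents, so the mode \<open>u_n v\<close>, which is the
  coefficient of \<open>x^(-n-1)\<close>, is found at \<open>-n-1\<close>.

  Infinite sums below are \<^const>\<open>Sum_any\<close>, the sum of a finitely supported family; it is \<open>0\<close> on
  families with infinite support, which do not arise under the axioms imposed below.\<close>

type_synonym 'w log_series = "complex \<times> nat \<Rightarrow> 'w"

text \<open>Coefficientwise application of a series-valued operator \<open>T(x)\<close> to a series \<open>f(x)\<close>.\<close>

definition apply_series ::
  "('a \<Rightarrow> 'e::comm_monoid_add \<Rightarrow> 'b) \<Rightarrow> ('e \<Rightarrow> 'a) \<Rightarrow> 'e \<Rightarrow> 'b::complex_vector"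
  where "apply_series T f e = Sum_any (\<lambda>(i, j). if i + j = e then T (f i) j else 0)"

definition invert_x :: "(int \<Rightarrow> 'w) \<Rightarrow> int \<Rightarrow> 'w"
  where "invert_x f n = f (- n)"

definition invert_x_log :: "'w::complex_vector log_series \<Rightarrow> 'w log_series"
  where "invert_x_log f = (\<lambda>(n, k). (-1) ^ k *\<^sub>C f (- n, k))"

definition deriv_log :: "'w::complex_vector log_series \<Rightarrow> 'w log_series"
  where "deriv_log f =
    (\<lambda>(n, k). (n + 1) *\<^sub>C f (n + 1, k) + of_nat (Suc k) *\<^sub>C f (n + 1, Suc k))"

text \<open>The coefficient of \<open>z0^a z1^b z2^c\<close> in
  \<open>z0^(-1) \<delta>((z1 - z2)/z0) = (\<Sum>n. z0^(-n-1) (z1 - z2)^n)\<close>, where \<open>(z1 - z2)^n\<close> is expanded in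
  nonnegative powers of \<open>z2\<close>; necessarily \<open>n = - a - 1 = b + c\<close>.\<close>

definition delta_coeff :: "int \<Rightarrow> int \<Rightarrow> int \<Rightarrow> complex"
  where "delta_coeff a b c =
    (if 0 \<le> c \<and> a + b + c = - 1
     then (-1) ^ nat c * (of_int (b + c) gchoose nat c) else 0)"

text \<open>Equality of the coefficients of \<open>x0^p x1^q x2^s\<close> on both sides of the Jacobi identity. The
  sums run over the exponents contributed by the delta function. In the second term the delta
  function is \<open>x0^(-1) \<delta>((x2 - x1)/(-x0))\<close>, whose coefficient of \<open>x0^p\<close> carries the extra sign
  \<open>(-1)^(-p-1) = (-1)^(p+1)\<close>. The exponents of \<open>x2\<close> are integers for vertex algebras and modules
  and complex numbers for intertwining operators.\<close>

definition jacobi_identity ::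
  "('v \<Rightarrow> 'a \<Rightarrow> int \<Rightarrow> 'a) \<Rightarrow> ('v \<Rightarrow> 'b \<Rightarrow> int \<Rightarrow> 'b) \<Rightarrow> ('v \<Rightarrow> 'c \<Rightarrow> int \<Rightarrow> 'c) \<Rightarrow>
   ('a \<Rightarrow> 'b \<Rightarrow> 'e::ring_1 \<Rightarrow> 'c::complex_vector) \<Rightarrow> 'v \<Rightarrow> 'a \<Rightarrow> 'b \<Rightarrow> bool"
  where "jacobi_identity Y1 Y2 Y3 \<Y> v w1 w2 \<longleftrightarrow> (\<forall>p q s.
    Sum_any (\<lambda>(b, c). delta_coeff p b c *\<^sub>C Y3 v (\<Y> w1 w2 (s - of_int c)) (q - b))
    - Sum_any (\<lambda>(b, c). ((-1) powi (p + 1) * delta_coeff p c b) *\<^sub>C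
        \<Y> w1 (Y2 v w2 (q - b)) (s - of_int c))
    = Sum_any (\<lambda>(a, c). delta_coeff c q a *\<^sub>C \<Y> (Y1 v w1 (p - a)) w2 (s - of_int c)))"

text \<open>The relations \<open>[L(j), \<Y>(a, x)] = (\<Sum>i\<le>j+1. (j+1 choose i) x^i \<Y>(L(j-i) a, x))\<close>,
  \<open>j = -1, 0, 1\<close>, applied to \<open>b\<close>.\<close>

definition sl2_bracket ::
  "(int \<Rightarrow> 'a \<Rightarrow> 'a) \<Rightarrow> (int \<Rightarrow> 'b \<Rightarrow> 'b) \<Rightarrow> (int \<Rightarrow> 'c \<Rightarrow> 'c) \<Rightarrow>
   ('a \<Rightarrow> 'b \<Rightarrow> 'e::ring_1 \<Rightarrow> 'c::complex_vector) \<Rightarrow> 'a \<Rightarrow> 'b \<Rightarrow> bool"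
  where "sl2_bracket L1 L2 L3 \<Y> a b \<longleftrightarrow> (\<forall>j\<in>{-1, 0, 1}. \<forall>n.
    L3 j (\<Y> a b n) - \<Y> a (L2 j b) n =
    (\<Sum>i\<le>nat (j + 1). of_nat (nat (j + 1) choose i) *\<^sub>C \<Y> (L1 (j - int i) a) b (n - of_nat i)))"

definition sl2_relations :: "'w set \<Rightarrow> (int \<Rightarrow> 'w \<Rightarrow> 'w::complex_vector) \<Rightarrow> bool"
  where "sl2_relations S L \<longleftrightarrow> (\<forall>w\<in>S.
    L 0 (L 1 w) - L 1 (L 0 w) = - L 1 w \<and>
    L 0 (L (-1) w) - L (-1) (L 0 w) = L (-1) w \<and>
    L 1 (L (-1) w) - L (-1) (L 1 w) = 2 *\<^sub>C L 0 w)"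

definition virasoro_relations ::
  "'w set \<Rightarrow> (int \<Rightarrow> 'w \<Rightarrow> 'w::complex_vector) \<Rightarrow> complex \<Rightarrow> bool"
  where "virasoro_relations S L c \<longleftrightarrow> (\<forall>w\<in>S. \<forall>m n.
    L m (L n w) - L n (L m w) =
    of_int (m - n) *\<^sub>C L (m + n) w
    + (if m + n = 0 then (of_int (m ^ 3 - m) / 12 * c) *\<^sub>C w else 0))"

text \<open>The vertex algebra is the whole type \<open>'v\<close>, and the group indexing the second gradings is the
  whole type \<open>'g\<close>. If \<open>conformal_vector\<close> is \<open>Some \<omega>\<close>, the structure is a conformal vertex algebra
  and the operators \<open>L(n)\<close> are required to be those given by \<open>\<omega>\<close>; if it is \<open>None\<close>, it is a
  Moebius vertex algebra and only \<open>L(-1), L(0), L(1)\<close> are meaningful.\<close>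

record ('v, 'g) vertex_structure =
  vertex_op :: "'v \<Rightarrow> 'v \<Rightarrow> int \<Rightarrow> 'v"
  vacuum :: 'v
  conformal_vector :: "'v option"
  L_alg :: "int \<Rightarrow> 'v \<Rightarrow> 'v"
  weight_alg :: "int \<Rightarrow> 'v set"
  grade_alg :: "'g \<Rightarrow> 'v set"

definition vertex_algebra :: "('v::complex_vector, 'g) vertex_structure \<Rightarrow> bool"
  where "vertex_algebra V \<longleftrightarrow>
    is_direct_sum UNIV (weight_alg V) UNIV \<and>
    (\<forall>u n. clinear_on UNIV UNIV (\<lambda>v. vertex_op V u v n)) \<and>
    (\<forall>v n. clinear_on UNIV UNIV (\<lambda>u. vertex_op V u v n)) \<and>
    (\<forall>u v. \<exists>N. \<forall>n<N. vertex_op V u v n = 0) \<and>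
    vacuum V \<in> weight_alg V 0 \<and>
    (\<forall>v n. vertex_op V (vacuum V) v n = (if n = 0 then v else 0)) \<and>
    (\<forall>v. (\<forall>n<0. vertex_op V v (vacuum V) n = 0) \<and> vertex_op V v (vacuum V) 0 = v) \<and>
    (\<forall>u v w. jacobi_identity (vertex_op V) (vertex_op V) (vertex_op V) (vertex_op V) u v w) \<and>
    (\<forall>n. \<forall>v\<in>weight_alg V n. L_alg V 0 v = of_int n *\<^sub>C v) \<and>
    (\<forall>u v n. vertex_op V (L_alg V (-1) u) v n = of_int (n + 1) *\<^sub>C vertex_op V u v (n + 1)) \<and>
    (case conformal_vector V of
      None \<Rightarrow>
        (\<forall>j\<in>{-1, 0, 1}. clinear_on UNIV UNIV (L_alg V j)) \<and>
        sl2_relations UNIV (L_alg V) \<and>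
        (\<forall>u v. sl2_bracket (L_alg V) (L_alg V) (L_alg V) (vertex_op V) u v)
    | Some \<omega> \<Rightarrow>
        \<omega> \<in> weight_alg V 2 \<and>
        (\<forall>n v. L_alg V n v = vertex_op V \<omega> v (- n - 2)) \<and>
        (\<exists>c. virasoro_relations UNIV (L_alg V) c))"

definition strongly_graded_vertex_algebra ::
  "'g::ab_group_add set \<Rightarrow> ('v::complex_vector, 'g) vertex_structure \<Rightarrow> bool"
  where "strongly_graded_vertex_algebra A V \<longleftrightarrow>
    vertex_algebra V \<and>
    is_direct_sum A (grade_alg V) UNIV \<and>
    (\<forall>\<alpha>\<in>A. is_direct_sum UNIV (\<lambda>n. grade_alg V \<alpha> \<inter> weight_alg V n) (grade_alg V \<alpha>)) \<and>
    (\<forall>\<alpha>\<in>A. \<exists>N. \<forall>n<N. grade_alg V \<alpha> \<inter> weight_alg V n = {0}) \<and>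
    (\<forall>\<alpha>\<in>A. \<forall>n. finite_dimensional (grade_alg V \<alpha> \<inter> weight_alg V n)) \<and>
    vacuum V \<in> grade_alg V 0 \<inter> weight_alg V 0 \<and>
    (\<forall>\<alpha>\<in>A. \<forall>\<beta>\<in>A. \<forall>u\<in>grade_alg V \<alpha>. \<forall>v\<in>grade_alg V \<beta>. \<forall>n.
      vertex_op V u v n \<in> grade_alg V (\<alpha> + \<beta>)) \<and>
    (\<forall>\<alpha>\<in>A. \<forall>j\<in>{-1, 0, 1}. L_alg V j ` grade_alg V \<alpha> \<subseteq> grade_alg V \<alpha>) \<and>
    (\<forall>\<omega>. conformal_vector V = Some \<omega> \<longrightarrow> \<omega> \<in> grade_alg V 0 \<inter> weight_alg V 2)"

text \<open>Modules have an explicit carrier inside the type \<open>'w\<close>, because contragredient modules are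
  subspaces of dual spaces. The operations are constrained on the carrier only.\<close>

record ('v, 'w, 'g) module_structure =
  mspace :: "'w set"
  module_op :: "'v \<Rightarrow> 'w \<Rightarrow> int \<Rightarrow> 'w"
  L_mod :: "int \<Rightarrow> 'w \<Rightarrow> 'w"
  weight_mod :: "complex \<Rightarrow> 'w set"
  grade_mod :: "'g \<Rightarrow> 'w set"

definition generalized_module ::
  "('v::complex_vector, 'g) vertex_structure \<Rightarrow>
   ('v, 'w::complex_vector, 'g) module_structure \<Rightarrow> bool"
  where "generalized_module V W \<longleftrightarrow>
    cvec.subspace (mspace W) \<and>
    is_direct_sum UNIV (weight_mod W) (mspace W) \<and>
    (\<forall>v n. clinear_on (mspace W) (mspace W) (\<lambda>w. module_op W v w n)) \<and>
    (\<forall>w\<in>mspace W. \<forall>n. clinear_on UNIV (mspace W) (\<lambda>v. module_op W v w n)) \<and>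
    (\<forall>v. \<forall>w\<in>mspace W. \<exists>N. \<forall>n<N. module_op W v w n = 0) \<and>
    (\<forall>w\<in>mspace W. \<forall>n. module_op W (vacuum V) w n = (if n = 0 then w else 0)) \<and>
    (\<forall>u v. \<forall>w\<in>mspace W.
      jacobi_identity (vertex_op V) (module_op W) (module_op W) (module_op W) u v w) \<and>
    (\<forall>n. \<forall>w\<in>weight_mod W n. \<exists>N. \<forall>M\<ge>N. ((\<lambda>u. L_mod W 0 u - n *\<^sub>C u) ^^ M) w = 0) \<and>
    (\<forall>v. \<forall>w\<in>mspace W. \<forall>n.
      module_op W (L_alg V (-1) v) w n = of_int (n + 1) *\<^sub>C module_op W v w (n + 1)) \<and>
    (case conformal_vector V of
      None \<Rightarrow>
        (\<forall>j\<in>{-1, 0, 1}. clinear_on (mspace W) (mspace W) (L_mod W j)) \<and>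
        sl2_relations (mspace W) (L_mod W) \<and>
        (\<forall>v. \<forall>w\<in>mspace W. sl2_bracket (L_alg V) (L_mod W) (L_mod W) (module_op W) v w)
    | Some \<omega> \<Rightarrow>
        (\<forall>n. \<forall>w\<in>mspace W. L_mod W n w = module_op W \<omega> w (- n - 2)) \<and>
        (\<exists>c. virasoro_relations UNIV (L_alg V) c \<and> virasoro_relations (mspace W) (L_mod W) c))"

definition strongly_graded_module ::
  "'g::ab_group_add set \<Rightarrow> ('v::complex_vector, 'g) vertex_structure \<Rightarrow>
   ('v, 'w::complex_vector, 'g) module_structure \<Rightarrow> bool"
  where "strongly_graded_module A V W \<longleftrightarrow>
    generalized_module V W \<and>
    is_direct_sum UNIV (grade_mod W) (mspace W) \<and>
    (\<forall>\<beta>. is_direct_sum UNIV (\<lambda>n. grade_mod W \<beta> \<inter> weight_mod W n) (grade_mod W \<beta>)) \<and>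
    (\<forall>\<beta> n. \<exists>K. \<forall>k<K. grade_mod W \<beta> \<inter> weight_mod W (n + of_int k) = {0}) \<and>
    (\<forall>\<beta> n. finite_dimensional (grade_mod W \<beta> \<inter> weight_mod W n)) \<and>
    (\<forall>\<alpha>\<in>A. \<forall>\<beta>. \<forall>v\<in>grade_alg V \<alpha>. \<forall>w\<in>grade_mod W \<beta>. \<forall>n.
      module_op W v w n \<in> grade_mod W (\<alpha> + \<beta>)) \<and>
    (\<forall>\<beta>. \<forall>j\<in>{-1, 0, 1}. L_mod W j ` grade_mod W \<beta> \<subseteq> grade_mod W \<beta>)"

definition is_subgroup :: "'g::ab_group_add set \<Rightarrow> bool"
  where "is_subgroup A \<longleftrightarrow> 0 \<in> A \<and> (\<forall>a\<in>A. \<forall>b\<in>A. a + b \<in> A) \<and> (\<forall>a\<in>A. - a \<in> A)"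

text \<open>\<open>exp(x L(1)) v\<close> and \<open>(-x^(-2))^L(0) v\<close> for \<open>v \<in> V\<close>; the latter is \<open>(-1)^n x^(-2n) v\<close> for
  \<open>v\<close> of weight \<open>n\<close>.\<close>

definition exp_xL1_alg :: "('v::complex_vector, 'g) vertex_structure \<Rightarrow> 'v \<Rightarrow> int \<Rightarrow> 'v"
  where "exp_xL1_alg V v n =
    (if 0 \<le> n then (1 / fact (nat n)) *\<^sub>C (L_alg V 1 ^^ nat n) v else 0)"

definition neg_x_power_L0_alg :: "('v::complex_vector, 'g) vertex_structure \<Rightarrow> 'v \<Rightarrow> int \<Rightarrow> 'v"
  where "neg_x_power_L0_alg V v p =
    Sum_any (\<lambda>n. if p = - 2 * n then (-1) powi n *\<^sub>C homogeneous_component (weight_alg V) v n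
                 else 0)"

text \<open>Functionals on a carrier are functions that vanish outside it; the pairing of \<open>f\<close> and \<open>w\<close> is
  \<open>f w\<close>.\<close>

definition dual_component ::
  "('v, 'w::complex_vector, 'g::ab_group_add) module_structure \<Rightarrow> 'g \<Rightarrow> complex \<Rightarrow>
   ('w \<Rightarrow> complex) set"
  where "dual_component W \<beta> n =
    {f. clinear_on (mspace W) UNIV f \<and> (\<forall>w. w \<notin> mspace W \<longrightarrow> f w = 0) \<and>
        (\<forall>\<gamma> m. (\<gamma>, m) \<noteq> (- \<beta>, n) \<longrightarrow> (\<forall>w\<in>grade_mod W \<gamma> \<inter> weight_mod W m. f w = 0))}"

definition contragredient ::
  "('v::complex_vector, 'g::ab_group_add) vertex_structure \<Rightarrow>
   ('v, 'w::complex_vector, 'g) module_structure \<Rightarrow>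
   ('v, 'w \<Rightarrow> complex, 'g) module_structure"
  where "contragredient V W =
    \<lparr> mspace = cvec.span (\<Union>\<beta> n. dual_component W \<beta> n),
      module_op = (\<lambda>v f n w. if w \<in> mspace W
        then f (apply_series (\<lambda>u. invert_x (module_op W u w))
                 (apply_series (exp_xL1_alg V) (neg_x_power_L0_alg V v)) n)
        else 0),
      L_mod = (\<lambda>j f w. if w \<in> mspace W then f (L_mod W (- j) w) else 0),
      weight_mod = (\<lambda>n. cvec.span (\<Union>\<beta>. dual_component W \<beta> n)),
      grade_mod = (\<lambda>\<beta>. cvec.span (\<Union>n. dual_component W \<beta> n)) \<rparr>"

text \<open>The natural map \<open>W \<rightarrow> W''\<close>.\<close>

definition to_bidual ::
  "('v::complex_vector, 'g::ab_group_add) vertex_structure \<Rightarrow>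
   ('v, 'w::complex_vector, 'g) module_structure \<Rightarrow> 'w \<Rightarrow> ('w \<Rightarrow> complex) \<Rightarrow> complex"
  where "to_bidual V W w = (\<lambda>f. if f \<in> mspace (contragredient V W) then f w else 0)"

text \<open>\<open>\<Y> w1 w2 (n, k)\<close> is the coefficient of \<open>x^n (log x)^k\<close> in \<open>\<Y>(w1, x) w2\<close>. Outside the
  carriers \<open>\<Y>\<close> is zero, so that two operators are equal iff they are equal as functions.\<close>

definition log_intertwining_operator ::
  "('v::complex_vector, 'g) vertex_structure \<Rightarrow>
   ('v, 'a::complex_vector, 'g) module_structure \<Rightarrow>
   ('v, 'b::complex_vector, 'g) module_structure \<Rightarrow>
   ('v, 'c::complex_vector, 'g) module_structure \<Rightarrow>
   ('a \<Rightarrow> 'b \<Rightarrow> 'c log_series) \<Rightarrow> bool"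
  where "log_intertwining_operator V W1 W2 W3 \<Y> \<longleftrightarrow>
    (\<forall>w1 w2. w1 \<notin> mspace W1 \<or> w2 \<notin> mspace W2 \<longrightarrow> \<Y> w1 w2 = 0) \<and>
    (\<forall>w1\<in>mspace W1. \<forall>e. clinear_on (mspace W2) (mspace W3) (\<lambda>w2. \<Y> w1 w2 e)) \<and>
    (\<forall>w2\<in>mspace W2. \<forall>e. clinear_on (mspace W1) (mspace W3) (\<lambda>w1. \<Y> w1 w2 e)) \<and>
    (\<forall>w1\<in>mspace W1. \<forall>w2\<in>mspace W2.
      (\<forall>n. finite {k. \<Y> w1 w2 (n, k) \<noteq> 0}) \<and>
      (\<forall>n. \<exists>M. \<forall>m\<ge>M. \<forall>k. \<Y> w1 w2 (n - of_nat m, k) = 0) \<and>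
      (\<forall>v k. jacobi_identity (module_op W1) (module_op W2) (module_op W3)
        (\<lambda>a b n. \<Y> a b (n, k)) v w1 w2) \<and>
      \<Y> (L_mod W1 (-1) w1) w2 = deriv_log (\<Y> w1 w2) \<and>
      (\<forall>k. sl2_bracket (L_mod W1) (L_mod W2) (L_mod W3) (\<lambda>a b n. \<Y> a b (n, k)) w1 w2))"

definition grading_compatible ::
  "('v, 'a, 'g::ab_group_add) module_structure \<Rightarrow> ('v, 'b, 'g) module_structure \<Rightarrow>
   ('v, 'c, 'g) module_structure \<Rightarrow> ('a \<Rightarrow> 'b \<Rightarrow> 'c log_series) \<Rightarrow> bool"
  where "grading_compatible W1 W2 W3 \<Y> \<longleftrightarrow>
    (\<forall>\<beta> \<gamma>. \<forall>w1\<in>grade_mod W1 \<beta>. \<forall>w2\<in>grade_mod W2 \<gamma>. \<forall>e. \<Y> w1 w2 e \<in> grade_mod W3 (\<beta> + \<gamma>))"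

definition intertwining_space ::
  "('v::complex_vector, 'g::ab_group_add) vertex_structure \<Rightarrow>
   ('v, 'a::complex_vector, 'g) module_structure \<Rightarrow>
   ('v, 'b::complex_vector, 'g) module_structure \<Rightarrow>
   ('v, 'c::complex_vector, 'g) module_structure \<Rightarrow>
   ('a \<Rightarrow> 'b \<Rightarrow> 'c log_series) set"
  where "intertwining_space V W1 W2 W3 =
    {\<Y>. log_intertwining_operator V W1 W2 W3 \<Y> \<and> grading_compatible W1 W2 W3 \<Y>}"

definition fusion_rule ::
  "('v::complex_vector, 'g::ab_group_add) vertex_structure \<Rightarrow>
   ('v, 'a::complex_vector, 'g) module_structure \<Rightarrow>
   ('v, 'b::complex_vector, 'g) module_structure \<Rightarrow>
   ('v, 'c::complex_vector, 'g) module_structure \<Rightarrow>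
   ('a \<Rightarrow> 'b \<Rightarrow> 'c log_series) rel"
  where "fusion_rule V W1 W2 W3 = cardinal_dim (intertwining_space V W1 W2 W3)"

text \<open>\<open>exp(x L(1)) w\<close>, \<open>exp(a L(0)) w\<close> and \<open>x^(-L(0)) w\<close> for \<open>w \<in> W\<close>. On the weight space of
  weight \<open>h\<close> the last two are \<open>exp(a h) exp(a (L(0) - h)) w\<close> and
  \<open>x^(-h) exp(- log x (L(0) - h)) w\<close>, so the coefficient of \<open>x^p\<close> in \<open>x^(-L(0)) w\<close> comes from the
  component of weight \<open>-p\<close>.\<close>

definition exp_xL1 ::
  "('v, 'w::complex_vector, 'g) module_structure \<Rightarrow> 'w \<Rightarrow> 'w log_series"
  where "exp_xL1 W w = (\<lambda>(p, k).
    Sum_any (\<lambda>n. if (p, k) = (of_nat n, 0) then (1 / fact n) *\<^sub>C (L_mod W 1 ^^ n) w else 0))"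

definition exp_L0 ::
  "('v, 'w::complex_vector, 'g) module_structure \<Rightarrow> complex \<Rightarrow> 'w \<Rightarrow> 'w"
  where "exp_L0 W a w = Sum_any (\<lambda>h. exp (a * h) *\<^sub>C
    Sum_any (\<lambda>m. (a ^ m / fact m) *\<^sub>C
      ((\<lambda>u. L_mod W 0 u - h *\<^sub>C u) ^^ m) (homogeneous_component (weight_mod W) w h)))"

definition x_neg_L0 ::
  "('v, 'w::complex_vector, 'g) module_structure \<Rightarrow> 'w \<Rightarrow> 'w log_series"
  where "x_neg_L0 W w = (\<lambda>(p, m). ((-1) ^ m / fact m) *\<^sub>C
    ((\<lambda>u. L_mod W 0 u - (- p) *\<^sub>C u) ^^ m) (homogeneous_component (weight_mod W) w (- p)))"

text \<open>\<open>exp(x L(1)) exp((2r+1) \<pi> \<i> L(0)) (x^(-L(0)))^2 w\<close>\<close>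

definition twisted_argument ::
  "int \<Rightarrow> ('v, 'w::complex_vector, 'g) module_structure \<Rightarrow> 'w \<Rightarrow> 'w log_series"
  where "twisted_argument r W w =
    apply_series (exp_xL1 W)
      (\<lambda>e. exp_L0 W (of_int (2 * r + 1) * of_real pi * \<i>)
        (apply_series (x_neg_L0 W) (x_neg_L0 W w) e))"

definition contragredient_operator ::
  "('v::complex_vector, 'g::ab_group_add) vertex_structure \<Rightarrow>
   ('v, 'a::complex_vector, 'g) module_structure \<Rightarrow>
   ('v, 'b::complex_vector, 'g) module_structure \<Rightarrow>
   ('v, 'c::complex_vector, 'g) module_structure \<Rightarrow>
   int \<Rightarrow> ('a \<Rightarrow> 'b \<Rightarrow> 'c log_series) \<Rightarrow> 'a \<Rightarrow> ('c \<Rightarrow> complex) \<Rightarrow> ('b \<Rightarrow> complex) log_series"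
  where "contragredient_operator V W1 W2 W3 r \<Y> w1 f e w2 =
    (if w1 \<in> mspace W1 \<and> f \<in> mspace (contragredient V W3) \<and> w2 \<in> mspace W2
     then f (apply_series (\<lambda>u. invert_x_log (\<Y> u w2)) (twisted_argument r W1 w1) e)
     else 0)"

text \<open>The operator \<open>W1 \<otimes> W2'' \<rightarrow> W3''{x}[[log x]]\<close> corresponding to \<open>\<Y> : W1 \<otimes> W2 \<rightarrow> W3{x}[[log x]]\<close>
  under the identifications of \<open>W2''\<close> with \<open>W2\<close> and of \<open>W3''\<close> with \<open>W3\<close>.\<close>

definition bidual_operator ::
  "('v::complex_vector, 'g::ab_group_add) vertex_structure \<Rightarrow>
   ('v, 'b::complex_vector, 'g) module_structure \<Rightarrow>
   ('v, 'c::complex_vector, 'g) module_structure \<Rightarrow>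
   ('a \<Rightarrow> 'b \<Rightarrow> 'c log_series) \<Rightarrow>
   'a \<Rightarrow> (('b \<Rightarrow> complex) \<Rightarrow> complex) \<Rightarrow> (('c \<Rightarrow> complex) \<Rightarrow> complex) log_series"
  where "bidual_operator V W2 W3 \<Y> w1 \<phi> e =
    (if \<phi> \<in> mspace (contragredient V (contragredient V W2))
     then to_bidual V W3 (\<Y> w1 (inv_into (mspace W2) (to_bidual V W2) \<phi>) e)
     else 0)"

end

theory Submission
  imports Defs "HOL-Computational_Algebra.Formal_Power_Series"
begin

text \<open>
  Substituting a complex number \<open>z\<close> for \<open>log x\<close> turns a finite logarithmic series into a linear
  combination of the functions \<open>exp (n z) z^k\<close>, and these are linearly independent; so identities
  between matrix coefficients of homogeneous vectors may be checked after this substitution. There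
  \<open>exp(x L(1)) exp((2r+1) \<pi> \<i> L(0)) (x^(-L(0)))^2\<close> becomes an honest operator \<open>T(z)\<close> on \<open>W1\<close>, and the
  matrix coefficients of \<open>A_r(Y)\<close> at \<open>z\<close> are those of \<open>Y(T(z) w, x)\<close> at \<open>-z\<close>. The axioms for \<open>A_r(Y)\<close>
  thus follow from those for \<open>Y\<close> by conjugating \<open>L(j)\<close> and \<open>v_n\<close> with \<open>T(z)\<close>, and \<open>A_(-r-1)\<close> inverts
  \<open>A_r\<close> because the operator \<open>T(-z)\<close> for \<open>r\<close> inverts \<open>T(z)\<close> for \<open>-r-1\<close>.

  The construction uses only a nondegenerate pairing between two graded spaces, symmetric in them.
  Applied to the pairs \<open>(W2, W2')\<close>, \<open>(W3', W3)\<close> it gives \<open>A_r\<close>, and applied to \<open>(W3', W3)\<close>, \<open>(W2, W2')\<close>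
  it gives the inverse map, so that contragredients of \<open>W2'\<close> and \<open>W3'\<close> do not have to be constructed.
\<close>

subsection \<open>Linear maps on subspaces and finitely supported sums\<close>

text \<open>Pairing with homogeneous vectors makes the series finite: L(0) is self-adjoint for the
  pairing, so such a matrix coefficient has one power of x and finitely many powers of log x. Apart
  from the finite series in W1 behind T(z), only scalar series of this kind are evaluated. The hard
  axiom is the Jacobi identity, used in component form with two integers m and n. Replacing x1 by
  its inverse changes m to 2h - i - m - n - 2 for the vector L(1)^i v; the identities of Y for these
  finitely many vectors, suitably weighted, add up to the identity of A_r(Y) for v, with the first
  two terms exchanged. An obstacle is uniformity: after conjugation by T(z) the place where the sums
  stop may depend on z, while linear independence needs one finite identity valid for all z. The
  bounds are therefore read off from the truncation of the operators on the three vectors. The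
  powers of log x in A_r(Y) are bounded by means of a finite spanning set of one bigraded component.
  The number -r-1 is forced by 2(-r-1)+1 = -(2r+1).\<close>

lemma clinear_onD:
  assumes "clinear_on S T f"
  shows "x \<in> S \<Longrightarrow> f x \<in> T" "x \<in> S \<Longrightarrow> y \<in> S \<Longrightarrow> f (x + y) = f x + f y"
    "x \<in> S \<Longrightarrow> f (c *\<^sub>C x) = c *\<^sub>C f x"
  using assms unfolding clinear_on_def by auto

context
  fixes S :: "'a::complex_vector set" and T :: "'b::complex_vector set" and f
  assumes lin: "clinear_on S T f" and sub: "cvec.subspace S"
begin

lemma clinear_on_zero: "f 0 = 0"
proof -
  have "0 \<in> S" using sub by (rule cvec.subspace_0)
  then have "f (0 *\<^sub>C 0) = 0 *\<^sub>C f 0" using clinear_onD(3)[OF lin] by blast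
  then show ?thesis by simp
qed

lemma clinear_on_minus: "x \<in> S \<Longrightarrow> f (- x) = - f x"
  using clinear_onD(3)[OF lin, of x "-1"] by simp

lemma clinear_on_diff: "x \<in> S \<Longrightarrow> y \<in> S \<Longrightarrow> f (x - y) = f x - f y"
  using clinear_onD(2)[OF lin, of x "-y"] clinear_on_minus[of y] cvec.subspace_neg[OF sub, of y]
  by simp

lemma clinear_on_sum: "(\<And>i. i \<in> I \<Longrightarrow> g i \<in> S) \<Longrightarrow> f (sum g I) = (\<Sum>i\<in>I. f (g i))"
proof (induction I rule: infinite_finite_induct)
  case (insert i I)
  then have "sum g I \<in> S" by (intro cvec.subspace_sum[OF sub]) auto
  then show ?case using insert clinear_onD(2)[OF lin, of "g i" "sum g I"] by simp
qed (simp_all add: clinear_on_zero)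

lemma clinear_on_Sum_any:
  assumes "finite {i. g i \<noteq> 0}" "\<And>i. g i \<in> S"
  shows "f (Sum_any g) = Sum_any (\<lambda>i. f (g i))"
proof -
  have "Sum_any (\<lambda>i. f (g i)) = (\<Sum>i\<in>{i. g i \<noteq> 0}. f (g i))"
    by (rule Sum_any.expand_superset) (use assms in \<open>auto simp: clinear_on_zero\<close>)
  then show ?thesis using assms by (simp add: Sum_any.expand_set clinear_on_sum)
qed

end

lemma Sum_any_in_subspace:
  assumes "cvec.subspace S" "\<And>i. g i \<in> S"
  shows "Sum_any g \<in> S"
  unfolding Sum_any.expand_set by (rule cvec.subspace_sum) (use assms in auto)

lemma Sum_any_eq_sum_lessThan:
  fixes g :: "nat \<Rightarrow> 'a::comm_monoid_add"
  assumes "\<And>i. i \<ge> N \<Longrightarrow> g i = 0"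
  shows "Sum_any g = (\<Sum>i<N. g i)"
  by (rule Sum_any.expand_superset) (use assms not_less in auto)

lemma finite_support_add:
  fixes f g :: "'i \<Rightarrow> 'a::monoid_add"
  assumes "finite {i. f i \<noteq> 0}" "finite {i. g i \<noteq> 0}"
  shows "finite {i. f i + g i \<noteq> 0}"
  by (rule finite_subset[OF _ finite_UnI[OF assms]]) auto

lemma finite_support_scaleC:
  assumes "finite {i. f i \<noteq> 0}"
  shows "finite {i. c i *\<^sub>C f i \<noteq> 0}"
  by (rule finite_subset[OF _ assms]) auto

lemma finite_support_sum:
  assumes "\<And>j. j \<in> J \<Longrightarrow> finite {i. f j i \<noteq> 0}"
  shows "finite {i. (\<Sum>j\<in>J. f j i) \<noteq> 0}"
  using assms
proof (induction J rule: infinite_finite_induct)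
  case (insert j J)
  then show ?case using finite_support_add[of "f j" "\<lambda>i. \<Sum>j\<in>J. f j i"] by simp
qed simp_all

lemma sum_fun_apply: "(\<Sum>i\<in>I. f i) x = (\<Sum>i\<in>I. f i x)"
  by (induction I rule: infinite_finite_induct) auto

lemma scaleC_fun_apply [simp]: "(c *\<^sub>C f) x = c *\<^sub>C f x"
  by (simp add: scaleC_fun_def)

lemma scaleC_complex [simp]: "c *\<^sub>C (z::complex) = c * z"
  by (simp add: scaleC_complex_def)

subsection \<open>Series composed with operators\<close>

definition shift_series :: "'e::cancel_comm_monoid_add \<Rightarrow> ('e \<Rightarrow> 'a) \<Rightarrow> 'e \<Rightarrow> 'a::comm_monoid_add"
  where "shift_series i g e = Sum_any (\<lambda>j. if i + j = e then g j else 0)"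

lemma shift_series_add [simp]: "shift_series i g (i + j) = g j"
proof -
  have "shift_series i g (i + j) = (\<Sum>j'\<in>{j}. if i + j' = i + j then g j' else 0)"
    unfolding shift_series_def by (rule Sum_any.expand_superset) auto
  then show ?thesis by simp
qed

lemma shift_series_outside: "(\<And>j. e \<noteq> i + j) \<Longrightarrow> shift_series i g e = 0"
  unfolding shift_series_def by (subst Sum_any.expand_superset[of "{}"]) auto

lemma shift_series_int [simp]: "shift_series (i::int) g e = g (e - i)"
  using shift_series_add[of i g "e - i"] by simp

lemma shift_series_map:
  assumes "h 0 = 0"
  shows "h (shift_series i g e) = shift_series i (\<lambda>j. h (g j)) e"
proof (cases "\<exists>j. e = i + j")
  case False
  then have "shift_series i g e = 0" "shift_series i (\<lambda>j. h (g j)) e = 0"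
    by (auto intro: shift_series_outside)
  then show ?thesis using assms by simp
qed auto

lemma shift_series_plus:
  "shift_series i (\<lambda>j. f j + g j) e = shift_series i f e + shift_series i g e"
proof (cases "\<exists>j. e = i + j")
  case False
  then have "\<And>h :: 'b \<Rightarrow> 'a. shift_series i h e = 0" by (intro shift_series_outside) auto
  then show ?thesis by simp
qed auto

lemma support_shift_series: "{e. shift_series i g e \<noteq> 0} \<subseteq> (\<lambda>j. i + j) ` {j. g j \<noteq> 0}"
proof
  fix e assume e: "e \<in> {e. shift_series i g e \<noteq> 0}"
  then obtain j where "e = i + j" using shift_series_outside[of e i g] by blast
  with e show "e \<in> (\<lambda>j. i + j) ` {j. g j \<noteq> 0}" by auto
qed

lemma finite_support_shift_series:
  assumes "finite {j. g j \<noteq> 0}"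
  shows "finite {e. shift_series i g e \<noteq> 0}"
  by (rule finite_subset[OF support_shift_series finite_imageI[OF assms]])

text \<open>In a cancellative monoid each \<open>i\<close> has at most one \<open>j\<close> with
  \<open>i + j = e\<close>. So finitely many nonzero coefficients of \<open>f\<close> suffice, while
  each \<open>T (f i)\<close> may have infinite support, as the series \<open>I w x\<close> of an
  intertwining operator does in general.\<close>

lemma apply_series_eq_sum:
  fixes T :: "'a::zero \<Rightarrow> 'e::cancel_comm_monoid_add \<Rightarrow> 'b::complex_vector"
  assumes "finite I" "\<And>i. i \<notin> I \<Longrightarrow> T (f i) = (\<lambda>_. 0)"
  shows "apply_series T f e = (\<Sum>i\<in>I. shift_series i (T (f i)) e)"
proof -
  define D where "D = Sigma I (\<lambda>i. {j. i + j = e})"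
  have fin: "finite {j. i + j = e}" for i :: 'e
  proof (cases "\<exists>j. e = i + j")
    case True
    then obtain j where "e = i + j" by blast
    then have "{j. i + j = e} = {j}" by auto
    then show ?thesis by simp
  next
    case False
    then have "{j. i + j = e} = {}" by blast
    then show ?thesis by simp
  qed
  have "apply_series T f e = (\<Sum>p\<in>D. case p of (i, j) \<Rightarrow> if i + j = e then T (f i) j else 0)"
    unfolding apply_series_def D_def
    by (rule Sum_any.expand_superset) (use assms fin in \<open>force split: if_splits\<close>)+
  also have "\<dots> = (\<Sum>i\<in>I. \<Sum>j\<in>{j. i + j = e}. if i + j = e then T (f i) j else 0)"
    unfolding D_def using assms fin by (subst sum.Sigma) auto
  also have "\<dots> = (\<Sum>i\<in>I. shift_series i (T (f i)) e)"
    unfolding shift_series_def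
    by (intro sum.cong refl Sum_any.expand_superset[symmetric]) (use fin in auto)
  finally show ?thesis .
qed

subsection \<open>Evaluation of finite logarithmic series at \<open>log x = z\<close>\<close>

text \<open>The value of x^n (log x)^k. The parameter is z = log x and not x, so that complex powers
  of x need no choice of a branch.\<close>

definition x_monomial :: "complex \<Rightarrow> complex \<times> nat \<Rightarrow> complex"
  where "x_monomial z i = exp (fst i * z) * z ^ snd i"

definition evalx :: "complex \<Rightarrow> 'w::complex_vector log_series \<Rightarrow> 'w"
  where "evalx z f = Sum_any (\<lambda>i. x_monomial z i *\<^sub>C f i)"

lemma x_monomial_add: "x_monomial z (i + j) = x_monomial z i * x_monomial z j"
  by (simp add: x_monomial_def exp_add power_add algebra_simps)

lemma evalx_superset:
  "finite I \<Longrightarrow> {i. f i \<noteq> 0} \<subseteq> I \<Longrightarrow> evalx z f = (\<Sum>i\<in>I. x_monomial z i *\<^sub>C f i)"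
  unfolding evalx_def by (rule Sum_any.expand_superset) auto

lemma evalx_zero [simp]: "evalx z (\<lambda>_. 0) = 0"
  by (simp add: evalx_def)

lemma evalx_add:
  assumes "finite {i. f i \<noteq> 0}" "finite {i. g i \<noteq> 0}"
  shows "evalx z (\<lambda>i. f i + g i) = evalx z f + evalx z g"
  unfolding evalx_def using assms
  by (simp add: scaleC_add_right Sum_any.distrib finite_support_scaleC)

lemma evalx_scaleC:
  assumes "finite {i. f i \<noteq> 0}"
  shows "evalx z (\<lambda>i. c *\<^sub>C f i) = c *\<^sub>C evalx z f"
proof -
  have "evalx z (\<lambda>i. c *\<^sub>C f i) = (\<Sum>i\<in>{i. f i \<noteq> 0}. x_monomial z i *\<^sub>C c *\<^sub>C f i)"
    by (rule evalx_superset) (use assms in auto)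
  also have "\<dots> = c *\<^sub>C evalx z f"
    unfolding evalx_superset[OF assms subset_refl]
    by (simp add: cvec.scale_sum_right scaleC_scaleC mult.commute)
  finally show ?thesis .
qed

lemma evalx_diff:
  assumes "finite {i. f i \<noteq> 0}" "finite {i. g i \<noteq> 0}"
  shows "evalx z (\<lambda>i. f i - g i) = evalx z f - evalx z g"
  using evalx_add[OF assms(1) finite_support_scaleC[OF assms(2), of "\<lambda>_. -1"], of z]
    evalx_scaleC[OF assms(2), of z "-1"] by simp

lemma evalx_sum:
  assumes "\<And>j. j \<in> J \<Longrightarrow> finite {i. f j i \<noteq> 0}"
  shows "evalx z (\<lambda>i. \<Sum>j\<in>J. f j i) = (\<Sum>j\<in>J. evalx z (f j))"
  using assms
proof (induction J rule: infinite_finite_induct)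
  case (insert j J)
  then show ?case
    using evalx_add[of "f j" "\<lambda>i. \<Sum>j\<in>J. f j i" z] finite_support_sum[of J f] by simp
qed simp_all

lemma evalx_linear:
  assumes "clinear_on S T h" "cvec.subspace S" "finite {i. f i \<noteq> 0}" "\<And>i. f i \<in> S"
  shows "evalx z (\<lambda>i. h (f i)) = h (evalx z f)"
proof -
  have "h (evalx z f) = Sum_any (\<lambda>i. h (x_monomial z i *\<^sub>C f i))"
    unfolding evalx_def using assms
    by (intro clinear_on_Sum_any[OF assms(1,2)] finite_support_scaleC cvec.subspace_scale) auto
  then show ?thesis by (simp add: evalx_def clinear_onD(3)[OF assms(1) assms(4)])
qed

lemma evalx_shift_series:
  assumes "finite {i. g i \<noteq> 0}"
  shows "evalx z (shift_series i g) = x_monomial z i *\<^sub>C evalx z g"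
proof -
  let ?I = "{i. g i \<noteq> 0}"
  have "evalx z (shift_series i g) = (\<Sum>e\<in>(\<lambda>j. i + j) ` ?I. x_monomial z e *\<^sub>C shift_series i g e)"
    by (rule evalx_superset[OF finite_imageI[OF assms] support_shift_series])
  also have "\<dots> = (\<Sum>j\<in>?I. x_monomial z (i + j) *\<^sub>C g j)"
    by (subst sum.reindex) (auto intro: inj_onI)
  also have "\<dots> = x_monomial z i *\<^sub>C evalx z g"
    unfolding evalx_superset[OF assms subset_refl]
    by (simp add: cvec.scale_sum_right scaleC_scaleC x_monomial_add)
  finally show ?thesis .
qed

lemma evalx_translate:
  assumes "finite {i. g i \<noteq> 0}"
  shows "finite {i. (\<lambda>(n, k). g (n - a, k)) i \<noteq> 0}"
    and "evalx z (\<lambda>(n, k). g (n - a, k)) = exp (a * z) *\<^sub>C evalx z g"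
proof -
  have *: "(\<lambda>(n, k). g (n - a, k)) = shift_series (a, 0) g"
  proof
    fix e :: "complex \<times> nat"
    have "e = (a, 0) + (fst e - a, snd e)" by (simp add: prod_eq_iff)
    then show "(\<lambda>(n, k). g (n - a, k)) e = shift_series (a, 0) g e"
      by (metis case_prod_beta shift_series_add fst_conv snd_conv)
  qed
  show "finite {i. (\<lambda>(n, k). g (n - a, k)) i \<noteq> 0}"
    unfolding * by (rule finite_support_shift_series[OF assms])
  show "evalx z (\<lambda>(n, k). g (n - a, k)) = exp (a * z) *\<^sub>C evalx z g"
    unfolding * evalx_shift_series[OF assms] by (simp add: x_monomial_def)
qed

lemma support_invert_x_log:
  "{i. invert_x_log g i \<noteq> 0} \<subseteq> (\<lambda>(n, k). (- n, k)) ` {i. g i \<noteq> 0}"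
proof
  fix i assume "i \<in> {i. invert_x_log g i \<noteq> 0}"
  then have "i = (\<lambda>(n, k). (- n, k)) (- fst i, snd i)" "g (- fst i, snd i) \<noteq> 0"
    by (auto simp: invert_x_log_def split: prod.splits)
  then show "i \<in> (\<lambda>(n, k). (- n, k)) ` {i. g i \<noteq> 0}" by blast
qed

lemma finite_support_invert_x_log:
  assumes "finite {i. g i \<noteq> 0}"
  shows "finite {i. invert_x_log g i \<noteq> 0}"
  by (rule finite_subset[OF support_invert_x_log finite_imageI[OF assms]])

lemma evalx_invert_x_log:
  assumes "finite {i. g i \<noteq> 0}"
  shows "evalx z (invert_x_log g) = evalx (- z) g"
proof -
  let ?I = "{i. g i \<noteq> 0}" and ?m = "\<lambda>(n, k). (- n :: complex, k :: nat)"
  have "evalx z (invert_x_log g) = (\<Sum>i\<in>?m ` ?I. x_monomial z i *\<^sub>C invert_x_log g i)"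
    by (rule evalx_superset[OF finite_imageI[OF assms] support_invert_x_log])
  also have "\<dots> = (\<Sum>i\<in>?I. x_monomial z (?m i) *\<^sub>C invert_x_log g (?m i))"
    by (subst sum.reindex) (auto intro: inj_onI)
  also have "\<dots> = (\<Sum>i\<in>?I. x_monomial (- z) i *\<^sub>C g i)"
  proof (rule sum.cong[OF refl])
    fix i assume "i \<in> ?I"
    have "(- z) ^ snd i = (- 1) ^ snd i * z ^ snd i" by (rule power_minus)
    then show "x_monomial z (?m i) *\<^sub>C invert_x_log g (?m i) = x_monomial (- z) i *\<^sub>C g i"
      by (cases i) (simp add: invert_x_log_def x_monomial_def scaleC_scaleC mult_ac)
  qed
  also have "\<dots> = evalx (- z) g"
    by (rule evalx_superset[symmetric]) (use assms in auto)
  finally show ?thesis .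
qed

text \<open>The operator x d/dx, which becomes d/dz under x = exp z. It differs from
  \<open>deriv_log\<close> by one power of x and has the advantage of preserving the exponent
  n.\<close>

definition x_deriv :: "'w::complex_vector log_series \<Rightarrow> 'w log_series"
  where "x_deriv g = (\<lambda>(n, k). n *\<^sub>C g (n, k) + of_nat (Suc k) *\<^sub>C g (n, Suc k))"

lemma finite_support_x_deriv:
  assumes "finite {i. g i \<noteq> 0}"
  shows "finite {i. x_deriv g i \<noteq> 0}"
proof -
  have "{i. x_deriv g i \<noteq> 0} \<subseteq> {i. g i \<noteq> 0} \<union> (\<lambda>(n, k). (n, k - 1)) ` {i. g i \<noteq> 0}"
  proof
    fix i assume i: "i \<in> {i. x_deriv g i \<noteq> 0}"
    obtain m k where mk: "i = (m, k)" by (cases i)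
    show "i \<in> {i. g i \<noteq> 0} \<union> (\<lambda>(n, k). (n, k - 1)) ` {i. g i \<noteq> 0}"
    proof (cases "g (m, k) = 0")
      case True
      with i have "g (m, Suc k) \<noteq> 0" by (auto simp: mk x_deriv_def)
      moreover have "i = (\<lambda>(n, k). (n, k - 1)) (m, Suc k)" by (simp add: mk)
      ultimately show ?thesis by blast
    qed (simp add: mk)
  qed
  then show ?thesis by (rule finite_subset) (use assms in simp)
qed

lemma finite_support_box:
  fixes g :: "complex \<times> nat \<Rightarrow> 'a::zero"
  assumes "finite {i. g i \<noteq> 0}"
  obtains P K where "finite P" "{i. g i \<noteq> 0} \<subseteq> P \<times> {..<K}"
proof -
  obtain K where "\<forall>k\<in>snd ` {i. g i \<noteq> 0}. k < K"
    using assms finite_nat_set_iff_bounded by blast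
  then have "{i. g i \<noteq> 0} \<subseteq> fst ` {i. g i \<noteq> 0} \<times> {..<K}" by force
  with assms that show thesis by blast
qed

lemma x_monomial_has_derivative:
  "((\<lambda>z. x_monomial z (n, k)) has_field_derivative
     n * x_monomial z (n, k) + of_nat k * x_monomial z (n, k - 1)) (at z)"
  unfolding x_monomial_def by (auto intro!: derivative_eq_intros simp: algebra_simps)

lemma evalx_has_derivative:
  fixes g :: "complex log_series"
  assumes "finite {i. g i \<noteq> 0}"
  shows "((\<lambda>z. evalx z g) has_field_derivative evalx z (x_deriv g)) (at z)"
proof -
  obtain P K where P: "finite P" and K: "{i. g i \<noteq> 0} \<subseteq> P \<times> {..<K}"
    using finite_support_box[OF assms] .
  have K0: "g (n, k) = 0" if "n \<notin> P \<or> k \<ge> K" for n k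
    using K that by force
  have ev: "evalx z g = (\<Sum>n\<in>P. \<Sum>k<K. x_monomial z (n, k) * g (n, k))" for z
    using evalx_superset[of "P \<times> {..<K}" g z] P K by (simp add: sum.cartesian_product)
  have "((\<lambda>z. evalx z g) has_field_derivative
    (\<Sum>n\<in>P. \<Sum>k<K. (n * x_monomial z (n, k) + of_nat k * x_monomial z (n, k - 1)) * g (n, k))) (at z)"
    unfolding ev
    by (intro DERIV_sum DERIV_cmult_right x_monomial_has_derivative)
  also have "(\<Sum>n\<in>P. \<Sum>k<K. (n * x_monomial z (n, k) + of_nat k * x_monomial z (n, k - 1)) * g (n, k))
    = (\<Sum>n\<in>P. \<Sum>k<K. x_monomial z (n, k) * x_deriv g (n, k))"
  proof (rule sum.cong[OF refl])
    fix n assume "n \<in> P"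
    \<comment> \<open>The terms that come from differentiating z^k are shifted down by one. Nothing
      is lost at the ends: the factor \<open>of_nat k\<close> kills k = 0 and the support bound
      kills k = K.\<close>
    define F where "F k = of_nat k * x_monomial z (n, k - 1) * g (n, k)" for k
    have "(\<Sum>k<K. F (Suc k)) = (\<Sum>k<K. F k)"
    proof -
      have "(\<Sum>k<Suc K. F k) = F 0 + (\<Sum>k<K. F (Suc k))" by (rule sum.lessThan_Suc_shift)
      moreover have "F 0 = 0" "F K = 0" by (simp_all add: F_def K0)
      ultimately show ?thesis by simp
    qed
    then show "(\<Sum>k<K. (n * x_monomial z (n, k) + of_nat k * x_monomial z (n, k - 1)) * g (n, k))
      = (\<Sum>k<K. x_monomial z (n, k) * x_deriv g (n, k))"
      by (simp add: F_def x_deriv_def sum.distrib algebra_simps)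
  qed
  also have "\<dots> = evalx z (x_deriv g)"
  proof -
    have "x_deriv g (n, k) = 0" if "n \<notin> P \<or> k \<ge> K" for n k
      using that by (auto simp: x_deriv_def K0)
    then have "{i. x_deriv g i \<noteq> 0} \<subseteq> P \<times> {..<K}" by (auto simp: not_le[symmetric])
    then show ?thesis
      using evalx_superset[of "P \<times> {..<K}" "x_deriv g" z] P by (simp add: sum.cartesian_product)
  qed
  finally show ?thesis .
qed

subsection \<open>Generalized eigenvectors\<close>

text \<open>On generalized eigenvectors for m the operator T - a with a different from m is
  injective; so a power of T - a removes the summand for a without losing the others. The space is a
  subspace \<open>S\<close> because both applications, d/dz on functions and L(0) on a module, have
  operators that are linear on a carrier only.\<close>

lemma generalized_eigenvectors_independent:
  fixes T :: "'a::complex_vector \<Rightarrow> 'a"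
  assumes sub: "cvec.subspace S" and lin: "clinear_on S S T"
    and F: "finite F" and u: "\<And>m. m \<in> F \<Longrightarrow> u m \<in> S"
    and nil: "\<And>m. m \<in> F \<Longrightarrow> \<exists>N. ((\<lambda>v. T v - m *\<^sub>C v) ^^ N) (u m) = 0"
    and sum0: "(\<Sum>m\<in>F. u m) = 0"
  shows "\<forall>m\<in>F. u m = 0"
proof -
  define D where "D m = (\<lambda>v. T v - m *\<^sub>C v)" for m
  have Dlin: "clinear_on S S (D m)" for m
    unfolding clinear_on_def D_def
    using clinear_onD[OF lin] cvec.subspace_diff[OF sub] cvec.subspace_scale[OF sub]
    by (auto simp: algebra_simps cvec.scale_right_diff_distrib scaleC_add_right scaleC_scaleC)
  have DNlin: "clinear_on S S (D m ^^ N)" for m N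
  proof (induction N)
    case (Suc N)
    then show ?case using clinear_onD[OF Dlin[of m]] by (auto simp: clinear_on_def)
  qed (auto simp: clinear_on_def)
  have comm1: "D m (D a v) = D a (D m v)" if "v \<in> S" for m a v
  proof -
    have "T (T v - b *\<^sub>C v) = T (T v) - b *\<^sub>C T v" for b
      using that clinear_onD(1,3)[OF lin] clinear_on_diff[OF lin sub] cvec.subspace_scale[OF sub]
      by simp
    then have "D m (D a v) = T (T v) - a *\<^sub>C T v - (m *\<^sub>C T v - (m * a) *\<^sub>C v)"
      "D a (D m v) = T (T v) - m *\<^sub>C T v - (a *\<^sub>C T v - (a * m) *\<^sub>C v)"
      by (simp_all add: D_def cvec.scale_right_diff_distrib)
    moreover have "P - p - (q - s) = P - q - (p - s)" for P p q s :: 'a by simp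
    ultimately show ?thesis by (simp add: mult.commute[of a m])
  qed
  have comm: "D m ((D a ^^ N) v) = (D a ^^ N) (D m v)" if "v \<in> S" for m a N v
    using that
  proof (induction N arbitrary: v)
    case (Suc N)
    show ?case
      using Suc comm1[of "(D a ^^ N) v" m a] clinear_onD(1)[OF DNlin Suc.prems] by simp
  qed simp
  have comm2: "(D m ^^ M) ((D a ^^ N) v) = (D a ^^ N) ((D m ^^ M) v)" if "v \<in> S" for m a M N v
    using that
  proof (induction M)
    case (Suc M)
    then show ?case using comm clinear_onD(1)[OF DNlin Suc.prems] by simp
  qed simp
  \<comment> \<open>If T v = a v, then T - m acts on v as the nonzero scalar a - m, and a power of
    it can vanish on v only if v = 0.\<close>
  have inj1: "v = 0" if "v \<in> S" "D a v = 0" "(D m ^^ N) v = 0" "m \<noteq> a" for v a m N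
    using that
  proof (induction N arbitrary: v)
    case (Suc N)
    have "D m v = (a - m) *\<^sub>C v"
      using Suc.prems(2) by (simp add: D_def cvec.scale_left_diff_distrib)
    then have "(a - m) *\<^sub>C (D m ^^ N) v = 0"
      using Suc.prems(3) clinear_onD(3)[OF DNlin Suc.prems(1)] by (simp add: funpow_swap1)
    then have "(D m ^^ N) v = 0" using Suc.prems(4) by simp
    then show ?case using Suc by blast
  qed simp
  have injN: "v = 0" if "v \<in> S" "(D a ^^ M) v = 0" "(D m ^^ N) v = 0" "m \<noteq> a" for v a m M N
    using that
  proof (induction M)
    case (Suc M)
    have "(D m ^^ N) ((D a ^^ M) v) = 0"
      using comm2[where v = v and m = m and M = N and a = a and N = M] Suc.prems clinear_on_zero[OF DNlin sub] by simp
    then have "(D a ^^ M) v = 0"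
      using inj1[where v = "(D a ^^ M) v" and a = a and m = m and N = N] clinear_onD(1)[OF DNlin Suc.prems(1)] Suc.prems(2,4) by simp
    then show ?case using Suc by blast
  qed simp
  have "\<forall>m\<in>F. \<exists>N. (D m ^^ N) (u m) = 0" using nil by (simp add: D_def)
  with F u sum0 show ?thesis
  proof (induction F arbitrary: u rule: finite_induct)
    case (insert a F)
    from insert.prems obtain M where M: "(D a ^^ M) (u a) = 0" by auto
    \<comment> \<open>The power \<open>D a ^^ M\<close> annihilates \<open>u a\<close> and keeps the
      remaining vectors generalized eigenvectors for their eigenvalues, since the operators
      \<open>D m\<close> commute; the induction hypothesis then applies to the images.\<close>
    have "(D a ^^ M) (\<Sum>m\<in>insert a F. u m) = 0"
      using insert.prems(2) clinear_on_zero[OF DNlin sub] by simp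
    moreover have "(D a ^^ M) (\<Sum>m\<in>insert a F. u m) = (\<Sum>m\<in>insert a F. (D a ^^ M) (u m))"
      by (rule clinear_on_sum[OF DNlin sub]) (use insert.prems in auto)
    ultimately have s: "(\<Sum>m\<in>F. (D a ^^ M) (u m)) = 0"
      using insert M by simp
    have "\<forall>m\<in>F. (D a ^^ M) (u m) = 0"
    proof (rule insert.IH[OF _ s])
      show "(D a ^^ M) (u m) \<in> S" if "m \<in> F" for m
        using clinear_onD(1)[OF DNlin] insert.prems(1) that by auto
      show "\<forall>m\<in>F. \<exists>N. (D m ^^ N) ((D a ^^ M) (u m)) = 0"
        using comm2 insert.prems(1,3) clinear_on_zero[OF DNlin sub] by (metis insertCI)
    qed
    then have z: "u m = 0" if "m \<in> F" for m
      using injN[where v = "u m" and a = a and M = M and m = m] insert.prems(1,3) that insert.hyps(2) by (metis insertCI)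
    then have "u a = 0" using insert.prems(2) insert.hyps by (simp add: sum.neutral)
    with z show ?case by simp
  qed simp
qed

text \<open>Linear independence of the functions \<open>exp (n z) z^k\<close>: for fixed \<open>n\<close> they are generalized
  eigenvectors of \<open>d/dz\<close> with eigenvalue \<open>n\<close>.\<close>

lemma evalx_injective:
  fixes g :: "complex log_series"
  assumes fin: "finite {i. g i \<noteq> 0}" and zero: "\<And>z. evalx z g = 0"
  shows "g = (\<lambda>_. 0)"
proof -
  define S where "S = {F. \<exists>h::complex log_series. finite {i. h i \<noteq> 0} \<and> F = (\<lambda>z. evalx z h)}"
  \<comment> \<open>The derivative as a total operator on functions; the definite description is
    meaningful on \<open>S\<close>, all of whose elements are differentiable.\<close>
  define T where "T F = (\<lambda>z::complex. THE d::complex. (F has_field_derivative d) (at z))" for F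
  have T: "T (\<lambda>z. evalx z h) = (\<lambda>z. evalx z (x_deriv h))" if "finite {i. h i \<noteq> 0}" for h
    unfolding T_def using evalx_has_derivative[OF that] DERIV_unique[OF _ evalx_has_derivative[OF that]]
    by (intro ext the_equality) auto
  have sub: "cvec.subspace S"
  proof (rule cvec.subspaceI)
    show "0 \<in> S" unfolding S_def by (auto simp: fun_eq_iff intro!: exI[of _ "\<lambda>_. 0"])
  next
    fix F G assume "F \<in> S" "G \<in> S"
    then obtain h h' where "finite {i. h i \<noteq> 0}" "F = (\<lambda>z. evalx z h)"
      "finite {i. h' i \<noteq> 0}" "G = (\<lambda>z. evalx z h')"
      unfolding S_def by blast
    then show "F + G \<in> S" unfolding S_def
      by (auto simp: fun_eq_iff evalx_add finite_support_add intro!: exI[of _ "\<lambda>i. h i + h' i"])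
  next
    fix c F assume "F \<in> S"
    then obtain h where "finite {i. h i \<noteq> 0}" "F = (\<lambda>z. evalx z h)"
      unfolding S_def by blast
    then show "c *\<^sub>C F \<in> S" unfolding S_def
      using evalx_scaleC[of h] finite_support_scaleC[of h "\<lambda>_. c"]
      by (auto simp: fun_eq_iff intro!: exI[of _ "\<lambda>i. c * h i"])
  qed
  have lin: "clinear_on S S T"
    unfolding clinear_on_def
  proof (intro conjI ballI allI)
    fix F assume "F \<in> S"
    then obtain h where h: "finite {i. h i \<noteq> 0}" "F = (\<lambda>z. evalx z h)"
      unfolding S_def by blast
    show "T F \<in> S"
      unfolding h(2) T[OF h(1)] S_def using finite_support_x_deriv[OF h(1)] by blast
    have Fd: "(F has_field_derivative T F z) (at z)" for z
      unfolding h(2) T[OF h(1)] by (rule evalx_has_derivative[OF h(1)])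
    show "T (c *\<^sub>C F) = c *\<^sub>C T F" for c
    proof
      fix z
      have "((c *\<^sub>C F) has_field_derivative c * T F z) (at z)"
        using DERIV_cmult[OF Fd, of c z] by (simp add: scaleC_fun_def)
      then show "T (c *\<^sub>C F) z = (c *\<^sub>C T F) z"
        unfolding T_def[of "c *\<^sub>C F"] using DERIV_unique by (auto intro!: the_equality)
    qed
    fix G assume "G \<in> S"
    then obtain h' where h': "finite {i. h' i \<noteq> 0}" "G = (\<lambda>z. evalx z h')"
      unfolding S_def by blast
    have Gd: "(G has_field_derivative T G z) (at z)" for z
      unfolding h'(2) T[OF h'(1)] by (rule evalx_has_derivative[OF h'(1)])
    show "T (F + G) = T F + T G"
    proof
      fix z
      have "((F + G) has_field_derivative T F z + T G z) (at z)"
        using DERIV_add[OF Fd Gd, of z] by (simp add: plus_fun_def)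
      then show "T (F + G) z = (T F + T G) z"
        unfolding T_def[of "F + G"] using DERIV_unique by (auto intro!: the_equality)
    qed
  qed
  obtain P K where P: "finite P" and K: "{i. g i \<noteq> 0} \<subseteq> P \<times> {..<K}"
    using finite_support_box[OF fin] .
  have K0: "g (n, k) = 0" if "n \<notin> P \<or> k \<ge> K" for n k
    using K that by force
  define part where "part n = (\<lambda>(m, k). if m = n then g (m, k) else 0)" for n
  have part_fin: "finite {i. part n i \<noteq> 0}" for n
    by (rule finite_subset[OF _ fin]) (auto simp: part_def split: if_splits)
  \<comment> \<open>On series with the single exponent n, \<open>x_deriv\<close> minus n sends the
    coefficient at k + 1 to k, up to the factor k + 1, and so lowers the degree in log x.\<close>
  have nil: "((\<lambda>F. T F - n *\<^sub>C F) ^^ N) (\<lambda>z. evalx z h) = 0"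
    if "\<And>m k. m \<noteq> n \<or> k \<ge> N \<Longrightarrow> h (m, k) = 0" for n N and h :: "complex log_series"
    using that
  proof (induction N arbitrary: h)
    case 0
    then have "h = (\<lambda>_. 0)" by (auto simp: fun_eq_iff)
    then have "(\<lambda>z. evalx z h) = (\<lambda>_. 0)" by simp
    then show ?case by (simp add: zero_fun_def)
  next
    case (Suc N)
    have fh: "finite {i. h i \<noteq> 0}"
      by (rule finite_subset[of _ "{n} \<times> {..<Suc N}"]) (use Suc.prems not_less in auto)
    let ?h = "\<lambda>i. x_deriv h i - n *\<^sub>C h i"
    have eq: "T (\<lambda>z. evalx z h) - n *\<^sub>C (\<lambda>z. evalx z h) = (\<lambda>z. evalx z ?h)"
      unfolding T[OF fh]
      using evalx_diff[OF finite_support_x_deriv[OF fh] finite_support_scaleC[OF fh, of "\<lambda>_. n"]]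
        evalx_scaleC[OF fh, of _ n]
      by (simp add: fun_eq_iff)
    have "((\<lambda>F. T F - n *\<^sub>C F) ^^ N) (\<lambda>z. evalx z ?h) = 0"
      by (rule Suc.IH) (use Suc.prems in \<open>auto simp: x_deriv_def\<close>)
    then show ?case by (simp only: funpow_Suc_right o_apply eq)
  qed
  have "\<forall>n\<in>P. (\<lambda>z. evalx z (part n)) = 0"
  proof (rule generalized_eigenvectors_independent[OF sub lin P])
    show "(\<lambda>z. evalx z (part n)) \<in> S" for n
      unfolding S_def using part_fin by blast
    show "\<exists>N. ((\<lambda>F. T F - n *\<^sub>C F) ^^ N) (\<lambda>z. evalx z (part n)) = 0" for n
      by (rule exI[of _ K], rule nil) (auto simp: part_def K0)
    have "(\<Sum>n\<in>P. part n i) = g i" for i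
      using K0[of "fst i" "snd i"] P by (auto simp: part_def case_prod_beta)
    then have "(\<lambda>i. \<Sum>n\<in>P. part n i) = g" by (rule ext)
    then have "(\<Sum>n\<in>P. evalx z (part n)) = 0" for z
      using evalx_sum[of P part z] part_fin zero by simp
    then show "(\<Sum>n\<in>P. (\<lambda>z. evalx z (part n))) = 0"
      by (simp add: fun_eq_iff sum_fun_apply)
  qed
  then have part0: "evalx z (part n) = 0" if "n \<in> P" for n z
    using that by (simp add: fun_eq_iff)
  have "g (n, k) = 0" if n: "n \<in> P" and "k < K" for n k
  proof -
    \<comment> \<open>The function exp (n z) has no zeros; what remains is a polynomial in z that
      vanishes everywhere.\<close>
    have "(\<Sum>k\<le>K. g (n, k) * z ^ k) = 0" for z
    proof -
      have "k < K" if "g (n, k) \<noteq> 0" for k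
        using K0 that not_le by blast
      then have "{i. part n i \<noteq> 0} \<subseteq> {n} \<times> {..K}"
        by (auto simp: part_def less_imp_le split: if_splits)
      then have "evalx z (part n) = (\<Sum>i\<in>{n} \<times> {..K}. x_monomial z i *\<^sub>C part n i)"
        by (rule evalx_superset[rotated]) simp
      also have "\<dots> = (\<Sum>k\<le>K. x_monomial z (n, k) * g (n, k))"
        proof -
        have "{n} \<times> {..K} = Pair n ` {..K}" by auto
        then show ?thesis by (simp add: sum.reindex inj_on_def part_def)
      qed
      also have "\<dots> = exp (n * z) * (\<Sum>k\<le>K. g (n, k) * z ^ k)"
        by (simp add: x_monomial_def sum_distrib_left mult_ac)
      finally show ?thesis using part0[OF n, of z] by simp
    qed
    then have "\<forall>k\<le>K. g (n, k) = 0" using polyfun_eq_0[where c = "\<lambda>k. g (n, k)" and n = K] by blast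
    then show ?thesis using that by simp
  qed
  with K0 show ?thesis by (auto simp: fun_eq_iff) (meson not_le)
qed

text \<open>The device by which every identity between coefficients is obtained from an identity of
  functions of z. Both finiteness hypotheses matter, because \<open>Sum_any\<close> takes the
  default value 0 on infinite supports and evaluation would then carry no information.\<close>

lemma evalx_eqD:
  fixes g h :: "complex log_series"
  assumes "finite {i. g i \<noteq> 0}" "finite {i. h i \<noteq> 0}" "\<And>z. evalx z g = evalx z h"
  shows "g = h"
proof -
  have "(\<lambda>i. g i - h i) = (\<lambda>_. 0)"
  proof (rule evalx_injective)
    show "finite {i. g i - h i \<noteq> 0}"
      by (rule finite_subset[OF _ finite_UnI[OF assms(1,2)]]) auto
    show "evalx z (\<lambda>i. g i - h i) = 0" for z
      using evalx_diff[OF assms(1,2)] assms(3) by simp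
  qed
  then show ?thesis by (auto simp: fun_eq_iff)
qed

subsection \<open>Direct sums\<close>

lemma is_direct_sum_Sum_any:
  assumes "is_direct_sum I G S" "f \<in> graded_families I G"
  shows "Sum_any f \<in> S"
  using assms by (auto simp: is_direct_sum_def bij_betw_def)

lemma is_direct_sum_unique:
  assumes "is_direct_sum I G S" "f \<in> graded_families I G" "g \<in> graded_families I G"
    "Sum_any f = Sum_any g"
  shows "f = g"
  using assms by (auto simp: is_direct_sum_def bij_betw_def dest: inj_onD)

lemma is_direct_sum_decompose:
  assumes "is_direct_sum I G S" "w \<in> S"
  obtains f where "f \<in> graded_families I G" "w = Sum_any f"
  using assms by (auto simp: is_direct_sum_def bij_betw_def)

lemma is_direct_sum_subspace:
  "is_direct_sum I G S \<Longrightarrow> i \<in> I \<Longrightarrow> cvec.subspace (G i)"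
  by (simp add: is_direct_sum_def)

lemma graded_families_single:
  assumes "is_direct_sum I G S" "i \<in> I" "w \<in> G i"
  shows "(\<lambda>j. if j = i then w else 0) \<in> graded_families I G"
  using assms by (auto simp: graded_families_def is_direct_sum_def cvec.subspace_0)

lemma Sum_any_single: "Sum_any (\<lambda>j. if j = i then w else 0) = w"
  by (subst Sum_any.expand_superset[of "{i}"]) auto

lemma is_direct_sum_summand:
  assumes "is_direct_sum I G S" "i \<in> I"
  shows "G i \<subseteq> S"
  using is_direct_sum_Sum_any[OF assms(1) graded_families_single[OF assms]]
  by (auto simp: Sum_any_single)

lemma graded_families_add:
  assumes "is_direct_sum I G S" "f \<in> graded_families I G" "g \<in> graded_families I G"
  shows "(\<lambda>i. f i + g i) \<in> graded_families I G"
  using assms finite_support_add[of f g]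
  by (auto simp: graded_families_def is_direct_sum_def cvec.subspace_add)

lemma graded_families_scaleC:
  assumes "is_direct_sum I G S" "f \<in> graded_families I G"
  shows "(\<lambda>i. c *\<^sub>C f i) \<in> graded_families I G"
  using assms finite_support_scaleC[of f "\<lambda>_. c"]
  by (auto simp: graded_families_def is_direct_sum_def cvec.subspace_scale)

lemma Sum_any_scaleC:
  assumes "finite {i. f i \<noteq> 0}"
  shows "Sum_any (\<lambda>i. c *\<^sub>C f i) = c *\<^sub>C Sum_any f"
  by (subst (1) Sum_any.expand_superset[OF assms])
    (auto simp: Sum_any.expand_set cvec.scale_sum_right)

lemma homogeneous_component_eqI:
  assumes "is_direct_sum UNIV G S" "f \<in> graded_families UNIV G" "w = Sum_any f"
  shows "homogeneous_component G w = f"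
  using assms unfolding homogeneous_component_def is_direct_sum_def bij_betw_def
  by (auto intro: inv_into_f_f)

lemma homogeneous_component_in:
  assumes "is_direct_sum UNIV G S" "w \<in> S"
  shows "homogeneous_component G w \<in> graded_families UNIV G"
    and "Sum_any (homogeneous_component G w) = w"
  using is_direct_sum_decompose[OF assms] homogeneous_component_eqI[OF assms(1)] by metis+

lemma homogeneous_component_single:
  assumes "is_direct_sum UNIV G S" "w \<in> G i"
  shows "homogeneous_component G w = (\<lambda>j. if j = i then w else 0)"
  by (rule homogeneous_component_eqI[OF assms(1) graded_families_single[OF assms(1) _ assms(2)]])
    (simp_all add: Sum_any_single)

lemma homogeneous_component_add:
  assumes "is_direct_sum UNIV G S" "u \<in> S" "w \<in> S"
  shows "homogeneous_component G (u + w) i = homogeneous_component G u i + homogeneous_component G w i"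
proof -
  note hc = homogeneous_component_in[OF assms(1)]
  have "homogeneous_component G (u + w)
    = (\<lambda>i. homogeneous_component G u i + homogeneous_component G w i)"
    by (rule homogeneous_component_eqI[OF assms(1) graded_families_add[OF assms(1)]])
      (use hc assms(2,3) in \<open>auto simp: graded_families_def Sum_any.distrib\<close>)
  then show ?thesis by simp
qed

lemma homogeneous_component_scaleC:
  assumes "is_direct_sum UNIV G S" "w \<in> S"
  shows "homogeneous_component G (c *\<^sub>C w) i = c *\<^sub>C homogeneous_component G w i"
proof -
  note hc = homogeneous_component_in[OF assms(1)]
  have "homogeneous_component G (c *\<^sub>C w) = (\<lambda>i. c *\<^sub>C homogeneous_component G w i)"
    by (rule homogeneous_component_eqI[OF assms(1) graded_families_scaleC[OF assms(1)]])
      (use hc assms(2) in \<open>auto simp: graded_families_def Sum_any_scaleC\<close>)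
  then show ?thesis by simp
qed

lemma is_direct_sum_total_subspace:
  assumes "is_direct_sum I G S"
  shows "cvec.subspace S"
proof (rule cvec.subspaceI)
  have "(\<lambda>_. 0) \<in> graded_families I G"
    using assms by (auto simp: graded_families_def is_direct_sum_def cvec.subspace_0)
  then show "0 \<in> S" using is_direct_sum_Sum_any[OF assms] by fastforce
next
  fix x y assume "x \<in> S" "y \<in> S"
  then obtain f g where f: "f \<in> graded_families I G" "x = Sum_any f"
    and g: "g \<in> graded_families I G" "y = Sum_any g"
    using is_direct_sum_decompose[OF assms] by metis
  then have "x + y = Sum_any (\<lambda>i. f i + g i)"
    by (simp add: Sum_any.distrib graded_families_def)
  then show "x + y \<in> S"
    using is_direct_sum_Sum_any[OF assms graded_families_add[OF assms f(1) g(1)]] by simp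
next
  fix c x assume "x \<in> S"
  then obtain f where f: "f \<in> graded_families I G" "x = Sum_any f"
    using is_direct_sum_decompose[OF assms] by metis
  then have "c *\<^sub>C x = Sum_any (\<lambda>i. c *\<^sub>C f i)"
    by (simp add: Sum_any_scaleC graded_families_def)
  then show "c *\<^sub>C x \<in> S"
    using is_direct_sum_Sum_any[OF assms graded_families_scaleC[OF assms f(1)]] by simp
qed

lemma is_direct_sum_span:
  assumes "is_direct_sum I G S"
  shows "S = cvec.span (\<Union>i\<in>I. G i)"
proof
  show "S \<subseteq> cvec.span (\<Union>i\<in>I. G i)"
  proof
    fix w assume "w \<in> S"
    then obtain f where f: "f \<in> graded_families I G" "w = Sum_any f"
      using is_direct_sum_decompose[OF assms] by metis
    then have "f i \<in> cvec.span (\<Union>i\<in>I. G i)" for i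
      by (cases "i \<in> I") (auto simp: graded_families_def cvec.span_zero intro: cvec.span_base)
    then show "w \<in> cvec.span (\<Union>i\<in>I. G i)"
      unfolding f(2) by (intro Sum_any_in_subspace) auto
  qed
  show "cvec.span (\<Union>i\<in>I. G i) \<subseteq> S"
    using is_direct_sum_summand[OF assms]
    by (intro cvec.span_minimal is_direct_sum_total_subspace[OF assms]) auto
qed

subsection \<open>The Jacobi identity with one summation index per term\<close>

lemma Sum_any_reindex:
  assumes "inj h" "\<And>x. x \<notin> range h \<Longrightarrow> g x = 0"
  shows "Sum_any g = Sum_any (\<lambda>i. g (h i))"
proof -
  have "{x. g x \<noteq> 0} = h ` {i. g (h i) \<noteq> 0}"
    using assms(2) by (auto simp: image_iff) (metis rangeE)
  then show ?thesis
    unfolding Sum_any.expand_set using assms(1)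
    by (simp add: sum.reindex inj_on_subset[OF assms(1)])
qed

text \<open>The coefficient of x0^p x1^q is the residue against x0^n x1^m with n = -1-p and m =
  -1-q; this is the component form of the Jacobi identity. Each delta coefficient is supported on a
  half-line, which a natural number parametrizes.\<close>

lemma jacobi_identity_iff:
  fixes Y :: "'a \<Rightarrow> 'b \<Rightarrow> 'e::ring_1 \<Rightarrow> 'c::complex_vector"
  shows "jacobi_identity Y1 Y2 Y3 Y v w1 w2 \<longleftrightarrow> (\<forall>m n s.
    Sum_any (\<lambda>c. ((-1) ^ c * (of_int n gchoose c)) *\<^sub>C
      Y3 v (Y w1 w2 (s - of_nat c)) (int c - m - n - 1))
    - Sum_any (\<lambda>b. ((-1) powi n * (-1) ^ b * (of_int n gchoose b)) *\<^sub>C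
      Y w1 (Y2 v w2 (- m - 1 - int b)) (s - of_int n + of_nat b))
    = Sum_any (\<lambda>a. (of_int m gchoose a) *\<^sub>C
      Y (Y1 v w1 (- n - 1 - int a)) w2 (s - of_int m + of_nat a)))"
proof -
  have range1: "delta_coeff p (fst x) (snd x) = 0" if "x \<notin> range (\<lambda>c. (- 1 - p - int c, int c))" for p x
  proof (rule ccontr)
    assume "delta_coeff p (fst x) (snd x) \<noteq> 0"
    then have "x = (\<lambda>c. (- 1 - p - int c, int c)) (nat (snd x))"
      by (auto simp: delta_coeff_def prod_eq_iff split: if_splits)
    with that show False by blast
  qed
  have range2: "delta_coeff p (snd x) (fst x) = 0" "delta_coeff (snd x) p (fst x) = 0"
    if "x \<notin> range (\<lambda>c. (int c, - 1 - p - int c))" for p x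
  proof -
    have "\<not> (0 \<le> fst x \<and> p + snd x + fst x = - 1)"
    proof
      assume "0 \<le> fst x \<and> p + snd x + fst x = - 1"
      then have "x = (\<lambda>c. (int c, - 1 - p - int c)) (nat (fst x))"
        by (auto simp: prod_eq_iff)
      with that show False by blast
    qed
    then show "delta_coeff p (snd x) (fst x) = 0" "delta_coeff (snd x) p (fst x) = 0"
      by (auto simp: delta_coeff_def)
  qed
  have 1: "Sum_any (\<lambda>(b, c). delta_coeff p b c *\<^sub>C Y3 v (Y w1 w2 (s - of_int c)) (q - b))
    = Sum_any (\<lambda>c. ((-1) ^ c * (of_int (- 1 - p) gchoose c)) *\<^sub>C
        Y3 v (Y w1 w2 (s - of_nat c)) (q - (- 1 - p - int c)))" for p q s
    by (subst Sum_any_reindex[of "\<lambda>c. (- 1 - p - int c, int c)"])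
      (use range1[of _ p] in \<open>force simp: delta_coeff_def inj_on_def split: prod.splits\<close>)+
  \<comment> \<open>The second term carries (-1)^(p+1) = (-1)^(-n), which equals (-1)^n.\<close>
  have sgn: "(-1 :: complex) powi (- n) = (-1) powi n" for n
    by (simp add: power_int_minus flip: power_int_inverse)
  have 2: "Sum_any (\<lambda>(b, c). ((-1) powi (p + 1) * delta_coeff p c b) *\<^sub>C
        Y w1 (Y2 v w2 (q - b)) (s - of_int c))
    = Sum_any (\<lambda>b. ((-1) powi (- (- 1 - p)) * (-1) ^ b * (of_int (- 1 - p) gchoose b)) *\<^sub>C
        Y w1 (Y2 v w2 (q - int b)) (s - of_int (- 1 - p - int b)))" for p q s
    by (subst Sum_any_reindex[of "\<lambda>b. (int b, - 1 - p - int b)"])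
      (use range2(1)[of _ p] in \<open>force simp: delta_coeff_def inj_on_def mult.assoc add.commute split: prod.splits\<close>)+
  have 3: "Sum_any (\<lambda>(a, c). delta_coeff c q a *\<^sub>C Y (Y1 v w1 (p - a)) w2 (s - of_int c))
    = Sum_any (\<lambda>a. (of_int (- 1 - q) gchoose a) *\<^sub>C
        Y (Y1 v w1 (p - int a)) w2 (s - of_int (- 1 - q - int a)))" for p q s
  proof (subst Sum_any_reindex[of "\<lambda>a. (int a, - 1 - q - int a)"])
    \<comment> \<open>Negation of the upper index absorbs the sign and turns the binomial into the
      coefficient of (x2 + x0)^m, where m = -1-q.\<close>
    have "(-1) ^ a * (of_int (q + int a) gchoose a) = (of_int (- 1 - q) gchoose a :: complex)" for a
      using gbinomial_negated_upper[of "of_int (- 1 - q) :: complex" a] by (simp add: algebra_simps)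
    then show "Sum_any (\<lambda>i. case (int i, - 1 - q - int i) of (a, c) \<Rightarrow>
          delta_coeff c q a *\<^sub>C Y (Y1 v w1 (p - a)) w2 (s - of_int c))
      = Sum_any (\<lambda>a. (of_int (- 1 - q) gchoose a) *\<^sub>C
        Y (Y1 v w1 (p - int a)) w2 (s - of_int (- 1 - q - int a)))"
      by (simp add: delta_coeff_def)
  qed (use range2(2)[of _ q] in \<open>force simp: inj_on_def split: prod.splits\<close>)+
  let ?Q = "\<lambda>m n s. Sum_any (\<lambda>c. ((-1) ^ c * (of_int n gchoose c)) *\<^sub>C
      Y3 v (Y w1 w2 (s - of_nat c)) (int c - m - n - 1))
    - Sum_any (\<lambda>b. ((-1) powi n * (-1) ^ b * (of_int n gchoose b)) *\<^sub>C
      Y w1 (Y2 v w2 (- m - 1 - int b)) (s - of_int n + of_nat b))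
    = Sum_any (\<lambda>a. (of_int m gchoose a) *\<^sub>C
      Y (Y1 v w1 (- n - 1 - int a)) w2 (s - of_int m + of_nat a))"
  have "jacobi_identity Y1 Y2 Y3 Y v w1 w2 \<longleftrightarrow> (\<forall>p q s. ?Q (- 1 - q) (- 1 - p) s)"
    unfolding jacobi_identity_def 1 2 3 sgn by (simp add: algebra_simps)
  also have "\<dots> \<longleftrightarrow> (\<forall>m n s. ?Q m n s)"
  proof (intro iffI allI)
    fix m n s assume *: "\<forall>p q s. ?Q (- 1 - q) (- 1 - p) s"
    show "?Q m n s" using *[rule_format, where p = "- 1 - n" and q = "- 1 - m" and s = s] by simp
  qed blast
  finally show ?thesis .
qed

text \<open>The span of a set closed under scalar multiples consists of finite sums of its members.
  With homogeneous vectors as the set, an induction has to treat only these and sums.\<close>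

lemma span_sum_induct:
  assumes "w \<in> cvec.span S" "\<And>c x. x \<in> S \<Longrightarrow> c *\<^sub>C x \<in> S" "P 0" "\<And>x. x \<in> S \<Longrightarrow> P x"
    "\<And>u v. u \<in> cvec.span S \<Longrightarrow> v \<in> cvec.span S \<Longrightarrow> P u \<Longrightarrow> P v \<Longrightarrow> P (u + v)"
  shows "P w"
proof -
  have "w \<in> cvec.span S \<and> P w"
    using assms(1)
  proof (induction rule: cvec.span_induct_alt)
    case (step c x y)
    then show ?case using assms(2,4,5) by (metis cvec.span_add cvec.span_base)
  qed (simp add: assms(3) cvec.span_zero)
  then show ?thesis by blast
qed

lemma clinear_on_funpow:
  assumes "clinear_on S S T"
  shows "clinear_on S S (T ^^ N)"
proof (induction N)
  case (Suc N)
  then show ?case using assms by (auto simp: clinear_on_def)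
qed (auto simp: clinear_on_def)

lemma clinear_on_minus_scaleC:
  assumes "clinear_on S S T" "cvec.subspace S"
  shows "clinear_on S S (\<lambda>u. T u - n *\<^sub>C u)"
  unfolding clinear_on_def
  using clinear_onD[OF assms(1)] cvec.subspace_diff[OF assms(2)] cvec.subspace_scale[OF assms(2)]
  by (auto simp: cvec.scale_right_diff_distrib scaleC_add_right mult.commute)

lemma funpow_eq_zero_mono:
  assumes "clinear_on S S T" "cvec.subspace S" "(T ^^ N) w = 0" "N \<le> M"
  shows "(T ^^ M) w = 0"
proof -
  have "(T ^^ M) w = (T ^^ (M - N)) ((T ^^ N) w)"
    using assms(4) by (metis funpow_add le_add_diff_inverse2 o_apply)
  then show ?thesis using assms(3) clinear_on_zero[OF clinear_on_funpow[OF assms(1)] assms(2)] by simp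
qed

subsection \<open>Strongly graded vertex algebras\<close>

text \<open>The central term is a multiple of m^3 - m, which vanishes for m = -1, 0, 1.\<close>

lemma virasoro_imp_sl2:
  assumes "virasoro_relations S L c"
  shows "sl2_relations S L"
  unfolding sl2_relations_def
proof (intro ballI)
  fix w assume "w \<in> S"
  note v = assms[unfolded virasoro_relations_def, rule_format, OF this]
  show "L 0 (L 1 w) - L 1 (L 0 w) = - L 1 w \<and> L 0 (L (- 1) w) - L (- 1) (L 0 w) = L (- 1) w \<and>
    L 1 (L (- 1) w) - L (- 1) (L 1 w) = 2 *\<^sub>C L 0 w"
    using v[of 0 1] v[of 0 "-1"] v[of 1 "-1"] by simp
qed

locale sg_algebra =
  fixes A :: "'g::ab_group_add set" and V :: "('v::complex_vector, 'g) vertex_structure"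
  assumes subgroup: "is_subgroup A" and sg_V: "strongly_graded_vertex_algebra A V"
begin

lemma va: "vertex_algebra V"
  using sg_V by (simp add: strongly_graded_vertex_algebra_def)

lemma weight_alg_direct_sum: "is_direct_sum UNIV (weight_alg V) UNIV"
  using va by (simp add: vertex_algebra_def)

lemma vertex_op_linear: "clinear_on UNIV UNIV (\<lambda>v. vertex_op V u v n)"
  using va by (simp add: vertex_algebra_def)

lemma L_alg_linear:
  assumes "j \<in> {-1, 0, 1}"
  shows "clinear_on UNIV UNIV (L_alg V j)"
proof (cases "conformal_vector V")
  case None
  then show ?thesis using va assms by (auto simp: vertex_algebra_def)
next
  case (Some \<omega>)
  then have "L_alg V j = (\<lambda>v. vertex_op V \<omega> v (- j - 2))"
    using va by (auto simp: vertex_algebra_def)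
  then show ?thesis using vertex_op_linear by simp
qed

lemma L_alg_sl2: "sl2_relations UNIV (L_alg V)"
proof (cases "conformal_vector V")
  case None
  then show ?thesis using va by (auto simp: vertex_algebra_def)
next
  case (Some \<omega>)
  then show ?thesis using va virasoro_imp_sl2 by (auto simp: vertex_algebra_def)
qed

lemma L0_alg: "v \<in> weight_alg V n \<Longrightarrow> L_alg V 0 v = of_int n *\<^sub>C v"
  using va by (simp add: vertex_algebra_def)

text \<open>Converse of the grading axiom. Applying L(0) to the decomposition of \<open>v\<close>
  and comparing components leaves only the component of weight n. It serves to find weights from
  commutation relations.\<close>

lemma weight_algI:
  assumes "L_alg V 0 v = of_int n *\<^sub>C v"
  shows "v \<in> weight_alg V n"
proof -
  note ds = weight_alg_direct_sum
  obtain f where f: "f \<in> graded_families UNIV (weight_alg V)" "v = Sum_any f"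
    using is_direct_sum_decompose[OF ds UNIV_I] .
  then have fin: "finite {i. f i \<noteq> 0}" and fi: "f i \<in> weight_alg V i" for i
    by (auto simp: graded_families_def)
  have "Sum_any (\<lambda>i. of_int i *\<^sub>C f i) = L_alg V 0 v"
    unfolding f(2) using fin fi
    by (subst clinear_on_Sum_any[OF L_alg_linear cvec.subspace_UNIV]) (auto simp: L0_alg[OF fi])
  also have "\<dots> = Sum_any (\<lambda>i. of_int n *\<^sub>C f i)"
    using Sum_any_scaleC[OF fin, of "of_int n"] assms f(2) by simp
  finally have "(\<lambda>i. of_int i *\<^sub>C f i) = (\<lambda>i. of_int n *\<^sub>C f i)"
    using is_direct_sum_subspace[OF ds] fi
    by (intro is_direct_sum_unique[OF ds])
      (auto simp: graded_families_def cvec.subspace_scale intro: finite_subset[OF _ fin])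
  then have "f i = 0" if "i \<noteq> n" for i
    using that by (metis cvec.scale_right_imp_eq of_int_eq_iff)
  then have "v = f n"
    unfolding f(2) by (subst Sum_any.expand_superset[of "{n}"]) auto
  then show ?thesis using fi by simp
qed

lemma L1_alg_weight:
  assumes "v \<in> weight_alg V n"
  shows "L_alg V 1 v \<in> weight_alg V (n - 1)"
proof (rule weight_algI)
  have "L_alg V 0 (L_alg V 1 v) = L_alg V 1 (L_alg V 0 v) - L_alg V 1 v"
    using L_alg_sl2 by (auto simp: sl2_relations_def algebra_simps)
  also have "L_alg V 1 (L_alg V 0 v) = of_int n *\<^sub>C L_alg V 1 v"
    using clinear_onD(3)[OF L_alg_linear] by (simp add: L0_alg[OF assms])
  finally show "L_alg V 0 (L_alg V 1 v) = of_int (n - 1) *\<^sub>C L_alg V 1 v"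
    by (simp add: cvec.scale_left_diff_distrib)
qed

lemma L1_pow_alg_weight:
  "v \<in> weight_alg V n \<Longrightarrow> (L_alg V 1 ^^ i) v \<in> weight_alg V (n - int i)"
proof (induction i)
  case (Suc i)
  then show ?case using L1_alg_weight[of "(L_alg V 1 ^^ i) v" "n - int i"] by (simp add: algebra_simps)
qed simp

lemma L1_alg_grade: "\<alpha> \<in> A \<Longrightarrow> v \<in> grade_alg V \<alpha> \<Longrightarrow> L_alg V 1 v \<in> grade_alg V \<alpha>"
  using sg_V by (auto simp: strongly_graded_vertex_algebra_def image_subset_iff)

lemma L1_pow_alg_grade:
  "\<alpha> \<in> A \<Longrightarrow> v \<in> grade_alg V \<alpha> \<Longrightarrow> (L_alg V 1 ^^ i) v \<in> grade_alg V \<alpha>"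
  by (induction i) (auto simp: L1_alg_grade)

text \<open>Opposite operators and the adjointness of modes have explicit formulas only for vectors
  homogeneous in both gradings; since the statements needed are additive in \<open>v\<close>, this
  induction extends them.\<close>

lemma alg_induct [consumes 0, case_names hom add]:
  assumes hom: "\<And>\<alpha> h v. \<alpha> \<in> A \<Longrightarrow> v \<in> grade_alg V \<alpha> \<Longrightarrow> v \<in> weight_alg V h \<Longrightarrow> P v"
    and add: "\<And>u v. P u \<Longrightarrow> P v \<Longrightarrow> P (u + v)"
  shows "P v"
proof -
  have ds: "is_direct_sum A (grade_alg V) UNIV"
    and ds2: "\<And>\<alpha>. \<alpha> \<in> A \<Longrightarrow>
      is_direct_sum UNIV (\<lambda>n. grade_alg V \<alpha> \<inter> weight_alg V n) (grade_alg V \<alpha>)"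
    using sg_V by (auto simp: strongly_graded_vertex_algebra_def)
  have P0: "P 0"
    using hom[of 0 0 0] subgroup is_direct_sum_subspace[OF ds] is_direct_sum_subspace[OF weight_alg_direct_sum]
    by (auto simp: cvec.subspace_0 is_subgroup_def)
  have grade: "P v" if "\<alpha> \<in> A" "v \<in> grade_alg V \<alpha>" for v \<alpha>
  proof -
    have "v \<in> cvec.span (\<Union>n. grade_alg V \<alpha> \<inter> weight_alg V n)"
      using that is_direct_sum_span[OF ds2[OF that(1)]] by simp
    then show ?thesis
    proof (rule span_sum_induct)
      fix c x assume "x \<in> (\<Union>n. grade_alg V \<alpha> \<inter> weight_alg V n)"
      then show "c *\<^sub>C x \<in> (\<Union>n. grade_alg V \<alpha> \<inter> weight_alg V n)"
        using is_direct_sum_subspace[OF ds that(1)] is_direct_sum_subspace[OF weight_alg_direct_sum]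
        by (auto intro: cvec.subspace_scale)
    qed (use that hom add P0 in auto)
  qed
  have "v \<in> cvec.span (\<Union>\<alpha>\<in>A. grade_alg V \<alpha>)"
    using is_direct_sum_span[OF ds] by simp
  then show ?thesis
  proof (rule span_sum_induct)
    fix c x assume "x \<in> (\<Union>\<alpha>\<in>A. grade_alg V \<alpha>)"
    then show "c *\<^sub>C x \<in> (\<Union>\<alpha>\<in>A. grade_alg V \<alpha>)"
      using is_direct_sum_subspace[OF ds] by (auto intro: cvec.subspace_scale)
  qed (use grade add P0 in auto)
qed

lemma L1_pow_alg_linear: "clinear_on UNIV UNIV (L_alg V 1 ^^ i)"
  by (intro clinear_on_funpow L_alg_linear) simp

text \<open>L(1) lowers the weight by one and preserves the second grade, in which the weights are
  bounded below.\<close>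

lemma L1_alg_nilpotent: "\<exists>N. \<forall>i\<ge>N. (L_alg V 1 ^^ i) v = 0"
proof (induction v rule: alg_induct)
  case (hom \<alpha> h v)
  then obtain K where K: "\<forall>n<K. grade_alg V \<alpha> \<inter> weight_alg V n = {0}"
    using sg_V by (auto simp: strongly_graded_vertex_algebra_def)
  have "(L_alg V 1 ^^ i) v = 0" if "i \<ge> nat (h - K) + 1" for i
  proof -
    have "(L_alg V 1 ^^ i) v \<in> grade_alg V \<alpha> \<inter> weight_alg V (h - int i)"
      using L1_pow_alg_weight L1_pow_alg_grade hom by blast
    moreover have "h - int i < K" using that by simp
    ultimately show ?thesis using K by blast
  qed
  then show ?case by blast
next
  case (add u v)
  then obtain N M where "\<forall>i\<ge>N. (L_alg V 1 ^^ i) u = 0" "\<forall>i\<ge>M. (L_alg V 1 ^^ i) v = 0" by blast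
  then have "\<forall>i\<ge>max N M. (L_alg V 1 ^^ i) (u + v) = 0"
    using clinear_onD(2)[OF L1_pow_alg_linear] by simp
  then show ?case by blast
qed

end

subsection \<open>Graded spaces with vertex operators\<close>

definition bihom :: "('v, 'w, 'g) module_structure \<Rightarrow> 'g \<Rightarrow> complex \<Rightarrow> 'w set"
  where "bihom M \<beta> n = grade_mod M \<beta> \<inter> weight_mod M n"

text \<open>The part of the module axioms that is needed of contragredient modules; in particular there
  is no Jacobi identity.\<close>

locale premodule =
  fixes M :: "('v::complex_vector, 'w::complex_vector, 'g::ab_group_add) module_structure"
  assumes subspace_mspace: "cvec.subspace (mspace M)"
    and subspace_bihom: "cvec.subspace (bihom M \<beta> n)"
    and mspace_span: "mspace M = cvec.span (\<Union>\<beta> n. bihom M \<beta> n)"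
    and grade_span: "grade_mod M \<beta> = cvec.span (\<Union>n. bihom M \<beta> n)"
    and bihom_truncated: "\<exists>K. \<forall>k<K. bihom M \<beta> (n + of_int k) = {0}"
    and bihom_finite_dimensional: "finite_dimensional (bihom M \<beta> n)"
    and L_linear: "j \<in> {-1, 0, 1} \<Longrightarrow> clinear_on (mspace M) (mspace M) (L_mod M j)"
    and L0_nilpotent: "w \<in> bihom M \<beta> n \<Longrightarrow> \<exists>N. ((\<lambda>u. L_mod M 0 u - n *\<^sub>C u) ^^ N) w = 0"
    and op_linear: "clinear_on (mspace M) (mspace M) (\<lambda>w. module_op M v w e)"
    and op_linear_left: "w \<in> mspace M \<Longrightarrow> clinear_on UNIV (mspace M) (\<lambda>v. module_op M v w e)"
    and op_truncated: "w \<in> mspace M \<Longrightarrow> \<exists>N. \<forall>e<N. module_op M v w e = 0"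
begin

lemma bihom_subset_mspace: "bihom M \<beta> n \<subseteq> mspace M"
  and bihom_subset_grade: "bihom M \<beta> n \<subseteq> grade_mod M \<beta>"
  unfolding mspace_span grade_span[of \<beta>] by (auto intro: cvec.span_base)

lemma subspace_grade: "cvec.subspace (grade_mod M \<beta>)"
  unfolding grade_span by simp

lemma grade_subset_mspace: "grade_mod M \<beta> \<subseteq> mspace M"
  unfolding mspace_span grade_span by (rule cvec.span_mono) blast

lemma mspace_induct [consumes 1, case_names hom add]:
  assumes "w \<in> mspace M" and hom: "\<And>\<beta> n w. w \<in> bihom M \<beta> n \<Longrightarrow> P w"
    and add: "\<And>u w. u \<in> mspace M \<Longrightarrow> w \<in> mspace M \<Longrightarrow> P u \<Longrightarrow> P w \<Longrightarrow> P (u + w)"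
  shows "P w"
  using assms(1) unfolding mspace_span
proof (rule span_sum_induct)
  show "P 0" using hom cvec.subspace_0[OF subspace_bihom] by blast
  show "c *\<^sub>C x \<in> (\<Union>\<beta> n. bihom M \<beta> n)" if "x \<in> (\<Union>\<beta> n. bihom M \<beta> n)" for c x
    using that by (auto intro: cvec.subspace_scale[OF subspace_bihom])
qed (use hom add mspace_span in auto)

lemma grade_induct [consumes 1, case_names hom add]:
  assumes "w \<in> grade_mod M \<beta>" and hom: "\<And>n w. w \<in> bihom M \<beta> n \<Longrightarrow> P w"
    and add: "\<And>u w. u \<in> grade_mod M \<beta> \<Longrightarrow> w \<in> grade_mod M \<beta> \<Longrightarrow> P u \<Longrightarrow> P w \<Longrightarrow> P (u + w)"
  shows "P w"
  using assms(1) unfolding grade_span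
proof (rule span_sum_induct)
  show "P 0" using hom cvec.subspace_0[OF subspace_bihom] by blast
  show "c *\<^sub>C x \<in> (\<Union>n. bihom M \<beta> n)" if "x \<in> (\<Union>n. bihom M \<beta> n)" for c x
    using that by (auto intro: cvec.subspace_scale[OF subspace_bihom])
qed (use hom add grade_span in auto)

end

subsection \<open>Strongly graded modules\<close>

locale sg_module = sg_algebra A V
  for A :: "'g::ab_group_add set" and V :: "('v::complex_vector, 'g) vertex_structure" +
  fixes W :: "('v, 'w::complex_vector, 'g) module_structure"
  assumes sg_W: "strongly_graded_module A V W"
begin

lemma gm: "generalized_module V W"
  using sg_W by (simp add: strongly_graded_module_def)

lemma mod_subspace: "cvec.subspace (mspace W)"
  and mod_weight_direct_sum: "is_direct_sum UNIV (weight_mod W) (mspace W)"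
  and mod_op_linear: "clinear_on (mspace W) (mspace W) (\<lambda>w. module_op W v w n)"
  and mod_op_linear_left: "w \<in> mspace W \<Longrightarrow> clinear_on UNIV (mspace W) (\<lambda>v. module_op W v w n)"
  and mod_op_truncated: "w \<in> mspace W \<Longrightarrow> \<exists>N. \<forall>n<N. module_op W v w n = 0"
  and mod_op_jacobi: "w \<in> mspace W \<Longrightarrow>
    jacobi_identity (vertex_op V) (module_op W) (module_op W) (module_op W) u v w"
  and mod_L0_nilpotent: "w \<in> weight_mod W m \<Longrightarrow>
    \<exists>N. \<forall>M\<ge>N. ((\<lambda>u. L_mod W 0 u - m *\<^sub>C u) ^^ M) w = 0"
  and mod_op_derivative: "w \<in> mspace W \<Longrightarrow>
    module_op W (L_alg V (-1) v) w n = of_int (n + 1) *\<^sub>C module_op W v w (n + 1)"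
  using gm by (simp_all add: generalized_module_def)

lemma mod_grade_direct_sum: "is_direct_sum UNIV (grade_mod W) (mspace W)"
  and mod_bigrade_direct_sum: "is_direct_sum UNIV (\<lambda>n. bihom W \<beta> n) (grade_mod W \<beta>)"
  and mod_truncated: "\<exists>K. \<forall>k<K. bihom W \<beta> (m + of_int k) = {0}"
  and mod_finite_dimensional: "finite_dimensional (bihom W \<beta> m)"
  and mod_op_grade: "\<alpha> \<in> A \<Longrightarrow> v \<in> grade_alg V \<alpha> \<Longrightarrow> w \<in> grade_mod W \<beta> \<Longrightarrow>
    module_op W v w n \<in> grade_mod W (\<alpha> + \<beta>)"
  and mod_L_grade: "j \<in> {-1, 0, 1} \<Longrightarrow> w \<in> grade_mod W \<beta> \<Longrightarrow> L_mod W j w \<in> grade_mod W \<beta>"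
  using sg_W by (auto simp add: strongly_graded_module_def bihom_def image_subset_iff)

lemma mod_L_linear:
  assumes "j \<in> {-1, 0, 1}"
  shows "clinear_on (mspace W) (mspace W) (L_mod W j)"
proof (cases "conformal_vector V")
  case None
  then show ?thesis using gm assms by (auto simp: generalized_module_def)
next
  case (Some \<omega>)
  then have *: "L_mod W j w = module_op W \<omega> w (- j - 2)" if "w \<in> mspace W" for w
    using gm that by (auto simp: generalized_module_def)
  show ?thesis
    using clinear_onD[OF mod_op_linear[of \<omega> "- j - 2"]]
      cvec.subspace_add[OF mod_subspace] cvec.subspace_scale[OF mod_subspace]
    by (auto simp: clinear_on_def *)
qed

lemma mod_sl2: "sl2_relations (mspace W) (L_mod W)"
proof (cases "conformal_vector V")
  case None
  then show ?thesis using gm by (auto simp: generalized_module_def)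
next
  case (Some \<omega>)
  then show ?thesis using gm virasoro_imp_sl2 by (auto simp: generalized_module_def)
qed

text \<open>In the conformal case the bracket relations are the commutator formula for \<open>\<omega>\<close>.\<close>

lemma mod_sl2_bracket:
  assumes w: "w \<in> mspace W"
  shows "sl2_bracket (L_alg V) (L_mod W) (L_mod W) (module_op W) v w"
proof (cases "conformal_vector V")
  case None
  then show ?thesis using gm w by (auto simp: generalized_module_def)
next
  case (Some \<omega>)
  then have L: "L_mod W j w = module_op W \<omega> w (- j - 2)" if "w \<in> mspace W" for w j
    using gm that by (auto simp: generalized_module_def)
  have Lv: "L_alg V j v = vertex_op V \<omega> v (- j - 2)" for j
    using va Some by (auto simp: vertex_algebra_def)
  \<comment> \<open>For n = 0 only the first summand of each of the two sums on the left
    survives.\<close>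
  have g0: "(0 :: complex) gchoose c = 0" if "c \<ge> 1" for c
    using that by (cases c) auto
  have "L_mod W (int m - 1) (module_op W v w s) - module_op W v (L_mod W (int m - 1) w) s
    = (\<Sum>i\<le>m. of_nat (m choose i) *\<^sub>C module_op W (L_alg V (int m - 1 - int i) v) w (s - int i))" for m s
  proof -
    \<comment> \<open>The component identity with n = 0 is the commutator formula for \<omega>_m,
      and \<omega>_m = L(m-1).\<close>
    note J = mod_op_jacobi[OF w, of \<omega> v, unfolded jacobi_identity_iff, rule_format, of 0 s "int m"]
    have 1: "Sum_any (\<lambda>c. ((-1) ^ c * (of_int 0 gchoose c)) *\<^sub>C
        module_op W \<omega> (module_op W v w (s - of_nat c)) (int c - int m - 0 - 1))
      = module_op W \<omega> (module_op W v w s) (- int m - 1)"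
      by (subst Sum_any_eq_sum_lessThan[of 1]) (simp_all add: g0)
    have 2: "Sum_any (\<lambda>b. ((-1) powi 0 * (-1) ^ b * (of_int 0 gchoose b)) *\<^sub>C
        module_op W v (module_op W \<omega> w (- int m - 1 - int b)) (s - of_int 0 + of_nat b))
      = module_op W v (module_op W \<omega> w (- int m - 1)) s"
      by (subst Sum_any_eq_sum_lessThan[of 1]) (simp_all add: g0)
    have 3: "Sum_any (\<lambda>a. (of_int (int m) gchoose a) *\<^sub>C
        module_op W (vertex_op V \<omega> v (- 0 - 1 - int a)) w (s - of_int (int m) + of_nat a))
      = (\<Sum>a<Suc m. of_nat (m choose a) *\<^sub>C
          module_op W (L_alg V (int a - 1) v) w (s - int m + int a))"
      by (subst Sum_any_eq_sum_lessThan[of "Suc m"])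
        (simp_all add: Lv binomial_gbinomial[symmetric] binomial_eq_0)
    \<comment> \<open>The summation is reversed, a = m - i, since the bracket relation counts powers
      of x upwards while the Jacobi identity counts modes of \<omega> upwards.\<close>
    have 4: "(\<Sum>a<Suc m. of_nat (m choose a) *\<^sub>C
          module_op W (L_alg V (int a - 1) v) w (s - int m + int a))
      = (\<Sum>i<Suc m. of_nat (m choose i) *\<^sub>C
          module_op W (L_alg V (int m - 1 - int i) v) w (s - int i))"
      by (subst sum.nat_diff_reindex[symmetric])
        (auto intro!: sum.cong simp: of_nat_diff binomial_symmetric[symmetric] algebra_simps)
    have "- (int m - 1) - 2 = - int m - 1" by simp
    then have Lm: "L_mod W (int m - 1) u = module_op W \<omega> u (- int m - 1)" if "u \<in> mspace W" for u
      using L[OF that, of "int m - 1"] by (simp only:)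
    show ?thesis
      using J unfolding 1 2 3 4
      by (simp only: Lm[OF w] Lm[OF clinear_onD(1)[OF mod_op_linear w]] lessThan_Suc_atMost)
  qed
  from this[of 0] this[of 1] this[of 2] show ?thesis
    unfolding sl2_bracket_def by auto
qed

text \<open>Decompose \<open>w\<close> and subtract \<open>w\<close> from its component of weight n:
  the results are generalized eigenvectors of L(0) for distinct eigenvalues with sum zero, hence all
  zero, and \<open>w\<close> equals that component.\<close>

lemma weight_modI:
  assumes w: "w \<in> mspace W" and nil: "((\<lambda>u. L_mod W 0 u - n *\<^sub>C u) ^^ N) w = 0"
  shows "w \<in> weight_mod W n"
proof -
  note ds = mod_weight_direct_sum
  let ?D = "\<lambda>m u. L_mod W 0 u - m *\<^sub>C u"
  have Dlin: "clinear_on (mspace W) (mspace W) (?D m)" for m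
    by (intro clinear_on_minus_scaleC mod_L_linear mod_subspace) simp
  obtain f where f: "f \<in> graded_families UNIV (weight_mod W)" "w = Sum_any f"
    using is_direct_sum_decompose[OF ds w] .
  then have fin: "finite {i. f i \<noteq> 0}" and fi: "f i \<in> weight_mod W i" for i
    by (auto simp: graded_families_def)
  have fm: "f i \<in> mspace W" for i
    using fi is_direct_sum_summand[OF ds] by blast
  let ?F = "insert n {i. f i \<noteq> 0}"
  define u where "u m = (if m = n then f m - w else f m)" for m
  have "\<forall>m\<in>?F. u m = 0"
  proof (rule generalized_eigenvectors_independent[OF mod_subspace mod_L_linear])
    show "u m \<in> mspace W" for m
      using fm w by (auto simp: u_def cvec.subspace_diff[OF mod_subspace])
    show "\<exists>M. (?D m ^^ M) (u m) = 0" for m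
    proof -
      obtain M where M: "\<forall>k\<ge>M. (?D m ^^ k) (f m) = 0"
        using mod_L0_nilpotent[OF fi] by blast
      have "(?D n ^^ max M N) w = 0"
        by (rule funpow_eq_zero_mono[OF Dlin mod_subspace nil]) simp
      then have "(?D m ^^ max M N) (u m) = 0"
        using M clinear_on_diff[OF clinear_on_funpow[OF Dlin] mod_subspace fm w]
        by (auto simp: u_def)
      then show ?thesis by blast
    qed
    have "(\<Sum>m\<in>?F. u m) = (\<Sum>m\<in>?F. f m - (if m = n then w else 0))"
      by (rule sum.cong) (auto simp: u_def)
    also have "\<dots> = (\<Sum>m\<in>?F. f m) - w"
      using fin by (simp add: sum_subtractf)
    also have "(\<Sum>m\<in>?F. f m) = w"
      unfolding f(2) by (rule Sum_any.expand_superset[symmetric]) (use fin in auto)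
    finally show "(\<Sum>m\<in>?F. u m) = 0" by simp
  qed (use fin in auto)
  then have "f n = w" by (auto simp: u_def)
  then show ?thesis using fi by metis
qed

context
  fixes K \<kappa>
  assumes K: "clinear_on (mspace W) (mspace W) K"
    and comm: "\<And>u. u \<in> mspace W \<Longrightarrow> L_mod W 0 (K u) = K (L_mod W 0 u) + \<kappa> *\<^sub>C K u"
begin

text \<open>The commutation relation says (L(0) - n - \<kappa>) K = K (L(0) - n), so
  \<open>K\<close> shifts generalized weights by \<kappa> and respects the nilpotent parts. It is
  applied to K = L(j) and to the modes of homogeneous vectors.\<close>

lemma L0_shift_power:
  assumes w: "w \<in> mspace W"
  shows "((\<lambda>u. L_mod W 0 u - (n + \<kappa>) *\<^sub>C u) ^^ M) (K w) = K (((\<lambda>u. L_mod W 0 u - n *\<^sub>C u) ^^ M) w)"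
proof (induction M)
  case (Suc M)
  let ?D = "\<lambda>m u. L_mod W 0 u - m *\<^sub>C u"
  have Dlin: "clinear_on (mspace W) (mspace W) (?D m)" for m
    by (intro clinear_on_minus_scaleC mod_L_linear mod_subspace) simp
  let ?u = "(?D n ^^ M) w"
  have u: "?u \<in> mspace W" using clinear_onD(1)[OF clinear_on_funpow[OF Dlin] w] .
  have "(?D (n + \<kappa>) ^^ Suc M) (K w) = L_mod W 0 (K ?u) - (n + \<kappa>) *\<^sub>C K ?u"
    using Suc by simp
  also have "\<dots> = K (L_mod W 0 ?u) - n *\<^sub>C K ?u"
    by (simp add: comm[OF u] scaleC_add_left)
  also have "\<dots> = K (L_mod W 0 ?u - n *\<^sub>C ?u)"
    using u clinear_onD(1)[OF mod_L_linear] clinear_on_diff[OF K mod_subspace] clinear_onD(3)[OF K]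
      cvec.subspace_scale[OF mod_subspace] by simp
  finally show ?case by simp
qed simp

lemma weight_mod_shift:
  assumes "w \<in> weight_mod W n"
  shows "K w \<in> weight_mod W (n + \<kappa>)"
proof -
  have w: "w \<in> mspace W"
    using assms is_direct_sum_summand[OF mod_weight_direct_sum] by blast
  obtain N where "\<forall>M\<ge>N. ((\<lambda>u. L_mod W 0 u - n *\<^sub>C u) ^^ M) w = 0"
    using mod_L0_nilpotent[OF assms] by blast
  then have "((\<lambda>u. L_mod W 0 u - (n + \<kappa>) *\<^sub>C u) ^^ N) (K w) = 0"
    using clinear_on_zero[OF K mod_subspace] by (simp add: L0_shift_power[OF w])
  then show ?thesis by (rule weight_modI[OF clinear_onD(1)[OF K w]])
qed

end

lemma L_mod_comm:
  assumes "w \<in> mspace W"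
  shows "L_mod W 0 (L_mod W 1 w) = L_mod W 1 (L_mod W 0 w) - L_mod W 1 w"
    "L_mod W 0 (L_mod W (-1) w) = L_mod W (-1) (L_mod W 0 w) + L_mod W (-1) w"
    "L_mod W 1 (L_mod W (-1) w) = L_mod W (-1) (L_mod W 1 w) + 2 *\<^sub>C L_mod W 0 w"
  using mod_sl2[unfolded sl2_relations_def, rule_format, OF assms] by (auto simp: diff_eq_eq)

text \<open>The bracket relations after inserting L(0) v = h v and the L(-1)-derivative property. In
  the second one, the binomial coefficients 1, 2, 1 contribute 2h from the middle term, and the last
  term, read at exponent e - 2, contributes e - 1.\<close>

lemma op_L_comm:
  assumes v: "v \<in> weight_alg V h" and w: "w \<in> mspace W"
  shows "L_mod W 0 (module_op W v w e)
      = module_op W v (L_mod W 0 w) e + of_int (h + e) *\<^sub>C module_op W v w e"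
    "L_mod W 1 (module_op W v w e) = module_op W v (L_mod W 1 w) e
      + module_op W (L_alg V 1 v) w e + of_int (2 * h + e - 1) *\<^sub>C module_op W v w (e - 1)"
proof -
  have move: "a = b + c + d" if "a - b = c + d" for a b c d :: 'w
    using that by (simp add: diff_eq_eq add_ac)
  note br = mod_sl2_bracket[OF w, of v, unfolded sl2_bracket_def, rule_format]
  have L0v: "module_op W (L_alg V 0 v) w n = of_int h *\<^sub>C module_op W v w n" for n
    using clinear_onD(3)[OF mod_op_linear_left[OF w]] by (simp add: L0_alg[OF v])
  have d: "module_op W (L_alg V (-1) v) w (n - 1) = of_int n *\<^sub>C module_op W v w n" for n
    using mod_op_derivative[OF w, of v "n - 1"] by simp
  have "L_mod W 0 (module_op W v w e) - module_op W v (L_mod W 0 w) e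
    = module_op W (L_alg V 0 v) w e + module_op W (L_alg V (-1) v) w (e - 1)"
    using br[of 0 e] by simp
  then show "L_mod W 0 (module_op W v w e)
      = module_op W v (L_mod W 0 w) e + of_int (h + e) *\<^sub>C module_op W v w e"
    by (simp add: L0v d scaleC_add_left diff_eq_eq add.commute)
  have "L_mod W 1 (module_op W v w e) - module_op W v (L_mod W 1 w) e
    = module_op W (L_alg V 1 v) w e + 2 *\<^sub>C module_op W (L_alg V 0 v) w (e - 1)
      + module_op W (L_alg V (-1) v) w (e - 2)"
    using br[of 1 e] by (simp add: numeral_2_eq_2 add.assoc)
  also have "module_op W (L_alg V (-1) v) w (e - 2) = of_int (e - 1) *\<^sub>C module_op W v w (e - 1)"
    using d[of "e - 1"] by simp
  finally have "L_mod W 1 (module_op W v w e) - module_op W v (L_mod W 1 w) e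
    = module_op W (L_alg V 1 v) w e + (of_int (2 * h) *\<^sub>C module_op W v w (e - 1)
      + of_int (e - 1) *\<^sub>C module_op W v w (e - 1))"
    by (simp add: L0v add.assoc)
  also have "of_int (2 * h) *\<^sub>C module_op W v w (e - 1) + of_int (e - 1) *\<^sub>C module_op W v w (e - 1)
    = of_int (2 * h + e - 1) *\<^sub>C module_op W v w (e - 1)"
    unfolding scaleC_add_left[symmetric] of_int_add[symmetric] by (simp add: algebra_simps)
  finally have "L_mod W 1 (module_op W v w e) - module_op W v (L_mod W 1 w) e
    = module_op W (L_alg V 1 v) w e + of_int (2 * h + e - 1) *\<^sub>C module_op W v w (e - 1)" .
  then show "L_mod W 1 (module_op W v w e) = module_op W v (L_mod W 1 w) e
      + module_op W (L_alg V 1 v) w e + of_int (2 * h + e - 1) *\<^sub>C module_op W v w (e - 1)"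
    by (rule move)
qed

lemma bihom_L_mod:
  assumes j: "j \<in> {-1, 0, 1}" and w: "w \<in> bihom W \<beta> n"
  shows "L_mod W j w \<in> bihom W \<beta> (n - of_int j)"
proof -
  have "L_mod W 0 (L_mod W j u) = L_mod W j (L_mod W 0 u) + (- of_int j) *\<^sub>C L_mod W j u"
    if "u \<in> mspace W" for u
    using j L_mod_comm[OF that] by auto
  from weight_mod_shift[OF mod_L_linear[OF j] this] w mod_L_grade[OF j]
  show ?thesis by (auto simp: bihom_def)
qed

lemma bihom_module_op:
  assumes "\<alpha> \<in> A" "v \<in> grade_alg V \<alpha>" "v \<in> weight_alg V h" "w \<in> bihom W \<beta> n"
  shows "module_op W v w e \<in> bihom W (\<alpha> + \<beta>) (n + of_int (h + e))"
proof -
  have "module_op W v w e \<in> weight_mod W (n + of_int (h + e))"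
    by (rule weight_mod_shift[OF mod_op_linear])
      (use assms op_L_comm(1) in \<open>auto simp: bihom_def\<close>)
  then show ?thesis using mod_op_grade assms by (auto simp: bihom_def)
qed

sublocale premodule W
proof
  show "mspace W = cvec.span (\<Union>\<beta> n. bihom W \<beta> n)"
  proof
    show "cvec.span (\<Union>\<beta> n. bihom W \<beta> n) \<subseteq> mspace W"
      using is_direct_sum_summand[OF mod_grade_direct_sum]
      by (intro cvec.span_minimal mod_subspace) (auto simp: bihom_def)
    have "grade_mod W \<beta> \<subseteq> cvec.span (\<Union>\<beta> n. bihom W \<beta> n)" for \<beta>
      by (subst is_direct_sum_span[OF mod_bigrade_direct_sum]) (rule cvec.span_mono, blast)
    then show "mspace W \<subseteq> cvec.span (\<Union>\<beta> n. bihom W \<beta> n)"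
      by (subst is_direct_sum_span[OF mod_grade_direct_sum]) (intro cvec.span_minimal, auto)
  qed
  show "\<exists>N. ((\<lambda>u. L_mod W 0 u - n *\<^sub>C u) ^^ N) w = 0" if "w \<in> bihom W \<beta> n" for w \<beta> n
    using that mod_L0_nilpotent[of w n] by (auto simp: bihom_def)
qed (use mod_subspace is_direct_sum_subspace[OF mod_bigrade_direct_sum]
    is_direct_sum_span[OF mod_bigrade_direct_sum] mod_truncated mod_finite_dimensional mod_L_linear
    mod_op_linear mod_op_linear_left mod_op_truncated in \<open>auto\<close>)

lemma L1_mod_pow_bihom:
  "w \<in> bihom W \<beta> n \<Longrightarrow> (L_mod W 1 ^^ i) w \<in> bihom W \<beta> (n - of_nat i)"
proof (induction i)
  case (Suc i)
  then show ?case using bihom_L_mod[of 1 "(L_mod W 1 ^^ i) w" \<beta> "n - of_nat i"]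
    by (simp add: algebra_simps)
qed simp

lemma L1_mod_nilpotent: "w \<in> mspace W \<Longrightarrow> \<exists>N. \<forall>i\<ge>N. (L_mod W 1 ^^ i) w = 0"
proof (induction w rule: mspace_induct)
  case (hom \<beta> n w)
  obtain K where K: "\<forall>k<K. bihom W \<beta> (n + of_int k) = {0}"
    using bihom_truncated by blast
  have "(L_mod W 1 ^^ i) w = 0" if "i \<ge> nat (- K) + 1" for i
  proof -
    have "- int i < K" using that by simp
    then show ?thesis using L1_mod_pow_bihom[OF hom, of i] K by fastforce
  qed
  then show ?case by blast
next
  case (add u w)
  then obtain N M where "\<forall>i\<ge>N. (L_mod W 1 ^^ i) u = 0" "\<forall>i\<ge>M. (L_mod W 1 ^^ i) w = 0" by blast
  then have "\<forall>i\<ge>max N M. (L_mod W 1 ^^ i) (u + w) = 0"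
    using clinear_onD(2)[OF clinear_on_funpow[OF mod_L_linear] add(1,2)] by simp
  then show ?case by blast
qed

end

text \<open>The rule exp(s) exp(t) = exp(s + t) for a terminating series. As \<open>F\<close>
  vanishes from N on, the square of indices may be replaced by the triangle i + j < N, on whose
  antidiagonals the binomial theorem applies. Besides the exponentials of L(1) and L(0) it covers,
  with s = -1 and t = 1, the double opposite operator.\<close>

lemma exp_product_sum:
  fixes F :: "nat \<Rightarrow> 'a::complex_vector"
  assumes "\<And>k. k \<ge> N \<Longrightarrow> F k = 0"
  shows "(\<Sum>i<N. \<Sum>j<N. ((s ^ i / fact i) * (t ^ j / fact j)) *\<^sub>C F (i + j))
    = (\<Sum>k<N. ((s + t) ^ k / fact k) *\<^sub>C F k)"
proof -
  let ?g = "\<lambda>i j. ((s ^ i / fact i) * (t ^ j / fact j)) *\<^sub>C F (i + j)"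
  have F: "k < N" if "F k \<noteq> 0" for k
    using assms[of k] that by (cases "k < N") auto
  have "(\<Sum>i<N. \<Sum>j<N. ?g i j) = (\<Sum>(i, j)\<in>{..<N} \<times> {..<N}. ?g i j)"
    by (simp add: sum.cartesian_product)
  also have "\<dots> = (\<Sum>(i, j)\<in>{(i, j). i + j < N}. ?g i j)"
    by (rule sum.mono_neutral_right) (auto dest: F)
  also have "\<dots> = (\<Sum>k<N. \<Sum>i\<le>k. ?g i (k - i))"
    by (rule sum.triangle_reindex)
  also have "\<dots> = (\<Sum>k<N. ((s + t) ^ k / fact k) *\<^sub>C F k)"
  proof (rule sum.cong[OF refl])
    fix k
    have "(\<Sum>i\<le>k. (s ^ i / fact i) * (t ^ (k - i) / fact (k - i))) = (s + t) ^ k / fact k"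
      unfolding binomial_ring sum_divide_distrib
      by (rule sum.cong) (auto simp: binomial_fact field_simps)
    then have "((s + t) ^ k / fact k) *\<^sub>C F k
      = (\<Sum>i\<le>k. ((s ^ i / fact i) * (t ^ (k - i) / fact (k - i))) *\<^sub>C F k)"
      by (simp only: cvec.scale_sum_left[symmetric])
    then show "(\<Sum>i\<le>k. ?g i (k - i)) = ((s + t) ^ k / fact k) *\<^sub>C F k"
      by (auto intro: sum.cong)
  qed
  finally show ?thesis .
qed

lemma apply_series_additive:
  fixes T :: "'a::complex_vector \<Rightarrow> 'e::cancel_comm_monoid_add \<Rightarrow> 'b::complex_vector"
  assumes "finite {i. f i \<noteq> 0}" "finite {i. g i \<noteq> 0}" "T 0 = (\<lambda>_. 0)"
    "\<And>i e. T (f i + g i) e = T (f i) e + T (g i) e"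
  shows "apply_series T (\<lambda>i. f i + g i) e = apply_series T f e + apply_series T g e"
proof -
  let ?I = "{i. f i \<noteq> 0} \<union> {i. g i \<noteq> 0}"
  have I: "finite ?I" using assms by simp
  have "apply_series T (\<lambda>i. f i + g i) e = (\<Sum>i\<in>?I. shift_series i (T (f i + g i)) e)"
    "apply_series T f e = (\<Sum>i\<in>?I. shift_series i (T (f i)) e)"
    "apply_series T g e = (\<Sum>i\<in>?I. shift_series i (T (g i)) e)"
    by (rule apply_series_eq_sum[OF I]; use assms(3) in auto)+
  moreover have "T (f i + g i) = (\<lambda>e. T (f i) e + T (g i) e)" for i
    using assms(4) by (rule ext)
  ultimately show ?thesis by (simp add: shift_series_plus sum.distrib)
qed

lemma apply_series_scaleC:
  fixes T :: "'a::complex_vector \<Rightarrow> 'e::cancel_comm_monoid_add \<Rightarrow> 'b::complex_vector"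
  assumes "finite {i. f i \<noteq> 0}" "T 0 = (\<lambda>_. 0)" "\<And>i e. T (c *\<^sub>C f i) e = c *\<^sub>C T (f i) e"
  shows "apply_series T (\<lambda>i. c *\<^sub>C f i) e = c *\<^sub>C apply_series T f e"
proof -
  have "apply_series T (\<lambda>i. c *\<^sub>C f i) e = (\<Sum>i\<in>{i. f i \<noteq> 0}. shift_series i (T (c *\<^sub>C f i)) e)"
    "apply_series T f e = (\<Sum>i\<in>{i. f i \<noteq> 0}. shift_series i (T (f i)) e)"
    by (rule apply_series_eq_sum[OF assms(1)]; use assms(2) in auto)+
  moreover have "T (c *\<^sub>C f i) = (\<lambda>e. c *\<^sub>C T (f i) e)" for i
    using assms(3) by (rule ext)
  ultimately show ?thesis
    by (simp add: cvec.scale_sum_right shift_series_map[where h = "\<lambda>x. c *\<^sub>C x"])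
qed

lemma finite_support_apply_series:
  fixes T :: "'a::complex_vector \<Rightarrow> 'e::cancel_comm_monoid_add \<Rightarrow> 'b::complex_vector"
  assumes "finite {i. f i \<noteq> 0}" "T 0 = (\<lambda>_. 0)" "\<And>i. finite {e. T (f i) e \<noteq> 0}"
  shows "finite {e. apply_series T f e \<noteq> 0}"
proof -
  have "apply_series T f = (\<lambda>e. \<Sum>i\<in>{i. f i \<noteq> 0}. shift_series i (T (f i)) e)"
    by (rule ext, rule apply_series_eq_sum) (use assms in auto)
  then show ?thesis
    using finite_support_sum[of _ "\<lambda>i. shift_series i (T (f i))"] finite_support_shift_series[OF assms(3)]
    by simp
qed

subsection \<open>Opposite vertex operators\<close>

text \<open>The coefficients of \<open>Y(exp(x L(1)) (-x^(-2))^L(0) v, x^(-1)) w\<close>.\<close>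

definition opposite_op ::
  "('v::complex_vector, 'g) vertex_structure \<Rightarrow> ('v, 'w::complex_vector, 'g) module_structure \<Rightarrow>
   'v \<Rightarrow> 'w \<Rightarrow> int \<Rightarrow> 'w"
  where "opposite_op V M v w = apply_series (\<lambda>u. invert_x (module_op M u w))
    (apply_series (exp_xL1_alg V) (neg_x_power_L0_alg V v))"

context sg_algebra
begin

lemma neg_x_power_L0_alg_hom:
  assumes "v \<in> weight_alg V h"
  shows "neg_x_power_L0_alg V v = (\<lambda>p. if p = - 2 * h then (-1) powi h *\<^sub>C v else 0)"
proof
  fix p
  show "neg_x_power_L0_alg V v p = (if p = - 2 * h then (-1) powi h *\<^sub>C v else 0)"
    unfolding neg_x_power_L0_alg_def homogeneous_component_single[OF weight_alg_direct_sum assms]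
    by (subst Sum_any.expand_superset[of "{h}"]) (auto split: if_splits)
qed

lemma neg_x_power_L0_alg_finite: "finite {p. neg_x_power_L0_alg V v p \<noteq> 0}"
proof -
  let ?c = "homogeneous_component (weight_alg V) v"
  have "{p. neg_x_power_L0_alg V v p \<noteq> 0} \<subseteq> (\<lambda>n. - 2 * n) ` {n. ?c n \<noteq> 0}"
  proof
    fix p assume "p \<in> {p. neg_x_power_L0_alg V v p \<noteq> 0}"
    then obtain n where "(if p = - 2 * n then (-1) powi n *\<^sub>C ?c n else 0) \<noteq> 0"
      unfolding neg_x_power_L0_alg_def by (auto elim: Sum_any.not_neutral_obtains_not_neutral)
    then show "p \<in> (\<lambda>n. - 2 * n) ` {n. ?c n \<noteq> 0}" by (auto split: if_splits)
  qed
  moreover have "finite {n. ?c n \<noteq> 0}"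
    using homogeneous_component_in[OF weight_alg_direct_sum UNIV_I] by (auto simp: graded_families_def)
  ultimately show ?thesis by (meson finite_imageI finite_subset)
qed

lemma homogeneous_component_alg_finite: "finite {n. homogeneous_component (weight_alg V) v n \<noteq> 0}"
  using homogeneous_component_in[OF weight_alg_direct_sum UNIV_I] by (auto simp: graded_families_def)

lemma neg_x_power_L0_alg_add:
  "neg_x_power_L0_alg V (u + v) p = neg_x_power_L0_alg V u p + neg_x_power_L0_alg V v p"
proof -
  let ?t = "\<lambda>v n. if p = - 2 * n then (-1) powi n *\<^sub>C homogeneous_component (weight_alg V) v n else 0"
  have fin: "finite {n. ?t v n \<noteq> 0}" for v
    by (rule finite_subset[OF _ homogeneous_component_alg_finite[of v]]) auto
  have "?t (u + v) n = ?t u n + ?t v n" for n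
    by (simp add: homogeneous_component_add[OF weight_alg_direct_sum UNIV_I UNIV_I] scaleC_add_right)
  then show ?thesis
    unfolding neg_x_power_L0_alg_def using Sum_any.distrib[OF fin fin] by (simp cong del: if_weak_cong)
qed

lemma neg_x_power_L0_alg_scaleC:
  "neg_x_power_L0_alg V (c *\<^sub>C v) p = c *\<^sub>C neg_x_power_L0_alg V v p"
proof -
  let ?t = "\<lambda>v n. if p = - 2 * n then (-1) powi n *\<^sub>C homogeneous_component (weight_alg V) v n else 0"
  have fin: "finite {n. ?t v n \<noteq> 0}" for v
    by (rule finite_subset[OF _ homogeneous_component_alg_finite[of v]]) auto
  have "?t (c *\<^sub>C v) n = c *\<^sub>C ?t v n" for n
    by (simp add: homogeneous_component_scaleC[OF weight_alg_direct_sum UNIV_I] mult.commute)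
  then show ?thesis
    unfolding neg_x_power_L0_alg_def using Sum_any_scaleC[OF fin] by (simp cong del: if_weak_cong)
qed

lemma exp_xL1_alg_linear: "clinear_on UNIV UNIV (\<lambda>v. exp_xL1_alg V v e)"
  using clinear_onD[OF L1_pow_alg_linear]
  by (auto simp: clinear_on_def exp_xL1_alg_def scaleC_add_right mult.commute)

lemma exp_xL1_alg_zero: "exp_xL1_alg V 0 = (\<lambda>_. 0)"
  using clinear_on_zero[OF exp_xL1_alg_linear cvec.subspace_UNIV] by auto

lemma exp_xL1_alg_finite: "finite {e. exp_xL1_alg V v e \<noteq> 0}"
proof -
  obtain N where N: "\<forall>i\<ge>N. (L_alg V 1 ^^ i) v = 0" using L1_alg_nilpotent by blast
  have "{e. exp_xL1_alg V v e \<noteq> 0} \<subseteq> int ` {..<N}"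
  proof
    fix e assume "e \<in> {e. exp_xL1_alg V v e \<noteq> 0}"
    then have "0 \<le> e" "(L_alg V 1 ^^ nat e) v \<noteq> 0"
      by (auto simp: exp_xL1_alg_def split: if_splits)
    then have "e = int (nat e)" "nat e < N" using N by (auto simp: not_le[symmetric])
    then show "e \<in> int ` {..<N}" by blast
  qed
  then show ?thesis by (rule finite_subset) simp
qed

lemma twisted_vector_add:
  "apply_series (exp_xL1_alg V) (neg_x_power_L0_alg V (u + v)) e
    = apply_series (exp_xL1_alg V) (neg_x_power_L0_alg V u) e
      + apply_series (exp_xL1_alg V) (neg_x_power_L0_alg V v) e"
  unfolding neg_x_power_L0_alg_add
  by (rule apply_series_additive[where f = "neg_x_power_L0_alg V u"])
    (simp_all add: clinear_onD(2)[OF exp_xL1_alg_linear] neg_x_power_L0_alg_finite exp_xL1_alg_zero)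

lemma twisted_vector_scaleC:
  "apply_series (exp_xL1_alg V) (neg_x_power_L0_alg V (c *\<^sub>C v)) e
    = c *\<^sub>C apply_series (exp_xL1_alg V) (neg_x_power_L0_alg V v) e"
  unfolding neg_x_power_L0_alg_scaleC
  by (rule apply_series_scaleC[where f = "neg_x_power_L0_alg V v"])
    (simp_all add: clinear_onD(3)[OF exp_xL1_alg_linear] neg_x_power_L0_alg_finite exp_xL1_alg_zero)

lemma twisted_vector_finite:
  "finite {e. apply_series (exp_xL1_alg V) (neg_x_power_L0_alg V v) e \<noteq> 0}"
  by (rule finite_support_apply_series)
    (simp_all add: neg_x_power_L0_alg_finite exp_xL1_alg_zero exp_xL1_alg_finite)

lemma twisted_vector_hom:
  assumes "v \<in> weight_alg V h"
  shows "apply_series (exp_xL1_alg V) (neg_x_power_L0_alg V v) e =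
    (if 0 \<le> e + 2 * h then ((-1) powi h / fact (nat (e + 2 * h))) *\<^sub>C (L_alg V 1 ^^ nat (e + 2 * h)) v
     else 0)"
proof -
  have "apply_series (exp_xL1_alg V) (neg_x_power_L0_alg V v) e
    = (\<Sum>i\<in>{- 2 * h}. shift_series i (exp_xL1_alg V (neg_x_power_L0_alg V v i)) e)"
    by (rule apply_series_eq_sum) (auto simp: neg_x_power_L0_alg_hom[OF assms] exp_xL1_alg_zero)
  then show ?thesis
    using clinear_onD(3)[OF L1_pow_alg_linear]
    by (simp add: neg_x_power_L0_alg_hom[OF assms] exp_xL1_alg_def)
qed

end

locale sg_premodule = sg_algebra A V + premodule M
  for A :: "'g::ab_group_add set" and V :: "('v::complex_vector, 'g) vertex_structure"
    and M :: "('v, 'w::complex_vector, 'g) module_structure"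
begin

lemma invert_op_zero: "w \<in> mspace M \<Longrightarrow> invert_x (module_op M 0 w) = (\<lambda>_. 0)"
  using clinear_on_zero[OF op_linear_left cvec.subspace_UNIV] by (auto simp: invert_x_def)

lemma opposite_op_eq_sum:
  assumes "w \<in> mspace M" "finite I" "\<And>i. i \<notin> I \<Longrightarrow> f i = 0"
    "f = apply_series (exp_xL1_alg V) (neg_x_power_L0_alg V v)"
  shows "opposite_op V M v w n = (\<Sum>i\<in>I. module_op M (f i) w (i - n))"
proof -
  have "opposite_op V M v w n = (\<Sum>i\<in>I. shift_series i (invert_x (module_op M (f i) w)) n)"
    unfolding opposite_op_def assms(4)[symmetric]
    by (rule apply_series_eq_sum) (use assms invert_op_zero in auto)
  then show ?thesis by (simp add: invert_x_def)
qed

lemma opposite_op_linear: "clinear_on (mspace M) (mspace M) (\<lambda>w. opposite_op V M v w n)"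
proof -
  define f where "f = apply_series (exp_xL1_alg V) (neg_x_power_L0_alg V v)"
  have *: "opposite_op V M v w n = (\<Sum>i\<in>{i. f i \<noteq> 0}. module_op M (f i) w (i - n))"
    if "w \<in> mspace M" for w
    by (rule opposite_op_eq_sum[OF that _ _ f_def]) (auto simp: f_def twisted_vector_finite)
  have "(\<Sum>i\<in>{i. f i \<noteq> 0}. module_op M (f i) w (i - n)) \<in> mspace M" if "w \<in> mspace M" for w
    by (rule cvec.subspace_sum[OF subspace_mspace]) (rule clinear_onD(1)[OF op_linear that])
  then show ?thesis
    using clinear_onD(2,3)[OF op_linear]
      cvec.subspace_add[OF subspace_mspace] cvec.subspace_scale[OF subspace_mspace]
    by (auto simp: clinear_on_def * sum.distrib cvec.scale_sum_right)
qed

lemma opposite_op_linear_left: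
  assumes w: "w \<in> mspace M"
  shows "clinear_on UNIV (mspace M) (\<lambda>v. opposite_op V M v w n)"
proof -
  note lin = clinear_onD[OF op_linear_left[OF w]]
  let ?f = "\<lambda>v. apply_series (exp_xL1_alg V) (neg_x_power_L0_alg V v)"
  have "opposite_op V M (u + v) w n = opposite_op V M u w n + opposite_op V M v w n" for u v
  proof -
    have "?f (u + v) = (\<lambda>e. ?f u e + ?f v e)" by (rule ext) (rule twisted_vector_add)
    then show ?thesis
      unfolding opposite_op_def
      using apply_series_additive[OF twisted_vector_finite[of u] twisted_vector_finite[of v],
          of "\<lambda>u. invert_x (module_op M u w)" n] invert_op_zero[OF w] lin(2)
      by (simp add: invert_x_def)
  qed
  moreover have "opposite_op V M (c *\<^sub>C v) w n = c *\<^sub>C opposite_op V M v w n" for c v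
  proof -
    have "?f (c *\<^sub>C v) = (\<lambda>e. c *\<^sub>C ?f v e)" by (rule ext) (rule twisted_vector_scaleC)
    then show ?thesis
      unfolding opposite_op_def
      using apply_series_scaleC[OF twisted_vector_finite[of v],
          of "\<lambda>u. invert_x (module_op M u w)" c n] invert_op_zero[OF w] lin(3)
      by (simp add: invert_x_def)
  qed
  ultimately show ?thesis
    using clinear_onD(1)[OF opposite_op_linear w] by (auto simp: clinear_on_def)
qed

text \<open>The term L(1)^i v comes with x^(i - 2h) from the exponential and the power of -x^(-2);
  inverting x in the vertex operator then makes the coefficient of x^n the one at exponent i - 2h -
  n.\<close>

lemma opposite_op_hom:
  assumes v: "v \<in> weight_alg V h" and N: "\<And>i. i \<ge> N \<Longrightarrow> (L_alg V 1 ^^ i) v = 0"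
    and w: "w \<in> mspace M"
  shows "opposite_op V M v w n =
    (\<Sum>i<N. ((-1) powi h / fact i) *\<^sub>C module_op M ((L_alg V 1 ^^ i) v) w (int i - 2 * h - n))"
proof -
  define f where "f = apply_series (exp_xL1_alg V) (neg_x_power_L0_alg V v)"
  note f = twisted_vector_hom[OF v, folded f_def]
  have "opposite_op V M v w n = (\<Sum>e\<in>(\<lambda>i. int i - 2 * h) ` {..<N}. module_op M (f e) w (e - n))"
  proof (rule opposite_op_eq_sum[OF w _ _ f_def])
    fix e assume e: "e \<notin> (\<lambda>i. int i - 2 * h) ` {..<N}"
    show "f e = 0"
    proof (rule ccontr)
      assume "f e \<noteq> 0"
      then have "0 \<le> e + 2 * h" "(L_alg V 1 ^^ nat (e + 2 * h)) v \<noteq> 0"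
        by (auto simp: f split: if_splits)
      then have "e = int (nat (e + 2 * h)) - 2 * h" "nat (e + 2 * h) < N"
        using N by (auto simp: not_le[symmetric])
      with e show False by blast
    qed
  qed simp
  also have "\<dots> = (\<Sum>i<N. module_op M (f (int i - 2 * h)) w (int i - 2 * h - n))"
    by (subst sum.reindex) (auto simp: inj_on_def)
  finally show ?thesis
    using clinear_onD(3)[OF op_linear_left[OF w]] by (simp add: f)
qed

text \<open>Inversion of x turns truncation from below into truncation from above. This bound cuts
  off the first sum of the Jacobi identity once the outer mode has been moved to the other side of
  the pairing.\<close>

lemma opposite_op_truncated:
  assumes v: "v \<in> weight_alg V h" and w: "w \<in> mspace M"
  shows "\<exists>N. \<forall>n>N. opposite_op V M v w n = 0"
proof -
  obtain K where K: "\<And>i. i \<ge> K \<Longrightarrow> (L_alg V 1 ^^ i) v = 0" using L1_alg_nilpotent by blast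
  have "\<forall>i. \<exists>N. \<forall>e<N. module_op M ((L_alg V 1 ^^ i) v) w e = 0"
    using op_truncated[OF w] by blast
  then obtain b where b: "\<And>i e. e < b i \<Longrightarrow> module_op M ((L_alg V 1 ^^ i) v) w e = 0"
    by metis
  define N where "N = Max (insert 0 ((\<lambda>i. int i - 2 * h - b i) ` {..<K}))"
  have "(\<Sum>i<K. ((-1) powi h / fact i) *\<^sub>C module_op M ((L_alg V 1 ^^ i) v) w (int i - 2 * h - n)) = 0"
    if n: "n > N" for n
  proof (rule sum.neutral, rule ballI)
    fix i assume "i \<in> {..<K}"
    then have "int i - 2 * h - b i \<le> N" unfolding N_def by (intro Max_ge) auto
    then show "((-1) powi h / fact i) *\<^sub>C module_op M ((L_alg V 1 ^^ i) v) w (int i - 2 * h - n) = 0"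
      using b[of "int i - 2 * h - n" i] n by simp
  qed
  moreover have "opposite_op V M v w n = (\<Sum>i<K. ((-1) powi h / fact i) *\<^sub>C
      module_op M ((L_alg V 1 ^^ i) v) w (int i - 2 * h - n))" for n
    by (rule opposite_op_hom[OF v _ w]) (rule K)
  ultimately show ?thesis by auto
qed

text \<open>Taking opposites twice gives back the vertex operator. In the double sum the vector and
  the exponent depend on i + j only, and the signs (-1)^h (-1)^(h-i) combine to (-1)^i; so the sum
  is exp(-L(1)) exp(L(1)) term by term, and only i + j = 0 survives.\<close>

lemma opposite_op_opposite_op:
  assumes v: "v \<in> weight_alg V h" and N: "\<And>i. i \<ge> N \<Longrightarrow> (L_alg V 1 ^^ i) v = 0"
    and w: "w \<in> mspace M"
  shows "(\<Sum>i<N. ((-1) powi h / fact i) *\<^sub>C opposite_op V M ((L_alg V 1 ^^ i) v) w (int i - 2 * h - n))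
    = module_op M v w n"
proof -
  define F where "F k = module_op M ((L_alg V 1 ^^ k) v) w (int k + n)" for k
  have F0: "F k = 0" if "k \<ge> N" for k
    using N[OF that] clinear_on_zero[OF op_linear_left[OF w] cvec.subspace_UNIV] by (simp add: F_def)
  have pow: "(L_alg V 1 ^^ j) ((L_alg V 1 ^^ i) v) = (L_alg V 1 ^^ (i + j)) v" for i j
    by (metis add.commute funpow_add o_apply)
  have sgn: "(-1 :: complex) powi h * (-1) powi (h - int i) = (-1) ^ i" for i
  proof -
    have "(-1 :: complex) powi h * (-1) powi (h - int i) = (-1) powi (2 * h - int i)"
      by (subst power_int_add[symmetric]) auto
    also have "\<dots> = (-1) ^ i"
      by (simp add: power_int_diff power_int_minus_left)
    finally show ?thesis .
  qed
  have "(\<Sum>i<N. ((-1) powi h / fact i) *\<^sub>C opposite_op V M ((L_alg V 1 ^^ i) v) w (int i - 2 * h - n))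
    = (\<Sum>i<N. \<Sum>j<N. (((-1) ^ i / fact i) * (1 ^ j / fact j)) *\<^sub>C F (i + j))"
  proof (rule sum.cong[OF refl])
    fix i assume "i \<in> {..<N}"
    have "opposite_op V M ((L_alg V 1 ^^ i) v) w (int i - 2 * h - n)
      = (\<Sum>j<N. ((-1) powi (h - int i) / fact j) *\<^sub>C module_op M
          ((L_alg V 1 ^^ j) ((L_alg V 1 ^^ i) v)) w (int j - 2 * (h - int i) - (int i - 2 * h - n)))"
      by (rule opposite_op_hom[OF L1_pow_alg_weight[OF v] _ w]) (auto simp: pow intro: N)
    also have "\<dots> = (\<Sum>j<N. ((-1) powi (h - int i) / fact j) *\<^sub>C F (i + j))"
      by (rule sum.cong) (auto simp: pow F_def algebra_simps)
    finally show "((-1) powi h / fact i) *\<^sub>C opposite_op V M ((L_alg V 1 ^^ i) v) w (int i - 2 * h - n)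
      = (\<Sum>j<N. (((-1) ^ i / fact i) * (1 ^ j / fact j)) *\<^sub>C F (i + j))"
      by (simp add: cvec.scale_sum_right flip: sgn)
  qed
  also have "\<dots> = (\<Sum>k<N. ((-1 + 1) ^ k / fact k) *\<^sub>C F k)"
    by (rule exp_product_sum[OF F0])
  also have "\<dots> = F 0"
  proof (cases N)
    case 0
    then show ?thesis using F0[of 0] by simp
  next
    case (Suc N')
    show ?thesis unfolding Suc sum.lessThan_Suc_shift by simp
  qed
  finally show ?thesis by (simp add: F_def)
qed

end

subsection \<open>Pairings\<close>

text \<open>A contragredient pair, described symmetrically: it covers the pairing of \<open>W'\<close> with \<open>W\<close> as
  well as that of \<open>W\<close> with \<open>W'\<close>.\<close>

locale pairing = sg_algebra A V + Y: premodule Y + Yd: premodule Yd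
  for A :: "'g::ab_group_add set" and V :: "('v::complex_vector, 'g) vertex_structure"
    and Y :: "('v, 'y::complex_vector, 'g) module_structure"
    and Yd :: "('v, 'z::complex_vector, 'g) module_structure" +
  fixes B :: "'y \<Rightarrow> 'z \<Rightarrow> complex"
  assumes B_linear_left: "z \<in> mspace Yd \<Longrightarrow> clinear_on (mspace Y) UNIV (\<lambda>y. B y z)"
    and B_linear: "y \<in> mspace Y \<Longrightarrow> clinear_on (mspace Yd) UNIV (B y)"
    and B_L: "j \<in> {-1, 0, 1} \<Longrightarrow> y \<in> mspace Y \<Longrightarrow> z \<in> mspace Yd \<Longrightarrow>
      B y (L_mod Yd j z) = B (L_mod Y (- j) y) z"
    and B_op: "\<alpha> \<in> A \<Longrightarrow> v \<in> grade_alg V \<alpha> \<Longrightarrow> v \<in> weight_alg V h \<Longrightarrow>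
      y \<in> mspace Y \<Longrightarrow> z \<in> mspace Yd \<Longrightarrow>
      B y (module_op Yd v z n) = B (opposite_op V Y v y n) z"
    and B_grade: "y \<in> grade_mod Y \<beta> \<Longrightarrow> z \<in> grade_mod Yd \<gamma> \<Longrightarrow> \<gamma> \<noteq> - \<beta> \<Longrightarrow> B y z = 0"
    and B_nondegenerate: "z \<in> mspace Yd \<Longrightarrow> (\<And>y. y \<in> mspace Y \<Longrightarrow> B y z = 0) \<Longrightarrow> z = 0"
    and B_representable: "clinear_on (mspace Y) UNIV \<phi> \<Longrightarrow>
      (\<And>\<gamma> m y. (\<gamma>, m) \<noteq> (\<beta>, l) \<Longrightarrow> y \<in> bihom Y \<gamma> m \<Longrightarrow> \<phi> y = 0) \<Longrightarrow>
      \<exists>z\<in>grade_mod Yd (- \<beta>). \<forall>y\<in>mspace Y. B y z = \<phi> y"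
begin

sublocale Y: sg_premodule A V Y ..
sublocale Yd: sg_premodule A V Yd ..

text \<open>Since L(0) is self-adjoint for \<open>B\<close>, the difference of the values of
  \<open>B\<close> with L(0) - m applied on the left and L(0) - l applied on the right is a nonzero
  multiple of \<open>B y z\<close>. Both values vanish by induction on the sum of the two orders of
  nilpotency.\<close>

lemma B_weight:
  assumes "y \<in> mspace Y" "z \<in> mspace Yd" "m \<noteq> l"
    "((\<lambda>u. L_mod Y 0 u - m *\<^sub>C u) ^^ K) y = 0" "((\<lambda>u. L_mod Yd 0 u - l *\<^sub>C u) ^^ M) z = 0"
  shows "B y z = 0"
  using assms
proof (induction "K + M" arbitrary: K M y z)
  case 0
  then show ?case using clinear_on_zero[OF B_linear Yd.subspace_mspace] by simp
next
  case (Suc d)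
  let ?D = "\<lambda>u. L_mod Y 0 u - m *\<^sub>C u" and ?D' = "\<lambda>u. L_mod Yd 0 u - l *\<^sub>C u"
  have lin: "clinear_on (mspace Y) (mspace Y) ?D" "clinear_on (mspace Yd) (mspace Yd) ?D'"
    by (intro clinear_on_minus_scaleC Y.L_linear Y.subspace_mspace Yd.L_linear Yd.subspace_mspace; simp)+
  have L0: "L_mod Y 0 y \<in> mspace Y" "L_mod Yd 0 z \<in> mspace Yd"
    using clinear_onD(1)[OF Y.L_linear] clinear_onD(1)[OF Yd.L_linear] Suc.prems by auto
  show ?case
  proof (cases K)
    case 0
    then show ?thesis
      using Suc.prems clinear_on_zero[OF B_linear_left Y.subspace_mspace] by simp
  next
    case (Suc K')
    note K' = this
    show ?thesis
    proof (cases M)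
      case 0
      then show ?thesis
        using Suc.prems clinear_on_zero[OF B_linear Yd.subspace_mspace] by simp
    next
      case (Suc M')
      have "(?D ^^ K') (?D y) = 0" "(?D' ^^ M') (?D' z) = 0"
        using Suc.prems(4,5) unfolding K' Suc funpow_Suc_right o_apply by blast+
      note nil = this
      have "B (?D y) z = 0"
        by (rule Suc.hyps(1)[OF _ clinear_onD(1)[OF lin(1)] _ _ nil(1) Suc.prems(5)])
          (use Suc.hyps(2) Suc.prems K' in auto)
      moreover have "B y (?D' z) = 0"
        by (rule Suc.hyps(1)[OF _ _ clinear_onD(1)[OF lin(2)] _ Suc.prems(4) nil(2)])
          (use Suc.hyps(2) Suc.prems Suc in auto)
      moreover have "B (?D y) z = B (L_mod Y 0 y) z - m * B y z"
        using Suc.prems L0 clinear_on_diff[OF B_linear_left Y.subspace_mspace]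
          clinear_onD(3)[OF B_linear_left] cvec.subspace_scale[OF Y.subspace_mspace] by simp
      moreover have "B y (?D' z) = B y (L_mod Yd 0 z) - l * B y z"
        using Suc.prems L0 clinear_on_diff[OF B_linear Yd.subspace_mspace]
          clinear_onD(3)[OF B_linear] cvec.subspace_scale[OF Yd.subspace_mspace] by simp
      moreover have "B y (L_mod Yd 0 z) = B (L_mod Y 0 y) z"
        using B_L[of 0 y z] Suc.prems by simp
      ultimately show ?thesis using Suc.prems(3) by (auto simp: algebra_simps)
    qed
  qed
qed

lemma B_eqI:
  assumes "z \<in> mspace Yd" "z' \<in> mspace Yd" "\<And>y. y \<in> mspace Y \<Longrightarrow> B y z = B y z'"
  shows "z = z'"
proof -
  have "z - z' = 0"
    using assms clinear_on_diff[OF B_linear Yd.subspace_mspace]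
    by (intro B_nondegenerate cvec.subspace_diff[OF Yd.subspace_mspace]) auto
  then show ?thesis by simp
qed

end

lemma finite_support_lessThan:
  fixes f :: "nat \<Rightarrow> 'a::zero"
  assumes "\<And>i. i \<ge> N \<Longrightarrow> f i = 0"
  shows "finite {i. f i \<noteq> 0}"
proof (rule finite_subset)
  show "{i. f i \<noteq> 0} \<subseteq> {..<N}"
    using assms by (metis (mono_tags, lifting) lessThan_iff mem_Collect_eq not_le subsetI)
qed simp

subsection \<open>Matrix coefficients of logarithmic intertwining operators\<close>

text \<open>The operator goes from W1 and \<open>X\<close> to \<open>Yd\<close>, and matrix
  coefficients are taken against \<open>Y\<close>. For the contragredient operator itself,
  \<open>X\<close> is W2, \<open>Yd\<close> is W3 and \<open>Y\<close> is W3'; for its inverse,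
  \<open>X\<close> is W3', \<open>Yd\<close> is W2' and \<open>Y\<close> is W2.\<close>

locale intertwiner = W1: sg_module A V W1 + X: premodule X + pairing A V Y Yd B
  for A :: "'g::ab_group_add set" and V :: "('v::complex_vector, 'g) vertex_structure"
    and W1 :: "('v, 'a::complex_vector, 'g) module_structure"
    and X :: "('v, 'x::complex_vector, 'g) module_structure"
    and Y :: "('v, 'y::complex_vector, 'g) module_structure"
    and Yd :: "('v, 'z::complex_vector, 'g) module_structure"
    and B :: "'y \<Rightarrow> 'z \<Rightarrow> complex" +
  fixes I :: "'a \<Rightarrow> 'x \<Rightarrow> 'z log_series"
  assumes intertwining: "log_intertwining_operator V W1 X Yd I"
    and compatible: "grading_compatible W1 X Yd I"
begin

sublocale X: sg_premodule A V X ..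

lemma I_outside: "w \<notin> mspace W1 \<or> x \<notin> mspace X \<Longrightarrow> I w x = 0"
  and I_linear: "w \<in> mspace W1 \<Longrightarrow> clinear_on (mspace X) (mspace Yd) (\<lambda>x. I w x e)"
  and I_linear_left: "x \<in> mspace X \<Longrightarrow> clinear_on (mspace W1) (mspace Yd) (\<lambda>w. I w x e)"
  using intertwining unfolding log_intertwining_operator_def by blast+

context
  fixes w x
  assumes w: "w \<in> mspace W1" and x: "x \<in> mspace X"
begin

lemma I_finite: "finite {k. I w x (n, k) \<noteq> 0}"
  and I_truncated: "\<exists>M. \<forall>m\<ge>M. \<forall>k. I w x (n - of_nat m, k) = 0"
  and I_jacobi: "jacobi_identity (module_op W1) (module_op X) (module_op Yd) (\<lambda>a b n. I a b (n, k)) v w x"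
  and I_derivative: "I (L_mod W1 (-1) w) x = deriv_log (I w x)"
  and I_sl2: "sl2_bracket (L_mod W1) (L_mod X) (L_mod Yd) (\<lambda>a b n. I a b (n, k)) w x"
  using intertwining w x unfolding log_intertwining_operator_def by auto

lemma I_mspace: "I w x e \<in> mspace Yd"
  using clinear_onD(1)[OF I_linear[OF w] x] .

end

lemma I_L0:
  assumes "w \<in> mspace W1" "x \<in> mspace X"
  shows "L_mod Yd 0 (I w x (n, k)) = I (L_mod W1 0 w) x (n, k) + I w (L_mod X 0 x) (n, k)
    + n *\<^sub>C I w x (n, k) + of_nat (Suc k) *\<^sub>C I w x (n, Suc k)"
proof -
  have "L_mod Yd 0 (I w x (n, k)) - I w (L_mod X 0 x) (n, k)
    = I (L_mod W1 0 w) x (n, k) + I (L_mod W1 (-1) w) x (n - 1, k)"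
    using I_sl2[OF assms, of k, unfolded sl2_bracket_def, rule_format, of 0 n] by simp
  also have "I (L_mod W1 (-1) w) x (n - 1, k) = n *\<^sub>C I w x (n, k) + of_nat (Suc k) *\<^sub>C I w x (n, Suc k)"
    unfolding I_derivative[OF assms] by (simp add: deriv_log_def)
  finally show ?thesis by (simp only: diff_eq_eq add_ac)
qed

text \<open>On the coefficient of x^n (log x)^k, L(0) minus the expected weight acts as the sum of
  three commuting shifts: the nilpotent part of L(0) on \<open>w\<close>, the one on
  \<open>x\<close>, and passage from log degree k to k + 1. Each of them runs out after finitely
  many applications.\<close>

lemma I_weight:
  assumes w: "w \<in> bihom W1 \<beta>1 n1" and x: "x \<in> bihom X \<beta>2 n2"
  shows "\<exists>M. ((\<lambda>u. L_mod Yd 0 u - (n + n1 + n2) *\<^sub>C u) ^^ M) (I w x (n, k)) = 0"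
proof -
  let ?D1 = "\<lambda>u. L_mod W1 0 u - n1 *\<^sub>C u" and ?D2 = "\<lambda>u. L_mod X 0 u - n2 *\<^sub>C u"
    and ?D = "\<lambda>u. L_mod Yd 0 u - (n + n1 + n2) *\<^sub>C u"
  have lin1: "clinear_on (mspace W1) (mspace W1) ?D1" and lin2: "clinear_on (mspace X) (mspace X) ?D2"
    and lin: "clinear_on (mspace Yd) (mspace Yd) ?D"
    by (intro clinear_on_minus_scaleC W1.L_linear W1.subspace_mspace X.L_linear X.subspace_mspace
        Yd.L_linear Yd.subspace_mspace; simp)+
  have wm: "w \<in> mspace W1" and xm: "x \<in> mspace X"
    using w x W1.bihom_subset_mspace X.bihom_subset_mspace by blast+
  have m1: "(?D1 ^^ i) w \<in> mspace W1" and m2: "(?D2 ^^ j) x \<in> mspace X" for i j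
    using clinear_onD(1)[OF clinear_on_funpow] lin1 lin2 wm xm by blast+
  obtain N1 where N1: "(?D1 ^^ N1) w = 0" using W1.L0_nilpotent[OF w] by blast
  obtain N2 where N2: "(?D2 ^^ N2) x = 0" using X.L0_nilpotent[OF x] by blast
  define f where "f i j k = I ((?D1 ^^ i) w) ((?D2 ^^ j) x) (n, k)" for i j k
  have "\<exists>K. \<forall>k\<ge>K. f i j k = 0" for i j
  proof -
    have "finite {k. f i j k \<noteq> 0}" unfolding f_def by (rule I_finite[OF m1 m2])
    then obtain K where "\<forall>k\<in>{k. f i j k \<noteq> 0}. k < K" using finite_nat_set_iff_bounded by blast
    then show ?thesis by (auto simp: not_less[symmetric])
  qed
  then obtain b where b: "\<And>i j k. k \<ge> b i j \<Longrightarrow> f i j k = 0" by metis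
  \<comment> \<open>The bound on the log degree depends on i and j, but only the finitely many pairs
    with i < N1 and j < N2 matter. The inserted 0 keeps the maximum defined when there are
    none.\<close>
  define K where "K = Max (insert 0 ((\<lambda>(i, j). b i j) ` ({..<N1} \<times> {..<N2})))"
  have bK: "b i j \<le> K" if "i < N1" "j < N2" for i j
    unfolding K_def by (rule Max_ge) (use that in auto)
  have f0: "f i j k = 0" if "i \<ge> N1 \<or> j \<ge> N2 \<or> k \<ge> K" for i j k
  proof (cases "i \<ge> N1 \<or> j \<ge> N2")
    case True
    then have "(?D1 ^^ i) w = 0 \<or> (?D2 ^^ j) x = 0"
      using funpow_eq_zero_mono[OF lin1 W1.subspace_mspace N1]
        funpow_eq_zero_mono[OF lin2 X.subspace_mspace N2] by blast
    then show ?thesis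
      using clinear_on_zero[OF I_linear[OF m1] X.subspace_mspace]
        clinear_on_zero[OF I_linear_left[OF m2] W1.subspace_mspace] by (auto simp: f_def)
  next
    case False
    then show ?thesis using that bK[of i j] b[of i j k] by auto
  qed
  have step: "?D (f i j k) = of_nat (Suc k) *\<^sub>C f i j (Suc k) + f (Suc i) j k + f i (Suc j) k" for i j k
  proof -
    let ?w = "(?D1 ^^ i) w" and ?x = "(?D2 ^^ j) x"
    have "f (Suc i) j k = I (L_mod W1 0 ?w) ?x (n, k) - n1 *\<^sub>C f i j k"
      using clinear_on_diff[OF I_linear_left[OF m2] W1.subspace_mspace] clinear_onD(3)[OF I_linear_left[OF m2] m1]
        clinear_onD(1)[OF W1.L_linear m1] cvec.subspace_scale[OF W1.subspace_mspace m1]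
      by (simp add: f_def)
    moreover have "f i (Suc j) k = I ?w (L_mod X 0 ?x) (n, k) - n2 *\<^sub>C f i j k"
      using clinear_on_diff[OF I_linear[OF m1] X.subspace_mspace] clinear_onD(3)[OF I_linear[OF m1] m2]
        clinear_onD(1)[OF X.L_linear m2] cvec.subspace_scale[OF X.subspace_mspace m2]
      by (simp add: f_def)
    moreover have "L_mod Yd 0 (f i j k) = I (L_mod W1 0 ?w) ?x (n, k) + I ?w (L_mod X 0 ?x) (n, k)
      + n *\<^sub>C f i j k + of_nat (Suc k) *\<^sub>C f i j (Suc k)"
      unfolding f_def by (rule I_L0[OF m1 m2])
    ultimately show ?thesis by (simp add: scaleC_add_left)
  qed
  have fm: "f i j k \<in> mspace Yd" for i j k
    unfolding f_def by (rule I_mspace[OF m1 m2])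
  \<comment> \<open>Each summand in \<open>step\<close> raises exactly one of i, j, k by one and so
    lowers this measure; at measure 0 all three indices have reached their bounds.\<close>
  have "(?D ^^ d) (f i j k) = 0" if "(N1 - i) + (N2 - j) + (K - k) \<le> d" for d i j k
    using that
  proof (induction d arbitrary: i j k)
    case 0
    then show ?case by (simp add: f0)
  next
    case (Suc d)
    show ?case
    proof (cases "i \<ge> N1 \<or> j \<ge> N2 \<or> k \<ge> K")
      case True
      then show ?thesis
        using clinear_on_zero[OF clinear_on_funpow[OF lin] Yd.subspace_mspace] by (simp only: f0)
    next
      case False
      note l = clinear_onD[OF clinear_on_funpow[OF lin, of d]]
      have "(?D ^^ Suc d) (f i j k)
        = (?D ^^ d) (of_nat (Suc k) *\<^sub>C f i j (Suc k) + f (Suc i) j k + f i (Suc j) k)"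
        unfolding funpow_Suc_right o_apply step ..
      also have "\<dots> = of_nat (Suc k) *\<^sub>C (?D ^^ d) (f i j (Suc k)) + (?D ^^ d) (f (Suc i) j k)
          + (?D ^^ d) (f i (Suc j) k)"
        using fm cvec.subspace_add[OF Yd.subspace_mspace] cvec.subspace_scale[OF Yd.subspace_mspace]
        by (simp only: l(2,3))
      also have "\<dots> = 0"
      proof -
        have "(?D ^^ d) (f i j (Suc k)) = 0" "(?D ^^ d) (f (Suc i) j k) = 0" "(?D ^^ d) (f i (Suc j) k) = 0"
          using Suc.prems False by (intro Suc.IH; simp)+
        then show ?thesis by (simp only: cvec.scale_zero_right add_0)
      qed
      finally show ?thesis .
    qed
  qed
  from this[of 0 0 k] have "\<exists>M. (?D ^^ M) (f 0 0 k) = 0" by blast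
  then show ?thesis by (simp add: f_def)
qed

section \<open>Matrix coefficients and their values at log x = z\<close>

definition coef :: "'a \<Rightarrow> 'x \<Rightarrow> 'y \<Rightarrow> complex log_series"
  where "coef w x y = (\<lambda>e. B y (I w x e))"

definition ev :: "complex \<Rightarrow> 'a \<Rightarrow> 'x \<Rightarrow> 'y \<Rightarrow> complex"
  where "ev z w x y = evalx z (coef w x y)"

lemma coef_linear:
  shows "x \<in> mspace X \<Longrightarrow> y \<in> mspace Y \<Longrightarrow> clinear_on (mspace W1) UNIV (\<lambda>w. coef w x y e)"
    and "w \<in> mspace W1 \<Longrightarrow> y \<in> mspace Y \<Longrightarrow> clinear_on (mspace X) UNIV (\<lambda>x. coef w x y e)"
    and "w \<in> mspace W1 \<Longrightarrow> x \<in> mspace X \<Longrightarrow> clinear_on (mspace Y) UNIV (\<lambda>y. coef w x y e)"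
  using B_linear B_linear_left I_linear I_linear_left I_mspace
  by (auto simp: clinear_on_def coef_def)

text \<open>The grade is fixed by compatibility with the second grading, the weight by orthogonality
  of distinct generalized weights. Hence between homogeneous vectors only one power of x can
  occur.\<close>

lemma coef_zero:
  assumes w: "w \<in> bihom W1 \<beta>1 n1" and x: "x \<in> bihom X \<beta>2 n2" and y: "y \<in> bihom Y \<beta>3 n3"
    and "coef w x y (n, k) \<noteq> 0"
  shows "\<beta>3 = - (\<beta>1 + \<beta>2)" "n3 = n + n1 + n2"
proof -
  have ms: "w \<in> mspace W1" "x \<in> mspace X" "y \<in> mspace Y"
    using w x y W1.bihom_subset_mspace X.bihom_subset_mspace Y.bihom_subset_mspace by blast+
  have gr: "w \<in> grade_mod W1 \<beta>1" "x \<in> grade_mod X \<beta>2" "y \<in> grade_mod Y \<beta>3"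
    using w x y by (auto simp: bihom_def)
  then have "I w x (n, k) \<in> grade_mod Yd (\<beta>1 + \<beta>2)"
    using compatible by (auto simp: grading_compatible_def)
  then have "\<beta>1 + \<beta>2 = - \<beta>3" using B_grade[OF gr(3)] assms(4) by (auto simp: coef_def)
  then show "\<beta>3 = - (\<beta>1 + \<beta>2)" by simp
  obtain M where M: "((\<lambda>u. L_mod Yd 0 u - (n + n1 + n2) *\<^sub>C u) ^^ M) (I w x (n, k)) = 0"
    using I_weight[OF w x] by blast
  obtain K where K: "((\<lambda>u. L_mod Y 0 u - n3 *\<^sub>C u) ^^ K) y = 0"
    using Y.L0_nilpotent[OF y] by blast
  show "n3 = n + n1 + n2"
    using B_weight[OF ms(3) I_mspace[OF ms(1,2)] _ K M] assms(4) by (auto simp: coef_def)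
qed

text \<open>For homogeneous arguments one power of x remains, and its coefficient is a polynomial in
  log x. Additivity in each of the three arguments does the rest. This is what allows evaluation,
  although \<open>I w x\<close> itself may have infinitely many powers of x.\<close>

lemma coef_finite:
  assumes "w \<in> mspace W1" "x \<in> mspace X" "y \<in> mspace Y"
  shows "finite {e. coef w x y e \<noteq> 0}"
  using assms(1)
proof (induction w rule: W1.mspace_induct)
  case w: (hom \<beta>1 n1 w)
  then have wm: "w \<in> mspace W1" using W1.bihom_subset_mspace by blast
  from assms(2) show ?case
  proof (induction x rule: X.mspace_induct)
    case x: (hom \<beta>2 n2 x)
    then have xm: "x \<in> mspace X" using X.bihom_subset_mspace by blast
    from assms(3) show ?case
    proof (induction y rule: Y.mspace_induct)
      case y: (hom \<beta>3 n3 y)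
      then have ym: "y \<in> mspace Y" using Y.bihom_subset_mspace by blast
      let ?n = "n3 - n1 - n2"
      have "{e. coef w x y e \<noteq> 0} \<subseteq> Pair ?n ` {k. I w x (?n, k) \<noteq> 0}"
      proof
        fix e assume e: "e \<in> {e. coef w x y e \<noteq> 0}"
        obtain n k where nk: "e = (n, k)" by (cases e)
        have "n = ?n" using coef_zero(2)[OF w x y, of n k] e nk by simp
        moreover have "I w x (n, k) \<noteq> 0"
          using e clinear_on_zero[OF B_linear[OF ym] Yd.subspace_mspace] by (auto simp: coef_def nk)
        ultimately show "e \<in> Pair ?n ` {k. I w x (?n, k) \<noteq> 0}" by (auto simp: nk)
      qed
      then show ?case by (rule finite_subset) (simp add: I_finite[OF wm xm])
    next
      case (add u y)
      then show ?case
        using clinear_onD(2)[OF coef_linear(3)[OF wm xm] add(1,2)] by (simp add: finite_support_add)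
    qed
  next
    case (add u x)
    then show ?case
      using clinear_onD(2)[OF coef_linear(2)[OF wm assms(3)] add(1,2)] by (simp add: finite_support_add)
  qed
next
  case (add u w)
  then show ?case
    using clinear_onD(2)[OF coef_linear(1)[OF assms(2,3)] add(1,2)] by (simp add: finite_support_add)
qed

lemma evalx_clinear_on:
  assumes "\<And>e. clinear_on S UNIV (\<lambda>u. f u e)" "\<And>u. u \<in> S \<Longrightarrow> finite {e. f u e \<noteq> 0}"
  shows "clinear_on S UNIV (\<lambda>u. evalx z (f u))"
  unfolding clinear_on_def
proof (intro conjI ballI allI)
  fix u v assume uv: "u \<in> S" "v \<in> S"
  have "f (u + v) = (\<lambda>e. f u e + f v e)" using clinear_onD(2)[OF assms(1) uv] by blast
  then show "evalx z (f (u + v)) = evalx z (f u) + evalx z (f v)"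
    using evalx_add[OF assms(2)[OF uv(1)] assms(2)[OF uv(2)]] by simp
next
  fix c u assume u: "u \<in> S"
  have "f (c *\<^sub>C u) = (\<lambda>e. c *\<^sub>C f u e)" using clinear_onD(3)[OF assms(1) u] by blast
  then show "evalx z (f (c *\<^sub>C u)) = c *\<^sub>C evalx z (f u)"
    using evalx_scaleC assms(2) u by metis
qed simp

lemma ev_linear:
  shows "x \<in> mspace X \<Longrightarrow> y \<in> mspace Y \<Longrightarrow> clinear_on (mspace W1) UNIV (\<lambda>w. ev z w x y)"
    and "w \<in> mspace W1 \<Longrightarrow> y \<in> mspace Y \<Longrightarrow> clinear_on (mspace X) UNIV (\<lambda>x. ev z w x y)"
    and "w \<in> mspace W1 \<Longrightarrow> x \<in> mspace X \<Longrightarrow> clinear_on (mspace Y) UNIV (\<lambda>y. ev z w x y)"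
  unfolding ev_def by (intro evalx_clinear_on coef_linear coef_finite; assumption)+

text \<open>The factor exp z is x: differentiation with respect to z is x d/dx, whereas L(-1) is
  d/dx.\<close>

lemma ev_has_derivative:
  assumes w: "w \<in> mspace W1" and x: "x \<in> mspace X" and y: "y \<in> mspace Y"
  shows "((\<lambda>z. ev z w x y) has_field_derivative exp z * ev z (L_mod W1 (-1) w) x y) (at z)"
proof -
  note fin = coef_finite[OF w x y]
  have L: "L_mod W1 (-1) w \<in> mspace W1" using clinear_onD(1)[OF W1.L_linear w] by simp
  note sub = cvec.subspace_scale[OF Yd.subspace_mspace I_mspace[OF w x]]
  have "coef (L_mod W1 (-1) w) x y (n, k) = deriv_log (coef w x y) (n, k)" for n k
    unfolding coef_def I_derivative[OF w x]
    using clinear_onD(2)[OF B_linear[OF y] sub sub] clinear_onD(3)[OF B_linear[OF y] I_mspace[OF w x]]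
    by (simp add: deriv_log_def)
  then have c: "coef (L_mod W1 (-1) w) x y = deriv_log (coef w x y)" by auto
  have "x_deriv (coef w x y) = (\<lambda>(n, k). deriv_log (coef w x y) (n - 1, k))"
    by (auto simp: x_deriv_def deriv_log_def fun_eq_iff)
  then have "evalx z (x_deriv (coef w x y)) = exp (1 * z) *\<^sub>C evalx z (deriv_log (coef w x y))"
    using evalx_translate(2)[OF coef_finite[OF L x y, unfolded c], of z 1] by simp
  then show ?thesis
    using evalx_has_derivative[OF fin, of z] by (simp add: ev_def[abs_def] c)
qed

lemma ev_sl2:
  assumes j: "j \<in> {-1, 0, 1}" and w: "w \<in> mspace W1" and x: "x \<in> mspace X" and y: "y \<in> mspace Y"
  shows "ev z w x (L_mod Y (- j) y) - ev z w (L_mod X j x) y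
    = (\<Sum>i\<le>nat (j + 1). of_nat (nat (j + 1) choose i) * exp (of_nat i * z) *
        ev z (L_mod W1 (j - int i) w) x y)"
proof -
  have j': "- j \<in> {-1, 0, 1}" "\<And>i. i \<le> nat (j + 1) \<Longrightarrow> j - int i \<in> {-1, 0, 1}" using j by auto
  have Ly: "L_mod Y (- j) y \<in> mspace Y" and Lx: "L_mod X j x \<in> mspace X"
    using clinear_onD(1)[OF Y.L_linear[OF j'(1)] y] clinear_onD(1)[OF X.L_linear[OF j] x] by auto
  have Lw: "L_mod W1 (j - int i) w \<in> mspace W1" if "i \<le> nat (j + 1)" for i
    using clinear_onD(1)[OF W1.L_linear[OF j'(2)[OF that]] w] .
  let ?R = "\<lambda>i (n, k). of_nat (nat (j + 1) choose i) *
    (\<lambda>(n, k). coef (L_mod W1 (j - int i) w) x y (n - of_nat i, k)) (n, k)"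
  have "coef w x (L_mod Y (- j) y) (n, k) - coef w (L_mod X j x) y (n, k)
    = (\<Sum>i\<le>nat (j + 1). of_nat (nat (j + 1) choose i) *
        coef (L_mod W1 (j - int i) w) x y (n - of_nat i, k))" for n k
  proof -
    have "coef w x (L_mod Y (- j) y) (n, k) - coef w (L_mod X j x) y (n, k)
      = B y (L_mod Yd j (I w x (n, k)) - I w (L_mod X j x) (n, k))"
      using B_L[OF j y I_mspace[OF w x]] clinear_onD(1)[OF Yd.L_linear[OF j] I_mspace[OF w x]]
        clinear_on_diff[OF B_linear[OF y] Yd.subspace_mspace] I_mspace[OF w Lx]
      by (simp add: coef_def)
    also have "\<dots> = B y (\<Sum>i\<le>nat (j + 1). of_nat (nat (j + 1) choose i) *\<^sub>C
        I (L_mod W1 (j - int i) w) x (n - of_nat i, k))"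
      using I_sl2[OF w x, of k, unfolded sl2_bracket_def, rule_format, OF j, of n] by simp
    also have "\<dots> = (\<Sum>i\<le>nat (j + 1). B y (of_nat (nat (j + 1) choose i) *\<^sub>C
        I (L_mod W1 (j - int i) w) x (n - of_nat i, k)))"
      using I_mspace[OF Lw x] cvec.subspace_scale[OF Yd.subspace_mspace]
      by (intro clinear_on_sum[OF B_linear[OF y] Yd.subspace_mspace]) auto
    also have "\<dots> = (\<Sum>i\<le>nat (j + 1). of_nat (nat (j + 1) choose i) *
        coef (L_mod W1 (j - int i) w) x y (n - of_nat i, k))"
      using clinear_onD(3)[OF B_linear[OF y] I_mspace[OF Lw x]]
      by (intro sum.cong) (auto simp: coef_def)
    finally show ?thesis .
  qed
  then have eq: "(\<lambda>e. coef w x (L_mod Y (- j) y) e - coef w (L_mod X j x) y e)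
    = (\<lambda>e. \<Sum>i\<le>nat (j + 1). of_nat (nat (j + 1) choose i) *\<^sub>C
        (\<lambda>(n, k). coef (L_mod W1 (j - int i) w) x y (n - of_nat i, k)) e)"
    by (auto simp: fun_eq_iff)
  have fin: "finite {e. (\<lambda>(n, k). coef (L_mod W1 (j - int i) w) x y (n - of_nat i, k)) e \<noteq> 0}"
    if "i \<le> nat (j + 1)" for i
    by (rule evalx_translate(1)[OF coef_finite[OF Lw[OF that] x y]])
  have "ev z w x (L_mod Y (- j) y) - ev z w (L_mod X j x) y
    = evalx z (\<lambda>e. \<Sum>i\<le>nat (j + 1). of_nat (nat (j + 1) choose i) *\<^sub>C
        (\<lambda>(n, k). coef (L_mod W1 (j - int i) w) x y (n - of_nat i, k)) e)"
    unfolding ev_def eq[symmetric]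
    by (rule evalx_diff[symmetric]) (use coef_finite w x y Lx Ly in auto)
  also have "\<dots> = (\<Sum>i\<le>nat (j + 1). of_nat (nat (j + 1) choose i) *\<^sub>C
      evalx z (\<lambda>(n, k). coef (L_mod W1 (j - int i) w) x y (n - of_nat i, k)))"
    using fin by (subst evalx_sum) (auto intro!: finite_support_scaleC evalx_scaleC sum.cong simp del: scaleC_complex)
  also have "\<dots> = (\<Sum>i\<le>nat (j + 1). of_nat (nat (j + 1) choose i) *
      (exp (of_nat i * z) * ev z (L_mod W1 (j - int i) w) x y))"
    using evalx_translate(2)[OF coef_finite[OF Lw x y]] by (intro sum.cong) (auto simp: ev_def)
  finally show ?thesis by (simp add: mult.assoc)
qed

text \<open>The point is that \<open>N0\<close> does not depend on \<open>s\<close> and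
  \<open>k\<close>. For the first sum this is achieved by moving the mode of \<open>v\<close> across
  the pairing: the opposite operator on \<open>y\<close> is truncated from above independently of s.
  The other two sums stop by truncation on \<open>x\<close> and \<open>w\<close>.\<close>

lemma coef_jacobi:
  assumes v: "\<alpha> \<in> A" "v \<in> grade_alg V \<alpha>" "v \<in> weight_alg V h"
    and w: "w \<in> mspace W1" and x: "x \<in> mspace X" and y: "y \<in> mspace Y"
  shows "\<exists>N0. \<forall>N\<ge>N0. \<forall>s k.
    (\<Sum>c<N. ((-1) ^ c * (of_int n gchoose c)) *
      coef w x (opposite_op V Y v y (int c - m - n - 1)) (s - of_nat c, k))
    - (\<Sum>b<N. ((-1) powi n * (-1) ^ b * (of_int n gchoose b)) *
      coef w (module_op X v x (- m - 1 - int b)) y (s - of_int n + of_nat b, k))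
    = (\<Sum>a<N. (of_int m gchoose a) *
      coef (module_op W1 v w (- n - 1 - int a)) x y (s - of_int m + of_nat a, k))"
proof -
  obtain e1 where e1: "\<forall>e>e1. opposite_op V Y v y e = 0" using Y.opposite_op_truncated[OF v(3) y] by blast
  obtain e2 where e2: "\<forall>e<e2. module_op X v x e = 0" using X.op_truncated[OF x] by blast
  obtain e3 where e3: "\<forall>e<e3. module_op W1 v w e = 0" using W1.op_truncated[OF w] by blast
  define N0 where "N0 = nat (e1 + m + n + 2) + nat (- m - e2) + nat (- n - e3)"
  have opx: "module_op X v x e \<in> mspace X" and opw: "module_op W1 v w e \<in> mspace W1"
    and opy: "opposite_op V Y v y e \<in> mspace Y" for e
    using clinear_onD(1)[OF X.op_linear x] clinear_onD(1)[OF W1.op_linear w]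
      clinear_onD(1)[OF Y.opposite_op_linear y] by auto
  note Bl = clinear_onD(3)[OF B_linear[OF y]] and Bsum = clinear_on_Sum_any[OF B_linear[OF y] Yd.subspace_mspace]
  note B0 = clinear_on_zero[OF B_linear[OF y] Yd.subspace_mspace]
  have "(\<Sum>c<N. ((-1) ^ c * (of_int n gchoose c)) *
      coef w x (opposite_op V Y v y (int c - m - n - 1)) (s - of_nat c, k))
    - (\<Sum>b<N. ((-1) powi n * (-1) ^ b * (of_int n gchoose b)) *
      coef w (module_op X v x (- m - 1 - int b)) y (s - of_int n + of_nat b, k))
    = (\<Sum>a<N. (of_int m gchoose a) *
      coef (module_op W1 v w (- n - 1 - int a)) x y (s - of_int m + of_nat a, k))" if N: "N \<ge> N0" for N s k
  proof -
    define F1 where "F1 c = ((-1) ^ c * (of_int n gchoose c)) *\<^sub>C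
      module_op Yd v (I w x (s - of_nat c, k)) (int c - m - n - 1)" for c :: nat
    define F2 where "F2 b = ((-1) powi n * (-1) ^ b * (of_int n gchoose b)) *\<^sub>C
      I w (module_op X v x (- m - 1 - int b)) (s - of_int n + of_nat b, k)" for b :: nat
    define F3 where "F3 a = (of_int m gchoose a) *\<^sub>C
      I (module_op W1 v w (- n - 1 - int a)) x (s - of_int m + of_nat a, k)" for a :: nat
    have J: "Sum_any F1 - Sum_any F2 = Sum_any F3"
      unfolding F1_def F2_def F3_def
      by (rule I_jacobi[OF w x, of k v, unfolded jacobi_identity_iff, rule_format])
    have mem: "F1 i \<in> mspace Yd" "F2 i \<in> mspace Yd" "F3 i \<in> mspace Yd" for i
      unfolding F1_def F2_def F3_def
      using clinear_onD(1)[OF Yd.op_linear I_mspace[OF w x]] I_mspace[OF w opx] I_mspace[OF opw x]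
      by (auto intro: cvec.subspace_scale[OF Yd.subspace_mspace])
    obtain M where M: "\<forall>m\<ge>M. \<forall>k. I w x (s - of_nat m, k) = 0" using I_truncated[OF w x] by blast
    \<comment> \<open>This bound comes from lower truncation of \<open>I\<close> and depends on s;
      it only permits applying \<open>B y\<close> term by term. The cut-off at N is obtained
      afterwards from the opposite operator.\<close>
    have fin1: "finite {i. F1 i \<noteq> 0}"
      by (rule finite_support_lessThan[of M])
        (use M clinear_on_zero[OF Yd.op_linear Yd.subspace_mspace] in \<open>simp add: F1_def\<close>)
    have F2z: "F2 b = 0" if "b \<ge> N" for b
    proof -
      have "- m - 1 - int b < e2" using that N unfolding N0_def by linarith
      then have "module_op X v x (- m - 1 - int b) = 0" using e2 by blast
      then show ?thesis
        using clinear_on_zero[OF I_linear[OF w] X.subspace_mspace] by (simp add: F2_def)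
    qed
    have F3z: "F3 a = 0" if "a \<ge> N" for a
    proof -
      have "- n - 1 - int a < e3" using that N unfolding N0_def by linarith
      then have "module_op W1 v w (- n - 1 - int a) = 0" using e3 by blast
      then show ?thesis
        using clinear_on_zero[OF I_linear_left[OF x] W1.subspace_mspace] by (simp add: F3_def)
    qed
    have fin2: "finite {i. F2 i \<noteq> 0}" and fin3: "finite {i. F3 i \<noteq> 0}"
      by (rule finite_support_lessThan[OF F2z], assumption)
        (rule finite_support_lessThan[OF F3z], assumption)
    have "B y (Sum_any F1) - B y (Sum_any F2) = B y (Sum_any F3)"
      unfolding J[symmetric]
      by (rule clinear_on_diff[OF B_linear[OF y] Yd.subspace_mspace, symmetric])
        (intro Sum_any_in_subspace Yd.subspace_mspace mem)+
    moreover have "B y (Sum_any F1) = (\<Sum>c<N. ((-1) ^ c * (of_int n gchoose c)) *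
      coef w x (opposite_op V Y v y (int c - m - n - 1)) (s - of_nat c, k))"
    proof -
      have BF: "B y (F1 c) = ((-1) ^ c * (of_int n gchoose c)) *
        coef w x (opposite_op V Y v y (int c - m - n - 1)) (s - of_nat c, k)" for c
        unfolding F1_def coef_def
        using Bl[OF clinear_onD(1)[OF Yd.op_linear I_mspace[OF w x]]] B_op[OF v y I_mspace[OF w x]] by simp
      have "B y (F1 c) = 0" if "c \<ge> N" for c
      proof -
        have "int c - m - n - 1 > e1" using that N unfolding N0_def by linarith
        then have "opposite_op V Y v y (int c - m - n - 1) = 0" using e1 by blast
        then show ?thesis
          unfolding BF using clinear_on_zero[OF coef_linear(3)[OF w x] Y.subspace_mspace] by simp
      qed
      then show ?thesis
        unfolding Bsum[OF fin1 mem(1)] by (subst Sum_any_eq_sum_lessThan[of N]) (simp_all add: BF)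
    qed
    moreover have "B y (Sum_any F2) = (\<Sum>b<N. ((-1) powi n * (-1) ^ b * (of_int n gchoose b)) *
      coef w (module_op X v x (- m - 1 - int b)) y (s - of_int n + of_nat b, k))"
      unfolding Bsum[OF fin2 mem(2)]
      by (subst Sum_any_eq_sum_lessThan[of N]) (simp_all add: F2z B0, simp_all add: F2_def coef_def Bl[OF I_mspace[OF w opx]])
    moreover have "B y (Sum_any F3) = (\<Sum>a<N. (of_int m gchoose a) *
      coef (module_op W1 v w (- n - 1 - int a)) x y (s - of_int m + of_nat a, k))"
      unfolding Bsum[OF fin3 mem(3)]
      by (subst Sum_any_eq_sum_lessThan[of N]) (simp_all add: F3z B0, simp_all add: F3_def coef_def Bl[OF I_mspace[OF opw x]])
    ultimately show ?thesis by simp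
  qed
  then show ?thesis by blast
qed

end

lemma evalx_translated_sum:
  fixes g :: "nat \<Rightarrow> complex log_series"
  assumes "\<And>i. finite {e. g i e \<noteq> 0}"
  shows "finite {e. (\<lambda>(s, k). \<Sum>i<N. a i * g i (s - b i, k)) e \<noteq> 0}"
    and "evalx z (\<lambda>(s, k). \<Sum>i<N. a i * g i (s - b i, k)) = (\<Sum>i<N. a i * (exp (b i * z) * evalx z (g i)))"
proof -
  have eq: "(\<lambda>(s, k). \<Sum>i<N. a i * g i (s - b i, k))
    = (\<lambda>e. \<Sum>i<N. a i *\<^sub>C (\<lambda>(s, k). g i (s - b i, k)) e)"
    by (auto simp: fun_eq_iff)
  note fin = finite_support_scaleC[OF evalx_translate(1)[OF assms]]
  show "finite {e. (\<lambda>(s, k). \<Sum>i<N. a i * g i (s - b i, k)) e \<noteq> 0}"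
    unfolding eq by (rule finite_support_sum) (rule fin)
  show "evalx z (\<lambda>(s, k). \<Sum>i<N. a i * g i (s - b i, k)) = (\<Sum>i<N. a i * (exp (b i * z) * evalx z (g i)))"
    unfolding eq evalx_sum[OF fin]
    unfolding evalx_scaleC[OF evalx_translate(1)[OF assms]] evalx_translate(2)[OF assms]
    unfolding scaleC_complex ..
qed

context intertwiner
begin

text \<open>The sums of \<open>coef_jacobi\<close> have the same length for all coefficients, so
  they can be evaluated as finite sums of series; each power of x becomes a scalar exponential, and
  one bound serves all z.\<close>

lemma ev_jacobi:
  assumes v: "\<alpha> \<in> A" "v \<in> grade_alg V \<alpha>" "v \<in> weight_alg V h"
    and w: "w \<in> mspace W1" and x: "x \<in> mspace X" and y: "y \<in> mspace Y"
  shows "\<exists>N0. \<forall>N\<ge>N0. \<forall>z.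
    (\<Sum>c<N. ((-1) ^ c * (of_int n gchoose c)) *
      (exp (of_nat c * z) * ev z w x (opposite_op V Y v y (int c - m - n - 1))))
    - (\<Sum>b<N. ((-1) powi n * (-1) ^ b * (of_int n gchoose b)) *
      (exp ((of_int n - of_nat b) * z) * ev z w (module_op X v x (- m - 1 - int b)) y))
    = (\<Sum>a<N. (of_int m gchoose a) *
      (exp ((of_int m - of_nat a) * z) * ev z (module_op W1 v w (- n - 1 - int a)) x y))"
proof -
  have opx: "module_op X v x e \<in> mspace X" and opw: "module_op W1 v w e \<in> mspace W1"
    and opy: "opposite_op V Y v y e \<in> mspace Y" for e
    using clinear_onD(1)[OF X.op_linear x] clinear_onD(1)[OF W1.op_linear w]
      clinear_onD(1)[OF Y.opposite_op_linear y] by auto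
  obtain N0 where N0: "\<forall>N\<ge>N0. \<forall>s k.
    (\<Sum>c<N. ((-1) ^ c * (of_int n gchoose c)) *
      coef w x (opposite_op V Y v y (int c - m - n - 1)) (s - of_nat c, k))
    - (\<Sum>b<N. ((-1) powi n * (-1) ^ b * (of_int n gchoose b)) *
      coef w (module_op X v x (- m - 1 - int b)) y (s - of_int n + of_nat b, k))
    = (\<Sum>a<N. (of_int m gchoose a) *
      coef (module_op W1 v w (- n - 1 - int a)) x y (s - of_int m + of_nat a, k))"
    using coef_jacobi[OF assms] by blast
  note fin1 = coef_finite[OF w x opy] and fin2 = coef_finite[OF w opx y] and fin3 = coef_finite[OF opw x y]
  note tr1 = evalx_translated_sum[where g = "\<lambda>c. coef w x (opposite_op V Y v y (int c - m - n - 1))" and b = of_nat, OF fin1]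
    and tr2 = evalx_translated_sum[where g = "\<lambda>b. coef w (module_op X v x (- m - 1 - int b)) y"
        and b = "\<lambda>b. of_int n - of_nat b", OF fin2]
    and tr3 = evalx_translated_sum[where g = "\<lambda>a. coef (module_op W1 v w (- n - 1 - int a)) x y"
        and b = "\<lambda>a. of_int m - of_nat a", OF fin3]
  show ?thesis
  proof (intro exI[of _ N0] allI impI)
    fix N z assume N: "N \<ge> N0"
    let ?f1 = "\<lambda>(s, k). \<Sum>c<N. ((-1) ^ c * (of_int n gchoose c)) *
      coef w x (opposite_op V Y v y (int c - m - n - 1)) (s - of_nat c, k)"
    let ?f2 = "\<lambda>(s, k). \<Sum>b<N. ((-1) powi n * (-1) ^ b * (of_int n gchoose b)) *
      coef w (module_op X v x (- m - 1 - int b)) y (s - (of_int n - of_nat b), k)"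
    let ?f3 = "\<lambda>(s, k). \<Sum>a<N. (of_int m gchoose a) *
      coef (module_op W1 v w (- n - 1 - int a)) x y (s - (of_int m - of_nat a), k)"
    have eq: "(\<lambda>e. ?f1 e - ?f2 e) = ?f3"
    proof -
      have d: "s - (p - q) = s - p + q" for s p q :: complex by simp
      show ?thesis
      proof
        fix e :: "complex \<times> nat"
        obtain s k where e: "e = (s, k)" by (cases e)
        show "?f1 e - ?f2 e = ?f3 e"
          unfolding e prod.case d by (rule N0[rule_format, OF N])
      qed
    qed
    have "evalx z ?f1 - evalx z ?f2 = evalx z (\<lambda>e. ?f1 e - ?f2 e)"
      by (rule evalx_diff[symmetric]) (rule tr1(1), rule tr2(1))
    also have "\<dots> = evalx z ?f3" unfolding eq ..
    finally show "(\<Sum>c<N. ((-1) ^ c * (of_int n gchoose c)) *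
        (exp (of_nat c * z) * ev z w x (opposite_op V Y v y (int c - m - n - 1))))
      - (\<Sum>b<N. ((-1) powi n * (-1) ^ b * (of_int n gchoose b)) *
        (exp ((of_int n - of_nat b) * z) * ev z w (module_op X v x (- m - 1 - int b)) y))
      = (\<Sum>a<N. (of_int m gchoose a) *
        (exp ((of_int m - of_nat a) * z) * ev z (module_op W1 v w (- n - 1 - int a)) x y))"
      unfolding tr1(2) tr2(2) tr3(2) ev_def .
  qed
qed

end

subsection \<open>Exponentials of \<open>L(0)\<close> and \<open>L(1)\<close>\<close>

text \<open>Monomials evaluate multiplicatively, so composition of operator-valued series becomes
  composition of operators. This turns the series in \<open>twisted_argument\<close> into an
  operator for each z.\<close>

lemma evalx_apply_series:
  fixes S :: "'a::complex_vector \<Rightarrow> 'b::complex_vector log_series"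
  assumes h: "clinear_on M N h" "cvec.subspace M" and S: "\<And>u. u \<in> M \<Longrightarrow> evalx z (S u) = h u"
    and fin: "\<And>u. u \<in> M \<Longrightarrow> finite {e. S u e \<noteq> 0}" and S0: "S 0 = (\<lambda>_. 0)"
    and f: "finite {i. f i \<noteq> 0}" "\<And>i. f i \<in> M"
  shows "evalx z (apply_series S f) = h (evalx z f)"
proof -
  have "apply_series S f = (\<lambda>e. \<Sum>i\<in>{i. f i \<noteq> 0}. shift_series i (S (f i)) e)"
    by (rule ext, rule apply_series_eq_sum) (use f S0 in auto)
  then have "evalx z (apply_series S f) = (\<Sum>i\<in>{i. f i \<noteq> 0}. evalx z (shift_series i (S (f i))))"
    using evalx_sum[of "{i. f i \<noteq> 0}" "\<lambda>i. shift_series i (S (f i))" z]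
      finite_support_shift_series[OF fin[OF f(2)]] by simp
  also have "\<dots> = (\<Sum>i\<in>{i. f i \<noteq> 0}. x_monomial z i *\<^sub>C h (f i))"
    using f fin S by (simp add: evalx_shift_series)
  also have "\<dots> = (\<Sum>i\<in>{i. f i \<noteq> 0}. h (x_monomial z i *\<^sub>C f i))"
    using clinear_onD(3)[OF h(1) f(2)] by simp
  also have "\<dots> = h (\<Sum>i\<in>{i. f i \<noteq> 0}. x_monomial z i *\<^sub>C f i)"
    by (rule clinear_on_sum[OF h, symmetric]) (rule cvec.subspace_scale[OF h(2) f(2)])
  also have "\<dots> = h (evalx z f)"
    by (simp add: evalx_superset[OF f(1) subset_refl])
  finally show ?thesis .
qed

definition exp_L1 :: "('v, 'w::complex_vector, 'g) module_structure \<Rightarrow> complex \<Rightarrow> 'w \<Rightarrow> 'w"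
  where "exp_L1 W t w = Sum_any (\<lambda>j. (t ^ j / fact j) *\<^sub>C (L_mod W 1 ^^ j) w)"

context sg_module
begin

lemma mod_weight_subset: "weight_mod W n \<subseteq> mspace W"
  using is_direct_sum_summand[OF mod_weight_direct_sum] by blast

lemma L1_pow_linear: "clinear_on (mspace W) (mspace W) (L_mod W 1 ^^ j)"
  by (intro clinear_on_funpow mod_L_linear) simp

lemma exp_L1_eq_sum:
  assumes "\<And>j. j \<ge> N \<Longrightarrow> (L_mod W 1 ^^ j) w = 0"
  shows "exp_L1 W t w = (\<Sum>j<N. (t ^ j / fact j) *\<^sub>C (L_mod W 1 ^^ j) w)"
  unfolding exp_L1_def by (rule Sum_any_eq_sum_lessThan) (simp add: assms)

lemma exp_L1_linear: "clinear_on (mspace W) (mspace W) (exp_L1 W t)"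
  unfolding clinear_on_def
proof (intro conjI ballI allI)
  fix w assume w: "w \<in> mspace W"
  show "exp_L1 W t w \<in> mspace W"
    unfolding exp_L1_def using clinear_onD(1)[OF L1_pow_linear w]
    by (intro Sum_any_in_subspace mod_subspace cvec.subspace_scale)
  obtain N where N: "\<And>j. j \<ge> N \<Longrightarrow> (L_mod W 1 ^^ j) w = 0" using L1_mod_nilpotent[OF w] by blast
  show "exp_L1 W t (c *\<^sub>C w) = c *\<^sub>C exp_L1 W t w" for c
    using N clinear_onD(3)[OF L1_pow_linear w]
    by (subst (1 2) exp_L1_eq_sum[of N]) (simp_all add: cvec.scale_sum_right mult.commute)
  fix u assume u: "u \<in> mspace W"
  obtain M where M: "\<And>j. j \<ge> M \<Longrightarrow> (L_mod W 1 ^^ j) u = 0" using L1_mod_nilpotent[OF u] by blast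
  have "exp_L1 W t (w + u) = (\<Sum>j<max N M. (t ^ j / fact j) *\<^sub>C (L_mod W 1 ^^ j) (w + u))"
    "exp_L1 W t w = (\<Sum>j<max N M. (t ^ j / fact j) *\<^sub>C (L_mod W 1 ^^ j) w)"
    "exp_L1 W t u = (\<Sum>j<max N M. (t ^ j / fact j) *\<^sub>C (L_mod W 1 ^^ j) u)"
    by (rule exp_L1_eq_sum; use N M clinear_onD(2)[OF L1_pow_linear w u] in simp)+
  then show "exp_L1 W t (w + u) = exp_L1 W t w + exp_L1 W t u"
    using clinear_onD(2)[OF L1_pow_linear w u] by (simp add: scaleC_add_right sum.distrib)
qed

lemma exp_L1_zero: "exp_L1 W 0 w = w"
proof -
  have "exp_L1 W 0 w = (\<Sum>j<1. (0 ^ j / fact j) *\<^sub>C (L_mod W 1 ^^ j) w)"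
    unfolding exp_L1_def by (rule Sum_any_eq_sum_lessThan) simp
  then show ?thesis by simp
qed

lemma exp_L1_exp_L1:
  assumes w: "w \<in> mspace W"
  shows "exp_L1 W s (exp_L1 W t w) = exp_L1 W (s + t) w"
proof -
  obtain N where N: "\<And>j. j \<ge> N \<Longrightarrow> (L_mod W 1 ^^ j) w = 0" using L1_mod_nilpotent[OF w] by blast
  have expw: "exp_L1 W t w = (\<Sum>j<N. (t ^ j / fact j) *\<^sub>C (L_mod W 1 ^^ j) w)" for t
    by (rule exp_L1_eq_sum) (rule N)
  have pow: "(L_mod W 1 ^^ i) ((L_mod W 1 ^^ j) w) = (L_mod W 1 ^^ (i + j)) w" for i j
    by (simp add: funpow_add)
  have in1: "(L_mod W 1 ^^ j) w \<in> mspace W" for j using clinear_onD(1)[OF L1_pow_linear w] .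
  have 1: "(L_mod W 1 ^^ i) (exp_L1 W t w) = (\<Sum>j<N. (t ^ j / fact j) *\<^sub>C (L_mod W 1 ^^ (i + j)) w)" for i
  proof -
    have "(L_mod W 1 ^^ i) (exp_L1 W t w)
      = (\<Sum>j<N. (L_mod W 1 ^^ i) ((t ^ j / fact j) *\<^sub>C (L_mod W 1 ^^ j) w))"
      unfolding expw
      by (rule clinear_on_sum[OF L1_pow_linear mod_subspace]) (rule cvec.subspace_scale[OF mod_subspace in1])
    then show ?thesis using clinear_onD(3)[OF L1_pow_linear in1] by (simp add: pow)
  qed
  have "exp_L1 W s (exp_L1 W t w) = (\<Sum>i<N. (s ^ i / fact i) *\<^sub>C (L_mod W 1 ^^ i) (exp_L1 W t w))"
    by (rule exp_L1_eq_sum) (use N in \<open>simp add: 1\<close>)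
  also have "\<dots> = (\<Sum>i<N. \<Sum>j<N. ((s ^ i / fact i) * (t ^ j / fact j)) *\<^sub>C (L_mod W 1 ^^ (i + j)) w)"
    by (simp add: 1 cvec.scale_sum_right)
  also have "\<dots> = (\<Sum>k<N. ((s + t) ^ k / fact k) *\<^sub>C (L_mod W 1 ^^ k) w)"
    by (rule exp_product_sum) (rule N)
  finally show ?thesis unfolding expw .
qed

text \<open>The operators \<open>K k\<close> are \<open>ad(L(1))^k (K 0) / k!\<close>.\<close>

lemma exp_L1_conjugate:
  assumes K: "\<And>k. clinear_on (mspace W) (mspace W) (K k)"
    and comm: "\<And>k u. u \<in> mspace W \<Longrightarrow> L_mod W 1 (K k u) = K k (L_mod W 1 u) + of_nat (Suc k) *\<^sub>C K (Suc k) u"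
    and nil: "\<And>u. u \<in> mspace W \<Longrightarrow> \<exists>N. \<forall>k\<ge>N. K k u = 0"
    and w: "w \<in> mspace W"
  shows "\<exists>N0. \<forall>N\<ge>N0. \<forall>t. exp_L1 W t (K 0 w) = (\<Sum>k<N. t ^ k *\<^sub>C K k (exp_L1 W t w))"
proof -
  let ?L = "L_mod W 1"
  note Llin = mod_L_linear[of 1, simplified]
  define b where "b j = (1 / fact j) *\<^sub>C (?L ^^ j) w" for j
  have bm: "b j \<in> mspace W" for j
    unfolding b_def using clinear_onD(1)[OF L1_pow_linear w] cvec.subspace_scale[OF mod_subspace] by blast
  have Lb: "?L (b j) = of_nat (Suc j) *\<^sub>C b (Suc j)" for j
  proof -
    have "?L (b j) = (1 / fact j) *\<^sub>C (?L ^^ Suc j) w"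
      unfolding b_def using clinear_onD(3)[OF Llin clinear_onD(1)[OF L1_pow_linear w]] by simp
    also have "(1 / fact j :: complex) = of_nat (Suc j) * (1 / fact (Suc j))"
      by (simp add: field_simps del: of_nat_Suc)
    finally show ?thesis by (simp add: b_def)
  qed
  have Km: "K k (b j) \<in> mspace W" for k j using clinear_onD(1)[OF K bm] .
  \<comment> \<open>Leibniz rule with divided powers: \<open>b j\<close> is L(1)^j w / j!, and the
    normalization of \<open>K\<close> absorbs the binomial coefficients.\<close>
  have pow: "(1 / fact n) *\<^sub>C (?L ^^ n) (K 0 w) = (\<Sum>k\<le>n. K k (b (n - k)))" for n
  proof (induction n)
    case 0
    then show ?case by (simp add: b_def)
  next
    case (Suc n)
    have w0: "K 0 w \<in> mspace W" using clinear_onD(1)[OF K w] .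
    have "?L ((1 / fact n) *\<^sub>C (?L ^^ n) (K 0 w)) = (\<Sum>k\<le>n. ?L (K k (b (n - k))))"
      unfolding Suc by (rule clinear_on_sum[OF Llin mod_subspace]) (rule Km)
    also have "\<dots> = (\<Sum>k\<le>n. of_nat (Suc n - k) *\<^sub>C K k (b (Suc n - k)) + of_nat (Suc k) *\<^sub>C K (Suc k) (b (n - k)))"
    proof (rule sum.cong[OF refl])
      fix k assume "k \<in> {..n}"
      then have "Suc (n - k) = Suc n - k" by auto
      then show "?L (K k (b (n - k))) = of_nat (Suc n - k) *\<^sub>C K k (b (Suc n - k)) + of_nat (Suc k) *\<^sub>C K (Suc k) (b (n - k))"
        unfolding comm[OF bm] Lb clinear_onD(3)[OF K bm] by simp
    qed
    also have "\<dots> = (\<Sum>k\<le>n. of_nat (Suc n - k) *\<^sub>C K k (b (Suc n - k)))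
      + (\<Sum>k\<le>n. of_nat (Suc k) *\<^sub>C K (Suc k) (b (Suc n - Suc k)))"
      by (simp add: sum.distrib)
    also have "(\<Sum>k\<le>n. of_nat (Suc n - k) *\<^sub>C K k (b (Suc n - k)))
      = (\<Sum>k\<le>Suc n. of_nat (Suc n - k) *\<^sub>C K k (b (Suc n - k)))"
      by simp
    \<comment> \<open>The shift is harmless because the new term at k = 0 has coefficient 0, just as
      the term at k = Suc n added to the other sum. The two coefficients k and Suc n - k now add up
      to Suc n.\<close>
    also have "(\<Sum>k\<le>n. of_nat (Suc k) *\<^sub>C K (Suc k) (b (Suc n - Suc k)))
      = (\<Sum>k\<le>Suc n. of_nat k *\<^sub>C K k (b (Suc n - k)))"
      by (subst sum.atMost_Suc_shift) simp
    also have "(\<Sum>k\<le>Suc n. of_nat (Suc n - k) *\<^sub>C K k (b (Suc n - k)))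
        + (\<Sum>k\<le>Suc n. of_nat k *\<^sub>C K k (b (Suc n - k)))
      = of_nat (Suc n) *\<^sub>C (\<Sum>k\<le>Suc n. K k (b (Suc n - k)))"
      unfolding sum.distrib[symmetric] scaleC_add_left[symmetric] cvec.scale_sum_right
      by (rule sum.cong) (auto simp: of_nat_diff)
    finally have "?L ((1 / fact n) *\<^sub>C (?L ^^ n) (K 0 w)) = of_nat (Suc n) *\<^sub>C (\<Sum>k\<le>Suc n. K k (b (Suc n - k)))" .
    moreover have "?L ((1 / fact n) *\<^sub>C (?L ^^ n) (K 0 w)) = (1 / fact n) *\<^sub>C (?L ^^ Suc n) (K 0 w)"
      using clinear_onD(3)[OF Llin clinear_onD(1)[OF L1_pow_linear w0]] by simp
    ultimately have "(1 / of_nat (Suc n)) *\<^sub>C (1 / fact n) *\<^sub>C (?L ^^ Suc n) (K 0 w)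
      = (\<Sum>k\<le>Suc n. K k (b (Suc n - k)))"
      by (simp del: of_nat_Suc sum.atMost_Suc)
    then show ?case by (simp add: mult.commute del: of_nat_Suc sum.atMost_Suc)
  qed
  obtain J where J: "\<And>j. j \<ge> J \<Longrightarrow> (?L ^^ j) w = 0" using L1_mod_nilpotent[OF w] by blast
  have b0: "b j = 0" if "j \<ge> J" for j using J[OF that] by (simp add: b_def)
  obtain n0 where n0: "\<And>j k. k \<ge> n0 j \<Longrightarrow> K k (b j) = 0" using nil[OF bm] by metis
  define N0 where "N0 = Max (insert 0 (n0 ` {..<J}))"
  have n0N0: "n0 j \<le> N0" if "j < J" for j unfolding N0_def by (rule Max_ge) (use that in auto)
  have Kb: "K k (b j) = 0" if "k \<ge> N0 \<or> j \<ge> J" for k j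
  proof (cases "j \<ge> J")
    case True
    then show ?thesis using clinear_on_zero[OF K mod_subspace] by (simp add: b0)
  next
    case False
    then have "n0 j \<le> k" using n0N0[of j] that by simp
    then show ?thesis by (rule n0)
  qed
  have "exp_L1 W t (K 0 w) = (\<Sum>k<N. t ^ k *\<^sub>C K k (exp_L1 W t w))" if N: "N \<ge> N0" for N t
  proof -
    let ?g = "\<lambda>k j. t ^ (k + j) *\<^sub>C K k (b j)"
    have z: "(1 / fact n) *\<^sub>C (?L ^^ n) (K 0 w) = 0" if "n \<ge> N + J" for n
      unfolding pow
    proof (rule sum.neutral, rule ballI)
      fix k
      have "k \<ge> N0 \<or> n - k \<ge> J" using that N by linarith
      then show "K k (b (n - k)) = 0" by (rule Kb)
    qed
    then have z': "(?L ^^ n) (K 0 w) = 0" if "n \<ge> N + J" for n using that by fastforce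
    have "exp_L1 W t (K 0 w) = (\<Sum>n<N + J. t ^ n *\<^sub>C (1 / fact n) *\<^sub>C (?L ^^ n) (K 0 w))"
      by (subst exp_L1_eq_sum[of "N + J"]) (simp_all add: z')
    also have "\<dots> = (\<Sum>n<N + J. \<Sum>k\<le>n. ?g k (n - k))"
      unfolding pow cvec.scale_sum_right by simp
    also have "\<dots> = (\<Sum>(k, j)\<in>{(k, j). k + j < N + J}. ?g k j)"
      by (rule sum.triangle_reindex[symmetric])
    also have "\<dots> = (\<Sum>(k, j)\<in>{..<N} \<times> {..<J}. ?g k j)"
    proof (rule sum.mono_neutral_right)
      have "{(k, j). k + j < N + J} \<subseteq> {..<N + J} \<times> {..<N + J}" by auto
      then show "finite {(k, j). k + j < N + J}" by (rule finite_subset) simp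
      have "k < N \<and> j < J" if "K k (b j) \<noteq> 0" for k j
        using Kb[of k j] that N by (meson le_trans not_le)
      then show "\<forall>i\<in>{(k, j). k + j < N + J} - {..<N} \<times> {..<J}. (case i of (k, j) \<Rightarrow> ?g k j) = 0"
        by auto
    qed auto
    also have "\<dots> = (\<Sum>k<N. \<Sum>j<J. ?g k j)"
      by (simp add: sum.cartesian_product)
    also have "\<dots> = (\<Sum>k<N. t ^ k *\<^sub>C K k (exp_L1 W t w))"
    proof (rule sum.cong[OF refl])
      fix k
      have "exp_L1 W t w = (\<Sum>j<J. t ^ j *\<^sub>C b j)"
        by (subst exp_L1_eq_sum[of J]) (simp_all add: b_def J)
      then have "K k (exp_L1 W t w) = (\<Sum>j<J. K k (t ^ j *\<^sub>C b j))"
        using clinear_on_sum[OF K mod_subspace, of "{..<J}" "\<lambda>j. t ^ j *\<^sub>C b j"]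
          cvec.subspace_scale[OF mod_subspace bm] by simp
      then show "(\<Sum>j<J. ?g k j) = t ^ k *\<^sub>C K k (exp_L1 W t w)"
        using clinear_onD(3)[OF K bm] by (simp add: cvec.scale_sum_right power_add)
    qed
    finally show ?thesis .
  qed
  then show ?thesis by blast
qed

text \<open>The chains of divided brackets with L(1) are short: L(-1) leads to 2 L(0) and then to
  L(1), where it stops. They start at L(1), L(0) and L(-1) in the three cases.\<close>

lemma exp_L1_L_mod:
  assumes w: "w \<in> mspace W"
  shows "exp_L1 W t (L_mod W 1 w) = L_mod W 1 (exp_L1 W t w)"
    "exp_L1 W t (L_mod W 0 w) = L_mod W 0 (exp_L1 W t w) + t *\<^sub>C L_mod W 1 (exp_L1 W t w)"
    "exp_L1 W t (L_mod W (-1) w) = L_mod W (-1) (exp_L1 W t w) + (2 * t) *\<^sub>C L_mod W 0 (exp_L1 W t w)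
      + t\<^sup>2 *\<^sub>C L_mod W 1 (exp_L1 W t w)"
proof -
  define Z where "Z = (\<lambda>_::'w. 0::'w)"
  have Zlin: "clinear_on (mspace W) (mspace W) Z"
    using cvec.subspace_0[OF mod_subspace] by (simp add: clinear_on_def Z_def)
  have lin: "clinear_on (mspace W) (mspace W) (L_mod W j)" if "j \<in> {-1, 0, 1}" for j
    using that by (rule mod_L_linear)
  have lin2: "clinear_on (mspace W) (mspace W) (\<lambda>u. 2 *\<^sub>C L_mod W 0 u)"
    using clinear_onD[OF lin[of 0]] cvec.subspace_scale[OF mod_subspace]
    by (auto simp: clinear_on_def scaleC_add_right)
  \<comment> \<open>Covers all chains of length at most three; \<open>Z\<close> is the zero operator
    that continues them.\<close>
  have conj: "exp_L1 W t (K 0 w) = K 0 (exp_L1 W t w) + t *\<^sub>C K 1 (exp_L1 W t w) + t\<^sup>2 *\<^sub>C K 2 (exp_L1 W t w)"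
    if K: "\<And>k. k < 3 \<Longrightarrow> clinear_on (mspace W) (mspace W) (K k)" and KZ: "\<And>k. k \<ge> 3 \<Longrightarrow> K k = Z"
      and comm: "\<And>u. u \<in> mspace W \<Longrightarrow> L_mod W 1 (K 0 u) = K 0 (L_mod W 1 u) + K 1 u"
        "\<And>u. u \<in> mspace W \<Longrightarrow> L_mod W 1 (K 1 u) = K 1 (L_mod W 1 u) + 2 *\<^sub>C K 2 u"
        "\<And>u. u \<in> mspace W \<Longrightarrow> L_mod W 1 (K 2 u) = K 2 (L_mod W 1 u)" for K :: "nat \<Rightarrow> 'w \<Rightarrow> 'w"
  proof -
    have Klin: "clinear_on (mspace W) (mspace W) (K k)" for k
      using K KZ Zlin by (cases "k < 3") auto
    have "L_mod W 1 (K k u) = K k (L_mod W 1 u) + of_nat (Suc k) *\<^sub>C K (Suc k) u"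
      if "u \<in> mspace W" for k u
    proof -
      consider "k = 0" | "k = 1" | "k = 2" | "k \<ge> 3" by linarith
      then show ?thesis
      proof cases
        case 4
        then show ?thesis using clinear_on_zero[OF lin[of 1] mod_subspace] by (simp add: KZ Z_def)
      qed (use comm[OF that] in \<open>simp_all add: KZ Z_def numeral_2_eq_2\<close>)
    qed
    moreover have "\<exists>N. \<forall>k\<ge>N. K k u = 0" for u
      by (rule exI[of _ 3]) (simp add: KZ Z_def)
    ultimately obtain N0 where N0: "\<forall>N\<ge>N0. \<forall>t. exp_L1 W t (K 0 w) = (\<Sum>k<N. t ^ k *\<^sub>C K k (exp_L1 W t w))"
      using exp_L1_conjugate[where K = K, OF Klin _ _ w] by blast
    have "exp_L1 W t (K 0 w) = (\<Sum>k<N0 + 3. t ^ k *\<^sub>C K k (exp_L1 W t w))"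
      using N0 by simp
    also have "\<dots> = (\<Sum>k<3. t ^ k *\<^sub>C K k (exp_L1 W t w))"
      by (rule sum.mono_neutral_right) (auto simp: KZ Z_def)
    finally show ?thesis by (simp add: numeral_3_eq_3 numeral_2_eq_2)
  qed
  have 1: "exp_L1 W t (K 0 w) = K 0 (exp_L1 W t w) + t *\<^sub>C K 1 (exp_L1 W t w) + t\<^sup>2 *\<^sub>C K 2 (exp_L1 W t w)"
    if "K = (\<lambda>k. if k = 0 then L_mod W 1 else Z)" for K :: "nat \<Rightarrow> 'w \<Rightarrow> 'w"
    by (rule conj) (use that lin Zlin clinear_on_zero[OF lin[of 1] mod_subspace] in \<open>auto simp: Z_def\<close>)
  show "exp_L1 W t (L_mod W 1 w) = L_mod W 1 (exp_L1 W t w)"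
    using 1[OF refl] by (simp add: Z_def)
  have 2: "exp_L1 W t (K 0 w) = K 0 (exp_L1 W t w) + t *\<^sub>C K 1 (exp_L1 W t w) + t\<^sup>2 *\<^sub>C K 2 (exp_L1 W t w)"
    if "K = (\<lambda>k. if k = 0 then L_mod W 0 else if k = 1 then L_mod W 1 else Z)" for K :: "nat \<Rightarrow> 'w \<Rightarrow> 'w"
    by (rule conj) (use that lin Zlin L_mod_comm(1) clinear_on_zero[OF lin[of 1] mod_subspace] in \<open>auto simp: Z_def\<close>)
  show "exp_L1 W t (L_mod W 0 w) = L_mod W 0 (exp_L1 W t w) + t *\<^sub>C L_mod W 1 (exp_L1 W t w)"
    using 2[OF refl] by (simp add: Z_def)
  have 3: "exp_L1 W t (K 0 w) = K 0 (exp_L1 W t w) + t *\<^sub>C K 1 (exp_L1 W t w) + t\<^sup>2 *\<^sub>C K 2 (exp_L1 W t w)"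
    if "K = (\<lambda>k. if k = 0 then L_mod W (-1) else if k = 1 then (\<lambda>u. 2 *\<^sub>C L_mod W 0 u)
      else if k = 2 then L_mod W 1 else Z)" for K :: "nat \<Rightarrow> 'w \<Rightarrow> 'w"
  proof (rule conj)
    fix u assume u: "u \<in> mspace W"
    show "L_mod W 1 (K 0 u) = K 0 (L_mod W 1 u) + K 1 u"
      using L_mod_comm(3)[OF u] by (simp add: that)
    have "L_mod W 1 (2 *\<^sub>C L_mod W 0 u) = 2 *\<^sub>C L_mod W 1 (L_mod W 0 u)"
      using clinear_onD(3)[OF lin] clinear_onD(1)[OF lin u] by simp
    also have "L_mod W 1 (L_mod W 0 u) = L_mod W 0 (L_mod W 1 u) + L_mod W 1 u"
      using L_mod_comm(1)[OF u] by simp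
    finally show "L_mod W 1 (K 1 u) = K 1 (L_mod W 1 u) + 2 *\<^sub>C K 2 u"
      by (simp add: that scaleC_add_right)
  qed (use that lin lin2 Zlin in auto)
  show "exp_L1 W t (L_mod W (-1) w) = L_mod W (-1) (exp_L1 W t w) + (2 * t) *\<^sub>C L_mod W 0 (exp_L1 W t w)
      + t\<^sup>2 *\<^sub>C L_mod W 1 (exp_L1 W t w)"
    using 3[OF refl] by (simp add: mult.commute)
qed

text \<open>Coefficient form of exp(t L(1)) Y(v, x) exp(-t L(1)) = Y(exp(t (1 - t x) L(1)) (1 - t
  x)^(-2 L(0)) v, x / (1 - t x)). Here i counts the applications of L(1) to \<open>v\<close>, and k
  - i is the power of x taken from the expansion of 1 - t x.\<close>

lemma exp_L1_module_op:
  assumes v: "v \<in> weight_alg V h" and w: "w \<in> mspace W"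
  shows "\<exists>N0. \<forall>N\<ge>N0. \<forall>t. exp_L1 W t (module_op W v w e) = (\<Sum>k<N. t ^ k *\<^sub>C (\<Sum>i\<le>k.
    ((of_int (2 * h + e - 1 - int i) gchoose (k - i)) / fact i) *\<^sub>C
      module_op W ((L_alg V 1 ^^ i) v) (exp_L1 W t w) (e - int (k - i))))"
proof -
  let ?L = "L_mod W 1"
  note Llin = mod_L_linear[of 1, simplified]
  define c where "c i l = (of_int (2 * h + e - 1 - int i) gchoose l) / (fact i :: complex)" for i l
  define G where "G i l u = module_op W ((L_alg V 1 ^^ i) v) u (e - int l)" for i l u
  define K where "K k u = (\<Sum>i\<le>k. c i (k - i) *\<^sub>C G i (k - i) u)" for k u
  have Gm: "G i l u \<in> mspace W" if "u \<in> mspace W" for i l u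
    unfolding G_def by (rule clinear_onD(1)[OF mod_op_linear that])
  have Km: "K k u \<in> mspace W" if "u \<in> mspace W" for k u
    unfolding K_def by (intro cvec.subspace_sum[OF mod_subspace] cvec.subspace_scale[OF mod_subspace] Gm that)
  have Klin: "clinear_on (mspace W) (mspace W) (K k)" for k
    using Km clinear_onD(2,3)[OF mod_op_linear]
    by (auto simp: clinear_on_def K_def G_def scaleC_add_right sum.distrib cvec.scale_sum_right mult.commute)
  have LG: "?L (G i l u) = G i l (?L u) + G (Suc i) l u + of_int (2 * (h - int i) + e - int l - 1) *\<^sub>C G i (Suc l) u"
    if "u \<in> mspace W" for i l u
  proof -
    have p: "e - int l - 1 = e - int (Suc l)" "2 * (h - int i) + (e - int l) - 1 = 2 * (h - int i) + e - int l - 1"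
      "L_alg V 1 ((L_alg V 1 ^^ i) v) = (L_alg V 1 ^^ Suc i) v" by simp_all
    show ?thesis
      unfolding G_def using op_L_comm(2)[OF L1_pow_alg_weight[OF v, of i] that, of "e - int l", unfolded p] .
  qed
  \<comment> \<open>The recursion for the coefficients that the hypothesis of
    \<open>exp_L1_conjugate\<close> demands. With a = 2h + e - 1 - i it follows from the Pascal rule
    for a + 1 and the absorption identity for l times the binomial coefficient.\<close>
  have coeff: "(if i = 0 then 0 else c (i - 1) l) + (if l = 0 then 0 else of_int (2 * (h - int i) + e - int (l - 1) - 1) * c i (l - 1))
    = of_nat (i + l) * c i l" for i l
  proof -
    define a :: complex where "a = of_int (2 * h + e - 1 - int i)"
    have ci: "c i l = (a gchoose l) / fact i" for l by (simp add: c_def a_def)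
    have p: "(if i = 0 then 0 else c (i - 1) l) = of_nat i * ((a + 1) gchoose l) / fact i"
    proof (cases i)
      case (Suc i')
      have eq: "of_int (2 * h + e - 1 - int i') = a + 1" by (simp add: a_def Suc)
      have "c i' l = ((a + 1) gchoose l) / fact i'" unfolding c_def eq ..
      then show ?thesis by (simp add: Suc del: of_nat_Suc)
    qed simp
    show ?thesis
    proof (cases l)
      case 0
      then show ?thesis unfolding p ci by simp
    next
      case (Suc l')
      have q: "of_nat (Suc l') * (a gchoose Suc l') = (a - of_nat l') * (a gchoose l')"
        by (metis gbinomial_absorption gbinomial_absorb_comp)
      have r: "of_int (2 * (h - int i) + e - int l' - 1) = a - of_nat i - of_nat l'"
        by (simp add: a_def)
      have "of_nat i * ((a + 1) gchoose Suc l') + (a - of_nat i - of_nat l') * (a gchoose l')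
        = of_nat i * (a gchoose Suc l') + (a - of_nat l') * (a gchoose l')"
        unfolding gbinomial_Suc_Suc by (simp add: algebra_simps)
      also have "\<dots> = of_nat (i + Suc l') * (a gchoose Suc l')"
        unfolding q[symmetric] by (simp add: algebra_simps)
      finally have "of_nat i * ((a + 1) gchoose Suc l') / fact i + (a - of_nat i - of_nat l') * ((a gchoose l') / fact i)
        = of_nat (i + Suc l') * ((a gchoose Suc l') / fact i)"
        by (simp only: times_divide_eq_right add_divide_distrib[symmetric])
      then show ?thesis
        unfolding p unfolding Suc by (simp only: ci r diff_Suc_1 Suc_not_Zero if_False)
    qed
  qed
  have comm: "?L (K k u) = K k (?L u) + of_nat (Suc k) *\<^sub>C K (Suc k) u" if u: "u \<in> mspace W" for k u
  proof -
    have "?L (K k u) = (\<Sum>i\<le>k. c i (k - i) *\<^sub>C ?L (G i (k - i) u))"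
      unfolding K_def
      by (subst clinear_on_sum[OF Llin mod_subspace])
        (use Gm[OF u] cvec.subspace_scale[OF mod_subspace] clinear_onD(3)[OF Llin] in auto)
    also have "\<dots> = K k (?L u) + (\<Sum>i\<le>k. c i (k - i) *\<^sub>C G (Suc i) (k - i) u)
      + (\<Sum>i\<le>k. (of_int (2 * (h - int i) + e - int (k - i) - 1) * c i (k - i)) *\<^sub>C G i (Suc (k - i)) u)"
      unfolding K_def LG[OF u] by (simp add: scaleC_add_right sum.distrib mult.commute add.assoc)
    also have "(\<Sum>i\<le>k. c i (k - i) *\<^sub>C G (Suc i) (k - i) u)
      = (\<Sum>i\<le>Suc k. (if i = 0 then 0 else c (i - 1) (Suc k - i)) *\<^sub>C G i (Suc k - i) u)"
      by (subst sum.atMost_Suc_shift) simp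
    also have "(\<Sum>i\<le>k. (of_int (2 * (h - int i) + e - int (k - i) - 1) * c i (k - i)) *\<^sub>C G i (Suc (k - i)) u)
      = (\<Sum>i\<le>Suc k. (if Suc k - i = 0 then 0 else
          of_int (2 * (h - int i) + e - int (Suc k - i - 1) - 1) * c i (Suc k - i - 1)) *\<^sub>C G i (Suc k - i) u)"
    proof -
      have "Suc (k - i) = Suc k - i" "Suc k - i - 1 = k - i" "Suc k - i \<noteq> 0" if "i \<le> k" for i
        using that by auto
      then show ?thesis unfolding sum.atMost_Suc by (auto intro!: sum.cong simp del: of_int_diff of_int_add)
    qed
    also have "K k (?L u) + (\<Sum>i\<le>Suc k. (if i = 0 then 0 else c (i - 1) (Suc k - i)) *\<^sub>C G i (Suc k - i) u)
      + (\<Sum>i\<le>Suc k. (if Suc k - i = 0 then 0 else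
          of_int (2 * (h - int i) + e - int (Suc k - i - 1) - 1) * c i (Suc k - i - 1)) *\<^sub>C G i (Suc k - i) u)
      = K k (?L u) + (\<Sum>i\<le>Suc k. (of_nat (i + (Suc k - i)) * c i (Suc k - i)) *\<^sub>C G i (Suc k - i) u)"
      unfolding add.assoc sum.distrib[symmetric] scaleC_add_left[symmetric] coeff ..
    also have "(\<Sum>i\<le>Suc k. (of_nat (i + (Suc k - i)) * c i (Suc k - i)) *\<^sub>C G i (Suc k - i) u)
      = of_nat (Suc k) *\<^sub>C K (Suc k) u"
      unfolding K_def cvec.scale_sum_right by (rule sum.cong) (auto simp: scaleC_scaleC)
    finally show ?thesis .
  qed
  \<comment> \<open>For large k either i is large, and L(1)^i v = 0, or k - i is large, and the mode
    is cut off by truncation on \<open>u\<close>.\<close>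
  have nil: "\<exists>N. \<forall>k\<ge>N. K k u = 0" if u: "u \<in> mspace W" for u
  proof -
    obtain I where I: "\<And>i. i \<ge> I \<Longrightarrow> (L_alg V 1 ^^ i) v = 0" using L1_alg_nilpotent by blast
    have "\<forall>i. \<exists>N. \<forall>e<N. module_op W ((L_alg V 1 ^^ i) v) u e = 0" using mod_op_truncated[OF u] by blast
    then obtain b where b: "\<And>i e. e < b i \<Longrightarrow> module_op W ((L_alg V 1 ^^ i) v) u e = 0" by metis
    define N where "N = I + nat (Max (insert 0 ((\<lambda>i. e - b i + 1) ` {..<I})))"
    have "K k u = 0" if k: "k \<ge> N" for k
      unfolding K_def
    proof (rule sum.neutral, rule ballI)
      fix i assume i: "i \<in> {..k}"
      show "c i (k - i) *\<^sub>C G i (k - i) u = 0"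
      proof (cases "i < I")
        case True
        have "e - b i + 1 \<le> Max (insert 0 ((\<lambda>i. e - b i + 1) ` {..<I}))"
          by (rule Max_ge) (use True in auto)
        then have "e - int (k - i) < b i" using k i True unfolding N_def by linarith
        then show ?thesis using b by (simp add: G_def)
      next
        case False
        then show ?thesis
          using I[of i] clinear_on_zero[OF mod_op_linear_left[OF u] cvec.subspace_UNIV] by (simp add: G_def)
      qed
    qed
    then show ?thesis by blast
  qed
  have "K 0 w = module_op W v w e" by (simp add: K_def c_def G_def)
  moreover obtain N0 where "\<forall>N\<ge>N0. \<forall>t. exp_L1 W t (K 0 w) = (\<Sum>k<N. t ^ k *\<^sub>C K k (exp_L1 W t w))"
    using exp_L1_conjugate[OF Klin comm nil w] by blast
  ultimately show ?thesis unfolding K_def c_def G_def by (intro exI[of _ N0]) simp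
qed

end

section \<open>Exponentials of L(0) and their commutation with other operators\<close>

context sg_module
begin

lemma L0_part_linear: "clinear_on (mspace W) (mspace W) ((\<lambda>u. L_mod W 0 u - n *\<^sub>C u) ^^ m)"
  by (intro clinear_on_funpow clinear_on_minus_scaleC mod_L_linear mod_subspace) simp

lemma bihom_mspace: "w \<in> bihom W \<beta> n \<Longrightarrow> w \<in> mspace W"
  using bihom_subset_mspace by blast

lemma bihom_scaleC: "w \<in> bihom W \<beta> n \<Longrightarrow> c *\<^sub>C w \<in> bihom W \<beta> n"
  by (rule cvec.subspace_scale[OF subspace_bihom])

lemma bihom_L0_part: "w \<in> bihom W \<beta> n \<Longrightarrow> ((\<lambda>u. L_mod W 0 u - n *\<^sub>C u) ^^ m) w \<in> bihom W \<beta> n"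
proof (induction m)
  case (Suc m)
  then show ?case
    using bihom_L_mod[of 0 _ \<beta> n] cvec.subspace_diff[OF subspace_bihom] bihom_scaleC by simp
qed simp

lemma L0_part_nilpotent:
  assumes "w \<in> weight_mod W n"
  obtains M where "\<And>m. m \<ge> M \<Longrightarrow> ((\<lambda>u. L_mod W 0 u - n *\<^sub>C u) ^^ m) w = 0"
  using mod_L0_nilpotent[OF assms] by blast

lemma exp_L0_hom:
  assumes w: "w \<in> weight_mod W n" and M: "\<And>m. m \<ge> M \<Longrightarrow> ((\<lambda>u. L_mod W 0 u - n *\<^sub>C u) ^^ m) w = 0"
  shows "exp_L0 W a w = exp (a * n) *\<^sub>C (\<Sum>m<M. (a ^ m / fact m) *\<^sub>C ((\<lambda>u. L_mod W 0 u - n *\<^sub>C u) ^^ m) w)"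
proof -
  have hc: "homogeneous_component (weight_mod W) w = (\<lambda>j. if j = n then w else 0)"
    by (rule homogeneous_component_single[OF mod_weight_direct_sum w])
  have "exp_L0 W a w = (\<Sum>h\<in>{n}. exp (a * h) *\<^sub>C
    Sum_any (\<lambda>m. (a ^ m / fact m) *\<^sub>C
      ((\<lambda>u. L_mod W 0 u - h *\<^sub>C u) ^^ m) (homogeneous_component (weight_mod W) w h)))"
    unfolding exp_L0_def
    by (rule Sum_any.expand_superset)
      (use clinear_on_zero[OF L0_part_linear mod_subspace] in \<open>auto simp: hc\<close>)
  also have "\<dots> = exp (a * n) *\<^sub>C
      Sum_any (\<lambda>m. (a ^ m / fact m) *\<^sub>C ((\<lambda>u. L_mod W 0 u - n *\<^sub>C u) ^^ m) w)"
    by (simp add: hc)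
  also have "Sum_any (\<lambda>m. (a ^ m / fact m) *\<^sub>C ((\<lambda>u. L_mod W 0 u - n *\<^sub>C u) ^^ m) w)
    = (\<Sum>m<M. (a ^ m / fact m) *\<^sub>C ((\<lambda>u. L_mod W 0 u - n *\<^sub>C u) ^^ m) w)"
    by (rule Sum_any_eq_sum_lessThan) (simp add: M)
  finally show ?thesis .
qed

lemma exp_L0_bihom:
  assumes "w \<in> bihom W \<beta> n"
  shows "exp_L0 W a w \<in> bihom W \<beta> n"
proof -
  have w: "w \<in> weight_mod W n" using assms by (simp add: bihom_def)
  obtain M where M: "\<And>m. m \<ge> M \<Longrightarrow> ((\<lambda>u. L_mod W 0 u - n *\<^sub>C u) ^^ m) w = 0"
    using L0_part_nilpotent[OF w] by blast
  have "exp_L0 W a w = exp (a * n) *\<^sub>C (\<Sum>m<M. (a ^ m / fact m) *\<^sub>C ((\<lambda>u. L_mod W 0 u - n *\<^sub>C u) ^^ m) w)"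
    by (rule exp_L0_hom[OF w]) (rule M)
  then show ?thesis
    using bihom_L0_part[OF assms]
    by (simp only:) (intro bihom_scaleC cvec.subspace_sum[OF subspace_bihom])
qed

lemma exp_L0_linear: "clinear_on (mspace W) (mspace W) (exp_L0 W a)"
proof -
  note ds = mod_weight_direct_sum
  let ?D = "\<lambda>h u. L_mod W 0 u - h *\<^sub>C u"
  define E where "E h u = exp (a * h) *\<^sub>C Sum_any (\<lambda>m. (a ^ m / fact m) *\<^sub>C (?D h ^^ m) u)" for h u
  have E: "exp_L0 W a w = Sum_any (\<lambda>h. E h (homogeneous_component (weight_mod W) w h))" for w
    unfolding exp_L0_def E_def ..
  have wsub: "cvec.subspace (weight_mod W h)" for h using is_direct_sum_subspace[OF ds] by blast
  have fin: "finite {m. (a ^ m / fact m) *\<^sub>C (?D h ^^ m) u \<noteq> 0}" if u: "u \<in> weight_mod W h" for h u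
  proof -
    obtain M where "\<And>m. m \<ge> M \<Longrightarrow> (?D h ^^ m) u = 0" using L0_part_nilpotent[OF u] by blast
    then show ?thesis by (intro finite_support_lessThan[of M]) simp
  qed
  have Elin: "clinear_on (weight_mod W h) (mspace W) (E h)" for h
    unfolding clinear_on_def
  proof (intro conjI ballI allI)
    fix u assume u: "u \<in> weight_mod W h"
    then have um: "u \<in> mspace W" using mod_weight_subset by blast
    show "E h u \<in> mspace W"
      unfolding E_def using clinear_onD(1)[OF L0_part_linear um]
      by (intro Sum_any_in_subspace mod_subspace cvec.subspace_scale)
    have "Sum_any (\<lambda>m. (a ^ m / fact m) *\<^sub>C (?D h ^^ m) (c *\<^sub>C u))
      = c *\<^sub>C Sum_any (\<lambda>m. (a ^ m / fact m) *\<^sub>C (?D h ^^ m) u)" for c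
      unfolding Sum_any_scaleC[OF fin[OF u], symmetric]
      using clinear_onD(3)[OF L0_part_linear um] by (simp add: mult.commute)
    then show "E h (c *\<^sub>C u) = c *\<^sub>C E h u" for c
      by (simp add: E_def mult.commute)
    fix v assume v: "v \<in> weight_mod W h"
    then have vm: "v \<in> mspace W" using mod_weight_subset by blast
    have "Sum_any (\<lambda>m. (a ^ m / fact m) *\<^sub>C (?D h ^^ m) (u + v))
      = Sum_any (\<lambda>m. (a ^ m / fact m) *\<^sub>C (?D h ^^ m) u) + Sum_any (\<lambda>m. (a ^ m / fact m) *\<^sub>C (?D h ^^ m) v)"
      unfolding Sum_any.distrib[OF fin[OF u] fin[OF v], symmetric]
      using clinear_onD(2)[OF L0_part_linear um vm] by (simp add: scaleC_add_right)
    then show "E h (u + v) = E h u + E h v"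
      by (simp add: E_def scaleC_add_right)
  qed
  have hc: "finite {h. homogeneous_component (weight_mod W) w h \<noteq> 0}"
    "homogeneous_component (weight_mod W) w h \<in> weight_mod W h" if "w \<in> mspace W" for w h
    using homogeneous_component_in(1)[OF ds that] by (auto simp: graded_families_def)
  have finE: "finite {h. E h (homogeneous_component (weight_mod W) w h) \<noteq> 0}" if "w \<in> mspace W" for w
    by (rule finite_subset[OF _ hc(1)[OF that]]) (use clinear_on_zero[OF Elin wsub] in auto)
  show ?thesis
    unfolding clinear_on_def
  proof (intro conjI ballI allI)
    fix w assume w: "w \<in> mspace W"
    show "exp_L0 W a w \<in> mspace W"
      unfolding E by (intro Sum_any_in_subspace mod_subspace clinear_onD(1)[OF Elin] hc(2) w)
    show "exp_L0 W a (c *\<^sub>C w) = c *\<^sub>C exp_L0 W a w" for c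
      unfolding E Sum_any_scaleC[OF finE[OF w], symmetric]
      using clinear_onD(3)[OF Elin hc(2)[OF w]] by (simp add: homogeneous_component_scaleC[OF ds w])
    fix u assume u: "u \<in> mspace W"
    show "exp_L0 W a (w + u) = exp_L0 W a w + exp_L0 W a u"
      unfolding E Sum_any.distrib[OF finE[OF w] finE[OF u], symmetric]
      using clinear_onD(2)[OF Elin hc(2)[OF w] hc(2)[OF u]] by (simp add: homogeneous_component_add[OF ds w u])
  qed
qed

text \<open>By \<open>L0_shift_power\<close> the unipotent part of the exponential passes through
  \<open>K\<close> unchanged; only the scalar exp (a n) of the weight changes, to exp (a (n +
  \<kappa>)).\<close>

lemma exp_L0_conjugate:
  assumes K: "clinear_on (mspace W) (mspace W) K"
    and comm: "\<And>u. u \<in> mspace W \<Longrightarrow> L_mod W 0 (K u) = K (L_mod W 0 u) + \<kappa> *\<^sub>C K u"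
    and w: "w \<in> mspace W"
  shows "exp_L0 W a (K w) = exp (a * \<kappa>) *\<^sub>C K (exp_L0 W a w)"
  using w
proof (induction w rule: mspace_induct)
  case (hom \<beta> n w)
  let ?D = "\<lambda>n u. L_mod W 0 u - n *\<^sub>C u"
  have ww: "w \<in> weight_mod W n" and wm: "w \<in> mspace W"
    using hom bihom_mspace by (auto simp: bihom_def)
  obtain M where M: "\<And>m. m \<ge> M \<Longrightarrow> (?D n ^^ m) w = 0" using L0_part_nilpotent[OF ww] by blast
  have pow: "(?D (n + \<kappa>) ^^ m) (K w) = K ((?D n ^^ m) w)" for m
    by (rule L0_shift_power[OF K comm wm])
  have "exp_L0 W a (K w) = exp (a * (n + \<kappa>)) *\<^sub>C (\<Sum>m<M. (a ^ m / fact m) *\<^sub>C (?D (n + \<kappa>) ^^ m) (K w))"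
    by (rule exp_L0_hom[OF weight_mod_shift[OF K comm ww]])
      (use M clinear_on_zero[OF K mod_subspace] in \<open>simp_all add: pow\<close>)
  also have "\<dots> = exp (a * (n + \<kappa>)) *\<^sub>C (\<Sum>m<M. K ((a ^ m / fact m) *\<^sub>C (?D n ^^ m) w))"
    using clinear_onD(3)[OF K clinear_onD(1)[OF L0_part_linear wm]] by (simp add: pow)
  also have "\<dots> = exp (a * (n + \<kappa>)) *\<^sub>C K (\<Sum>m<M. (a ^ m / fact m) *\<^sub>C (?D n ^^ m) w)"
    using cvec.subspace_scale[OF mod_subspace clinear_onD(1)[OF L0_part_linear wm]]
    by (subst clinear_on_sum[OF K mod_subspace]) auto
  also have "\<dots> = exp (a * \<kappa>) *\<^sub>C K (exp (a * n) *\<^sub>C (\<Sum>m<M. (a ^ m / fact m) *\<^sub>C (?D n ^^ m) w))"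
    using cvec.subspace_scale[OF mod_subspace clinear_onD(1)[OF L0_part_linear wm]]
    by (subst clinear_onD(3)[OF K cvec.subspace_sum[OF mod_subspace]])
      (auto simp: distrib_left exp_add mult.commute)
  also have "exp (a * n) *\<^sub>C (\<Sum>m<M. (a ^ m / fact m) *\<^sub>C (?D n ^^ m) w) = exp_L0 W a w"
    by (rule exp_L0_hom[OF ww, symmetric]) (rule M)
  finally show ?case .
next
  case (add u w)
  then show ?case
    using clinear_onD(1,2)[OF exp_L0_linear] clinear_onD(1,2)[OF K] by (simp add: scaleC_add_right)
qed

lemma exp_L0_zero: "w \<in> mspace W \<Longrightarrow> exp_L0 W 0 w = w"
proof (induction w rule: mspace_induct)
  case (hom \<beta> n w)
  then have w: "w \<in> weight_mod W n" by (simp add: bihom_def)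
  obtain M where M: "\<And>m. m \<ge> M \<Longrightarrow> ((\<lambda>u. L_mod W 0 u - n *\<^sub>C u) ^^ m) w = 0"
    using L0_part_nilpotent[OF w] by blast
  \<comment> \<open>One term more than required, so that the summand m = 0 can be split off also
    when M = 0.\<close>
  have "exp_L0 W 0 w = exp (0 * n) *\<^sub>C (\<Sum>m<Suc M. (0 ^ m / fact m) *\<^sub>C ((\<lambda>u. L_mod W 0 u - n *\<^sub>C u) ^^ m) w)"
    by (rule exp_L0_hom[OF w]) (simp add: M)
  then show ?case by (simp add: sum.lessThan_Suc_shift del: sum.lessThan_Suc)
next
  case (add u w)
  then show ?case using clinear_onD(2)[OF exp_L0_linear] by simp
qed

lemma exp_L0_exp_L0: "w \<in> mspace W \<Longrightarrow> exp_L0 W a (exp_L0 W b w) = exp_L0 W (a + b) w"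
proof (induction w rule: mspace_induct)
  case (hom \<beta> n w)
  let ?D = "\<lambda>u. L_mod W 0 u - n *\<^sub>C u"
  have ww: "w \<in> weight_mod W n" and wm: "w \<in> mspace W"
    using hom bihom_mspace by (auto simp: bihom_def)
  have Dm: "(?D ^^ m) w \<in> mspace W" for m by (rule clinear_onD(1)[OF L0_part_linear wm])
  obtain M where M: "\<And>m. m \<ge> M \<Longrightarrow> (?D ^^ m) w = 0" using L0_part_nilpotent[OF ww] by blast
  have E: "exp_L0 W c w = exp (c * n) *\<^sub>C (\<Sum>m<M. (c ^ m / fact m) *\<^sub>C (?D ^^ m) w)" for c
    by (rule exp_L0_hom[OF ww]) (rule M)
  have pow: "(?D ^^ i) ((?D ^^ j) w) = (?D ^^ (i + j)) w" for i j
    by (simp add: funpow_add)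
  have DE: "(?D ^^ i) (exp_L0 W b w) = exp (b * n) *\<^sub>C (\<Sum>j<M. (b ^ j / fact j) *\<^sub>C (?D ^^ (i + j)) w)" for i
  proof -
    have "(?D ^^ i) (exp_L0 W b w) = exp (b * n) *\<^sub>C (?D ^^ i) (\<Sum>j<M. (b ^ j / fact j) *\<^sub>C (?D ^^ j) w)"
      unfolding E
      by (rule clinear_onD(3)[OF L0_part_linear cvec.subspace_sum[OF mod_subspace]])
        (rule cvec.subspace_scale[OF mod_subspace Dm])
    also have "(?D ^^ i) (\<Sum>j<M. (b ^ j / fact j) *\<^sub>C (?D ^^ j) w)
      = (\<Sum>j<M. (?D ^^ i) ((b ^ j / fact j) *\<^sub>C (?D ^^ j) w))"
      by (rule clinear_on_sum[OF L0_part_linear mod_subspace]) (rule cvec.subspace_scale[OF mod_subspace Dm])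
    finally show ?thesis using clinear_onD(3)[OF L0_part_linear Dm] by (simp add: pow)
  qed
  have "exp_L0 W b w \<in> weight_mod W n" using exp_L0_bihom[OF hom] by (simp add: bihom_def)
  then have "exp_L0 W a (exp_L0 W b w) = exp (a * n) *\<^sub>C (\<Sum>i<M. (a ^ i / fact i) *\<^sub>C (?D ^^ i) (exp_L0 W b w))"
    by (rule exp_L0_hom) (simp add: DE M)
  also have "\<dots> = exp (a * n) *\<^sub>C exp (b * n) *\<^sub>C
      (\<Sum>i<M. \<Sum>j<M. ((a ^ i / fact i) * (b ^ j / fact j)) *\<^sub>C (?D ^^ (i + j)) w)"
    by (simp add: DE cvec.scale_sum_right mult_ac)
  also have "(\<Sum>i<M. \<Sum>j<M. ((a ^ i / fact i) * (b ^ j / fact j)) *\<^sub>C (?D ^^ (i + j)) w)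
    = (\<Sum>k<M. ((a + b) ^ k / fact k) *\<^sub>C (?D ^^ k) w)"
    by (rule exp_product_sum) (rule M)
  finally show ?case by (simp add: E distrib_right exp_add)
next
  case (add u w)
  then show ?case using clinear_onD(1,2)[OF exp_L0_linear] by simp
qed

lemma exp_L0_L_mod:
  assumes "w \<in> mspace W"
  shows "exp_L0 W a (L_mod W 1 w) = exp (- a) *\<^sub>C L_mod W 1 (exp_L0 W a w)"
    "exp_L0 W a (L_mod W 0 w) = L_mod W 0 (exp_L0 W a w)"
    "exp_L0 W a (L_mod W (-1) w) = exp a *\<^sub>C L_mod W (-1) (exp_L0 W a w)"
  using exp_L0_conjugate[OF mod_L_linear[of 1], of "-1" w a]
    exp_L0_conjugate[OF mod_L_linear[of 0], of 0 w a]
    exp_L0_conjugate[OF mod_L_linear[of "-1"], of 1 w a] L_mod_comm assms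
  by auto

text \<open>L(1) has weight -1, so conjugation by exp (a L(0)) multiplies it by exp (- a).\<close>

lemma exp_L0_exp_L1:
  assumes w: "w \<in> mspace W"
  shows "exp_L0 W a (exp_L1 W t w) = exp_L1 W (t * exp (- a)) (exp_L0 W a w)"
proof -
  have pow: "exp_L0 W a ((L_mod W 1 ^^ j) w) = exp (- a) ^ j *\<^sub>C (L_mod W 1 ^^ j) (exp_L0 W a w)" for j
  proof (induction j)
    case (Suc j)
    have "exp_L0 W a ((L_mod W 1 ^^ Suc j) w) = exp (- a) *\<^sub>C L_mod W 1 (exp_L0 W a ((L_mod W 1 ^^ j) w))"
      using exp_L0_L_mod(1)[OF clinear_onD(1)[OF L1_pow_linear w]] by simp
    then show ?case
      using Suc clinear_onD(3)[OF mod_L_linear clinear_onD(1)[OF L1_pow_linear clinear_onD(1)[OF exp_L0_linear w]]]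
      by simp
  qed simp
  obtain N where N: "\<And>j. j \<ge> N \<Longrightarrow> (L_mod W 1 ^^ j) w = 0" using L1_mod_nilpotent[OF w] by blast
  have N': "(L_mod W 1 ^^ j) (exp_L0 W a w) = 0" if "j \<ge> N" for j
    using pow[of j] N[OF that] clinear_on_zero[OF exp_L0_linear mod_subspace] by simp
  have wj: "(L_mod W 1 ^^ j) w \<in> mspace W" for j using clinear_onD(1)[OF L1_pow_linear w] .
  have "exp_L1 W t w = (\<Sum>j<N. (t ^ j / fact j) *\<^sub>C (L_mod W 1 ^^ j) w)"
    by (rule exp_L1_eq_sum) (rule N)
  then have "exp_L0 W a (exp_L1 W t w) = (\<Sum>j<N. exp_L0 W a ((t ^ j / fact j) *\<^sub>C (L_mod W 1 ^^ j) w))"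
    using clinear_on_sum[OF exp_L0_linear mod_subspace, of "{..<N}" "\<lambda>j. (t ^ j / fact j) *\<^sub>C (L_mod W 1 ^^ j) w"]
      cvec.subspace_scale[OF mod_subspace wj] by simp
  also have "\<dots> = (\<Sum>j<N. ((t * exp (- a)) ^ j / fact j) *\<^sub>C (L_mod W 1 ^^ j) (exp_L0 W a w))"
    using clinear_onD(3)[OF exp_L0_linear wj] by (simp add: pow power_mult_distrib)
  also have "\<dots> = exp_L1 W (t * exp (- a)) (exp_L0 W a w)"
    by (rule exp_L1_eq_sum[symmetric]) (rule N')
  finally show ?thesis .
qed

text \<open>The module carries no topology; operators are differentiated after application of a
  linear functional, where only a polynomial in t remains.\<close>

lemma exp_L1_has_derivative:
  assumes \<psi>: "clinear_on (mspace W) UNIV \<psi>" and w: "w \<in> mspace W"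
  shows "((\<lambda>t. \<psi> (exp_L1 W t w)) has_field_derivative \<psi> (L_mod W 1 (exp_L1 W t w))) (at t)"
proof -
  let ?L = "L_mod W 1"
  obtain N where N: "\<And>j. j \<ge> N \<Longrightarrow> (?L ^^ j) w = 0" using L1_mod_nilpotent[OF w] by blast
  define p where "p j = \<psi> ((?L ^^ j) w)" for j
  have pN: "p N = 0" using clinear_on_zero[OF \<psi> mod_subspace] N by (simp add: p_def)
  have E: "\<psi> (exp_L1 W t u) = (\<Sum>j<N. (t ^ j / fact j) * \<psi> ((?L ^^ j) u))"
    if u: "u \<in> mspace W" and uN: "\<And>j. j \<ge> N \<Longrightarrow> (?L ^^ j) u = 0" for u t
  proof -
    have um: "(?L ^^ j) u \<in> mspace W" for j by (rule clinear_onD(1)[OF L1_pow_linear u])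
    have "exp_L1 W t u = (\<Sum>j<N. (t ^ j / fact j) *\<^sub>C (?L ^^ j) u)" by (rule exp_L1_eq_sum) (rule uN)
    also have "\<psi> \<dots> = (\<Sum>j<N. \<psi> ((t ^ j / fact j) *\<^sub>C (?L ^^ j) u))"
      by (rule clinear_on_sum[OF \<psi> mod_subspace]) (rule cvec.subspace_scale[OF mod_subspace um])
    finally show ?thesis using clinear_onD(3)[OF \<psi> um] by simp
  qed
  have e1: "\<psi> (exp_L1 W t w) = (\<Sum>j<N. (t ^ j / fact j) * p j)" for t
    unfolding p_def by (rule E[OF w]) (rule N)
  have Lw: "?L w \<in> mspace W" using clinear_onD(1)[OF mod_L_linear w] by simp
  have pow: "(?L ^^ j) (?L w) = (?L ^^ Suc j) w" for j by (simp only: funpow_Suc_right o_apply)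
  have "\<psi> (?L (exp_L1 W t w)) = \<psi> (exp_L1 W t (?L w))" by (simp add: exp_L1_L_mod(1)[OF w])
  also have "\<dots> = (\<Sum>j<N. (t ^ j / fact j) * p (Suc j))"
    unfolding p_def pow[symmetric] by (rule E[OF Lw]) (simp only: pow, rule N, simp)
  finally have e2: "\<psi> (?L (exp_L1 W t w)) = (\<Sum>j<N. (t ^ j / fact j) * p (Suc j))" .
  have d: "((\<lambda>s. s ^ m / fact m * p m) has_field_derivative (if m = 0 then 0 else t ^ (m - 1) / fact (m - 1) * p m)) (at t)" for m
  proof (cases m)
    case (Suc k)
    have "((\<lambda>s. s ^ m / fact m * p m) has_field_derivative (of_nat m * t ^ (m - 1) / fact m * p m)) (at t)"
      by (auto intro!: derivative_eq_intros)
    moreover have "of_nat m * t ^ (m - 1) / fact m = t ^ (m - 1) / fact (m - 1)"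
      by (simp add: Suc field_simps del: of_nat_Suc)
    ultimately show ?thesis using Suc by simp
  qed simp
  have sh: "(\<Sum>m<N. if m = 0 then 0 else t ^ (m - 1) / fact (m - 1) * p m) = (\<Sum>m<N. (t ^ m / fact m) * p (Suc m))"
  proof -
    define F where "F m = (if m = 0 then 0 else t ^ (m - 1) / fact (m - 1) * p m)" for m
    have "(\<Sum>m<Suc N. F m) = F 0 + (\<Sum>m<N. F (Suc m))" by (rule sum.lessThan_Suc_shift)
    moreover have "F 0 = 0" "F N = 0" by (simp_all add: F_def pN)
    ultimately show ?thesis by (simp add: F_def)
  qed
  show ?thesis unfolding e1 e2 sh[symmetric] by (rule DERIV_sum[OF d])
qed

end

subsection \<open>The operators \<open>exp(x L(1)) exp((2r+1) \<pi> \<i> L(0)) (x^(-L(0)))^2\<close>\<close>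

text \<open>The operator T(z). At log x = z the factor (x^(-L(0)))^2 is exp(-2 z L(0)), which is
  merged with the other exponential of L(0).\<close>

definition twist :: "('v, 'w::complex_vector, 'g) module_structure \<Rightarrow> int \<Rightarrow> complex \<Rightarrow> 'w \<Rightarrow> 'w"
  where "twist W r z w = exp_L1 W (exp z) (exp_L0 W (of_int (2 * r + 1) * of_real pi * \<i> - 2 * z) w)"

lemma shift_series_in_subspace:
  assumes "cvec.subspace S" "\<And>j. e = i + j \<Longrightarrow> g j \<in> S"
  shows "shift_series i g e \<in> S"
proof (cases "\<exists>j. e = i + j")
  case False
  then have "shift_series i g e = 0" by (intro shift_series_outside) auto
  then show ?thesis using cvec.subspace_0[OF assms(1)] by simp
qed (use assms(2) in auto)

lemma apply_series_in_subspace: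
  fixes T :: "'a::complex_vector \<Rightarrow> 'e::cancel_comm_monoid_add \<Rightarrow> 'b::complex_vector"
  assumes "finite {i. f i \<noteq> 0}" "T 0 = (\<lambda>_. 0)" "cvec.subspace S"
    "\<And>i j. e = i + j \<Longrightarrow> T (f i) j \<in> S"
  shows "apply_series T f e \<in> S"
proof -
  have "apply_series T f e = (\<Sum>i\<in>{i. f i \<noteq> 0}. shift_series i (T (f i)) e)"
    by (rule apply_series_eq_sum) (use assms in auto)
  then show ?thesis
    using assms by (auto intro!: cvec.subspace_sum shift_series_in_subspace)
qed

text \<open>Conjugation by exp((2r+1) \<pi> i L(0)) multiplies an operator of integral weight n by
  this number. It is the sign (-1)^n for every r, as required for agreement with the power of
  -x^(-2) in the contragredient vertex operators.\<close>

lemma exp_odd_pi: "exp (of_int (2 * r + 1) * of_real pi * \<i> * of_int n) = (-1) powi n"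
proof -
  have "exp (of_int (2 * r + 1) * of_real pi * \<i> * of_int n) = exp (of_int n * (of_int (2 * r + 1) * (of_real pi * \<i>)))"
    by (simp add: mult_ac)
  also have "\<dots> = exp (of_int (2 * r + 1) * (of_real pi * \<i>)) powi n"
    by (rule exp_power_int[symmetric])
  also have "exp (of_int (2 * r + 1) * (of_real pi * \<i>)) = exp (of_real pi * \<i>) powi (2 * r + 1)"
    by (rule exp_power_int[symmetric])
  also have "exp (of_real pi * \<i>) = -1"
    using exp_pi_i by (simp add: mult.commute)
  also have "(-1 :: complex) powi (2 * r + 1) = -1"
    by (simp add: power_int_minus_left)
  finally show ?thesis .
qed

section \<open>The series for x^(-L(0)), exp(x L(1)) and their composite\<close>

context sg_module
begin

lemma x_neg_L0_add:
  assumes "u \<in> mspace W" "w \<in> mspace W"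
  shows "x_neg_L0 W (u + w) e = x_neg_L0 W u e + x_neg_L0 W w e"
proof -
  have hc: "homogeneous_component (weight_mod W) w h \<in> mspace W" if "w \<in> mspace W" for w h
    using homogeneous_component_in(1)[OF mod_weight_direct_sum that] mod_weight_subset
    by (auto simp: graded_families_def)
  show ?thesis
    using clinear_onD(2)[OF L0_part_linear[where n = "- fst e"] hc[OF assms(1)] hc[OF assms(2)]]
    by (cases e) (simp add: x_neg_L0_def homogeneous_component_add[OF mod_weight_direct_sum assms] scaleC_add_right)
qed

lemma x_neg_L0_hom:
  assumes w: "w \<in> weight_mod W n"
  shows "x_neg_L0 W w (p, m) = (if p = - n then ((-1) ^ m / fact m) *\<^sub>C ((\<lambda>u. L_mod W 0 u - n *\<^sub>C u) ^^ m) w else 0)"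
proof (cases "p = - n")
  case True
  then show ?thesis
    by (simp add: x_neg_L0_def homogeneous_component_single[OF mod_weight_direct_sum w])
next
  case False
  then have "- p \<noteq> n" by auto
  then show ?thesis
    using False clinear_on_zero[OF L0_part_linear[where n = "- p"] mod_subspace]
    by (simp add: x_neg_L0_def homogeneous_component_single[OF mod_weight_direct_sum w])
qed

text \<open>The three facts share one induction: evaluation is additive only for finite supports, so
  the step for the value needs the finiteness of the summands.\<close>

lemma x_neg_L0_props:
  assumes "w \<in> mspace W"
  shows "finite {e. x_neg_L0 W w e \<noteq> 0} \<and> evalx z (x_neg_L0 W w) = exp_L0 W (- z) w \<and> (\<forall>e. x_neg_L0 W w e \<in> mspace W)"
  using assms
proof (induction w rule: mspace_induct)
  case (hom \<beta> n w)
  then have w: "w \<in> weight_mod W n" by (simp add: bihom_def)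
  let ?D = "\<lambda>u. L_mod W 0 u - n *\<^sub>C u"
  obtain M where M: "\<And>m. m \<ge> M \<Longrightarrow> (?D ^^ m) w = 0" using L0_part_nilpotent[OF w] by blast
  have sup: "{e. x_neg_L0 W w e \<noteq> 0} \<subseteq> Pair (- n) ` {..<M}"
  proof
    fix e assume e: "e \<in> {e. x_neg_L0 W w e \<noteq> 0}"
    obtain p m where pm: "e = (p, m)" by (cases e)
    have "p = - n" "(?D ^^ m) w \<noteq> 0"
      using e unfolding pm by (auto simp: x_neg_L0_hom[OF w] split: if_splits)
    moreover from this have "m < M" using M[of m] by (cases "m < M") auto
    ultimately show "e \<in> Pair (- n) ` {..<M}" by (auto simp: pm)
  qed
  have "evalx z (x_neg_L0 W w) = (\<Sum>e\<in>Pair (- n) ` {..<M}. x_monomial z e *\<^sub>C x_neg_L0 W w e)"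
    by (rule evalx_superset[OF _ sup]) simp
  also have "\<dots> = (\<Sum>m<M. x_monomial z (- n, m) *\<^sub>C x_neg_L0 W w (- n, m))"
    by (subst sum.reindex) (auto simp: inj_on_def)
  also have "\<dots> = exp (- z * n) *\<^sub>C (\<Sum>m<M. ((- z) ^ m / fact m) *\<^sub>C (?D ^^ m) w)"
    unfolding cvec.scale_sum_right
  proof (rule sum.cong[OF refl])
    fix m
    have "(- z) ^ m = (- 1) ^ m * z ^ m" by (rule power_minus)
    then show "x_monomial z (- n, m) *\<^sub>C x_neg_L0 W w (- n, m) = exp (- z * n) *\<^sub>C ((- z) ^ m / fact m) *\<^sub>C (?D ^^ m) w"
      by (simp add: x_monomial_def x_neg_L0_hom[OF w] mult_ac)
  qed
  also have "\<dots> = exp_L0 W (- z) w"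
    by (rule exp_L0_hom[OF w, symmetric]) (rule M)
  finally have "evalx z (x_neg_L0 W w) = exp_L0 W (- z) w" .
  moreover have "x_neg_L0 W w e \<in> mspace W" for e
    by (cases e) (use clinear_onD(1)[OF L0_part_linear bihom_mspace[OF hom]] cvec.subspace_0[OF mod_subspace] in
        \<open>auto simp: x_neg_L0_hom[OF w] intro: cvec.subspace_scale[OF mod_subspace]\<close>)
  ultimately show ?case using finite_subset[OF sup] by simp
next
  case (add u w)
  have eq: "x_neg_L0 W (u + w) = (\<lambda>e. x_neg_L0 W u e + x_neg_L0 W w e)"
    using x_neg_L0_add[OF add(1,2)] by (rule ext)
  show ?case
    unfolding eq
    using add evalx_add[of "x_neg_L0 W u" "x_neg_L0 W w" z] finite_support_add[of "x_neg_L0 W u" "x_neg_L0 W w"]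
      clinear_onD(2)[OF exp_L0_linear add(1,2)] cvec.subspace_add[OF mod_subspace]
    by simp
qed

lemma x_neg_L0_zero: "x_neg_L0 W 0 = (\<lambda>_. 0)"
  using x_neg_L0_add[of 0 0] cvec.subspace_0[OF mod_subspace] by (auto simp: fun_eq_iff)

lemma exp_xL1_props:
  assumes w: "w \<in> mspace W"
  shows "finite {e. exp_xL1 W w e \<noteq> 0}" "evalx z (exp_xL1 W w) = exp_L1 W (exp z) w"
    "exp_xL1 W w (p, k) = 0 \<or> (\<exists>j. (p, k) = (of_nat j, 0) \<and> exp_xL1 W w (p, k) = (1 / fact j) *\<^sub>C (L_mod W 1 ^^ j) w)"
proof -
  have v: "exp_xL1 W w (of_nat j, 0) = (1 / fact j) *\<^sub>C (L_mod W 1 ^^ j) w" for j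
    unfolding exp_xL1_def by (subst prod.case, subst Sum_any.expand_superset[of "{j}"]) (auto split: if_splits)
  have o: "exp_xL1 W w (p, k) = 0" if "\<And>j. (p, k) \<noteq> (of_nat j, 0)" for p k
    unfolding exp_xL1_def by (subst prod.case, subst Sum_any.expand_superset[of "{}"]) (use that in auto)
  show "exp_xL1 W w (p, k) = 0 \<or> (\<exists>j. (p, k) = (of_nat j, 0) \<and> exp_xL1 W w (p, k) = (1 / fact j) *\<^sub>C (L_mod W 1 ^^ j) w)"
    using v o by (cases "\<exists>j. (p, k) = (of_nat j, 0)") auto
  obtain N where N: "\<And>j. j \<ge> N \<Longrightarrow> (L_mod W 1 ^^ j) w = 0" using L1_mod_nilpotent[OF w] by blast
  have sup: "{e. exp_xL1 W w e \<noteq> 0} \<subseteq> (\<lambda>j. (of_nat j, 0)) ` {..<N}"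
  proof
    fix e assume e: "e \<in> {e. exp_xL1 W w e \<noteq> 0}"
    have "\<exists>j. e = (of_nat j, 0)"
    proof (rule ccontr)
      assume "\<nexists>j. e = (of_nat j, 0)"
      then have "exp_xL1 W w e = 0" using o[of "fst e" "snd e"] by simp
      then show False using e by simp
    qed
    then obtain j where j: "e = (of_nat j, 0)" by blast
    then have "(L_mod W 1 ^^ j) w \<noteq> 0" using e v[of j] by auto
    then have "j < N" using N[of j] by (cases "j < N") auto
    then show "e \<in> (\<lambda>j. (of_nat j, 0)) ` {..<N}" using j by blast
  qed
  then show "finite {e. exp_xL1 W w e \<noteq> 0}" by (rule finite_subset) simp
  have "evalx z (exp_xL1 W w) = (\<Sum>e\<in>(\<lambda>j. (of_nat j, 0)) ` {..<N}. x_monomial z e *\<^sub>C exp_xL1 W w e)"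
    by (rule evalx_superset[OF _ sup]) simp
  also have "\<dots> = (\<Sum>j<N. x_monomial z (of_nat j, 0) *\<^sub>C exp_xL1 W w (of_nat j, 0))"
    by (subst sum.reindex) (auto simp: inj_on_def)
  also have "\<dots> = (\<Sum>j<N. (exp z ^ j / fact j) *\<^sub>C (L_mod W 1 ^^ j) w)"
    by (simp add: v x_monomial_def exp_of_nat_mult)
  also have "\<dots> = exp_L1 W (exp z) w"
    by (rule exp_L1_eq_sum[symmetric]) (rule N)
  finally show "evalx z (exp_xL1 W w) = exp_L1 W (exp z) w" .
qed

lemma exp_xL1_mspace:
  assumes "w \<in> mspace W"
  shows "exp_xL1 W w e \<in> mspace W"
  using exp_xL1_props(3)[OF assms, of "fst e" "snd e"] clinear_onD(1)[OF L1_pow_linear assms]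
    cvec.subspace_0[OF mod_subspace] cvec.subspace_scale[OF mod_subspace] by auto

lemma exp_xL1_zero: "exp_xL1 W 0 = (\<lambda>_. 0)"
proof
  fix e :: "complex \<times> nat"
  show "exp_xL1 W 0 e = 0"
    using exp_xL1_props(3)[OF cvec.subspace_0[OF mod_subspace], of "fst e" "snd e"]
      clinear_on_zero[OF L1_pow_linear mod_subspace] by auto
qed

context
  fixes r :: int
begin

abbreviation (input) inner_series :: "'w \<Rightarrow> 'w log_series"
  where "inner_series w \<equiv> (\<lambda>e. exp_L0 W (of_int (2 * r + 1) * of_real pi * \<i>)
    (apply_series (x_neg_L0 W) (x_neg_L0 W w) e))"

lemma x_neg_x_neg_props:
  assumes w: "w \<in> mspace W"
  shows "finite {e. apply_series (x_neg_L0 W) (x_neg_L0 W w) e \<noteq> 0}"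
    "apply_series (x_neg_L0 W) (x_neg_L0 W w) e \<in> mspace W"
    "evalx z (apply_series (x_neg_L0 W) (x_neg_L0 W w)) = exp_L0 W (- 2 * z) w"
proof -
  note p = x_neg_L0_props
  show "finite {e. apply_series (x_neg_L0 W) (x_neg_L0 W w) e \<noteq> 0}"
    by (rule finite_support_apply_series) (use p w x_neg_L0_zero in auto)
  show "apply_series (x_neg_L0 W) (x_neg_L0 W w) e \<in> mspace W"
    by (rule apply_series_in_subspace) (use p w x_neg_L0_zero mod_subspace in auto)
  have "evalx z (apply_series (x_neg_L0 W) (x_neg_L0 W w)) = exp_L0 W (- z) (evalx z (x_neg_L0 W w))"
    by (rule evalx_apply_series[OF exp_L0_linear mod_subspace]) (use p w x_neg_L0_zero in auto)
  also have "\<dots> = exp_L0 W (- 2 * z) w"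
    using p[OF w, of z] exp_L0_exp_L0[OF w, of "- z" "- z"] by (simp add: field_simps)
  finally show "evalx z (apply_series (x_neg_L0 W) (x_neg_L0 W w)) = exp_L0 W (- 2 * z) w" .
qed

lemma inner_series_props:
  assumes w: "w \<in> mspace W"
  shows "finite {e. inner_series w e \<noteq> 0}" "inner_series w e \<in> mspace W"
    "evalx z (inner_series w) = exp_L0 W (of_int (2 * r + 1) * of_real pi * \<i> - 2 * z) w"
proof -
  note p = x_neg_x_neg_props[OF w]
  show "finite {e. inner_series w e \<noteq> 0}"
    by (rule finite_subset[OF _ p(1)]) (use clinear_on_zero[OF exp_L0_linear mod_subspace] in auto)
  show "inner_series w e \<in> mspace W" by (rule clinear_onD(1)[OF exp_L0_linear p(2)])
  show "evalx z (inner_series w) = exp_L0 W (of_int (2 * r + 1) * of_real pi * \<i> - 2 * z) w"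
    using evalx_linear[OF exp_L0_linear mod_subspace p(1,2)] exp_L0_exp_L0[OF w] by (simp add: p(3))
qed

lemma twisted_argument_finite: "w \<in> mspace W \<Longrightarrow> finite {e. twisted_argument r W w e \<noteq> 0}"
  unfolding twisted_argument_def
  by (rule finite_support_apply_series[OF inner_series_props(1) exp_xL1_zero exp_xL1_props(1)[OF inner_series_props(2)]])

lemma twisted_argument_mspace: "w \<in> mspace W \<Longrightarrow> twisted_argument r W w e \<in> mspace W"
  unfolding twisted_argument_def
  by (rule apply_series_in_subspace[OF inner_series_props(1) exp_xL1_zero mod_subspace
        exp_xL1_mspace[OF inner_series_props(2)]])

lemma evalx_twisted_argument:
  assumes w: "w \<in> mspace W"
  shows "evalx z (twisted_argument r W w) = twist W r z w"
  unfolding twisted_argument_def twist_def inner_series_props(3)[OF w, symmetric]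
  by (rule evalx_apply_series[OF exp_L1_linear mod_subspace])
    (use exp_xL1_props exp_xL1_zero inner_series_props[OF w] in auto)

text \<open>The two factors x^(-L(0)) contribute exactly the exponent -2n, and each L(1) raises the
  exponent and lowers the weight by one. So p = -2n + l goes with weight n - l = -n - p.\<close>

lemma twisted_argument_bihom:
  assumes w: "w \<in> bihom W \<beta> n"
  shows "twisted_argument r W w (p, k) \<in> bihom W \<beta> (- n - p)"
proof -
  note sub = subspace_bihom
  have wm: "w \<in> mspace W" by (rule bihom_mspace[OF w])
  have x1: "x_neg_L0 W u (p, m) \<in> bihom W \<beta> n \<and> (p \<noteq> - n \<longrightarrow> x_neg_L0 W u (p, m) = 0)"
    if "u \<in> bihom W \<beta> n" for u p m
  proof -
    have "u \<in> weight_mod W n" using that by (simp add: bihom_def)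
    from x_neg_L0_hom[OF this] show ?thesis
      using bihom_scaleC[OF bihom_L0_part[OF that]] cvec.subspace_0[OF sub] by auto
  qed
  have x2: "apply_series (x_neg_L0 W) (x_neg_L0 W w) (p, m) \<in> bihom W \<beta> n" for p m
    by (rule apply_series_in_subspace) (use x_neg_L0_props[OF wm] x_neg_L0_zero sub x1 w in auto)
  \<comment> \<open>Vanishing off the exponent -2n is phrased as membership in a subspace depending
    on p, so that it passes through the composition of series.\<close>
  have x3: "apply_series (x_neg_L0 W) (x_neg_L0 W w) (p, m) \<in> (if p = - 2 * n then UNIV else {0})" for p m
  proof (rule apply_series_in_subspace)
    fix i j assume ij: "(p, m) = i + j"
    show "x_neg_L0 W (x_neg_L0 W w i) j \<in> (if p = - 2 * n then UNIV else {0})"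
    proof (cases "fst i = - n \<and> fst j = - n")
      case True
      then show ?thesis using ij by (auto simp: prod_eq_iff)
    next
      case False
      have "x_neg_L0 W (x_neg_L0 W w i) j = 0"
      proof (cases "fst i = - n")
        case True
        moreover have "x_neg_L0 W w i \<in> bihom W \<beta> n" using x1[OF w, of "fst i" "snd i"] by simp
        ultimately show ?thesis
          using False x1[where u = "x_neg_L0 W w i" and p = "fst j" and m = "snd j"] by simp
      next
        case False
        then have "x_neg_L0 W w i = 0" using x1[OF w, where p = "fst i" and m = "snd i"] by simp
        then show ?thesis by (simp add: x_neg_L0_zero)
      qed
      then show ?thesis by simp
    qed
  qed (use x_neg_L0_props[OF wm] x_neg_L0_zero cvec.subspace_UNIV cvec.subspace_single_0 in auto)
  have in1: "inner_series w i \<in> bihom W \<beta> n" "fst i \<noteq> - 2 * n \<Longrightarrow> inner_series w i = 0" for i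
    using exp_L0_bihom[OF x2[of "fst i" "snd i"]] x3[of "fst i" "snd i"]
      clinear_on_zero[OF exp_L0_linear mod_subspace] by auto
  show ?thesis
    unfolding twisted_argument_def
  proof (rule apply_series_in_subspace)
    fix i j assume ij: "(p, k) = i + j"
    show "exp_xL1 W (inner_series w i) j \<in> bihom W \<beta> (- n - p)"
    proof (cases "fst i = - 2 * n")
      case False
      then show ?thesis using in1(2)[of i] exp_xL1_zero cvec.subspace_0[OF sub] by simp
    next
      case True
      from exp_xL1_props(3)[OF bihom_mspace[OF in1(1)[of i]], of "fst j" "snd j"]
      show ?thesis
      proof
        assume "exp_xL1 W (inner_series w i) (fst j, snd j) = 0"
        then show ?thesis using cvec.subspace_0[OF sub] by simp
      next
        assume "\<exists>l. (fst j, snd j) = (of_nat l, 0) \<and>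
          exp_xL1 W (inner_series w i) (fst j, snd j) = (1 / fact l) *\<^sub>C (L_mod W 1 ^^ l) (inner_series w i)"
        then obtain l where l: "fst j = of_nat l"
          "exp_xL1 W (inner_series w i) j = (1 / fact l) *\<^sub>C (L_mod W 1 ^^ l) (inner_series w i)"
          by auto
        have deg: "n - of_nat l = - n - p"
          using ij True l(1) by (auto simp: prod_eq_iff)
        show ?thesis
          unfolding l(2) deg[symmetric] by (rule bihom_scaleC[OF L1_mod_pow_bihom[OF in1(1)[of i]]])
      qed
    qed
  qed (rule inner_series_props(1)[OF wm] exp_xL1_zero sub)+
qed

section \<open>Conjugation by T(z)\<close>

lemma twist_linear: "clinear_on (mspace W) (mspace W) (twist W r z)"
  using clinear_onD[OF exp_L1_linear] clinear_onD[OF exp_L0_linear]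
  by (auto simp: clinear_on_def twist_def)

lemma twist_mspace: "w \<in> mspace W \<Longrightarrow> twist W r z w \<in> mspace W"
  by (rule clinear_onD(1)[OF twist_linear])

text \<open>The odd integer for -r-1 is the negative of that for r, so the exponentials of L(0)
  cancel once the outer one has been moved past exp(x L(1)). This move rescales x to x exp(c) x^(-2)
  = -x^(-1), because exp(c) = -1, and the remaining exponentials of L(1) cancel too.\<close>

lemma twist_inverse:
  assumes w: "w \<in> mspace W"
  shows "twist W (- r - 1) (- z) (twist W r z w) = w"
proof -
  define c where "c = of_int (2 * r + 1) * of_real pi * \<i>"
  have c': "of_int (2 * (- r - 1) + 1) * of_real pi * \<i> = - c"
    by (simp add: c_def algebra_simps)
  have ec: "exp c = -1" using exp_odd_pi[of r 1] by (simp add: c_def)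
  define u where "u = exp_L0 W (c - 2 * z) w"
  have u: "u \<in> mspace W" unfolding u_def by (rule clinear_onD(1)[OF exp_L0_linear w])
  have "twist W (- r - 1) (- z) (twist W r z w) = exp_L1 W (exp (- z)) (exp_L0 W (- c + 2 * z) (exp_L1 W (exp z) u))"
    unfolding twist_def c' by (simp add: u_def c_def)
  also have "exp_L0 W (- c + 2 * z) (exp_L1 W (exp z) u)
    = exp_L1 W (exp z * exp (- (- c + 2 * z))) (exp_L0 W (- c + 2 * z) u)"
    by (rule exp_L0_exp_L1[OF u])
  also have "exp_L0 W (- c + 2 * z) u = w"
    unfolding u_def exp_L0_exp_L0[OF w] by (simp add: exp_L0_zero[OF w])
  also have "exp z * exp (- (- c + 2 * z)) = - exp (- z)"
  proof -
    have "exp z * exp (- (- c + 2 * z)) = exp c * exp (- z)"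
      by (simp add: exp_add[symmetric])
    then show ?thesis by (simp add: ec)
  qed
  also have "exp_L1 W (exp (- z)) (exp_L1 W (- exp (- z)) w) = w"
    using exp_L1_exp_L1[OF w, of "exp (- z)" "- exp (- z)"] by (simp add: exp_L1_zero)
  finally show ?thesis .
qed

text \<open>First exp((2r+1) \<pi> i L(0)) x^(-2 L(0)) scales L(1) and L(-1) by -x^2 and -x^(-2),
  then exp(x L(1)) is moved through by \<open>exp_L1_L_mod\<close>.\<close>

lemma twist_L_mod:
  assumes w: "w \<in> mspace W"
  shows "twist W r z (L_mod W 1 w) = - exp (2 * z) *\<^sub>C L_mod W 1 (twist W r z w)"
    "twist W r z (L_mod W 0 w) = L_mod W 0 (twist W r z w) + exp z *\<^sub>C L_mod W 1 (twist W r z w)"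
    "twist W r z (L_mod W (-1) w) = - (exp (- 2 * z) *\<^sub>C L_mod W (-1) (twist W r z w)
      + (2 * exp (- z)) *\<^sub>C L_mod W 0 (twist W r z w) + L_mod W 1 (twist W r z w))"
proof -
  define c where "c = of_int (2 * r + 1) * of_real pi * \<i>"
  have ec: "exp c = -1" using exp_odd_pi[of r 1] by (simp add: c_def)
  have ec': "exp (- c) = -1" by (simp add: exp_minus ec)
  define u where "u = exp_L0 W (c - 2 * z) w"
  have u: "u \<in> mspace W" unfolding u_def by (rule clinear_onD(1)[OF exp_L0_linear w])
  have t: "twist W r z w = exp_L1 W (exp z) u" by (simp add: twist_def u_def c_def)
  have t': "twist W r z (L_mod W j w) = exp_L1 W (exp z) (exp_L0 W (c - 2 * z) (L_mod W j w))" for j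
    by (simp add: twist_def c_def)
  have Lu: "L_mod W 1 u \<in> mspace W" "L_mod W (-1) u \<in> mspace W"
    using clinear_onD(1)[OF mod_L_linear u] by auto
  have "exp (- (c - 2 * z)) = exp (- c) * exp (2 * z)" by (simp add: exp_add[symmetric])
  then have e1: "exp (- (c - 2 * z)) = - exp (2 * z)" by (simp add: ec')
  have "exp (c - 2 * z) = exp c * exp (- 2 * z)" by (simp add: exp_add[symmetric])
  then have e2: "exp (c - 2 * z) = - exp (- 2 * z)" by (simp add: ec)
  show "twist W r z (L_mod W 1 w) = - exp (2 * z) *\<^sub>C L_mod W 1 (twist W r z w)"
    unfolding t t' exp_L0_L_mod(1)[OF w] u_def[symmetric] clinear_onD(3)[OF exp_L1_linear Lu(1)]
      exp_L1_L_mod(1)[OF u] e1 by simp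
  show "twist W r z (L_mod W 0 w) = L_mod W 0 (twist W r z w) + exp z *\<^sub>C L_mod W 1 (twist W r z w)"
    unfolding t t' exp_L0_L_mod(2)[OF w] u_def[symmetric] exp_L1_L_mod(2)[OF u] ..
  have "exp (- 2 * z) * (2 * exp z) = 2 * exp (- z)" "exp (- 2 * z) * (exp z)\<^sup>2 = 1"
    by (simp_all add: power2_eq_square exp_add[symmetric])
  then show "twist W r z (L_mod W (-1) w) = - (exp (- 2 * z) *\<^sub>C L_mod W (-1) (twist W r z w)
      + (2 * exp (- z)) *\<^sub>C L_mod W 0 (twist W r z w) + L_mod W 1 (twist W r z w))"
    unfolding t t' exp_L0_L_mod(3)[OF w] u_def[symmetric] clinear_onD(3)[OF exp_L1_linear Lu(2)]
      exp_L1_L_mod(3)[OF u] e2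
    by (simp add: scaleC_add_right)
qed

text \<open>Formally x d/dx T = -(2 L(0) + x L(1)) T: the factor exp(x L(1)) contributes x L(1) T,
  and the factor x^(-2 L(0)) contributes -2 exp(x L(1)) L(0) ..., which is -2 (L(0) + x L(1)) T
  after moving L(0) to the left.\<close>

lemma twist_has_derivative:
  assumes \<psi>: "clinear_on (mspace W) UNIV \<psi>" and w: "w \<in> mspace W"
  shows "((\<lambda>z. \<psi> (twist W r z w)) has_field_derivative
    - \<psi> (2 *\<^sub>C L_mod W 0 (twist W r z w) + exp z *\<^sub>C L_mod W 1 (twist W r z w))) (at z)"
proof -
  define c where "c = of_int (2 * r + 1) * of_real pi * \<i>"
  have t: "twist W r z w = exp_L1 W (exp z) (exp_L0 W (c - 2 * z) w)" for z w
    by (simp add: twist_def c_def)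
  have sc: "s *\<^sub>C u \<in> mspace W" if "u \<in> mspace W" for s u
    by (rule cvec.subspace_scale[OF mod_subspace that])
  have L: "L_mod W 0 u \<in> mspace W" "L_mod W 1 u \<in> mspace W" if "u \<in> mspace W" for u
    using clinear_onD(1)[OF mod_L_linear that] by auto
  from w show ?thesis
  proof (induction w rule: mspace_induct)
    case (hom \<beta> n w)
    let ?D = "\<lambda>u. L_mod W 0 u - n *\<^sub>C u"
    have ww: "w \<in> weight_mod W n" and wm: "w \<in> mspace W"
      using hom bihom_mspace by (auto simp: bihom_def)
    have Dm: "(?D ^^ m) w \<in> mspace W" for m by (rule clinear_onD(1)[OF L0_part_linear wm])
    obtain M where M: "\<And>m. m \<ge> M \<Longrightarrow> (?D ^^ m) w = 0" using L0_part_nilpotent[OF ww] by blast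
    define \<phi> where "\<phi> m s = exp ((c - 2 * s) * n) * ((c - 2 * s) ^ m / fact m)" for m and s :: complex
    have E: "exp_L0 W (c - 2 * s) w = (\<Sum>m<M. \<phi> m s *\<^sub>C (?D ^^ m) w)" for s
    proof -
      have "exp_L0 W (c - 2 * s) w = exp ((c - 2 * s) * n) *\<^sub>C (\<Sum>m<M. ((c - 2 * s) ^ m / fact m) *\<^sub>C (?D ^^ m) w)"
        by (rule exp_L0_hom[OF ww]) (rule M)
      then show ?thesis by (simp add: cvec.scale_sum_right \<phi>_def)
    qed
    have \<psi>E: "\<psi>' (exp_L0 W (c - 2 * s) w) = (\<Sum>m<M. \<phi> m s * \<psi>' ((?D ^^ m) w))"
      if "clinear_on (mspace W) UNIV \<psi>'" for \<psi>' and s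
      unfolding E
      by (subst clinear_on_sum[OF that mod_subspace sc[OF Dm]])
        (simp add: clinear_onD(3)[OF that Dm])
    have lin: "clinear_on (mspace W) UNIV (\<lambda>u. \<psi> (exp_L1 W s u))" for s
      using clinear_onD[OF exp_L1_linear] clinear_onD[OF \<psi>] by (auto simp: clinear_on_def)
    have lin1: "clinear_on (mspace W) UNIV (\<lambda>u. \<psi> (L_mod W 1 (exp_L1 W s u)))" for s
      using clinear_onD[OF exp_L1_linear] clinear_onD[OF \<psi>] clinear_onD[OF mod_L_linear[of 1]]
      by (auto simp: clinear_on_def)
    have F: "\<psi> (twist W r s w) = (\<Sum>m<M. \<phi> m s * \<psi> (exp_L1 W (exp s) ((?D ^^ m) w)))" for s
      unfolding t by (rule \<psi>E[OF lin])
    define \<phi>' where "\<phi>' m = (- 2 * n) * \<phi> m z + (if m = 0 then 0 else - 2 * \<phi> (m - 1) z)" for m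
    have d\<phi>: "(\<phi> m has_field_derivative \<phi>' m) (at z)" for m
    proof (cases m)
      case 0
      then show ?thesis unfolding \<phi>_def[abs_def] \<phi>'_def
        by (auto intro!: derivative_eq_intros)
    next
      case (Suc k)
      have "(\<phi> m has_field_derivative (- 2 * n) * \<phi> m z
          + exp ((c - 2 * z) * n) * (of_nat m * (c - 2 * z) ^ (m - 1) * (- 2) / fact m)) (at z)"
      proof -
        have 1: "((\<lambda>s. exp ((c - 2 * s) * n)) has_field_derivative (- 2 * n) * exp ((c - 2 * z) * n)) (at z)"
          by (auto intro!: derivative_eq_intros)
        have 2: "((\<lambda>s. (c - 2 * s) ^ m / fact m) has_field_derivative
            of_nat m * (c - 2 * z) ^ (m - 1) * (- 2) / fact m) (at z)"
          by (rule DERIV_cdivide) (auto intro!: derivative_eq_intros)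
        show ?thesis
          unfolding \<phi>_def[abs_def] using DERIV_mult[OF 1 2] by (simp add: mult_ac)
      qed
      moreover have eq: "of_nat m * (c - 2 * z) ^ (m - 1) * (- 2) / fact m = - 2 * ((c - 2 * z) ^ (m - 1) / fact (m - 1))"
        by (simp add: Suc field_simps del: of_nat_Suc)
      moreover have "\<phi>' m = (- 2 * n) * \<phi> m z
          + exp ((c - 2 * z) * n) * (of_nat m * (c - 2 * z) ^ (m - 1) * (- 2) / fact m)"
        unfolding eq \<phi>'_def by (simp add: Suc \<phi>_def mult_ac)
      ultimately show ?thesis by (simp only:)
    qed
    have dg: "((\<lambda>s. \<psi> (exp_L1 W (exp s) u)) has_field_derivative \<psi> (L_mod W 1 (exp_L1 W (exp z) u)) * exp z) (at z)"
      if "u \<in> mspace W" for u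
      by (rule DERIV_chain2[OF exp_L1_has_derivative[OF \<psi> that] DERIV_exp])
    have "((\<lambda>s. \<psi> (twist W r s w)) has_field_derivative
      (\<Sum>m<M. \<phi>' m * \<psi> (exp_L1 W (exp z) ((?D ^^ m) w))
        + (\<psi> (L_mod W 1 (exp_L1 W (exp z) ((?D ^^ m) w))) * exp z) * \<phi> m z)) (at z)"
      unfolding F by (rule DERIV_sum) (rule DERIV_mult[OF d\<phi> dg[OF Dm]])
    also have "(\<Sum>m<M. \<phi>' m * \<psi> (exp_L1 W (exp z) ((?D ^^ m) w))
        + (\<psi> (L_mod W 1 (exp_L1 W (exp z) ((?D ^^ m) w))) * exp z) * \<phi> m z)
      = (\<Sum>m<M. \<phi>' m * \<psi> (exp_L1 W (exp z) ((?D ^^ m) w)))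
        + exp z * \<psi> (L_mod W 1 (twist W r z w))"
      unfolding t \<psi>E[OF lin1] by (simp add: sum.distrib sum_distrib_left mult_ac)
    \<comment> \<open>The part of \<open>\<phi>'\<close> with index m - 1 is shifted by one and
      meets the other part as g (m+1) + n g m, which is the value at L(0) D^m w because L(0) = D +
      n. The boundary term vanishes as D^M w = 0.\<close>
    also have "(\<Sum>m<M. \<phi>' m * \<psi> (exp_L1 W (exp z) ((?D ^^ m) w)))
      = - 2 * \<psi> (L_mod W 0 (twist W r z w)) - 2 * exp z * \<psi> (L_mod W 1 (twist W r z w))"
    proof -
      define g where "g m = \<psi> (exp_L1 W (exp z) ((?D ^^ m) w))" for m
      have gM: "g M = 0"
        using M clinear_on_zero[OF lin mod_subspace] by (simp add: g_def)
      have "(\<Sum>m<M. if m = 0 then 0 else - 2 * \<phi> (m - 1) z * g m) = (\<Sum>m<M. - 2 * \<phi> m z * g (Suc m))"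
      proof -
        define F where "F m = (if m = 0 then 0 else - 2 * \<phi> (m - 1) z * g m)" for m
        have "(\<Sum>m<Suc M. F m) = F 0 + (\<Sum>m<M. F (Suc m))" by (rule sum.lessThan_Suc_shift)
        moreover have "F 0 = 0" "F M = 0" by (simp_all add: F_def gM)
        ultimately show ?thesis by (simp add: F_def)
      qed
      moreover have "(\<Sum>m<M. \<phi>' m * g m) = (\<Sum>m<M. (- 2 * n) * \<phi> m z * g m)
          + (\<Sum>m<M. if m = 0 then 0 else - 2 * \<phi> (m - 1) z * g m)"
        unfolding sum.distrib[symmetric] by (rule sum.cong) (auto simp: \<phi>'_def algebra_simps)
      ultimately have "(\<Sum>m<M. \<phi>' m * g m) = - 2 * (\<Sum>m<M. \<phi> m z * (g (Suc m) + n * g m))"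
        by (simp add: sum_distrib_left sum.distrib algebra_simps)
      also have "(\<Sum>m<M. \<phi> m z * (g (Suc m) + n * g m))
        = (\<Sum>m<M. \<phi> m z * \<psi> (exp_L1 W (exp z) (L_mod W 0 ((?D ^^ m) w))))"
      proof (rule sum.cong[OF refl])
        fix m
        have "L_mod W 0 ((?D ^^ m) w) = (?D ^^ Suc m) w + n *\<^sub>C (?D ^^ m) w" by simp
        then have "\<psi> (exp_L1 W (exp z) (L_mod W 0 ((?D ^^ m) w))) = g (Suc m) + n * g m"
          unfolding g_def
          using clinear_onD(2)[OF lin Dm sc[OF Dm], of "exp z" "Suc m" n m] clinear_onD(3)[OF lin Dm]
          by (simp del: funpow.simps)
        then show "\<phi> m z * (g (Suc m) + n * g m) = \<phi> m z * \<psi> (exp_L1 W (exp z) (L_mod W 0 ((?D ^^ m) w)))"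
          by simp
      qed
      also have "\<dots> = \<psi> (exp_L1 W (exp z) (L_mod W 0 (exp_L0 W (c - 2 * z) w)))"
      proof -
        have "clinear_on (mspace W) UNIV (\<lambda>u. \<psi> (exp_L1 W (exp z) (L_mod W 0 u)))"
          using clinear_onD[OF lin] clinear_onD[OF mod_L_linear[of 0]] by (auto simp: clinear_on_def)
        from \<psi>E[OF this] show ?thesis by simp
      qed
      also have "\<dots> = \<psi> (L_mod W 0 (twist W r z w)) + exp z * \<psi> (L_mod W 1 (twist W r z w))"
      proof -
        have e: "exp_L0 W (c - 2 * z) w \<in> mspace W" by (rule clinear_onD(1)[OF exp_L0_linear wm])
        have tm: "twist W r z w \<in> mspace W" by (rule twist_mspace[OF wm])
        show ?thesis
          unfolding exp_L1_L_mod(2)[OF e] t[symmetric]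
          using clinear_onD(2)[OF \<psi> L(1)[OF tm] sc[OF L(2)[OF tm]]] clinear_onD(3)[OF \<psi> L(2)[OF tm]] by simp
      qed
      finally show ?thesis by (simp add: g_def algebra_simps)
    qed
    also have "- 2 * \<psi> (L_mod W 0 (twist W r z w)) - 2 * exp z * \<psi> (L_mod W 1 (twist W r z w))
        + exp z * \<psi> (L_mod W 1 (twist W r z w))
      = - \<psi> (2 *\<^sub>C L_mod W 0 (twist W r z w) + exp z *\<^sub>C L_mod W 1 (twist W r z w))"
    proof -
      have tm: "twist W r z w \<in> mspace W" by (rule twist_mspace[OF wm])
      show ?thesis
        using clinear_onD(2)[OF \<psi> sc[OF L(1)[OF tm]] sc[OF L(2)[OF tm]]] clinear_onD(3)[OF \<psi> L(1)[OF tm]]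
          clinear_onD(3)[OF \<psi> L(2)[OF tm]] by simp
    qed
    finally show ?case .
  next
    case (add u w)
    have lin2: "clinear_on (mspace W) UNIV (\<lambda>w. \<psi> (2 *\<^sub>C L_mod W 0 w + exp z *\<^sub>C L_mod W 1 w))"
      using clinear_onD[OF mod_L_linear[of 0]] clinear_onD[OF mod_L_linear[of 1]] clinear_onD[OF \<psi>] sc
        cvec.subspace_add[OF mod_subspace]
      by (auto simp: clinear_on_def scaleC_add_right algebra_simps)
    have T: "twist W r z (u + w) = twist W r z u + twist W r z w" for z
      by (rule clinear_onD(2)[OF twist_linear add(1,2)])
    have "\<psi> (twist W r z (u + w)) = \<psi> (twist W r z u) + \<psi> (twist W r z w)" for z
      unfolding T by (rule clinear_onD(2)[OF \<psi> twist_mspace[OF add(1)] twist_mspace[OF add(2)]])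
    moreover have "\<psi> (2 *\<^sub>C L_mod W 0 (twist W r z (u + w)) + exp z *\<^sub>C L_mod W 1 (twist W r z (u + w)))
      = \<psi> (2 *\<^sub>C L_mod W 0 (twist W r z u) + exp z *\<^sub>C L_mod W 1 (twist W r z u))
        + \<psi> (2 *\<^sub>C L_mod W 0 (twist W r z w) + exp z *\<^sub>C L_mod W 1 (twist W r z w))"
      unfolding T by (rule clinear_onD(2)[OF lin2 twist_mspace[OF add(1)] twist_mspace[OF add(2)]])
    ultimately show ?case using DERIV_add[OF add(3,4)] by simp
  qed
qed

text \<open>A mode of \<open>v\<close> at exponent e has L(0)-weight h + e, so the exponential of
  L(0) yields the scalar in front; the rest is \<open>exp_L1_module_op\<close>. The bound
  \<open>N0\<close> is obtained for a fixed z, since that lemma is applied to a vector depending on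
  z.\<close>

lemma twist_module_op:
  assumes v: "v \<in> weight_alg V h" and w: "w \<in> mspace W"
  shows "\<exists>N0. \<forall>N\<ge>N0. twist W r z (module_op W v w e)
    = ((-1) powi (h + e) * exp (- 2 * of_int (h + e) * z)) *\<^sub>C (\<Sum>k<N. exp z ^ k *\<^sub>C (\<Sum>i\<le>k.
    ((of_int (2 * h + e - 1 - int i) gchoose (k - i)) / fact i) *\<^sub>C
      module_op W ((L_alg V 1 ^^ i) v) (twist W r z w) (e - int (k - i))))"
proof -
  define c where "c = of_int (2 * r + 1) * of_real pi * \<i>"
  have t: "twist W r z w = exp_L1 W (exp z) (exp_L0 W (c - 2 * z) w)" for z w
    by (simp add: twist_def c_def)
  have u: "exp_L0 W (c - 2 * z) w \<in> mspace W" by (rule clinear_onD(1)[OF exp_L0_linear w])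
  have "exp ((c - 2 * z) * of_int (h + e)) = exp (c * of_int (h + e)) * exp (- 2 * of_int (h + e) * z)"
    by (simp add: exp_add[symmetric] algebra_simps)
  also have "exp (c * of_int (h + e)) = (-1) powi (h + e)"
    unfolding c_def by (rule exp_odd_pi)
  finally have s: "exp ((c - 2 * z) * of_int (h + e)) = (-1) powi (h + e) * exp (- 2 * of_int (h + e) * z)" .
  have "exp_L0 W (c - 2 * z) (module_op W v w e)
    = exp ((c - 2 * z) * of_int (h + e)) *\<^sub>C module_op W v (exp_L0 W (c - 2 * z) w) e"
    by (rule exp_L0_conjugate[OF mod_op_linear op_L_comm(1)[OF v] w])
  then have T: "twist W r z (module_op W v w e)
    = ((-1) powi (h + e) * exp (- 2 * of_int (h + e) * z)) *\<^sub>C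
      exp_L1 W (exp z) (module_op W v (exp_L0 W (c - 2 * z) w) e)"
    unfolding t s using clinear_onD(3)[OF exp_L1_linear clinear_onD(1)[OF mod_op_linear u]] by simp
  show ?thesis
    unfolding T using exp_L1_module_op[OF v u, of e] unfolding t by auto
qed

end

end

subsection \<open>Contragredient operators for a pair of dual pairs\<close>

text \<open>From an operator on W1 and \<open>X\<close> with values in \<open>Yd\<close> an operator
  on W1 and \<open>Y\<close> with values in \<open>Xd\<close> is built. Exchanging the two pairs and
  replacing r by -r-1 gives an instance of the same locale, so one construction provides both the
  map and its inverse.\<close>

locale adjoint_intertwiner = intertwiner A V W1 X Y Yd B I + Xp: pairing A V X Xd C
  for A :: "'g::ab_group_add set" and V :: "('v::complex_vector, 'g) vertex_structure"
    and W1 :: "('v, 'a::complex_vector, 'g) module_structure"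
    and X :: "('v, 'x::complex_vector, 'g) module_structure"
    and Xd :: "('v, 'u::complex_vector, 'g) module_structure"
    and Y :: "('v, 'y::complex_vector, 'g) module_structure"
    and Yd :: "('v, 'z::complex_vector, 'g) module_structure"
    and B :: "'y \<Rightarrow> 'z \<Rightarrow> complex" and C :: "'x \<Rightarrow> 'u \<Rightarrow> complex"
    and I :: "'a \<Rightarrow> 'x \<Rightarrow> 'z log_series" +
  fixes r :: int
begin

abbreviation (input) tw :: "'a \<Rightarrow> 'a log_series" where "tw \<equiv> twisted_argument r W1"

abbreviation (input) T :: "complex \<Rightarrow> 'a \<Rightarrow> 'a" where "T \<equiv> twist W1 r"

definition adj :: "'a \<Rightarrow> 'x \<Rightarrow> 'z log_series"
  where "adj w x = apply_series (\<lambda>u. invert_x_log (I u x)) (tw w)"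

text \<open>The arguments follow the type of the operator to be built: \<open>y\<close> is now its
  second argument, and \<open>x\<close> is the vector against which its value is tested.\<close>

definition adj_coef :: "'a \<Rightarrow> 'y \<Rightarrow> 'x \<Rightarrow> complex log_series"
  where "adj_coef w y x = (\<lambda>e. B y (adj w x e))"

lemma invert_I_zero: "x \<in> mspace X \<Longrightarrow> invert_x_log (I 0 x) = (\<lambda>_. 0)"
  using clinear_on_zero[OF I_linear_left W1.subspace_mspace] by (auto simp: invert_x_log_def fun_eq_iff)

lemma adj_eq_sum:
  assumes "w \<in> mspace W1" "x \<in> mspace X"
  shows "adj w x e = (\<Sum>i\<in>{i. tw w i \<noteq> 0}. shift_series i (invert_x_log (I (tw w i) x)) e)"
  unfolding adj_def
  by (rule apply_series_eq_sum) (use W1.twisted_argument_finite[OF assms(1)] invert_I_zero[OF assms(2)] in auto)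

context
  fixes w x
  assumes w: "w \<in> mspace W1" and x: "x \<in> mspace X"
begin

lemma invert_I_mspace: "invert_x_log (I (tw w i) x) e \<in> mspace Yd"
  by (cases e) (simp add: invert_x_log_def
      cvec.subspace_scale[OF Yd.subspace_mspace I_mspace[OF W1.twisted_argument_mspace[OF w] x]])

lemma adj_mspace: "adj w x e \<in> mspace Yd"
  unfolding adj_eq_sum[OF w x]
  by (intro cvec.subspace_sum[OF Yd.subspace_mspace] shift_series_in_subspace[OF Yd.subspace_mspace] invert_I_mspace)

lemma adj_coef_eq_sum:
  assumes y: "y \<in> mspace Y"
  shows "adj_coef w y x = (\<lambda>e. \<Sum>i\<in>{i. tw w i \<noteq> 0}. shift_series i (invert_x_log (coef (tw w i) x y)) e)"
proof
  fix e
  note lin = B_linear[OF y]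
  have inv: "B y (invert_x_log (I (tw w i) x) e) = invert_x_log (coef (tw w i) x y) e" for i e
    using clinear_onD(3)[OF lin I_mspace[OF W1.twisted_argument_mspace[OF w] x]]
    by (auto simp: invert_x_log_def coef_def split: prod.splits)
  have "adj_coef w y x e = (\<Sum>i\<in>{i. tw w i \<noteq> 0}. B y (shift_series i (invert_x_log (I (tw w i) x)) e))"
    unfolding adj_coef_def adj_eq_sum[OF w x]
    by (intro clinear_on_sum[OF lin Yd.subspace_mspace] shift_series_in_subspace[OF Yd.subspace_mspace] invert_I_mspace)
  also have "\<dots> = (\<Sum>i\<in>{i. tw w i \<noteq> 0}. shift_series i (invert_x_log (coef (tw w i) x y)) e)"
  proof (rule sum.cong[OF refl])
    fix i
    show "B y (shift_series i (invert_x_log (I (tw w i) x)) e) = shift_series i (invert_x_log (coef (tw w i) x y)) e"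
      unfolding shift_series_map[where h = "B y", OF clinear_on_zero[OF lin Yd.subspace_mspace]] inv ..
  qed
  finally show "adj_coef w y x e = (\<Sum>i\<in>{i. tw w i \<noteq> 0}. shift_series i (invert_x_log (coef (tw w i) x y)) e)" .
qed

lemma adj_coef_finite:
  assumes y: "y \<in> mspace Y"
  shows "finite {e. adj_coef w y x e \<noteq> 0}"
  unfolding adj_coef_eq_sum[OF y]
  by (intro finite_support_sum finite_support_shift_series finite_support_invert_x_log
      coef_finite W1.twisted_argument_mspace w x y)

lemma evalx_adj_coef:
  assumes y: "y \<in> mspace Y"
  shows "evalx z (adj_coef w y x) = ev (- z) (T z w) x y"
proof -
  let ?J = "{i. tw w i \<noteq> 0}"
  note tm = W1.twisted_argument_mspace[OF w]
  note fin = coef_finite[OF tm x y]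
  have "evalx z (adj_coef w y x) = (\<Sum>i\<in>?J. evalx z (shift_series i (invert_x_log (coef (tw w i) x y))))"
    unfolding adj_coef_eq_sum[OF y]
    by (rule evalx_sum) (intro finite_support_shift_series finite_support_invert_x_log fin)
  also have "\<dots> = (\<Sum>i\<in>?J. x_monomial z i * ev (- z) (tw w i) x y)"
    by (simp add: evalx_shift_series[OF finite_support_invert_x_log[OF fin]] evalx_invert_x_log[OF fin] ev_def)
  also have "\<dots> = ev (- z) (evalx z (tw w)) x y"
  proof -
    note lin = ev_linear(1)[OF x y, of "- z"]
    have "evalx z (tw w) = (\<Sum>i\<in>?J. x_monomial z i *\<^sub>C tw w i)"
      by (rule evalx_superset[OF W1.twisted_argument_finite[OF w] subset_refl])
    then have "ev (- z) (evalx z (tw w)) x y = (\<Sum>i\<in>?J. ev (- z) (x_monomial z i *\<^sub>C tw w i) x y)"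
      using clinear_on_sum[OF lin W1.subspace_mspace, of ?J "\<lambda>i. x_monomial z i *\<^sub>C tw w i"]
        cvec.subspace_scale[OF W1.subspace_mspace tm] by simp
    then show ?thesis using clinear_onD(3)[OF lin tm] by simp
  qed
  finally show ?thesis by (simp add: W1.evalx_twisted_argument[OF w])
qed

end

lemma ev_twist_linear:
  shows "x \<in> mspace X \<Longrightarrow> y \<in> mspace Y \<Longrightarrow> clinear_on (mspace W1) UNIV (\<lambda>w. ev (- z) (T z w) x y)"
  using clinear_onD[OF W1.twist_linear[of r z]] clinear_onD[OF ev_linear(1)] by (auto simp: clinear_on_def)

text \<open>Linear independence of the exponential monomials carries linearity from all evaluations
  to each coefficient. It is needed because the linearity of T(z) is known for the operator at each
  z.\<close>

lemma clinear_on_from_evalx: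
  fixes f :: "'s::complex_vector \<Rightarrow> complex log_series"
  assumes "cvec.subspace S" and fin: "\<And>u. u \<in> S \<Longrightarrow> finite {e. f u e \<noteq> 0}"
    and lin: "\<And>z. clinear_on S UNIV (\<lambda>u. evalx z (f u))"
  shows "clinear_on S UNIV (\<lambda>u. f u e)"
  unfolding clinear_on_def
proof (intro conjI ballI allI)
  fix u v assume u: "u \<in> S" and v: "v \<in> S"
  have "f (u + v) = (\<lambda>e. f u e + f v e)"
  proof (rule evalx_eqD)
    show "finite {e. f (u + v) e \<noteq> 0}" by (rule fin[OF cvec.subspace_add[OF assms(1) u v]])
    show "finite {e. f u e + f v e \<noteq> 0}" by (rule finite_support_add[OF fin[OF u] fin[OF v]])
    show "evalx z (f (u + v)) = evalx z (\<lambda>e. f u e + f v e)" for z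
      using clinear_onD(2)[OF lin u v] evalx_add[OF fin[OF u] fin[OF v]] by simp
  qed
  then show "f (u + v) e = f u e + f v e" by simp
next
  fix c u assume u: "u \<in> S"
  have "f (c *\<^sub>C u) = (\<lambda>e. c *\<^sub>C f u e)"
  proof (rule evalx_eqD)
    show "finite {e. f (c *\<^sub>C u) e \<noteq> 0}" by (rule fin[OF cvec.subspace_scale[OF assms(1) u]])
    show "finite {e. c *\<^sub>C f u e \<noteq> 0}" by (rule finite_support_scaleC[OF fin[OF u]])
    show "evalx z (f (c *\<^sub>C u)) = evalx z (\<lambda>e. c *\<^sub>C f u e)" for z
      using clinear_onD(3)[OF lin u] evalx_scaleC[OF fin[OF u]] by simp
  qed
  then show "f (c *\<^sub>C u) e = c *\<^sub>C f u e" by simp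
qed simp

lemma adj_coef_linear:
  shows "x \<in> mspace X \<Longrightarrow> y \<in> mspace Y \<Longrightarrow> clinear_on (mspace W1) UNIV (\<lambda>w. adj_coef w y x e)"
    and "w \<in> mspace W1 \<Longrightarrow> y \<in> mspace Y \<Longrightarrow> clinear_on (mspace X) UNIV (\<lambda>x. adj_coef w y x e)"
    and "w \<in> mspace W1 \<Longrightarrow> x \<in> mspace X \<Longrightarrow> clinear_on (mspace Y) UNIV (\<lambda>y. adj_coef w y x e)"
proof -
  show "clinear_on (mspace W1) UNIV (\<lambda>w. adj_coef w y x e)" if "x \<in> mspace X" "y \<in> mspace Y"
  proof (rule clinear_on_from_evalx[OF W1.subspace_mspace])
    show "clinear_on (mspace W1) UNIV (\<lambda>w. evalx z (adj_coef w y x))" for z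
      using ev_twist_linear[OF that, of z] cvec.subspace_add[OF W1.subspace_mspace]
        cvec.subspace_scale[OF W1.subspace_mspace] evalx_adj_coef[OF _ that]
      by (auto simp: clinear_on_def)
  qed (use adj_coef_finite that in auto)
  show "clinear_on (mspace X) UNIV (\<lambda>x. adj_coef w y x e)" if w: "w \<in> mspace W1" and y: "y \<in> mspace Y"
  proof (rule clinear_on_from_evalx[OF X.subspace_mspace])
    show "clinear_on (mspace X) UNIV (\<lambda>x. evalx z (adj_coef w y x))" for z
      using ev_linear(2)[OF W1.twist_mspace[OF w] y] cvec.subspace_add[OF X.subspace_mspace]
        cvec.subspace_scale[OF X.subspace_mspace] evalx_adj_coef[OF w _ y]
      by (auto simp: clinear_on_def)
  qed (use adj_coef_finite w y in auto)
  show "clinear_on (mspace Y) UNIV (\<lambda>y. adj_coef w y x e)" if w: "w \<in> mspace W1" and x: "x \<in> mspace X"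
    using clinear_onD(2,3)[OF B_linear_left[OF adj_mspace[OF w x]]]
    by (auto simp: clinear_on_def adj_coef_def)
qed

text \<open>The term of exponent i in \<open>tw w\<close> has weight -n1 - i, and inversion of x
  negates the exponent j of the coefficient of \<open>I\<close>. Adding up with p = i + j leaves a
  single weight and a single grade for \<open>x\<close>.\<close>

lemma adj_coef_zero:
  assumes w: "w \<in> bihom W1 \<beta>1 n1" and x: "x \<in> bihom X \<beta>2 n2" and y: "y \<in> bihom Y \<beta>3 n3"
    and nz: "adj_coef w y x (p, k) \<noteq> 0"
  shows "\<beta>2 = - (\<beta>1 + \<beta>3) \<and> n2 = p + n1 + n3"
proof -
  have ms: "w \<in> mspace W1" "x \<in> mspace X" "y \<in> mspace Y"
    using w x y W1.bihom_subset_mspace X.bihom_subset_mspace Y.bihom_subset_mspace by blast+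
  obtain i where i: "shift_series i (invert_x_log (coef (tw w i) x y)) (p, k) \<noteq> 0"
    using nz unfolding adj_coef_eq_sum[OF ms] by (meson sum.neutral)
  then obtain j where j: "(p, k) = i + j"
    using shift_series_outside[of "(p, k)" i "invert_x_log (coef (tw w i) x y)"] by blast
  then have "coef (tw w i) x y (- fst j, snd j) \<noteq> 0"
    using i unfolding j by (auto simp: invert_x_log_def split: prod.splits)
  moreover have "tw w i \<in> bihom W1 \<beta>1 (- n1 - fst i)"
    using W1.twisted_argument_bihom[OF w, of r "fst i" "snd i"] by simp
  ultimately have "\<beta>3 = - (\<beta>1 + \<beta>2)" "n3 = - fst j + (- n1 - fst i) + n2"
    using coef_zero[OF _ x y] by blast+
  moreover have "p = fst i + fst j" using j by (auto simp: prod_eq_iff)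
  ultimately show ?thesis by simp
qed

text \<open>Uniqueness of the described vector is nondegeneracy of \<open>C\<close>, its existence
  is \<open>adjoint_exists\<close>. The value 0 off the carriers is the convention that makes
  equality of operators equality of functions.\<close>

definition adjoint :: "'a \<Rightarrow> 'y \<Rightarrow> 'u log_series"
  where "adjoint w y e = (if w \<in> mspace W1 \<and> y \<in> mspace Y
    then THE u. u \<in> mspace Xd \<and> (\<forall>x\<in>mspace X. C x u = adj_coef w y x e) else 0)"

lemma adjoint_eqI:
  assumes "w \<in> mspace W1" "y \<in> mspace Y" "u \<in> mspace Xd" "\<And>x. x \<in> mspace X \<Longrightarrow> C x u = adj_coef w y x e"
  shows "adjoint w y e = u"
  unfolding adjoint_def using assms by (auto intro!: the_equality Xp.B_eqI)

lemma adjoint_outside: "w \<notin> mspace W1 \<or> y \<notin> mspace Y \<Longrightarrow> adjoint w y = 0"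
  by (auto simp: adjoint_def fun_eq_iff)

text \<open>For homogeneous \<open>w\<close> and \<open>y\<close> the functional in \<open>x\<close>
  vanishes on all bigraded components but one, and such functionals are represented by vectors of
  \<open>Xd\<close>. The grade of the representing vector comes with it.\<close>

lemma adjoint_exists_bihom:
  assumes w: "w \<in> bihom W1 \<beta>1 n1" and y: "y \<in> bihom Y \<beta>3 n3"
  shows "\<exists>u\<in>grade_mod Xd (\<beta>1 + \<beta>3). \<forall>x\<in>mspace X. C x u = adj_coef w y x e"
proof -
  have ms: "w \<in> mspace W1" "y \<in> mspace Y"
    using w y W1.bihom_subset_mspace Y.bihom_subset_mspace by blast+
  have "\<exists>u\<in>grade_mod Xd (- (- (\<beta>1 + \<beta>3))). \<forall>x\<in>mspace X. C x u = adj_coef w y x e"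
  proof (rule Xp.B_representable[where l = "fst e + n1 + n3"])
    show "clinear_on (mspace X) UNIV (\<lambda>x. adj_coef w y x e)" by (rule adj_coef_linear(2)[OF ms])
    show "adj_coef w y x e = 0"
      if "(\<gamma>, m) \<noteq> (- (\<beta>1 + \<beta>3), fst e + n1 + n3)" "x \<in> bihom X \<gamma> m" for \<gamma> m x
      using adj_coef_zero[OF w that(2) y, of "fst e" "snd e"] that(1) by fastforce
  qed
  then show ?thesis by (simp add: add.commute)
qed

lemma adjoint_exists:
  assumes "w \<in> mspace W1" "y \<in> mspace Y"
  shows "\<exists>u\<in>mspace Xd. \<forall>x\<in>mspace X. C x u = adj_coef w y x e"
  using assms(1)
proof (induction w rule: W1.mspace_induct)
  case w: (hom \<beta>1 n1 w)
  then have wm: "w \<in> mspace W1" using W1.bihom_subset_mspace by blast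
  from assms(2) show ?case
  proof (induction y rule: Y.mspace_induct)
    case (hom \<beta>3 n3 y)
    then show ?case using adjoint_exists_bihom[OF w] Xp.Yd.grade_subset_mspace by blast
  next
    case (add y y')
    then obtain u u' where u: "u \<in> mspace Xd" "\<forall>x\<in>mspace X. C x u = adj_coef w y x e"
      and u': "u' \<in> mspace Xd" "\<forall>x\<in>mspace X. C x u' = adj_coef w y' x e" by blast
    have "C x (u + u') = adj_coef w (y + y') x e" if "x \<in> mspace X" for x
      using u u' that clinear_onD(2)[OF Xp.B_linear[OF that] u(1) u'(1)]
        clinear_onD(2)[OF adj_coef_linear(3)[OF wm that] add(1,2)] by simp
    then show ?case using cvec.subspace_add[OF Xp.Yd.subspace_mspace u(1) u'(1)] by blast
  qed
next
  case (add w w')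
  then obtain u u' where u: "u \<in> mspace Xd" "\<forall>x\<in>mspace X. C x u = adj_coef w y x e"
    and u': "u' \<in> mspace Xd" "\<forall>x\<in>mspace X. C x u' = adj_coef w' y x e" by blast
  have "C x (u + u') = adj_coef (w + w') y x e" if "x \<in> mspace X" for x
    using u u' that clinear_onD(2)[OF Xp.B_linear[OF that] u(1) u'(1)]
      clinear_onD(2)[OF adj_coef_linear(1)[OF that assms(2)] add(1,2)] by simp
  then show ?case using cvec.subspace_add[OF Xp.Yd.subspace_mspace u(1) u'(1)] by blast
qed

lemma
  assumes w: "w \<in> mspace W1" and y: "y \<in> mspace Y"
  shows adjoint_mspace: "adjoint w y e \<in> mspace Xd"
    and adjoint_spec: "x \<in> mspace X \<Longrightarrow> C x (adjoint w y e) = adj_coef w y x e"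
proof -
  obtain u where u: "u \<in> mspace Xd" "\<forall>x\<in>mspace X. C x u = adj_coef w y x e"
    using adjoint_exists[OF assms] by blast
  then have "adjoint w y e = u" by (intro adjoint_eqI[OF assms]) auto
  with u show "adjoint w y e \<in> mspace Xd" "x \<in> mspace X \<Longrightarrow> C x (adjoint w y e) = adj_coef w y x e" by auto
qed

lemma adjoint_linear: "w \<in> mspace W1 \<Longrightarrow> clinear_on (mspace Y) (mspace Xd) (\<lambda>y. adjoint w y e)"
  and adjoint_linear_left: "y \<in> mspace Y \<Longrightarrow> clinear_on (mspace W1) (mspace Xd) (\<lambda>w. adjoint w y e)"
proof -
  note sub = Xp.Yd.subspace_mspace
  show "clinear_on (mspace Y) (mspace Xd) (\<lambda>y. adjoint w y e)" if w: "w \<in> mspace W1"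
    unfolding clinear_on_def
  proof (intro conjI ballI allI)
    fix y assume y: "y \<in> mspace Y"
    note a = adjoint_mspace[OF w y] and s = adjoint_spec[OF w y]
    show "adjoint w y e \<in> mspace Xd" by (rule a)
    show "adjoint w (c *\<^sub>C y) e = c *\<^sub>C adjoint w y e" for c
      by (rule adjoint_eqI[OF w cvec.subspace_scale[OF Y.subspace_mspace y] cvec.subspace_scale[OF sub a]])
        (simp add: clinear_onD(3)[OF Xp.B_linear a] s clinear_onD(3)[OF adj_coef_linear(3)[OF w] y])
    fix y' assume y': "y' \<in> mspace Y"
    note a' = adjoint_mspace[OF w y'] and s' = adjoint_spec[OF w y']
    show "adjoint w (y + y') e = adjoint w y e + adjoint w y' e"
      by (rule adjoint_eqI[OF w cvec.subspace_add[OF Y.subspace_mspace y y'] cvec.subspace_add[OF sub a a']])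
        (simp add: clinear_onD(2)[OF Xp.B_linear a a'] s s' clinear_onD(2)[OF adj_coef_linear(3)[OF w] y y'])
  qed
  show "clinear_on (mspace W1) (mspace Xd) (\<lambda>w. adjoint w y e)" if y: "y \<in> mspace Y"
    unfolding clinear_on_def
  proof (intro conjI ballI allI)
    fix w assume w: "w \<in> mspace W1"
    note a = adjoint_mspace[OF w y] and s = adjoint_spec[OF w y]
    show "adjoint w y e \<in> mspace Xd" by (rule a)
    show "adjoint (c *\<^sub>C w) y e = c *\<^sub>C adjoint w y e" for c
      by (rule adjoint_eqI[OF cvec.subspace_scale[OF W1.subspace_mspace w] y cvec.subspace_scale[OF sub a]])
        (simp add: clinear_onD(3)[OF Xp.B_linear a] s clinear_onD(3)[OF adj_coef_linear(1)[OF _ y] w])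
    fix w' assume w': "w' \<in> mspace W1"
    note a' = adjoint_mspace[OF w' y] and s' = adjoint_spec[OF w' y]
    show "adjoint (w + w') y e = adjoint w y e + adjoint w' y e"
      by (rule adjoint_eqI[OF cvec.subspace_add[OF W1.subspace_mspace w w'] y cvec.subspace_add[OF sub a a']])
        (simp add: clinear_onD(2)[OF Xp.B_linear a a'] s s' clinear_onD(2)[OF adj_coef_linear(1)[OF _ y] w w'])
  qed
qed

lemma adjoint_grade:
  assumes "w \<in> grade_mod W1 \<beta>" "y \<in> grade_mod Y \<gamma>"
  shows "adjoint w y e \<in> grade_mod Xd (\<beta> + \<gamma>)"
  using assms(1)
proof (induction w rule: W1.grade_induct)
  case w: (hom n1 w)
  then have wm: "w \<in> mspace W1" using W1.bihom_subset_mspace by blast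
  from assms(2) show ?case
  proof (induction y rule: Y.grade_induct)
    case (hom n3 y)
    then have ym: "y \<in> mspace Y" using Y.bihom_subset_mspace by blast
    obtain u where u: "u \<in> grade_mod Xd (\<beta> + \<gamma>)" "\<forall>x\<in>mspace X. C x u = adj_coef w y x e"
      using adjoint_exists_bihom[OF w hom] by blast
    then have "adjoint w y e = u"
      using Xp.Yd.grade_subset_mspace by (intro adjoint_eqI[OF wm ym]) auto
    with u show ?case by simp
  next
    case (add y y')
    then have m: "y \<in> mspace Y" "y' \<in> mspace Y" using Y.grade_subset_mspace by blast+
    show ?case
      unfolding clinear_onD(2)[OF adjoint_linear[OF wm] m]
      by (rule cvec.subspace_add[OF Xp.Yd.subspace_grade add(3,4)])
  qed
next
  case (add w w')
  have y: "y \<in> mspace Y" using assms(2) Y.grade_subset_mspace by blast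
  have m: "w \<in> mspace W1" "w' \<in> mspace W1" using add(1,2) W1.grade_subset_mspace by blast+
  show ?case
    unfolding clinear_onD(2)[OF adjoint_linear_left[OF y] m]
    by (rule cvec.subspace_add[OF Xp.Yd.subspace_grade add(3,4)])
qed

section \<open>Finiteness in log x and lower truncation of the adjoint\<close>

lemma adjoint_bihom_eq_zero:
  assumes w: "w \<in> bihom W1 \<beta>1 n1" and y: "y \<in> bihom Y \<beta>3 n3"
    and z: "\<And>x. x \<in> bihom X (- (\<beta>1 + \<beta>3)) (p + n1 + n3) \<Longrightarrow> adj_coef w y x (p, k) = 0"
  shows "adjoint w y (p, k) = 0"
proof -
  have ms: "w \<in> mspace W1" "y \<in> mspace Y"
    using w y W1.bihom_subset_mspace Y.bihom_subset_mspace by blast+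
  show ?thesis
  proof (rule adjoint_eqI[OF ms cvec.subspace_0[OF Xp.Yd.subspace_mspace]])
    fix x assume x: "x \<in> mspace X"
    have "adj_coef w y x (p, k) = 0"
      using x
    proof (induction x rule: X.mspace_induct)
      case (hom \<beta> n x)
      show ?case
      proof (rule ccontr)
        assume nz: "adj_coef w y x (p, k) \<noteq> 0"
        from adj_coef_zero[OF w hom y nz] have "x \<in> bihom X (- (\<beta>1 + \<beta>3)) (p + n1 + n3)" using hom by simp
        from z[OF this] nz show False by simp
      qed
    next
      case (add u x)
      then show ?case using clinear_onD(2)[OF adj_coef_linear(2)[OF ms] add(1,2)] by simp
    qed
    then show "C x 0 = adj_coef w y x (p, k)"
      using clinear_on_zero[OF Xp.B_linear[OF x] Xp.Yd.subspace_mspace] by simp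
  qed
qed

text \<open>By \<open>adjoint_bihom_eq_zero\<close> a coefficient is determined by its values on one
  bigraded component of \<open>X\<close>. A finite spanning set of that component suffices, and each
  of its members allows only finitely many powers of log x.\<close>

lemma adjoint_finite:
  assumes "w \<in> mspace W1" "y \<in> mspace Y"
  shows "finite {k. adjoint w y (n, k) \<noteq> 0}"
  using assms(1)
proof (induction w rule: W1.mspace_induct)
  case w: (hom \<beta>1 n1 w)
  then have wm: "w \<in> mspace W1" using W1.bihom_subset_mspace by blast
  from assms(2) show ?case
  proof (induction y rule: Y.mspace_induct)
    case (hom \<beta>3 n3 y)
    then have ym: "y \<in> mspace Y" using Y.bihom_subset_mspace by blast
    let ?G = "bihom X (- (\<beta>1 + \<beta>3)) (n + n1 + n3)"
    obtain S where S: "finite S" "cvec.span S = ?G"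
      using X.bihom_finite_dimensional unfolding finite_dimensional_def by blast
    then have Sm: "b \<in> mspace X" if "b \<in> S" for b
      using that cvec.span_base[of b S] X.bihom_subset_mspace by blast
    have "{k. adjoint w y (n, k) \<noteq> 0} \<subseteq> (\<Union>b\<in>S. snd ` {e. adj_coef w y b e \<noteq> 0})"
    proof
      fix k assume k: "k \<in> {k. adjoint w y (n, k) \<noteq> 0}"
      have "\<exists>b\<in>S. adj_coef w y b (n, k) \<noteq> 0"
      proof (rule ccontr)
        assume "\<not> (\<exists>b\<in>S. adj_coef w y b (n, k) \<noteq> 0)"
        then have z: "adj_coef w y b (n, k) = 0" if "b \<in> S" for b using that by blast
        note lin = adj_coef_linear(2)[OF wm ym, of "(n, k)"]
        have "adj_coef w y x (n, k) = 0 \<and> x \<in> mspace X" if "x \<in> cvec.span S" for x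
          using that
        proof (induction rule: cvec.span_induct_alt)
          case base
          then show ?case
            using clinear_on_zero[OF lin X.subspace_mspace] cvec.subspace_0[OF X.subspace_mspace] by simp
        next
          case (step c x y')
          then show ?case
            using z Sm clinear_onD(2,3)[OF lin] cvec.subspace_add[OF X.subspace_mspace]
              cvec.subspace_scale[OF X.subspace_mspace] by simp
        qed
        then have "adjoint w y (n, k) = 0"
          using S(2) by (intro adjoint_bihom_eq_zero[OF w hom]) blast
        then show False using k by simp
      qed
      then show "k \<in> (\<Union>b\<in>S. snd ` {e. adj_coef w y b e \<noteq> 0})" by force
    qed
    then show ?case
      by (rule finite_subset) (use S(1) adj_coef_finite[OF wm Sm ym] in auto)
  next
    case (add y y')
    then show ?case
      using clinear_onD(2)[OF adjoint_linear[OF wm] add(1,2)] by (simp add: finite_support_add)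
  qed
next
  case (add w w')
  then show ?case
    using clinear_onD(2)[OF adjoint_linear_left[OF assms(2)] add(1,2)] by (simp add: finite_support_add)
qed

text \<open>Truncation of the adjoint comes from the grading of \<open>X\<close>: lowering the
  exponent by m lowers the weight of the relevant component by m, and for large m this component is
  zero, whatever the power of log x.\<close>

lemma adjoint_truncated:
  assumes "w \<in> mspace W1" "y \<in> mspace Y"
  shows "\<exists>M. \<forall>m\<ge>M. \<forall>k. adjoint w y (n - of_nat m, k) = 0"
  using assms(1)
proof (induction w rule: W1.mspace_induct)
  case w: (hom \<beta>1 n1 w)
  then have wm: "w \<in> mspace W1" using W1.bihom_subset_mspace by blast
  from assms(2) show ?case
  proof (induction y rule: Y.mspace_induct)
    case (hom \<beta>3 n3 y)
    then have ym: "y \<in> mspace Y" using Y.bihom_subset_mspace by blast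
    obtain K where K: "\<forall>k<K. bihom X (- (\<beta>1 + \<beta>3)) (n + n1 + n3 + of_int k) = {0}"
      using X.bihom_truncated by blast
    have "adjoint w y (n - of_nat m, k) = 0" if "m \<ge> nat (- K) + 1" for m k
    proof (rule adjoint_bihom_eq_zero[OF w hom])
      fix x assume "x \<in> bihom X (- (\<beta>1 + \<beta>3)) (n - of_nat m + n1 + n3)"
      then have "x \<in> bihom X (- (\<beta>1 + \<beta>3)) (n + n1 + n3 + of_int (- int m))"
        by (simp add: algebra_simps)
      moreover have "- int m < K" using that by simp
      ultimately have "x = 0" using K by blast
      then show "adj_coef w y x (n - of_nat m, k) = 0"
        using clinear_on_zero[OF adj_coef_linear(2)[OF wm ym] X.subspace_mspace] by simp
    qed
    then show ?case by blast
  next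
    case (add y y')
    then obtain M M' where "\<forall>m\<ge>M. \<forall>k. adjoint w y (n - of_nat m, k) = 0"
      "\<forall>m\<ge>M'. \<forall>k. adjoint w y' (n - of_nat m, k) = 0" by blast
    then have "\<forall>m\<ge>max M M'. \<forall>k. adjoint w (y + y') (n - of_nat m, k) = 0"
      using clinear_onD(2)[OF adjoint_linear[OF wm] add(1,2)] by simp
    then show ?case by blast
  qed
next
  case (add w w')
  then obtain M M' where "\<forall>m\<ge>M. \<forall>k. adjoint w y (n - of_nat m, k) = 0"
    "\<forall>m\<ge>M'. \<forall>k. adjoint w' y (n - of_nat m, k) = 0" by blast
  then have "\<forall>m\<ge>max M M'. \<forall>k. adjoint (w + w') y (n - of_nat m, k) = 0"
    using clinear_onD(2)[OF adjoint_linear_left[OF assms(2)] add(1,2)] by simp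
  then show ?case by blast
qed

text \<open>Product rule, as z enters through T(z) and through the evaluation at -z. The first
  contributes -(2 L(0) + x L(1)) T(z) w, the second -x^(-1) L(-1) T(z) w; together they are x T(z)
  L(-1) w by \<open>twist_L_mod\<close>.\<close>

lemma ev_twist_has_derivative:
  assumes w: "w \<in> mspace W1" and x: "x \<in> mspace X" and y: "y \<in> mspace Y"
  shows "((\<lambda>z. ev (- z) (T z w) x y) has_field_derivative
    exp z * ev (- z) (T z (L_mod W1 (-1) w)) x y) (at z)"
proof -
  let ?J = "{i. tw w i \<noteq> 0}"
  note tm = W1.twisted_argument_mspace[OF w] and Tm = W1.twist_mspace[OF w]
  have L: "L_mod W1 j u \<in> mspace W1" if "u \<in> mspace W1" "j \<in> {-1, 0, 1}" for j u
    using clinear_onD(1)[OF W1.L_linear[OF that(2)] that(1)] .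
  have lin: "clinear_on (mspace W1) UNIV (\<lambda>u. ev s u x y)" for s by (rule ev_linear(1)[OF x y])
  \<comment> \<open>T(s) w is a finite sum of fixed vectors with scalar coefficients depending on s;
    this reduces the derivative to the product rule for scalar functions.\<close>
  have exp_T: "\<psi> (T s w) = (\<Sum>i\<in>?J. x_monomial s i * \<psi> (tw w i))"
    if \<psi>: "clinear_on (mspace W1) UNIV \<psi>" for \<psi> s
  proof -
    have "T s w = (\<Sum>i\<in>?J. x_monomial s i *\<^sub>C tw w i)"
      unfolding W1.evalx_twisted_argument[OF w, symmetric]
      by (rule evalx_superset[OF W1.twisted_argument_finite[OF w] subset_refl])
    then show ?thesis
      using clinear_on_sum[OF \<psi> W1.subspace_mspace, of ?J "\<lambda>i. x_monomial s i *\<^sub>C tw w i"]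
        cvec.subspace_scale[OF W1.subspace_mspace tm] clinear_onD(3)[OF \<psi> tm] by simp
  qed
  define xm' where "xm' i = fst i * x_monomial z i + of_nat (snd i) * x_monomial z (fst i, snd i - 1)" for i
  have dxm: "((\<lambda>s. x_monomial s i) has_field_derivative xm' i) (at z)" for i
    using x_monomial_has_derivative[of "fst i" "snd i" z] by (simp add: xm'_def)
  have dev: "((\<lambda>s. ev (- s) u x y) has_field_derivative - (exp (- z) * ev (- z) (L_mod W1 (-1) u) x y)) (at z)"
    if "u \<in> mspace W1" for u
  proof -
    have "((\<lambda>s. ev (- s) u x y) has_field_derivative (exp (- z) * ev (- z) (L_mod W1 (-1) u) x y) * (- 1)) (at z)"
      by (rule DERIV_chain2[OF ev_has_derivative[OF that x y]]) (auto intro!: derivative_eq_intros)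
    then show ?thesis by simp
  qed
  have F: "(\<lambda>s. ev (- s) (T s w) x y) = (\<lambda>s. \<Sum>i\<in>?J. x_monomial s i * ev (- s) (tw w i) x y)"
    by (rule ext) (rule exp_T[OF lin])
  have "((\<lambda>s. ev (- s) (T s w) x y) has_field_derivative
    (\<Sum>i\<in>?J. xm' i * ev (- z) (tw w i) x y + - (exp (- z) * ev (- z) (L_mod W1 (-1) (tw w i)) x y) * x_monomial z i)) (at z)"
    unfolding F by (rule DERIV_sum) (rule DERIV_mult[OF dxm dev[OF tm]])
  also have "(\<Sum>i\<in>?J. xm' i * ev (- z) (tw w i) x y + - (exp (- z) * ev (- z) (L_mod W1 (-1) (tw w i)) x y) * x_monomial z i)
    = (\<Sum>i\<in>?J. xm' i * ev (- z) (tw w i) x y)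
      - exp (- z) * (\<Sum>i\<in>?J. x_monomial z i * ev (- z) (L_mod W1 (-1) (tw w i)) x y)"
    by (simp add: sum_subtractf sum_distrib_left mult_ac)
  also have "(\<Sum>i\<in>?J. x_monomial z i * ev (- z) (L_mod W1 (-1) (tw w i)) x y) = ev (- z) (L_mod W1 (-1) (T z w)) x y"
  proof -
    have "clinear_on (mspace W1) UNIV (\<lambda>u. ev (- z) (L_mod W1 (-1) u) x y)"
      using clinear_onD[OF lin] clinear_onD[OF W1.L_linear[of "-1"]] by (auto simp: clinear_on_def)
    from exp_T[OF this] show ?thesis by simp
  qed
  \<comment> \<open>This sum is the derivative of T alone with the evaluation frozen at -z, so it
    agrees with the formula of \<open>twist_has_derivative\<close> by uniqueness of
    derivatives.\<close>
  also have "(\<Sum>i\<in>?J. xm' i * ev (- z) (tw w i) x y)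
    = - ev (- z) (2 *\<^sub>C L_mod W1 0 (T z w) + exp z *\<^sub>C L_mod W1 1 (T z w)) x y"
  proof -
    have "((\<lambda>s. ev (- z) (T s w) x y) has_field_derivative (\<Sum>i\<in>?J. xm' i * ev (- z) (tw w i) x y)) (at z)"
      unfolding exp_T[OF lin[of "- z"]]
      by (rule DERIV_sum) (rule DERIV_cmult_right[OF dxm])
    then show ?thesis
      using DERIV_unique[OF _ W1.twist_has_derivative[OF lin[of "- z"] w, of r z]] by blast
  qed
  also have "- ev (- z) (2 *\<^sub>C L_mod W1 0 (T z w) + exp z *\<^sub>C L_mod W1 1 (T z w)) x y
      - exp (- z) * ev (- z) (L_mod W1 (-1) (T z w)) x y
    = exp z * ev (- z) (T z (L_mod W1 (-1) w)) x y"
  proof -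
    let ?u0 = "L_mod W1 0 (T z w)" and ?u1 = "L_mod W1 1 (T z w)" and ?um = "L_mod W1 (-1) (T z w)"
    have m: "?u0 \<in> mspace W1" "?u1 \<in> mspace W1" "?um \<in> mspace W1" using L[OF Tm] by auto
    note s = cvec.subspace_scale[OF W1.subspace_mspace] and a = cvec.subspace_add[OF W1.subspace_mspace]
    note l2 = clinear_onD(2)[OF lin] and l3 = clinear_onD(3)[OF lin]
    have 1: "ev (- z) (2 *\<^sub>C ?u0 + exp z *\<^sub>C ?u1) x y = 2 * ev (- z) ?u0 x y + exp z * ev (- z) ?u1 x y"
      using l2[OF s[OF m(1)] s[OF m(2)]] l3[OF m(1)] l3[OF m(2)] by simp
    have 2: "ev (- z) (T z (L_mod W1 (-1) w)) x y
      = - (exp (- 2 * z) * ev (- z) ?um x y + 2 * exp (- z) * ev (- z) ?u0 x y + ev (- z) ?u1 x y)"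
      unfolding W1.twist_L_mod(3)[OF w] clinear_on_minus[OF lin W1.subspace_mspace a[OF a[OF s[OF m(3)] s[OF m(1)]] m(2)]]
        l2[OF a[OF s[OF m(3)] s[OF m(1)]] m(2)] l2[OF s[OF m(3)] s[OF m(1)]] l3[OF m(1)] l3[OF m(3)]
      by simp
    have e: "exp z * exp (- 2 * z) = exp (- z)" "exp z * exp (- z) = 1"
      by (simp_all add: exp_add[symmetric])
    have "exp z * ev (- z) (T z (L_mod W1 (-1) w)) x y
      = - ((exp z * exp (- 2 * z)) * ev (- z) ?um x y + 2 * (exp z * exp (- z)) * ev (- z) ?u0 x y + exp z * ev (- z) ?u1 x y)"
      unfolding 2 by (simp add: algebra_simps)
    then show ?thesis unfolding 1 e by simp
  qed
  finally show ?thesis .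
qed

lemma adjoint_derivative:
  assumes w: "w \<in> mspace W1" and y: "y \<in> mspace Y"
  shows "adjoint (L_mod W1 (-1) w) y = deriv_log (adjoint w y)"
proof
  fix e :: "complex \<times> nat"
  have Lw: "L_mod W1 (-1) w \<in> mspace W1" using clinear_onD(1)[OF W1.L_linear w] by simp
  note a = adjoint_mspace[OF w y] and s = adjoint_spec[OF w y]
  note sc = cvec.subspace_scale[OF Xp.Yd.subspace_mspace a]
  show "adjoint (L_mod W1 (-1) w) y e = deriv_log (adjoint w y) e"
  proof (rule adjoint_eqI[OF Lw y])
    show "deriv_log (adjoint w y) e \<in> mspace Xd"
      by (cases e) (simp add: deriv_log_def cvec.subspace_add[OF Xp.Yd.subspace_mspace sc sc])
    fix x assume x: "x \<in> mspace X"
    note fin = adj_coef_finite[OF w x y]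
    let ?g = "adj_coef w y x"
    have 1: "C x (deriv_log (adjoint w y) e) = deriv_log ?g e"
      using clinear_onD(2)[OF Xp.B_linear[OF x] sc sc] clinear_onD(3)[OF Xp.B_linear[OF x] a]
      by (cases e) (simp add: deriv_log_def s[OF x])
    \<comment> \<open>Dividing x d/dx by x is a translation of the exponents by -1.\<close>
    have eq: "deriv_log ?g = (\<lambda>(n, k). x_deriv ?g (n - (-1), k))"
      by (auto simp: x_deriv_def deriv_log_def fun_eq_iff)
    note fd = finite_support_x_deriv[OF fin]
    have "adj_coef (L_mod W1 (-1) w) y x = deriv_log ?g"
    proof (rule evalx_eqD[OF adj_coef_finite[OF Lw x y]])
      show "finite {i. deriv_log ?g i \<noteq> 0}" unfolding eq by (rule evalx_translate(1)[OF fd])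
      fix z
      have "evalx z (x_deriv ?g) = exp z * ev (- z) (T z (L_mod W1 (-1) w)) x y"
        using DERIV_unique[OF evalx_has_derivative[OF fin, of z], unfolded evalx_adj_coef[OF w x y],
            OF ev_twist_has_derivative[OF w x y]] .
      moreover have "evalx z (deriv_log ?g) = exp (- z) * evalx z (x_deriv ?g)"
        unfolding eq evalx_translate(2)[OF fd] by simp
      moreover have "exp (- z) * (exp z * c) = c" for c :: complex
        by (simp add: exp_minus)
      ultimately show "evalx z (adj_coef (L_mod W1 (-1) w) y x) = evalx z (deriv_log ?g)"
        by (simp add: evalx_adj_coef[OF Lw x y])
    qed
    then show "C x (deriv_log (adjoint w y) e) = adj_coef (L_mod W1 (-1) w) y x e" using 1 by simp
  qed
qed

text \<open>The adjoint of L(j) is L(-j), so the relation for j comes from the relation of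
  \<open>I\<close> for -j at the inverse of x, up to sign. Moving T(z) past the L(j - i) makes both
  sides combinations of the same three values \<open>e0\<close>, \<open>e1\<close>,
  \<open>em\<close>, and in each case the surplus terms cancel.\<close>

lemma ev_twist_sl2:
  assumes j: "j \<in> {-1, 0, 1}" and w: "w \<in> mspace W1" and x: "x \<in> mspace X" and y: "y \<in> mspace Y"
  shows "ev (- z) (T z w) (L_mod X (- j) x) y - ev (- z) (T z w) x (L_mod Y j y)
    = (\<Sum>i\<le>nat (j + 1). of_nat (nat (j + 1) choose i) * (exp (of_nat i * z) *
        ev (- z) (T z (L_mod W1 (j - int i) w)) x y))"
proof -
  note Tm = W1.twist_mspace[OF w]
  have L: "L_mod W1 j u \<in> mspace W1" if "u \<in> mspace W1" "j \<in> {-1, 0, 1}" for j u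
    using clinear_onD(1)[OF W1.L_linear[OF that(2)] that(1)] .
  have lin: "clinear_on (mspace W1) UNIV (\<lambda>u. ev s u x y)" for s by (rule ev_linear(1)[OF x y])
  let ?u0 = "L_mod W1 0 (T z w)" and ?u1 = "L_mod W1 1 (T z w)" and ?um = "L_mod W1 (-1) (T z w)"
  have m: "?u0 \<in> mspace W1" "?u1 \<in> mspace W1" "?um \<in> mspace W1" using L[OF Tm] by auto
  note s = cvec.subspace_scale[OF W1.subspace_mspace] and a = cvec.subspace_add[OF W1.subspace_mspace]
  note l2 = clinear_onD(2)[OF lin] and l3 = clinear_onD(3)[OF lin]
  define e0 e1 em where "e0 = ev (- z) ?u0 x y" and "e1 = ev (- z) ?u1 x y" and "em = ev (- z) ?um x y"
  have t1: "ev (- z) (T z (L_mod W1 1 w)) x y = - (exp (2 * z) * e1)"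
    unfolding W1.twist_L_mod(1)[OF w] l3[OF m(2)] by (simp add: e1_def)
  have t0: "ev (- z) (T z (L_mod W1 0 w)) x y = e0 + exp z * e1"
    unfolding W1.twist_L_mod(2)[OF w] l2[OF m(1) s[OF m(2)]] l3[OF m(2)] by (simp add: e1_def e0_def)
  have tm: "ev (- z) (T z (L_mod W1 (-1) w)) x y = - (exp (- 2 * z) * em + 2 * exp (- z) * e0 + e1)"
    unfolding W1.twist_L_mod(3)[OF w] clinear_on_minus[OF lin W1.subspace_mspace a[OF a[OF s[OF m(3)] s[OF m(1)]] m(2)]]
      l2[OF a[OF s[OF m(3)] s[OF m(1)]] m(2)] l2[OF s[OF m(3)] s[OF m(1)]] l3[OF m(1)] l3[OF m(3)]
    by (simp add: e0_def e1_def em_def)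
  have ex: "exp z * exp (- 2 * z) = exp (- z)" "exp z * exp (- z) = 1" "exp (2 * z) * exp (- 2 * z) = 1"
    "exp (2 * z) * exp (- z) = exp z" "exp z * exp z = exp (2 * z)"
    by (simp_all add: exp_add[symmetric])
  have j': "- j \<in> {-1, 0, 1}" using j by auto
  have main: "ev (- z) (T z w) x (L_mod Y j y) - ev (- z) (T z w) (L_mod X (- j) x) y
    = (\<Sum>i\<le>nat (- j + 1). of_nat (nat (- j + 1) choose i) * exp (of_nat i * - z) *
        ev (- z) (L_mod W1 (- j - int i) (T z w)) x y)"
    using ev_sl2[OF j' Tm x y, of "- z"] by simp
  let ?S = "\<Sum>i\<le>nat (j + 1). of_nat (nat (j + 1) choose i) * (exp (of_nat i * z) *
        ev (- z) (T z (L_mod W1 (j - int i) w)) x y)"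
  consider "j = -1" | "j = 0" | "j = 1" using j by auto
  then have "ev (- z) (T z w) x (L_mod Y j y) - ev (- z) (T z w) (L_mod X (- j) x) y = - ?S"
  proof cases
    case 1
    then show ?thesis
      unfolding main by (simp add: tm numeral_2_eq_2 e0_def e1_def em_def)
  next
    case 2
    have "?S = e0 - (exp z * exp (- 2 * z)) * em - 2 * (exp z * exp (- z)) * e0"
      by (simp add: 2 t0 tm algebra_simps)
    then have "?S = - (e0 + exp (- z) * em)" unfolding ex by simp
    then show ?thesis unfolding main by (simp add: 2 e0_def em_def)
  next
    case 3
    have "?S = - (2 * exp (2 * z) * e1) + 2 * exp z * e0 + 2 * (exp z * exp z) * e1
        - (exp (2 * z) * exp (- 2 * z)) * em - 2 * (exp (2 * z) * exp (- z)) * e0"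
      by (simp add: 3 numeral_2_eq_2 t0 t1 tm algebra_simps)
    then have "?S = - em" unfolding ex by simp
    then show ?thesis unfolding main by (simp add: 3 em_def)
  qed
  moreover have "b - a = s" if "a - b = - s" for a b s :: complex
    using arg_cong[OF that, of uminus] by simp
  ultimately show ?thesis by blast
qed

lemma adjoint_sl2:
  assumes w: "w \<in> mspace W1" and y: "y \<in> mspace Y"
  shows "sl2_bracket (L_mod W1) (L_mod Y) (L_mod Xd) (\<lambda>a b n. adjoint a b (n, k)) w y"
  unfolding sl2_bracket_def
proof (intro ballI allI)
  fix j :: int and n :: complex
  assume j: "j \<in> {-1, 0, 1}"
  have j': "- j \<in> {-1, 0, 1}" "\<And>i. i \<le> nat (j + 1) \<Longrightarrow> j - int i \<in> {-1, 0, 1}" using j by auto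
  note a = adjoint_mspace[OF w y] and sub = Xp.Yd.subspace_mspace
  have Ly: "L_mod Y j y \<in> mspace Y" using clinear_onD(1)[OF Y.L_linear[OF j] y] .
  have Lw: "L_mod W1 (j - int i) w \<in> mspace W1" if "i \<le> nat (j + 1)" for i
    using clinear_onD(1)[OF W1.L_linear[OF j'(2)[OF that]] w] .
  have La: "L_mod Xd j (adjoint w y e) \<in> mspace Xd" for e
    using clinear_onD(1)[OF Xp.Yd.L_linear[OF j] a] .
  show "L_mod Xd j (adjoint w y (n, k)) - adjoint w (L_mod Y j y) (n, k)
    = (\<Sum>i\<le>nat (j + 1). of_nat (nat (j + 1) choose i) *\<^sub>C adjoint (L_mod W1 (j - int i) w) y (n - of_nat i, k))"
  proof (rule Xp.B_eqI)
    show "L_mod Xd j (adjoint w y (n, k)) - adjoint w (L_mod Y j y) (n, k) \<in> mspace Xd"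
      by (rule cvec.subspace_diff[OF sub La adjoint_mspace[OF w Ly]])
    show "(\<Sum>i\<le>nat (j + 1). of_nat (nat (j + 1) choose i) *\<^sub>C adjoint (L_mod W1 (j - int i) w) y (n - of_nat i, k)) \<in> mspace Xd"
      by (rule cvec.subspace_sum[OF sub], rule cvec.subspace_scale[OF sub]) (use adjoint_mspace[OF Lw y] in auto)
    fix x assume x: "x \<in> mspace X"
    have Lx: "L_mod X (- j) x \<in> mspace X" using clinear_onD(1)[OF X.L_linear[OF j'(1)] x] .
    note lin = Xp.B_linear[OF x]
    have "C x (L_mod Xd j (adjoint w y (n, k)) - adjoint w (L_mod Y j y) (n, k))
      = adj_coef w y (L_mod X (- j) x) (n, k) - adj_coef w (L_mod Y j y) x (n, k)"
      unfolding clinear_on_diff[OF lin sub La adjoint_mspace[OF w Ly]] Xp.B_L[OF j x a]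
        adjoint_spec[OF w y Lx] adjoint_spec[OF w Ly x] ..
    also have "\<dots> = (\<Sum>i\<le>nat (j + 1). of_nat (nat (j + 1) choose i) *
        adj_coef (L_mod W1 (j - int i) w) y x (n - of_nat i, k))"
    proof -
      let ?N = "Suc (nat (j + 1))"
      \<comment> \<open>Padded by zero: beyond the range, j - i leaves {-1, 0, 1} and the finiteness
        required of every member of the family would not be available.\<close>
      let ?g = "\<lambda>i. if i < ?N then adj_coef (L_mod W1 (j - int i) w) y x else (\<lambda>_. 0)"
      have fin: "finite {e. ?g i e \<noteq> 0}" for i
        using adj_coef_finite[OF Lw x y, of i] by simp
      note tr = evalx_translated_sum[where g = ?g and b = of_nat and N = ?N and a = "\<lambda>i. of_nat (nat (j + 1) choose i)", OF fin]
      have fin1: "finite {e. adj_coef w y (L_mod X (- j) x) e - adj_coef w (L_mod Y j y) x e \<noteq> 0}"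
        by (rule finite_subset[OF _ finite_UnI[OF adj_coef_finite[OF w Lx y] adj_coef_finite[OF w x Ly]]]) auto
      have "(\<lambda>e. adj_coef w y (L_mod X (- j) x) e - adj_coef w (L_mod Y j y) x e)
        = (\<lambda>(s, k). \<Sum>i<?N. of_nat (nat (j + 1) choose i) * ?g i (s - of_nat i, k))"
      proof (rule evalx_eqD[OF fin1 tr(1)])
        fix z
        have "evalx z (\<lambda>e. adj_coef w y (L_mod X (- j) x) e - adj_coef w (L_mod Y j y) x e)
          = ev (- z) (T z w) (L_mod X (- j) x) y - ev (- z) (T z w) x (L_mod Y j y)"
          using evalx_diff[OF adj_coef_finite[OF w Lx y] adj_coef_finite[OF w x Ly]]
          by (simp add: evalx_adj_coef[OF w Lx y] evalx_adj_coef[OF w x Ly])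
        also have "\<dots> = (\<Sum>i\<le>nat (j + 1). of_nat (nat (j + 1) choose i) * (exp (of_nat i * z) *
            ev (- z) (T z (L_mod W1 (j - int i) w)) x y))"
          by (rule ev_twist_sl2[OF j w x y])
        also have "\<dots> = (\<Sum>i<?N. of_nat (nat (j + 1) choose i) * (exp (of_nat i * z) * evalx z (?g i)))"
          unfolding lessThan_Suc_atMost
          by (rule sum.cong) (auto simp: evalx_adj_coef[OF Lw x y])
        finally show "evalx z (\<lambda>e. adj_coef w y (L_mod X (- j) x) e - adj_coef w (L_mod Y j y) x e)
          = evalx z (\<lambda>(s, k). \<Sum>i<?N. of_nat (nat (j + 1) choose i) * ?g i (s - of_nat i, k))"
          unfolding tr(2) .
      qed
      from fun_cong[OF this, of "(n, k)"] show ?thesis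
        unfolding lessThan_Suc_atMost by (auto intro: sum.cong)
    qed
    also have "\<dots> = (\<Sum>i\<le>nat (j + 1). C x (of_nat (nat (j + 1) choose i) *\<^sub>C adjoint (L_mod W1 (j - int i) w) y (n - of_nat i, k)))"
      by (rule sum.cong) (auto simp: clinear_onD(3)[OF lin adjoint_mspace[OF Lw y]] adjoint_spec[OF Lw y x])
    also have "\<dots> = C x (\<Sum>i\<le>nat (j + 1). of_nat (nat (j + 1) choose i) *\<^sub>C adjoint (L_mod W1 (j - int i) w) y (n - of_nat i, k))"
      by (rule clinear_on_sum[OF lin sub, symmetric], rule cvec.subspace_scale[OF sub])
        (use adjoint_mspace[OF Lw y] in auto)
    finally show "C x (L_mod Xd j (adjoint w y (n, k)) - adjoint w (L_mod Y j y) (n, k))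
      = C x (\<Sum>i\<le>nat (j + 1). of_nat (nat (j + 1) choose i) *\<^sub>C adjoint (L_mod W1 (j - int i) w) y (n - of_nat i, k))" .
  qed
qed

end

section \<open>The Jacobi identity for the adjoint\<close>

lemma double_sum_triangle:
  fixes g :: "nat \<Rightarrow> nat \<Rightarrow> 'a::comm_monoid_add"
  assumes "\<And>a l. a + l \<ge> N \<Longrightarrow> g a l = 0"
  shows "(\<Sum>a<N. \<Sum>l<N. g a l) = (\<Sum>s<N. \<Sum>a\<le>s. g a (s - a))"
proof -
  have nz: "a + l < N" if "g a l \<noteq> 0" for a l
    using assms[of a l] that by (cases "a + l < N") auto
  have "(\<Sum>a<N. \<Sum>l<N. g a l) = (\<Sum>(a, l)\<in>{..<N} \<times> {..<N}. g a l)"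
    by (simp add: sum.cartesian_product)
  also have "\<dots> = (\<Sum>(a, l)\<in>{(a, l). a + l < N}. g a l)"
    by (rule sum.mono_neutral_right) (auto dest: nz)
  also have "\<dots> = (\<Sum>s<N. \<Sum>a\<le>s. g a (s - a))" by (rule sum.triangle_reindex)
  finally show ?thesis .
qed

text \<open>Negating the upper index of the second binomial makes all signs equal and the sum a
  Vandermonde convolution; a second negation brings the result back.\<close>

lemma gbinomial_alternating_sum:
  fixes A m :: complex
  shows "(\<Sum>a\<le>s. (-1) ^ a * (m gchoose a) * ((A - of_nat a) gchoose (s - a))) = (A - m) gchoose s"
proof -
  have "(\<Sum>a\<le>s. (-1) ^ a * (m gchoose a) * ((A - of_nat a) gchoose (s - a)))
    = (\<Sum>a\<le>s. (-1) ^ s * ((m gchoose a) * ((of_nat s - A - 1) gchoose (s - a))))"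
  proof (rule sum.cong[OF refl])
    fix a assume "a \<in> {..s}"
    then have a: "a \<le> s" by simp
    have "(A - of_nat a) gchoose (s - a) = (-1) ^ (s - a) * ((of_nat (s - a) - (A - of_nat a) - 1) gchoose (s - a))"
      by (rule gbinomial_negated_upper)
    also have "of_nat (s - a) - (A - of_nat a) - 1 = of_nat s - A - 1"
      using a by (simp add: of_nat_diff)
    finally have 1: "(A - of_nat a) gchoose (s - a) = (-1) ^ (s - a) * ((of_nat s - A - 1) gchoose (s - a))" .
    have 2: "(-1 :: complex) ^ a * (-1) ^ (s - a) = (-1) ^ s"
      using a by (simp add: power_add[symmetric])
    have 3: "p * q * (p' * q') = (p * p') * (q * q')" for p q p' q' :: complex
      by (simp only: mult_ac)
    show "(-1) ^ a * (m gchoose a) * ((A - of_nat a) gchoose (s - a))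
      = (-1) ^ s * ((m gchoose a) * ((of_nat s - A - 1) gchoose (s - a)))"
      by (simp only: 1 3[of "(-1) ^ a" "m gchoose a" "(-1) ^ (s - a)"] 2)
  qed
  also have "\<dots> = (-1) ^ s * (\<Sum>a\<in>{0..s}. (m gchoose a) * ((of_nat s - A - 1) gchoose (s - a)))"
    by (simp add: sum_distrib_left atMost_atLeast0)
  also have "\<dots> = (-1) ^ s * ((m + (of_nat s - A - 1)) gchoose s)"
    by (simp only: gbinomial_Vandermonde)
  also have "\<dots> = (A - m) gchoose s"
    using gbinomial_negated_upper[of "A - m" s] by (simp add: algebra_simps)
  finally show ?thesis .
qed

context adjoint_intertwiner
begin

context
  fixes \<alpha> v h w x y and m n :: int and I0 :: nat
  assumes v: "\<alpha> \<in> A" "v \<in> grade_alg V \<alpha>" "v \<in> weight_alg V h"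
    and w: "w \<in> mspace W1" and x: "x \<in> mspace X" and y: "y \<in> mspace Y"
    and I0: "\<And>i. i \<ge> I0 \<Longrightarrow> (L_alg V 1 ^^ i) v = 0"
begin

abbreviation (input) vi :: "nat \<Rightarrow> 'v" where "vi i \<equiv> (L_alg V 1 ^^ i) v"

text \<open>The index that takes the place of m for L(1)^i v when x1 is replaced by its inverse:
  x1^m dx1 contributes -m - 2, the factor (x1 - x2)^n contributes -n, and the power x1^(i - 2h) in
  the opposite vertex operator contributes 2h - i.\<close>

abbreviation (input) mi :: "nat \<Rightarrow> int" where "mi i \<equiv> 2 * h - int i - m - n - 2"

text \<open>The conjugation formula for \<open>T z\<close>, multiplied by \<open>(x + x0)^m\<close>.\<close>

lemma ev_twist_third:
  "\<exists>N0. \<forall>N\<ge>N0. (\<Sum>a<N. (of_int m gchoose a) *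
      (exp ((of_int m - of_nat a) * z) * ev (- z) (T z (module_op W1 v w (- n - 1 - int a))) x y))
    = (\<Sum>i<I0. ((-1) powi (h - n - 1) * exp (of_int n * z) / fact i) *
      (\<Sum>s<N. (of_int (mi i) gchoose s) * (exp ((of_int (mi i) - of_nat s) * (- z)) *
        ev (- z) (module_op W1 (vi i) (T z w) (- n - 1 - int s)) x y)))"
proof -
  note Tm = W1.twist_mspace[OF w, of r z]
  note lin = ev_linear(1)[OF x y, of "- z"]
  define P where "P i s = ev (- z) (module_op W1 (vi i) (T z w) (- n - 1 - int s)) x y" for i s
  have opm: "module_op W1 u (T z w) e \<in> mspace W1" for u e
    by (rule clinear_onD(1)[OF W1.op_linear Tm])
  have PI: "P i s = 0" if "i \<ge> I0" for i s
    using I0[OF that] clinear_on_zero[OF W1.op_linear_left[OF Tm] cvec.subspace_UNIV]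
      clinear_on_zero[OF lin W1.subspace_mspace] by (simp add: P_def)
  have "\<forall>i. \<exists>N. \<forall>e<N. module_op W1 (vi i) (T z w) e = 0" using W1.op_truncated[OF Tm] by blast
  then obtain b where b: "\<And>i e. e < b i \<Longrightarrow> module_op W1 (vi i) (T z w) e = 0" by metis
  define S0 where "S0 = nat (Max (insert 0 ((\<lambda>i. - n - b i) ` {..<I0})))"
  have PS: "P i s = 0" if s: "s \<ge> S0" for i s
  proof (cases "i < I0")
    case True
    have "- n - b i \<le> Max (insert 0 ((\<lambda>i. - n - b i) ` {..<I0}))"
      by (rule Max_ge) (use True in auto)
    then have "- n - 1 - int s < b i" using s unfolding S0_def by linarith
    then show ?thesis using b clinear_on_zero[OF lin W1.subspace_mspace] by (simp add: P_def)
  qed (use PI in simp)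
  show ?thesis
  proof (intro exI[of _ S0] allI impI)
    fix N assume N: "N \<ge> S0"
    define co where "co a i l = (of_int (2 * h - n - 2 - int a - int i) gchoose l) / (fact i :: complex)" for a i l
    define cc where "cc a = (-1) powi (h - n - 1 - int a) * exp (- 2 * of_int (h - n - 1 - int a) * z)" for a
    have T: "ev (- z) (T z (module_op W1 v w (- n - 1 - int a))) x y
      = cc a * (\<Sum>i<I0. \<Sum>l<N. exp z ^ (i + l) * co a i l * P i (a + l))" for a
    proof -
      define e where "e = - n - 1 - int a"
      obtain K0 where K0: "\<forall>K\<ge>K0. T z (module_op W1 v w e)
        = ((-1) powi (h + e) * exp (- 2 * of_int (h + e) * z)) *\<^sub>C (\<Sum>k<K. exp z ^ k *\<^sub>C (\<Sum>i\<le>k.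
        ((of_int (2 * h + e - 1 - int i) gchoose (k - i)) / fact i) *\<^sub>C
          module_op W1 (vi i) (T z w) (e - int (k - i))))"
        using W1.twist_module_op[OF v(3) w, of r z e] by blast
      \<comment> \<open>Large enough for the conjugation formula and for the triangle i + l < K to
        contain the rectangle i < I0, l < N, outside of which the terms vanish.\<close>
      define K where "K = K0 + I0 + N"
      have ee: "2 * h + e - 1 - int i = 2 * h - n - 2 - int a - int i" "h + e = h - n - 1 - int a"
        "e - int l = - n - 1 - int (a + l)" for i l by (simp_all add: e_def)
      have T1: "T z (module_op W1 v w e) = cc a *\<^sub>C (\<Sum>k<K. exp z ^ k *\<^sub>C (\<Sum>i\<le>k.
        co a i (k - i) *\<^sub>C module_op W1 (vi i) (T z w) (- n - 1 - int (a + (k - i)))))"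
        unfolding co_def cc_def ee[symmetric] by (rule K0[rule_format]) (simp add: K_def)
      note sc = cvec.subspace_scale[OF W1.subspace_mspace] and su = cvec.subspace_sum[OF W1.subspace_mspace]
      note l3 = clinear_onD(3)[OF lin] and ls = clinear_on_sum[OF lin W1.subspace_mspace]
      have in1: "co a i (k - i) *\<^sub>C module_op W1 (vi i) (T z w) (- n - 1 - int (a + (k - i))) \<in> mspace W1" for i k
        by (rule sc[OF opm])
      have in2: "(\<Sum>i\<le>k. co a i (k - i) *\<^sub>C module_op W1 (vi i) (T z w) (- n - 1 - int (a + (k - i)))) \<in> mspace W1" for k
        by (rule su[OF in1])
      have "ev (- z) (T z (module_op W1 v w e)) x y = cc a * (\<Sum>k<K. exp z ^ k * (\<Sum>i\<le>k. co a i (k - i) * P i (a + (k - i))))"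
        unfolding T1 l3[OF su[OF sc[OF in2]]] ls[OF sc[OF in2]] l3[OF in2] ls[OF in1] l3[OF opm] P_def scaleC_complex ..
      also have "(\<Sum>k<K. exp z ^ k * (\<Sum>i\<le>k. co a i (k - i) * P i (a + (k - i))))
        = (\<Sum>k<K. \<Sum>i\<le>k. exp z ^ (i + (k - i)) * co a i (k - i) * P i (a + (k - i)))"
        by (simp add: sum_distrib_left mult.assoc)
      also have "\<dots> = (\<Sum>(i, l)\<in>{(i, l). i + l < K}. exp z ^ (i + l) * co a i l * P i (a + l))"
        by (rule sum.triangle_reindex[symmetric])
      also have "\<dots> = (\<Sum>(i, l)\<in>{..<I0} \<times> {..<N}. exp z ^ (i + l) * co a i l * P i (a + l))"
      proof (rule sum.mono_neutral_right)
        have "{(i, l). i + l < K} \<subseteq> {..<K} \<times> {..<K}" by auto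
        then show "finite {(i, l). i + l < K}" by (rule finite_subset) simp
        show "{..<I0} \<times> {..<N} \<subseteq> {(i, l). i + l < K}" by (auto simp: K_def)
        have "i < I0 \<and> l < N" if "P i (a + l) \<noteq> 0" for i l
        proof -
          have "\<not> I0 \<le> i" using PI that by blast
          moreover have "\<not> S0 \<le> a + l" using PS that by blast
          ultimately show ?thesis using N by linarith
        qed
        then show "\<forall>p\<in>{(i, l). i + l < K} - {..<I0} \<times> {..<N}.
          (case p of (i, l) \<Rightarrow> exp z ^ (i + l) * co a i l * P i (a + l)) = 0" by auto
      qed
      also have "\<dots> = (\<Sum>i<I0. \<Sum>l<N. exp z ^ (i + l) * co a i l * P i (a + l))"
        by (simp add: sum.cartesian_product)
      finally show ?thesis unfolding e_def .
    qed
    define g where "g i a l = (of_int m gchoose a) * (exp ((of_int m - of_nat a) * z) *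
      (cc a * (exp z ^ (i + l) * co a i l * P i (a + l))))" for i a l
    have "(\<Sum>a<N. (of_int m gchoose a) *
      (exp ((of_int m - of_nat a) * z) * ev (- z) (T z (module_op W1 v w (- n - 1 - int a))) x y))
      = (\<Sum>a<N. \<Sum>i<I0. \<Sum>l<N. g i a l)"
      unfolding T g_def by (simp add: sum_distrib_left)
    also have "\<dots> = (\<Sum>i<I0. \<Sum>a<N. \<Sum>l<N. g i a l)" by (rule sum.swap)
    also have "\<dots> = (\<Sum>i<I0. ((-1) powi (h - n - 1) * exp (of_int n * z) / fact i) *
      (\<Sum>s<N. (of_int (mi i) gchoose s) * (exp ((of_int (mi i) - of_nat s) * (- z)) * P i s)))"
    proof (rule sum.cong[OF refl])
      fix i assume "i \<in> {..<I0}"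
      \<comment> \<open>For fixed s = a + l the operators and the powers of x no longer depend on a.
        What remains is an alternating sum of products of binomials in m and \<open>bi\<close>, and
        its value has upper index bi - m = \<open>mi i\<close>.\<close>
      define bi :: complex where "bi = of_int (2 * h - n - 2 - int i)"
      let ?\<kappa> = "(-1) powi (h - n - 1) * exp (of_int n * z) / fact i"
      have "(\<Sum>a<N. \<Sum>l<N. g i a l) = (\<Sum>s<N. \<Sum>a\<le>s. g i a (s - a))"
        by (rule double_sum_triangle) (use PS N in \<open>simp add: g_def\<close>)
      also have "\<dots> = (\<Sum>s<N. ?\<kappa> * ((of_int (mi i) gchoose s) * (exp ((of_int (mi i) - of_nat s) * (- z)) * P i s)))"
      proof (rule sum.cong[OF refl])
        fix s assume "s \<in> {..<N}"
        let ?E = "exp ((of_int (mi i) - of_nat s) * (- z)) * P i s"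
        have "g i a (s - a) = ?\<kappa> * (((-1) ^ a * (of_int m gchoose a) * ((bi - of_nat a) gchoose (s - a))) * ?E)"
          if a: "a \<le> s" for a
        proof -
          have 1: "co a i (s - a) = ((bi - of_nat a) gchoose (s - a)) / fact i"
          proof -
            have "of_int (2 * h - n - 2 - int a - int i) = bi - of_nat a" by (simp add: bi_def)
            then show ?thesis by (simp only: co_def)
          qed
          have 2: "(-1 :: complex) powi (h - n - 1 - int a) = (-1) powi (h - n - 1) * (-1) ^ a"
            by (simp add: power_int_diff power_int_minus_left)
          have "exp ((of_int m - of_nat a) * z) * (exp (- 2 * of_int (h - n - 1 - int a) * z) * exp z ^ (i + (s - a)))
            = exp ((of_int m - of_nat a) * z + (- 2 * of_int (h - n - 1 - int a) * z + of_nat (i + (s - a)) * z))"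
            by (simp only: exp_add exp_of_nat_mult)
          also have "(of_int m - of_nat a) * z + (- 2 * of_int (h - n - 1 - int a) * z + of_nat (i + (s - a)) * z)
            = of_int n * z + (of_int (mi i) - of_nat s) * (- z)"
            using a by (simp add: of_nat_diff algebra_simps)
          finally have 3: "exp ((of_int m - of_nat a) * z) * (exp (- 2 * of_int (h - n - 1 - int a) * z) * exp z ^ (i + (s - a)))
            = exp (of_int n * z) * exp ((of_int (mi i) - of_nat s) * (- z))"
            by (simp only: exp_add)
          have "g i a (s - a) = (of_int m gchoose a) * ((-1) powi (h - n - 1) * (-1) ^ a) *
            (exp ((of_int m - of_nat a) * z) * (exp (- 2 * of_int (h - n - 1 - int a) * z) * exp z ^ (i + (s - a))))
            * (((bi - of_nat a) gchoose (s - a)) / fact i) * P i s"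
            using a unfolding g_def cc_def 1 2 by (simp only: le_add_diff_inverse mult_ac)
          then show ?thesis unfolding 3 by (simp add: mult_ac)
        qed
        then have "(\<Sum>a\<le>s. g i a (s - a))
          = (\<Sum>a\<le>s. ?\<kappa> * (((-1) ^ a * (of_int m gchoose a) * ((bi - of_nat a) gchoose (s - a))) * ?E))"
          by (intro sum.cong) auto
        also have "\<dots> = ?\<kappa> * ((\<Sum>a\<le>s. (-1) ^ a * (of_int m gchoose a) * ((bi - of_nat a) gchoose (s - a))) * ?E)"
          by (simp only: sum_distrib_left sum_distrib_right)
        also have "(\<Sum>a\<le>s. (-1) ^ a * (of_int m gchoose a) * ((bi - of_nat a) gchoose (s - a))) = (bi - of_int m) gchoose s"
          by (rule gbinomial_alternating_sum)
        also have "bi - of_int m = of_int (mi i)" by (simp add: bi_def)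
        finally show "(\<Sum>a\<le>s. g i a (s - a)) = ?\<kappa> * ((of_int (mi i) gchoose s) * ?E)" .
      qed
      finally show "(\<Sum>a<N. \<Sum>l<N. g i a l) = ?\<kappa> *
        (\<Sum>s<N. (of_int (mi i) gchoose s) * (exp ((of_int (mi i) - of_nat s) * (- z)) * P i s))"
        by (simp only: sum_distrib_left)
    qed
    finally show "(\<Sum>a<N. (of_int m gchoose a) *
      (exp ((of_int m - of_nat a) * z) * ev (- z) (T z (module_op W1 v w (- n - 1 - int a))) x y))
      = (\<Sum>i<I0. ((-1) powi (h - n - 1) * exp (of_int n * z) / fact i) *
        (\<Sum>s<N. (of_int (mi i) gchoose s) * (exp ((of_int (mi i) - of_nat s) * (- z)) *
          ev (- z) (module_op W1 (vi i) (T z w) (- n - 1 - int s)) x y)))"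
      unfolding P_def .
  qed
qed

text \<open>The Jacobi identity of \<open>I\<close> is taken at T(z) w for each L(1)^i v with the
  index \<open>mi i\<close>, and these identities are added with weights \<open>\<kappa> i\<close>.
  The third terms give T(z) applied to modes on \<open>w\<close> by \<open>ev_twist_third\<close>;
  the first and second terms change places, as the modes of \<open>v\<close> move between the two
  sides of the pairings. The bound may depend on z.\<close>

lemma ev_twist_jacobi_pointwise:
  "\<exists>N0. \<forall>N\<ge>N0.
    (\<Sum>c<N. ((-1) ^ c * (of_int n gchoose c)) *
      (exp (of_nat c * z) * ev (- z) (T z w) (opposite_op V X v x (int c - m - n - 1)) y))
    - (\<Sum>b<N. ((-1) powi n * (-1) ^ b * (of_int n gchoose b)) *
      (exp ((of_int n - of_nat b) * z) * ev (- z) (T z w) x (module_op Y v y (- m - 1 - int b))))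
    = (\<Sum>a<N. (of_int m gchoose a) *
      (exp ((of_int m - of_nat a) * z) * ev (- z) (T z (module_op W1 v w (- n - 1 - int a))) x y))"
proof -
  note Tm = W1.twist_mspace[OF w, of r z]
  obtain N1 where N1: "\<And>N. N \<ge> N1 \<Longrightarrow> (\<Sum>a<N. (of_int m gchoose a) *
      (exp ((of_int m - of_nat a) * z) * ev (- z) (T z (module_op W1 v w (- n - 1 - int a))) x y))
    = (\<Sum>i<I0. ((-1) powi (h - n - 1) * exp (of_int n * z) / fact i) *
      (\<Sum>s<N. (of_int (mi i) gchoose s) * (exp ((of_int (mi i) - of_nat s) * (- z)) *
        ev (- z) (module_op W1 (vi i) (T z w) (- n - 1 - int s)) x y)))"
    using ev_twist_third by blast
  define fst_t where "fst_t i c = ((-1) ^ c * (of_int n gchoose c)) *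
      (exp (of_nat c * - z) * ev (- z) (T z w) x (opposite_op V Y (vi i) y (int c - mi i - n - 1)))" for i c :: nat
  define snd_t where "snd_t i b = ((-1) powi n * (-1) ^ b * (of_int n gchoose b)) *
      (exp ((of_int n - of_nat b) * - z) * ev (- z) (T z w) (module_op X (vi i) x (- mi i - 1 - int b)) y)" for i b :: nat
  define Q where "Q i N0 \<longleftrightarrow> (\<forall>N\<ge>N0. (\<Sum>c<N. fst_t i c) - (\<Sum>b<N. snd_t i b)
    = (\<Sum>s<N. (of_int (mi i) gchoose s) * (exp ((of_int (mi i) - of_nat s) * (- z)) *
        ev (- z) (module_op W1 (vi i) (T z w) (- n - 1 - int s)) x y)))" for i N0
  have "\<exists>N0. Q i N0" for i
    unfolding Q_def fst_t_def snd_t_def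
    using ev_jacobi[OF v(1) W1.L1_pow_alg_grade[OF v(1,2)] W1.L1_pow_alg_weight[OF v(3)] Tm x y, where n = n and m = "mi i"]
    by blast
  then obtain N2 where "\<And>i. Q i (N2 i)" by metis
  note N2 = this[unfolded Q_def, rule_format]
  define N0 where "N0 = Max (insert N1 (N2 ` {..<I0}))"
  have N0: "N1 \<le> N0" "\<And>i. i < I0 \<Longrightarrow> N2 i \<le> N0"
    unfolding N0_def by (auto intro: Max_ge)
  define \<kappa> where "\<kappa> i = (-1) powi (h - n - 1) * exp (of_int n * z) / fact i" for i
  \<comment> \<open>The shift by one in h - n - 1 supplies the minus sign that belongs to the
    exchange of the first two terms.\<close>
  have sgn: "(-1 :: complex) powi (h - n - 1) = - ((-1) powi n * (-1) powi h)"
    by (simp add: power_int_diff power_int_minus_left)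
  have sgn2: "(-1 :: complex) powi n * (-1) powi n = 1"
    by (simp add: power_int_minus_left)
  \<comment> \<open>The weights (-1)^h / i! contained in \<open>\<kappa> i\<close> are those with
    which the opposite operators of the L(1)^i v on \<open>Y\<close> recombine to the vertex
    operator of \<open>v\<close>.\<close>
  have first: "(\<Sum>i<I0. \<kappa> i * (\<Sum>c<N. fst_t i c)) = - (\<Sum>b<N. ((-1) powi n * (-1) ^ b * (of_int n gchoose b)) *
      (exp ((of_int n - of_nat b) * z) * ev (- z) (T z w) x (module_op Y v y (- m - 1 - int b))))" for N
  proof -
    note lin = ev_linear(3)[OF Tm x, of "- z"]
    have opm: "opposite_op V Y u y e \<in> mspace Y" for u e by (rule clinear_onD(1)[OF Y.opposite_op_linear y])
    have "(\<Sum>i<I0. \<kappa> i * (\<Sum>c<N. fst_t i c)) = (\<Sum>c<N. \<Sum>i<I0. \<kappa> i * fst_t i c)"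
      unfolding sum_distrib_left by (rule sum.swap)
    also have "\<dots> = (\<Sum>c<N. - (((-1) powi n * (-1) ^ c * (of_int n gchoose c)) *
      (exp ((of_int n - of_nat c) * z) * ev (- z) (T z w) x (module_op Y v y (- m - 1 - int c)))))"
    proof (rule sum.cong[OF refl])
      fix c
      define e where "e = - m - 1 - int c"
      have ei: "int c - mi i - n - 1 = int i - 2 * h - e" for i by (simp add: e_def)
      have "module_op Y v y e = (\<Sum>i<I0. ((-1) powi h / fact i) *\<^sub>C opposite_op V Y (vi i) y (int i - 2 * h - e))"
        by (rule Y.opposite_op_opposite_op[OF v(3) _ y, symmetric]) (rule I0)
      then have "ev (- z) (T z w) x (module_op Y v y e)
        = (\<Sum>i<I0. ev (- z) (T z w) x (((-1) powi h / fact i) *\<^sub>C opposite_op V Y (vi i) y (int i - 2 * h - e)))"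
        using clinear_on_sum[OF lin Y.subspace_mspace, of "{..<I0}"
            "\<lambda>i. ((-1) powi h / fact i) *\<^sub>C opposite_op V Y (vi i) y (int i - 2 * h - e)"]
          cvec.subspace_scale[OF Y.subspace_mspace opm] by simp
      also have "\<dots> = (\<Sum>i<I0. ((-1) powi h / fact i) * ev (- z) (T z w) x (opposite_op V Y (vi i) y (int i - 2 * h - e)))"
        using clinear_onD(3)[OF lin opm] by simp
      finally have E: "ev (- z) (T z w) x (module_op Y v y e)
        = (\<Sum>i<I0. ((-1) powi h / fact i) * ev (- z) (T z w) x (opposite_op V Y (vi i) y (int i - 2 * h - e)))" .
      have ex: "exp ((of_int n - of_nat c) * z) = exp (of_int n * z) * exp (of_nat c * - z)"
        by (simp add: exp_add[symmetric] algebra_simps)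
      show "(\<Sum>i<I0. \<kappa> i * fst_t i c) = - (((-1) powi n * (-1) ^ c * (of_int n gchoose c)) *
        (exp ((of_int n - of_nat c) * z) * ev (- z) (T z w) x (module_op Y v y (- m - 1 - int c))))"
        unfolding e_def[symmetric] E ex \<kappa>_def fst_t_def ei sgn
        unfolding sum_distrib_left sum_negf[symmetric] by (rule sum.cong) (simp_all add: mult_ac)
    qed
    finally show ?thesis by (simp add: sum_negf)
  qed
  \<comment> \<open>The same weights assemble the modes of the L(1)^i v on \<open>X\<close> into the
    opposite operator of \<open>v\<close>.\<close>
  have second: "(\<Sum>i<I0. \<kappa> i * (\<Sum>b<N. snd_t i b)) = - (\<Sum>c<N. ((-1) ^ c * (of_int n gchoose c)) *
      (exp (of_nat c * z) * ev (- z) (T z w) (opposite_op V X v x (int c - m - n - 1)) y))" for N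
  proof -
    note lin = ev_linear(2)[OF Tm y, of "- z"]
    have opm: "module_op X u x e \<in> mspace X" for u e by (rule clinear_onD(1)[OF X.op_linear x])
    have "(\<Sum>i<I0. \<kappa> i * (\<Sum>b<N. snd_t i b)) = (\<Sum>b<N. \<Sum>i<I0. \<kappa> i * snd_t i b)"
      unfolding sum_distrib_left by (rule sum.swap)
    also have "\<dots> = (\<Sum>c<N. - (((-1) ^ c * (of_int n gchoose c)) *
      (exp (of_nat c * z) * ev (- z) (T z w) (opposite_op V X v x (int c - m - n - 1)) y)))"
    proof (rule sum.cong[OF refl])
      fix c
      define e where "e = int c - m - n - 1"
      have ei: "- mi i - 1 - int c = int i - 2 * h - e" for i by (simp add: e_def)
      have "opposite_op V X v x e = (\<Sum>i<I0. ((-1) powi h / fact i) *\<^sub>C module_op X (vi i) x (int i - 2 * h - e))"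
        by (rule X.opposite_op_hom[OF v(3) _ x]) (rule I0)
      then have "ev (- z) (T z w) (opposite_op V X v x e) y
        = (\<Sum>i<I0. ev (- z) (T z w) (((-1) powi h / fact i) *\<^sub>C module_op X (vi i) x (int i - 2 * h - e)) y)"
        using clinear_on_sum[OF lin X.subspace_mspace, of "{..<I0}"
            "\<lambda>i. ((-1) powi h / fact i) *\<^sub>C module_op X (vi i) x (int i - 2 * h - e)"]
          cvec.subspace_scale[OF X.subspace_mspace opm] by simp
      also have "\<dots> = (\<Sum>i<I0. ((-1) powi h / fact i) * ev (- z) (T z w) (module_op X (vi i) x (int i - 2 * h - e)) y)"
        using clinear_onD(3)[OF lin opm] by simp
      finally have E: "ev (- z) (T z w) (opposite_op V X v x e) y
        = (\<Sum>i<I0. ((-1) powi h / fact i) * ev (- z) (T z w) (module_op X (vi i) x (int i - 2 * h - e)) y)" .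
      have ex: "exp (of_nat c * z) = exp (of_int n * z) * exp ((of_int n - of_nat c) * - z)"
        by (simp add: exp_add[symmetric] algebra_simps)
      have "\<kappa> i * snd_t i c = - ((-1) powi n * (-1) powi n) * (((-1) ^ c * (of_int n gchoose c)) *
        ((exp (of_int n * z) * exp ((of_int n - of_nat c) * - z)) *
        (((-1) powi h / fact i) * ev (- z) (T z w) (module_op X (vi i) x (int i - 2 * h - e)) y)))" for i
        unfolding \<kappa>_def snd_t_def ei sgn by (simp add: mult_ac)
      then show "(\<Sum>i<I0. \<kappa> i * snd_t i c) = - (((-1) ^ c * (of_int n gchoose c)) *
        (exp (of_nat c * z) * ev (- z) (T z w) (opposite_op V X v x (int c - m - n - 1)) y))"
        unfolding e_def[symmetric] E ex sgn2
        by (simp add: sum_distrib_left sum_negf)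
    qed
    finally show ?thesis by (simp add: sum_negf)
  qed
  show ?thesis
  proof (intro exI[of _ N0] allI impI)
    fix N assume N: "N \<ge> N0"
    have "(\<Sum>a<N. (of_int m gchoose a) *
      (exp ((of_int m - of_nat a) * z) * ev (- z) (T z (module_op W1 v w (- n - 1 - int a))) x y))
      = (\<Sum>i<I0. \<kappa> i * ((\<Sum>c<N. fst_t i c) - (\<Sum>b<N. snd_t i b)))"
      unfolding \<kappa>_def N1[OF order_trans[OF N0(1) N]]
      by (rule sum.cong) (use N2 order_trans[OF N0(2) N] in auto)
    also have "\<dots> = (\<Sum>i<I0. \<kappa> i * (\<Sum>c<N. fst_t i c)) - (\<Sum>i<I0. \<kappa> i * (\<Sum>b<N. snd_t i b))"
      by (simp add: right_diff_distrib sum_subtractf)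
    finally show "(\<Sum>c<N. ((-1) ^ c * (of_int n gchoose c)) *
        (exp (of_nat c * z) * ev (- z) (T z w) (opposite_op V X v x (int c - m - n - 1)) y))
      - (\<Sum>b<N. ((-1) powi n * (-1) ^ b * (of_int n gchoose b)) *
        (exp ((of_int n - of_nat b) * z) * ev (- z) (T z w) x (module_op Y v y (- m - 1 - int b))))
      = (\<Sum>a<N. (of_int m gchoose a) *
        (exp ((of_int m - of_nat a) * z) * ev (- z) (T z (module_op W1 v w (- n - 1 - int a))) x y))"
      unfolding first second by simp
  qed
qed

end

text \<open>The pointwise identity has a bound depending on z, but truncation on \<open>x\<close>,
  \<open>y\<close> and \<open>w\<close> stops all three sums at one N for every z. Thus for this N
  both sides are finite series with equal evaluations, and linear independence applies.\<close>

lemma adj_coef_jacobi: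
  assumes v: "\<alpha> \<in> A" "v \<in> grade_alg V \<alpha>" "v \<in> weight_alg V h"
    and w: "w \<in> mspace W1" and x: "x \<in> mspace X" and y: "y \<in> mspace Y"
  shows "\<exists>N0. \<forall>N\<ge>N0. \<forall>s k.
    (\<Sum>c<N. ((-1) ^ c * (of_int n gchoose c)) *
      adj_coef w y (opposite_op V X v x (int c - m - n - 1)) (s - of_nat c, k))
    - (\<Sum>b<N. ((-1) powi n * (-1) ^ b * (of_int n gchoose b)) *
      adj_coef w (module_op Y v y (- m - 1 - int b)) x (s - (of_int n - of_nat b), k))
    = (\<Sum>a<N. (of_int m gchoose a) *
      adj_coef (module_op W1 v w (- n - 1 - int a)) y x (s - (of_int m - of_nat a), k))"
proof -
  obtain I0 where I0: "\<And>i. i \<ge> I0 \<Longrightarrow> (L_alg V 1 ^^ i) v = 0" using W1.L1_alg_nilpotent by blast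
  obtain e1 where e1: "\<forall>e>e1. opposite_op V X v x e = 0" using X.opposite_op_truncated[OF v(3) x] by blast
  obtain e2 where e2: "\<forall>e<e2. module_op Y v y e = 0" using Y.op_truncated[OF y] by blast
  obtain e3 where e3: "\<forall>e<e3. module_op W1 v w e = 0" using W1.op_truncated[OF w] by blast
  define N0 where "N0 = nat (e1 + m + n + 2) + nat (- m - e2) + nat (- n - e3)"
  have opx: "opposite_op V X v x e \<in> mspace X" and opw: "module_op W1 v w e \<in> mspace W1"
    and opy: "module_op Y v y e \<in> mspace Y" for e
    using clinear_onD(1)[OF X.opposite_op_linear x] clinear_onD(1)[OF W1.op_linear w]
      clinear_onD(1)[OF Y.op_linear y] by auto
  note fin1 = adj_coef_finite[OF w opx y] and fin2 = adj_coef_finite[OF w x opy]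
    and fin3 = adj_coef_finite[OF opw x y]
  note tr1 = evalx_translated_sum[where g = "\<lambda>c. adj_coef w y (opposite_op V X v x (int c - m - n - 1))" and b = of_nat, OF fin1]
    and tr2 = evalx_translated_sum[where g = "\<lambda>b. adj_coef w (module_op Y v y (- m - 1 - int b)) x"
        and b = "\<lambda>b. of_int n - of_nat b", OF fin2]
    and tr3 = evalx_translated_sum[where g = "\<lambda>a. adj_coef (module_op W1 v w (- n - 1 - int a)) y x"
        and b = "\<lambda>a. of_int m - of_nat a", OF fin3]
  show ?thesis
  proof (intro exI[of _ N0] allI impI)
    fix N s k assume N: "N \<ge> N0"
    let ?f1 = "\<lambda>(s, k). \<Sum>c<N. ((-1) ^ c * (of_int n gchoose c)) *
      adj_coef w y (opposite_op V X v x (int c - m - n - 1)) (s - of_nat c, k)"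
    let ?f2 = "\<lambda>(s, k). \<Sum>b<N. ((-1) powi n * (-1) ^ b * (of_int n gchoose b)) *
      adj_coef w (module_op Y v y (- m - 1 - int b)) x (s - (of_int n - of_nat b), k)"
    let ?f3 = "\<lambda>(s, k). \<Sum>a<N. (of_int m gchoose a) *
      adj_coef (module_op W1 v w (- n - 1 - int a)) y x (s - (of_int m - of_nat a), k)"
    have "(\<lambda>e. ?f1 e - ?f2 e) = ?f3"
    proof (rule evalx_eqD)
      have "finite {e. ?f1 e \<noteq> 0}" "finite {e. ?f2 e \<noteq> 0}" by (rule tr1(1), rule tr2(1))
      from finite_UnI[OF this] show "finite {e. ?f1 e - ?f2 e \<noteq> 0}"
        by (rule finite_subset[rotated]) auto
      show "finite {e. ?f3 e \<noteq> 0}" by (rule tr3(1))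
      fix z
      note Tm = W1.twist_mspace[OF w, of r z]
      define G1 where "G1 c = ((-1) ^ c * (of_int n gchoose c)) *
        (exp (of_nat c * z) * ev (- z) (T z w) (opposite_op V X v x (int c - m - n - 1)) y)" for c :: nat
      define G2 where "G2 b = ((-1) powi n * (-1) ^ b * (of_int n gchoose b)) *
        (exp ((of_int n - of_nat b) * z) * ev (- z) (T z w) x (module_op Y v y (- m - 1 - int b)))" for b :: nat
      define G3 where "G3 a = (of_int m gchoose a) *
        (exp ((of_int m - of_nat a) * z) * ev (- z) (T z (module_op W1 v w (- n - 1 - int a))) x y)" for a :: nat
      have G1z: "G1 c = 0" if "c \<ge> N" for c
      proof -
        have "int c - m - n - 1 > e1" using that N unfolding N0_def by linarith
        then have "opposite_op V X v x (int c - m - n - 1) = 0" using e1 by blast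
        then show ?thesis using clinear_on_zero[OF ev_linear(2)[OF Tm y] X.subspace_mspace] by (simp add: G1_def)
      qed
      have G2z: "G2 b = 0" if "b \<ge> N" for b
      proof -
        have "- m - 1 - int b < e2" using that N unfolding N0_def by linarith
        then have "module_op Y v y (- m - 1 - int b) = 0" using e2 by blast
        then show ?thesis using clinear_on_zero[OF ev_linear(3)[OF Tm x] Y.subspace_mspace] by (simp add: G2_def)
      qed
      have G3z: "G3 a = 0" if "a \<ge> N" for a
      proof -
        have "- n - 1 - int a < e3" using that N unfolding N0_def by linarith
        then have "module_op W1 v w (- n - 1 - int a) = 0" using e3 by blast
        then show ?thesis using clinear_on_zero[OF ev_twist_linear[OF x y] W1.subspace_mspace] by (simp add: G3_def)
      qed
      obtain M where M: "\<forall>K\<ge>M. (\<Sum>c<K. G1 c) - (\<Sum>b<K. G2 b) = (\<Sum>a<K. G3 a)"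
        unfolding G1_def G2_def G3_def
        using ev_twist_jacobi_pointwise[OF v w x y I0, where z = z and m = m and n = n] by blast
      \<comment> \<open>\<open>M\<close> depends on z; the terms between N and N + M vanish by
        truncation, so the identity for N + M summands is the identity for N summands.\<close>
      have ext: "(\<Sum>i<N + M. G i) = (\<Sum>i<N. G i)" if "\<And>i. i \<ge> N \<Longrightarrow> G i = 0" for G :: "nat \<Rightarrow> complex"
        by (rule sum.mono_neutral_right) (use that in auto)
      have "(\<Sum>c<N. G1 c) - (\<Sum>b<N. G2 b) = (\<Sum>a<N. G3 a)"
        using M[rule_format, of "N + M"] by (simp add: ext[of G1, OF G1z] ext[of G2, OF G2z] ext[of G3, OF G3z])
      moreover have "evalx z ?f1 = (\<Sum>c<N. G1 c)" "evalx z ?f2 = (\<Sum>b<N. G2 b)" "evalx z ?f3 = (\<Sum>a<N. G3 a)"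
        unfolding tr1(2) tr2(2) tr3(2) G1_def G2_def G3_def
          evalx_adj_coef[OF w opx y] evalx_adj_coef[OF w x opy] evalx_adj_coef[OF opw x y] by (rule refl)+
      moreover have "evalx z (\<lambda>e. ?f1 e - ?f2 e) = evalx z ?f1 - evalx z ?f2"
        by (rule evalx_diff) (rule tr1(1), rule tr2(1))
      ultimately show "evalx z (\<lambda>e. ?f1 e - ?f2 e) = evalx z ?f3" by (simp only:)
    qed
    from fun_cong[OF this, of "(s, k)"]
    show "(\<Sum>c<N. ((-1) ^ c * (of_int n gchoose c)) *
        adj_coef w y (opposite_op V X v x (int c - m - n - 1)) (s - of_nat c, k))
      - (\<Sum>b<N. ((-1) powi n * (-1) ^ b * (of_int n gchoose b)) *
        adj_coef w (module_op Y v y (- m - 1 - int b)) x (s - (of_int n - of_nat b), k))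
      = (\<Sum>a<N. (of_int m gchoose a) *
        adj_coef (module_op W1 v w (- n - 1 - int a)) y x (s - (of_int m - of_nat a), k))"
      by (simp only: prod.case)
  qed
qed

context
  fixes w :: 'a and y :: 'y and s :: complex and k :: nat and m n :: int
begin

definition "jac1 v c = ((-1) ^ c * (of_int n gchoose c)) *\<^sub>C
  module_op Xd v (adjoint w y (s - of_nat c, k)) (int c - m - n - 1)"

definition "jac2 v b = ((-1) powi n * (-1) ^ b * (of_int n gchoose b)) *\<^sub>C
  adjoint w (module_op Y v y (- m - 1 - int b)) (s - of_int n + of_nat b, k)"

definition "jac3 v a = (of_int m gchoose a) *\<^sub>C
  adjoint (module_op W1 v w (- n - 1 - int a)) y (s - of_int m + of_nat a, k)"

context
  assumes w: "w \<in> mspace W1" and y: "y \<in> mspace Y"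
begin

lemma opm: "module_op W1 v w e \<in> mspace W1" "module_op Y v y e \<in> mspace Y"
  by (rule clinear_onD(1)[OF W1.op_linear w], rule clinear_onD(1)[OF Y.op_linear y])

lemma jac_mspace: "jac1 v i \<in> mspace Xd" "jac2 v i \<in> mspace Xd" "jac3 v i \<in> mspace Xd"
  unfolding jac1_def jac2_def jac3_def
  using clinear_onD(1)[OF Xp.Yd.op_linear adjoint_mspace[OF w y]] adjoint_mspace[OF w opm(2)]
    adjoint_mspace[OF opm(1) y]
  by (auto intro: cvec.subspace_scale[OF Xp.Yd.subspace_mspace])

lemma jac_finite: "finite {i. jac1 v i \<noteq> 0}" "finite {i. jac2 v i \<noteq> 0}" "finite {i. jac3 v i \<noteq> 0}"
proof -
  obtain M where M: "\<forall>m\<ge>M. \<forall>k. adjoint w y (s - of_nat m, k) = 0"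
    using adjoint_truncated[OF w y] by blast
  show "finite {i. jac1 v i \<noteq> 0}"
    by (rule finite_support_lessThan[of M])
      (use M clinear_on_zero[OF Xp.Yd.op_linear Xp.Yd.subspace_mspace] in \<open>simp add: jac1_def\<close>)
  obtain e2 where e2: "\<forall>e<e2. module_op Y v y e = 0" using Y.op_truncated[OF y] by blast
  show "finite {i. jac2 v i \<noteq> 0}"
  proof (rule finite_support_lessThan)
    fix i assume "i \<ge> nat (- m - e2)"
    then have "- m - 1 - int i < e2" by linarith
    then have "module_op Y v y (- m - 1 - int i) = 0" using e2 by blast
    then show "jac2 v i = 0"
      using clinear_on_zero[OF adjoint_linear[OF w] Y.subspace_mspace] by (simp add: jac2_def)
  qed
  obtain e3 where e3: "\<forall>e<e3. module_op W1 v w e = 0" using W1.op_truncated[OF w] by blast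
  show "finite {i. jac3 v i \<noteq> 0}"
  proof (rule finite_support_lessThan)
    fix i assume "i \<ge> nat (- n - e3)"
    then have "- n - 1 - int i < e3" by linarith
    then have "module_op W1 v w (- n - 1 - int i) = 0" using e3 by blast
    then show "jac3 v i = 0"
      using clinear_on_zero[OF adjoint_linear_left[OF y] W1.subspace_mspace] by (simp add: jac3_def)
  qed
qed

lemma jac_add: "jac1 (u + v) i = jac1 u i + jac1 v i" "jac2 (u + v) i = jac2 u i + jac2 v i"
  "jac3 (u + v) i = jac3 u i + jac3 v i"
  unfolding jac1_def jac2_def jac3_def
  using clinear_onD(2)[OF Xp.Yd.op_linear_left[OF adjoint_mspace[OF w y]]]
    clinear_onD(2)[OF Y.op_linear_left[OF y]] clinear_onD(2)[OF W1.op_linear_left[OF w]]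
    clinear_onD(2)[OF adjoint_linear[OF w] opm(2) opm(2)]
    clinear_onD(2)[OF adjoint_linear_left[OF y] opm(1) opm(1)]
  by (simp_all add: scaleC_add_right)

text \<open>Additivity in \<open>v\<close> reduces the identity to homogeneous vectors, for which
  modes have adjoints with respect to \<open>C\<close>. There nondegeneracy reduces it to matrix
  coefficients.\<close>

lemma jac_identity: "Sum_any (jac1 v) - Sum_any (jac2 v) = Sum_any (jac3 v)"
proof (induction v rule: W1.alg_induct)
  case v: (hom \<alpha> h v)
  note sub = Xp.Yd.subspace_mspace
  note mem = Sum_any_in_subspace[OF sub, of "jac1 v", OF jac_mspace(1)]
    Sum_any_in_subspace[OF sub, of "jac2 v", OF jac_mspace(2)]
    Sum_any_in_subspace[OF sub, of "jac3 v", OF jac_mspace(3)]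
  show ?case
  proof (rule Xp.B_eqI[OF cvec.subspace_diff[OF sub mem(1,2)] mem(3)])
    fix x assume x: "x \<in> mspace X"
    note lin = Xp.B_linear[OF x] and fin = jac_finite[of v]
    note Cl = clinear_onD(3)[OF lin]
    have d: "s - (p - q) = s - p + q" for p q :: complex by simp
    obtain N0 where N0: "\<forall>N\<ge>N0. \<forall>s k.
      (\<Sum>c<N. ((-1) ^ c * (of_int n gchoose c)) *
        adj_coef w y (opposite_op V X v x (int c - m - n - 1)) (s - of_nat c, k))
      - (\<Sum>b<N. ((-1) powi n * (-1) ^ b * (of_int n gchoose b)) *
        adj_coef w (module_op Y v y (- m - 1 - int b)) x (s - (of_int n - of_nat b), k))
      = (\<Sum>a<N. (of_int m gchoose a) *
        adj_coef (module_op W1 v w (- n - 1 - int a)) y x (s - (of_int m - of_nat a), k))"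
      using adj_coef_jacobi[OF v w x y] by blast
    have opx: "opposite_op V X v x e \<in> mspace X" for e by (rule clinear_onD(1)[OF X.opposite_op_linear x])
    have C1: "C x (jac1 v c) = ((-1) ^ c * (of_int n gchoose c)) *
        adj_coef w y (opposite_op V X v x (int c - m - n - 1)) (s - of_nat c, k)" for c
      unfolding jac1_def Cl[OF clinear_onD(1)[OF Xp.Yd.op_linear adjoint_mspace[OF w y]]]
        Xp.B_op[OF v x adjoint_mspace[OF w y]] adjoint_spec[OF w y opx] scaleC_complex ..
    have C2: "C x (jac2 v b) = ((-1) powi n * (-1) ^ b * (of_int n gchoose b)) *
        adj_coef w (module_op Y v y (- m - 1 - int b)) x (s - (of_int n - of_nat b), k)" for b
      unfolding jac2_def Cl[OF adjoint_mspace[OF w opm(2)]] adjoint_spec[OF w opm(2) x] scaleC_complex d ..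
    have C3: "C x (jac3 v a) = (of_int m gchoose a) *
        adj_coef (module_op W1 v w (- n - 1 - int a)) y x (s - (of_int m - of_nat a), k)" for a
      unfolding jac3_def Cl[OF adjoint_mspace[OF opm(1) y]] adjoint_spec[OF opm(1) y x] scaleC_complex d ..
    have "finite ({i. jac1 v i \<noteq> 0} \<union> {i. jac2 v i \<noteq> 0} \<union> {i. jac3 v i \<noteq> 0})" using fin by simp
    then obtain N1 where N1: "\<forall>i\<in>{i. jac1 v i \<noteq> 0} \<union> {i. jac2 v i \<noteq> 0} \<union> {i. jac3 v i \<noteq> 0}. i < N1"
      using finite_nat_set_iff_bounded by blast
    define N where "N = N0 + N1"
    have z: "jac1 v i = 0" "jac2 v i = 0" "jac3 v i = 0" if "i \<ge> N" for i
    proof -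
      have "\<not> i < N1" using that by (simp add: N_def)
      then show "jac1 v i = 0" "jac2 v i = 0" "jac3 v i = 0" using N1 by blast+
    qed
    have eq: "C x (Sum_any f) = (\<Sum>i<N. C x (f i))"
      if "\<And>i. i \<ge> N \<Longrightarrow> f i = 0" "\<And>i. f i \<in> mspace Xd" for f :: "nat \<Rightarrow> 'u"
      using that by (simp add: Sum_any_eq_sum_lessThan[of N] clinear_on_sum[OF lin sub])
    have "C x (Sum_any (jac1 v) - Sum_any (jac2 v)) = C x (Sum_any (jac1 v)) - C x (Sum_any (jac2 v))"
      by (rule clinear_on_diff[OF lin sub mem(1,2)])
    also have "\<dots> = (\<Sum>i<N. C x (jac1 v i)) - (\<Sum>i<N. C x (jac2 v i))"
      using eq[of "jac1 v", OF z(1) jac_mspace(1)] eq[of "jac2 v", OF z(2) jac_mspace(2)] by simp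
    also have "\<dots> = (\<Sum>i<N. C x (jac3 v i))"
      unfolding C1 C2 C3 by (rule N0[rule_format]) (simp add: N_def)
    also have "\<dots> = C x (Sum_any (jac3 v))"
      using eq[of "jac3 v", OF z(3) jac_mspace(3)] by simp
    finally show "C x (Sum_any (jac1 v) - Sum_any (jac2 v)) = C x (Sum_any (jac3 v))" .
  qed
next
  case (add u v)
  have "jac1 (u + v) = (\<lambda>i. jac1 u i + jac1 v i)" "jac2 (u + v) = (\<lambda>i. jac2 u i + jac2 v i)"
    "jac3 (u + v) = (\<lambda>i. jac3 u i + jac3 v i)"
    using jac_add by blast+
  then have "Sum_any (jac1 (u + v)) = Sum_any (jac1 u) + Sum_any (jac1 v)"
    "Sum_any (jac2 (u + v)) = Sum_any (jac2 u) + Sum_any (jac2 v)"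
    "Sum_any (jac3 (u + v)) = Sum_any (jac3 u) + Sum_any (jac3 v)"
    by (simp_all only: Sum_any.distrib[OF jac_finite(1) jac_finite(1)]
        Sum_any.distrib[OF jac_finite(2) jac_finite(2)] Sum_any.distrib[OF jac_finite(3) jac_finite(3)])
  then show ?case using add by (simp add: algebra_simps)
qed

end

end

lemma adjoint_jacobi:
  assumes w: "w \<in> mspace W1" and y: "y \<in> mspace Y"
  shows "jacobi_identity (module_op W1) (module_op Y) (module_op Xd) (\<lambda>a b n. adjoint a b (n, k)) v w y"
  unfolding jacobi_identity_iff
  using jac_identity[OF w y, unfolded jac1_def[abs_def] jac2_def[abs_def] jac3_def[abs_def]]
  by blast

theorem adjoint_intertwining: "log_intertwining_operator V W1 Y Xd adjoint"
  unfolding log_intertwining_operator_def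
  using adjoint_outside adjoint_linear adjoint_linear_left adjoint_finite adjoint_truncated adjoint_jacobi
    adjoint_derivative adjoint_sl2
  by (intro conjI allI ballI impI) blast+

theorem adjoint_compatible: "grading_compatible W1 Y Xd adjoint"
  unfolding grading_compatible_def using adjoint_grade by blast

text \<open>The construction is applied to \<open>adjoint\<close> itself with the pairs exchanged,
  and the two twists cancel at each z. The statement stops at the matrix coefficient, which is the
  form in which \<open>contragredient_operator\<close> presents it.\<close>

theorem adjoint_adjoint:
  assumes w: "w \<in> mspace W1" and x: "x \<in> mspace X" and y: "y \<in> mspace Y"
  shows "C x (apply_series (\<lambda>u. invert_x_log (adjoint u y)) (twisted_argument (- r - 1) W1 w) e) = B y (I w x e)"
proof -
  interpret J: adjoint_intertwiner A V W1 Y Yd X Xd C B adjoint "- r - 1"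
    by unfold_locales (rule adjoint_intertwining, rule adjoint_compatible)
  have coef: "J.coef u y x = adj_coef u y x" if "u \<in> mspace W1" for u
    using adjoint_spec[OF that y x] by (auto simp: J.coef_def)
  have ev: "J.ev z u y x = ev (- z) (T z u) x y" if "u \<in> mspace W1" for u z
    by (simp add: J.ev_def coef[OF that] evalx_adj_coef[OF that x y])
  have "J.adj_coef w x y = coef w x y"
  proof (rule evalx_eqD[OF J.adj_coef_finite[OF w y x] coef_finite[OF w x y]])
    fix z
    have "evalx z (J.adj_coef w x y) = J.ev (- z) (twist W1 (- r - 1) z w) y x"
      by (rule J.evalx_adj_coef[OF w y x])
    also have "\<dots> = ev z (T (- z) (twist W1 (- r - 1) z w)) x y"
      using ev[OF W1.twist_mspace[OF w], of "- z"] by simp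
    also have "T (- z) (twist W1 (- r - 1) z w) = w"
      using W1.twist_inverse[OF w, of "- r - 1" z] by simp
    finally show "evalx z (J.adj_coef w x y) = evalx z (coef w x y)" by (simp add: ev_def)
  qed
  from fun_cong[OF this, of e] show ?thesis by (simp add: J.adj_coef_def J.adj_def coef_def)
qed

end

subsection \<open>Contragredient modules\<close>

context sg_module
begin

abbreviation (input) W' :: "('v, 'w \<Rightarrow> complex, 'g) module_structure"
  where "W' \<equiv> contragredient V W"

lemma contragredient_simps:
  "mspace W' = cvec.span (\<Union>\<beta> n. dual_component W \<beta> n)"
  "weight_mod W' n = cvec.span (\<Union>\<beta>. dual_component W \<beta> n)"
  "grade_mod W' \<beta> = cvec.span (\<Union>n. dual_component W \<beta> n)"
  "module_op W' v f e w = (if w \<in> mspace W then f (opposite_op V W v w e) else 0)"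
  "L_mod W' j f w = (if w \<in> mspace W then f (L_mod W (- j) w) else 0)"
  by (simp_all add: contragredient_def opposite_op_def)

sublocale sg_premodule A V W ..

lemma dual_componentI:
  assumes "clinear_on (mspace W) UNIV f" "\<And>w. w \<notin> mspace W \<Longrightarrow> f w = 0"
    "\<And>\<gamma> m w. (\<gamma>, m) \<noteq> (- \<beta>, n) \<Longrightarrow> w \<in> bihom W \<gamma> m \<Longrightarrow> f w = 0"
  shows "f \<in> dual_component W \<beta> n"
  using assms unfolding dual_component_def bihom_def by blast

lemma dual_componentD:
  assumes "f \<in> dual_component W \<beta> n"
  shows "clinear_on (mspace W) UNIV f" "w \<notin> mspace W \<Longrightarrow> f w = 0"
    "(\<gamma>, m) \<noteq> (- \<beta>, n) \<Longrightarrow> w \<in> bihom W \<gamma> m \<Longrightarrow> f w = 0"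
  using assms unfolding dual_component_def bihom_def by blast+

lemma subspace_functionals: "cvec.subspace {f. clinear_on (mspace W) UNIV f \<and> (\<forall>w. w \<notin> mspace W \<longrightarrow> f w = (0::complex))}"
  by (rule cvec.subspaceI) (auto simp: clinear_on_def algebra_simps)

lemma subspace_vanishing: "cvec.subspace {f :: 'w \<Rightarrow> complex. \<forall>w\<in>S. f w = 0}"
  by (rule cvec.subspaceI) auto

lemma subspace_dual_component: "cvec.subspace (dual_component W \<beta> n)"
proof -
  have "dual_component W \<beta> n = {f. clinear_on (mspace W) UNIV f \<and> (\<forall>w. w \<notin> mspace W \<longrightarrow> f w = 0)}
    \<inter> {f. \<forall>w\<in>(\<Union>(\<gamma>, m)\<in>- {(- \<beta>, n)}. bihom W \<gamma> m). f w = 0}"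
    unfolding dual_component_def bihom_def by auto
  then show ?thesis
    by (simp only: cvec.subspace_inter[OF subspace_functionals subspace_vanishing])
qed

lemma contragredient_mspaceD:
  assumes "f \<in> mspace W'"
  shows "clinear_on (mspace W) UNIV f" "w \<notin> mspace W \<Longrightarrow> f w = 0"
proof -
  have "mspace W' \<subseteq> {f. clinear_on (mspace W) UNIV f \<and> (\<forall>w. w \<notin> mspace W \<longrightarrow> f w = 0)}"
    unfolding contragredient_simps
    by (rule cvec.span_minimal[OF _ subspace_functionals]) (use dual_componentD in blast)
  with assms show "clinear_on (mspace W) UNIV f" "w \<notin> mspace W \<Longrightarrow> f w = 0" by auto
qed

lemma dual_component_subset: "dual_component W \<beta> n \<subseteq> mspace W'"
  "dual_component W \<beta> n \<subseteq> grade_mod W' \<beta>" "dual_component W \<beta> n \<subseteq> weight_mod W' n"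
  unfolding contragredient_simps by (auto intro: cvec.span_base)

text \<open>The gradings of W' are spans of dual components, so their intersection has to be
  identified: functionals of one grade vanish on all other grades of W, those of one weight on all
  other weights, and both conditions together define the dual component.\<close>

lemma bihom_contragredient: "bihom W' \<beta> n = dual_component W \<beta> n"
proof
  show "dual_component W \<beta> n \<subseteq> bihom W' \<beta> n"
    using dual_component_subset by (auto simp: bihom_def)
  have g: "grade_mod W' \<beta> \<subseteq> {f. \<forall>w\<in>(\<Union>\<gamma>\<in>- {- \<beta>}. \<Union>m. bihom W \<gamma> m). f w = 0}"
    unfolding contragredient_simps
    by (rule cvec.span_minimal[OF _ subspace_vanishing]) (use dual_componentD(3) in blast)
  have n: "weight_mod W' n \<subseteq> {f. \<forall>w\<in>(\<Union>\<gamma>. \<Union>m\<in>- {n}. bihom W \<gamma> m). f w = 0}"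
    unfolding contragredient_simps
    by (rule cvec.span_minimal[OF _ subspace_vanishing]) (use dual_componentD(3) in blast)
  have m: "grade_mod W' \<beta> \<subseteq> mspace W'"
    unfolding contragredient_simps by (rule cvec.span_mono) blast
  show "bihom W' \<beta> n \<subseteq> dual_component W \<beta> n"
  proof
    fix f assume "f \<in> bihom W' \<beta> n"
    then have f: "f \<in> grade_mod W' \<beta>" "f \<in> weight_mod W' n" by (auto simp: bihom_def)
    show "f \<in> dual_component W \<beta> n"
    proof (rule dual_componentI)
      show "f w = 0" if "(\<gamma>, m) \<noteq> (- \<beta>, n)" "w \<in> bihom W \<gamma> m" for \<gamma> m w
        using that f g n by blast
    qed (use f m contragredient_mspaceD in auto)
  qed
qed

lemma functional_eqI:
  assumes f: "clinear_on (mspace W) UNIV f" "\<And>w. w \<notin> mspace W \<Longrightarrow> f w = 0"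
    and g: "clinear_on (mspace W) UNIV g" "\<And>w. w \<notin> mspace W \<Longrightarrow> g w = 0"
    and eq: "\<And>\<gamma> m w. w \<in> bihom W \<gamma> m \<Longrightarrow> f w = g w"
  shows "f = (g :: 'w \<Rightarrow> complex)"
proof
  fix w
  show "f w = g w"
  proof (cases "w \<in> mspace W")
    case True
    then show ?thesis
    proof (induction w rule: mspace_induct)
      case (add u w)
      then show ?case using clinear_onD(2)[OF f(1) add(1,2)] clinear_onD(2)[OF g(1) add(1,2)] by simp
    qed (rule eq)
  qed (simp add: f(2) g(2))
qed

lemma dual_component_eqI:
  assumes "f \<in> dual_component W \<beta> n" "g \<in> dual_component W \<beta> n" "\<And>w. w \<in> bihom W (- \<beta>) n \<Longrightarrow> f w = g w"
  shows "f = g"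
proof (rule functional_eqI)
  show "f w = g w" if "w \<in> bihom W \<gamma> m" for \<gamma> m w
    using assms(3) dual_componentD(3)[OF assms(1) _ that] dual_componentD(3)[OF assms(2) _ that] that
    by (cases "(\<gamma>, m) = (- \<beta>, n)") auto
qed (use assms dual_componentD in auto)

text \<open>Projection onto a bigraded component in two stages, because the decompositions by grade
  and, within a grade, by weight are given as separate direct sums.\<close>

definition proj :: "'g \<Rightarrow> complex \<Rightarrow> 'w \<Rightarrow> 'w"
  where "proj \<beta> n w = homogeneous_component (\<lambda>n. bihom W \<beta> n) (homogeneous_component (grade_mod W) w \<beta>) n"

lemma grade_component: "w \<in> mspace W \<Longrightarrow> homogeneous_component (grade_mod W) w \<beta> \<in> grade_mod W \<beta>"
  using homogeneous_component_in(1)[OF mod_grade_direct_sum] by (auto simp: graded_families_def)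

lemma proj_in: "w \<in> mspace W \<Longrightarrow> proj \<beta> n w \<in> bihom W \<beta> n"
  unfolding proj_def
  using homogeneous_component_in(1)[OF mod_bigrade_direct_sum grade_component] by (auto simp: graded_families_def)

lemma proj_add: "u \<in> mspace W \<Longrightarrow> w \<in> mspace W \<Longrightarrow> proj \<beta> n (u + w) = proj \<beta> n u + proj \<beta> n w"
  by (simp add: proj_def homogeneous_component_add[OF mod_grade_direct_sum]
      homogeneous_component_add[OF mod_bigrade_direct_sum] grade_component)

lemma proj_scaleC: "w \<in> mspace W \<Longrightarrow> proj \<beta> n (c *\<^sub>C w) = c *\<^sub>C proj \<beta> n w"
  by (simp add: proj_def homogeneous_component_scaleC[OF mod_grade_direct_sum]
      homogeneous_component_scaleC[OF mod_bigrade_direct_sum] grade_component)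

lemma proj_bihom:
  assumes "w \<in> bihom W \<gamma> m"
  shows "proj \<beta> n w = (if (\<gamma>, m) = (\<beta>, n) then w else 0)"
proof -
  have g: "homogeneous_component (grade_mod W) w = (\<lambda>\<beta>. if \<beta> = \<gamma> then w else 0)"
    by (rule homogeneous_component_single[OF mod_grade_direct_sum]) (use assms in \<open>simp add: bihom_def\<close>)
  show ?thesis
  proof (cases "\<beta> = \<gamma>")
    case True
    then show ?thesis
      using homogeneous_component_single[OF mod_bigrade_direct_sum assms] by (auto simp: proj_def g)
  next
    case False
    have "0 \<in> bihom W \<beta> 0" by (rule cvec.subspace_0[OF subspace_bihom])
    from homogeneous_component_single[OF mod_bigrade_direct_sum this] False show ?thesis
      by (auto simp: proj_def g)
  qed
qed

lemma proj_separates: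
  assumes w: "w \<in> mspace W" and z: "\<And>\<beta> n. proj \<beta> n w = 0"
  shows "w = 0"
proof -
  have "homogeneous_component (grade_mod W) w \<beta> = 0" for \<beta>
  proof -
    have "Sum_any (\<lambda>n. proj \<beta> n w) = homogeneous_component (grade_mod W) w \<beta>"
      unfolding proj_def
      using homogeneous_component_in(2)[OF mod_bigrade_direct_sum grade_component[OF w]] by simp
    then show ?thesis by (simp add: z)
  qed
  then have "Sum_any (homogeneous_component (grade_mod W) w) = 0"
    by (simp add: Sum_any.expand_set)
  then show ?thesis using homogeneous_component_in(2)[OF mod_grade_direct_sum w] by simp
qed

text \<open>The functionals are the coordinates of the projection with respect to a basis of the
  component, which is finite by finite-dimensionality. They yield the finite dimension of dual
  components, the representability of functionals on W', and the separation of points of W.\<close>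

lemma dual_basis:
  obtains S F where "finite S" "S \<subseteq> bihom W \<beta> n" "\<And>b. F b \<in> dual_component W (- \<beta>) n"
    "\<And>w. w \<in> mspace W \<Longrightarrow> proj \<beta> n w = (\<Sum>b\<in>S. F b w *\<^sub>C b)"
proof -
  obtain T where T: "finite T" "cvec.span T = bihom W \<beta> n"
    using bihom_finite_dimensional unfolding finite_dimensional_def by blast
  obtain S where S: "S \<subseteq> bihom W \<beta> n" "cvec.independent S" "bihom W \<beta> n \<subseteq> cvec.span S"
    using cvec.maximal_independent_subset by blast
  have fin: "finite S"
    using cvec.independent_span_bound[OF T(1) S(2)] S(1) T(2) by blast
  have span: "proj \<beta> n w \<in> cvec.span S" if "w \<in> mspace W" for w
    using proj_in[OF that] S(3) by blast
  define F where "F b w = (if w \<in> mspace W then cvec.representation S (proj \<beta> n w) b else 0)" for b w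
  have "F b \<in> dual_component W (- \<beta>) n" for b
  proof (rule dual_componentI)
    show "clinear_on (mspace W) UNIV (F b)"
      unfolding clinear_on_def F_def
      using cvec.subspace_add[OF mod_subspace] cvec.subspace_scale[OF mod_subspace]
      by (simp add: proj_add proj_scaleC cvec.representation_add[OF S(2) span span]
          cvec.representation_scale[OF S(2) span])
    show "F b w = 0" if "(\<gamma>, m) \<noteq> (- (- \<beta>), n)" "w \<in> bihom W \<gamma> m" for \<gamma> m w
    proof -
      have "proj \<beta> n w = 0" using proj_bihom[OF that(2), of \<beta> n] that(1) by auto
      then show ?thesis by (simp add: F_def cvec.representation_zero)
    qed
  qed (simp add: F_def)
  moreover have "proj \<beta> n w = (\<Sum>b\<in>S. F b w *\<^sub>C b)" if "w \<in> mspace W" for w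
    using cvec.sum_representation_eq[OF S(2) span[OF that] fin subset_refl] that by (simp add: F_def)
  ultimately show thesis using that fin S(1) by blast
qed

lemma dual_component_expand:
  assumes f: "f \<in> dual_component W (- \<beta>) n" and S: "S \<subseteq> bihom W \<beta> n"
    and F: "\<And>b. F b \<in> dual_component W (- \<beta>) n"
    and proj: "\<And>w. w \<in> mspace W \<Longrightarrow> proj \<beta> n w = (\<Sum>b\<in>S. F b w *\<^sub>C b)"
  shows "f = (\<Sum>b\<in>S. f b *\<^sub>C F b)"
proof (rule dual_component_eqI[OF f])
  show "(\<Sum>b\<in>S. f b *\<^sub>C F b) \<in> dual_component W (- \<beta>) n"
    by (intro cvec.subspace_sum[OF subspace_dual_component] cvec.subspace_scale[OF subspace_dual_component] F)
  fix w assume w: "w \<in> bihom W (- (- \<beta>)) n"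
  then have wm: "w \<in> mspace W" using bihom_subset_mspace by blast
  have Sm: "b \<in> mspace W" if "b \<in> S" for b using that S bihom_subset_mspace by blast
  have "w = (\<Sum>b\<in>S. F b w *\<^sub>C b)"
    using proj[OF wm] proj_bihom[OF w, of \<beta> n] by simp
  then have "f w = f (\<Sum>b\<in>S. F b w *\<^sub>C b)" by simp
  also have "\<dots> = (\<Sum>b\<in>S. f (F b w *\<^sub>C b))"
    by (rule clinear_on_sum[OF dual_componentD(1)[OF f] mod_subspace]) (use Sm cvec.subspace_scale[OF mod_subspace] in auto)
  also have "\<dots> = (\<Sum>b\<in>S. f b *\<^sub>C F b) w"
    using clinear_onD(3)[OF dual_componentD(1)[OF f] Sm] by (simp add: sum_fun_apply mult.commute)
  finally show "f w = (\<Sum>b\<in>S. f b *\<^sub>C F b) w" .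
qed

lemma dual_component_finite_dimensional: "finite_dimensional (dual_component W \<beta> n)"
proof -
  obtain S F where S: "finite S" "S \<subseteq> bihom W (- \<beta>) n" "\<And>b. F b \<in> dual_component W (- (- \<beta>)) n"
    "\<And>w. w \<in> mspace W \<Longrightarrow> proj (- \<beta>) n w = (\<Sum>b\<in>S. F b w *\<^sub>C b)"
    using dual_basis by blast
  have "dual_component W \<beta> n \<subseteq> cvec.span (F ` S)"
  proof
    fix f assume "f \<in> dual_component W \<beta> n"
    then have "f = (\<Sum>b\<in>S. f b *\<^sub>C F b)" by (intro dual_component_expand[OF _ S(2-4)]) auto
    also have "\<dots> \<in> cvec.span (F ` S)"
      by (intro cvec.span_sum cvec.span_scale cvec.span_base) auto
    finally show "f \<in> cvec.span (F ` S)" .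
  qed
  moreover have "cvec.span (F ` S) \<subseteq> dual_component W \<beta> n"
    by (rule cvec.span_minimal[OF _ subspace_dual_component]) (use S(3) in auto)
  ultimately show ?thesis unfolding finite_dimensional_def using S(1) by blast
qed

lemma contragredient_induct [consumes 1, case_names hom add]:
  assumes "f \<in> mspace W'" "\<And>\<beta> n f. f \<in> dual_component W \<beta> n \<Longrightarrow> P f"
    "\<And>f g. f \<in> mspace W' \<Longrightarrow> g \<in> mspace W' \<Longrightarrow> P f \<Longrightarrow> P g \<Longrightarrow> P (f + g)"
  shows "P f"
  using assms(1) unfolding contragredient_simps
proof (rule span_sum_induct)
  show "P 0" using assms(2) cvec.subspace_0[OF subspace_dual_component] by blast
  show "c *\<^sub>C x \<in> (\<Union>\<beta> n. dual_component W \<beta> n)" if "x \<in> (\<Union>\<beta> n. dual_component W \<beta> n)" for c x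
    using that by (auto intro: cvec.subspace_scale[OF subspace_dual_component])
  show "P x" if "x \<in> (\<Union>\<beta> n. dual_component W \<beta> n)" for x using that assms(2) by blast
qed (use assms(3) in \<open>unfold contragredient_simps(1), blast\<close>)

section \<open>Operators on the contragredient space\<close>

lemma dual_L_mod:
  assumes j: "j \<in> {-1, 0, 1}" and f: "f \<in> dual_component W \<beta> n"
  shows "L_mod W' j f \<in> dual_component W \<beta> (n - of_int j)"
proof (rule dual_componentI)
  have j': "- j \<in> {-1, 0, 1}" using j by auto
  note fl = dual_componentD(1)[OF f]
  show "clinear_on (mspace W) UNIV (L_mod W' j f)"
    using clinear_onD[OF mod_L_linear[OF j']] clinear_onD[OF fl]
      cvec.subspace_add[OF mod_subspace] cvec.subspace_scale[OF mod_subspace]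
    by (auto simp: clinear_on_def contragredient_simps)
  show "L_mod W' j f w = 0" if "(\<gamma>, m) \<noteq> (- \<beta>, n - of_int j)" "w \<in> bihom W \<gamma> m" for \<gamma> m w
  proof -
    have "L_mod W (- j) w \<in> bihom W \<gamma> (m + of_int j)" using bihom_L_mod[OF j' that(2)] by simp
    moreover have "(\<gamma>, m + of_int j) \<noteq> (- \<beta>, n)" using that(1) by auto
    ultimately show ?thesis using dual_componentD(3)[OF f] by (simp add: contragredient_simps)
  qed
qed (simp add: contragredient_simps)

lemma opposite_op_bihom:
  assumes v: "\<alpha> \<in> A" "v \<in> grade_alg V \<alpha>" "v \<in> weight_alg V h" and w: "w \<in> bihom W \<gamma> m"
  shows "opposite_op V W v w e \<in> bihom W (\<alpha> + \<gamma>) (m - of_int (h + e))"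
proof -
  obtain N where N: "\<And>i. i \<ge> N \<Longrightarrow> (L_alg V 1 ^^ i) v = 0" using L1_alg_nilpotent by blast
  have "opposite_op V W v w e = (\<Sum>i<N. ((-1) powi h / fact i) *\<^sub>C
      module_op W ((L_alg V 1 ^^ i) v) w (int i - 2 * h - e))"
    by (rule opposite_op_hom[OF v(3) _ bihom_mspace[OF w]]) (rule N)
  moreover have "module_op W ((L_alg V 1 ^^ i) v) w (int i - 2 * h - e) \<in> bihom W (\<alpha> + \<gamma>) (m - of_int (h + e))" for i
    using bihom_module_op[OF v(1) L1_pow_alg_grade[OF v(1,2)] L1_pow_alg_weight[OF v(3)] w, of i "int i - 2 * h - e"]
    by (simp add: algebra_simps)
  ultimately show ?thesis by (simp only:) (intro cvec.subspace_sum[OF subspace_bihom] bihom_scaleC)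
qed

lemma dual_module_op:
  assumes v: "\<alpha> \<in> A" "v \<in> grade_alg V \<alpha>" "v \<in> weight_alg V h" and f: "f \<in> dual_component W \<beta> n"
  shows "module_op W' v f e \<in> dual_component W (\<alpha> + \<beta>) (n + of_int (h + e))"
proof (rule dual_componentI)
  note fl = dual_componentD(1)[OF f]
  show "clinear_on (mspace W) UNIV (module_op W' v f e)"
    using clinear_onD[OF opposite_op_linear[of v e]] clinear_onD[OF fl]
      cvec.subspace_add[OF mod_subspace] cvec.subspace_scale[OF mod_subspace]
    by (auto simp: clinear_on_def contragredient_simps)
  show "module_op W' v f e w = 0" if "(\<gamma>, m) \<noteq> (- (\<alpha> + \<beta>), n + of_int (h + e))" "w \<in> bihom W \<gamma> m" for \<gamma> m w
  proof -
    have "\<gamma> = - (\<alpha> + \<beta>)" if "\<alpha> + \<gamma> = - \<beta>"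
      using that by (metis add.commute add_diff_cancel_left' diff_conv_add_uminus minus_add_distrib)
    then have "(\<alpha> + \<gamma>, m - of_int (h + e)) \<noteq> (- \<beta>, n)"
      using that(1) by (auto simp: diff_eq_eq)
    then show ?thesis
      using dual_componentD(3)[OF f _ opposite_op_bihom[OF v that(2)]] by (simp add: contragredient_simps)
  qed
qed (simp add: contragredient_simps)

lemma dual_op_add: "module_op W' (u + v) f e = module_op W' u f e + module_op W' v f e"
  if "f \<in> mspace W'"
  using clinear_onD[OF contragredient_mspaceD(1)[OF that]] clinear_onD[OF opposite_op_linear_left]
  by (auto simp: fun_eq_iff contragredient_simps)

lemma dual_op_linear: "clinear_on (mspace W') (mspace W') (\<lambda>f. module_op W' v f e)"
proof -
  have "module_op W' v f e \<in> mspace W'" if "f \<in> mspace W'" for v f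
    using that
  proof (induction f rule: contragredient_induct)
    case f: (hom \<beta> n f)
    then have fm: "f \<in> mspace W'" using dual_component_subset by blast
    show ?case
    proof (induction v rule: alg_induct)
      case (hom \<alpha> h v)
      then show ?case using dual_module_op[OF hom f] dual_component_subset(1) by blast
    next
      case (add u v)
      then show ?case unfolding dual_op_add[OF fm] by (simp only: contragredient_simps(1) cvec.span_add)
    qed
  next
    case (add f g)
    have "module_op W' v (f + g) e = module_op W' v f e + module_op W' v g e"
      by (auto simp: fun_eq_iff contragredient_simps)
    then show ?case using add(3,4) by (simp only: contragredient_simps(1) cvec.span_add)
  qed
  then show ?thesis by (auto simp: clinear_on_def fun_eq_iff contragredient_simps)
qed

lemma dual_L_linear:
  assumes j: "j \<in> {-1, 0, 1}"
  shows "clinear_on (mspace W') (mspace W') (L_mod W' j)"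
proof -
  have "L_mod W' j f \<in> mspace W'" if "f \<in> mspace W'" for f
    using that
  proof (induction f rule: contragredient_induct)
    case (hom \<beta> n f)
    then show ?case using dual_L_mod[OF j hom] dual_component_subset(1) by blast
  next
    case (add f g)
    have "L_mod W' j (f + g) = L_mod W' j f + L_mod W' j g"
      by (auto simp: fun_eq_iff contragredient_simps)
    then show ?case using add(3,4) by (simp only: contragredient_simps(1) cvec.span_add)
  qed
  then show ?thesis by (auto simp: clinear_on_def fun_eq_iff contragredient_simps)
qed

lemma dual_truncated: "\<exists>K. \<forall>k<K. dual_component W \<beta> (n + of_int k) = {0}"
proof -
  obtain K where K: "\<forall>k<K. bihom W (- \<beta>) (n + of_int k) = {0}" using bihom_truncated by blast
  have "dual_component W \<beta> (n + of_int k) = {0}" if k: "k < K" for k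
  proof -
    have z: "0 \<in> dual_component W \<beta> (n + of_int k)" by (rule cvec.subspace_0[OF subspace_dual_component])
    have "f = 0" if f: "f \<in> dual_component W \<beta> (n + of_int k)" for f
      by (rule dual_component_eqI[OF f z])
        (use K k clinear_on_zero[OF dual_componentD(1)[OF f] mod_subspace] in auto)
    with z show ?thesis by blast
  qed
  then show ?thesis by blast
qed

lemma dual_op_truncated:
  assumes "f \<in> mspace W'"
  shows "\<exists>N. \<forall>e<N. module_op W' v f e = 0"
  using assms
proof (induction f rule: contragredient_induct)
  case f: (hom \<beta> n f)
  then have fm: "f \<in> mspace W'" using dual_component_subset by blast
  show ?case
  proof (induction v rule: alg_induct)
    case (hom \<alpha> h v)
    obtain K where K: "\<forall>k<K. dual_component W (\<alpha> + \<beta>) (n + of_int k) = {0}" using dual_truncated by blast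
    have "module_op W' v f e = 0" if "e < K - h" for e
    proof -
      have "h + e < K" using that by simp
      then show ?thesis using dual_module_op[OF hom f, of e] K by blast
    qed
    then show ?case by blast
  next
    case (add u v)
    then obtain N M where "\<forall>e<N. module_op W' u f e = 0" "\<forall>e<M. module_op W' v f e = 0" by blast
    then have "\<forall>e<min N M. module_op W' (u + v) f e = 0" by (simp add: dual_op_add[OF fm])
    then show ?case by blast
  qed
next
  case (add f g)
  then obtain N M where "\<forall>e<N. module_op W' v f e = 0" "\<forall>e<M. module_op W' v g e = 0" by blast
  then have "\<forall>e<min N M. module_op W' v (f + g) e = 0"
    using clinear_onD(2)[OF dual_op_linear add(1,2)] by simp
  then show ?case by blast
qed

text \<open>Powers of L'(0) - n on \<open>f\<close> are \<open>f\<close> composed with powers of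
  L(0) - n. The order of nilpotency of the latter depends on the vector, but a finite spanning set
  of the component gives one order for all of it.\<close>

lemma dual_L0_nilpotent:
  assumes f: "f \<in> dual_component W \<beta> n"
  shows "\<exists>N. ((\<lambda>u. L_mod W' 0 u - n *\<^sub>C u) ^^ N) f = 0"
proof -
  let ?D = "\<lambda>u. L_mod W 0 u - n *\<^sub>C u" and ?D' = "\<lambda>u. L_mod W' 0 u - n *\<^sub>C u"
  obtain S where S: "finite S" "cvec.span S = bihom W (- \<beta>) n"
    using bihom_finite_dimensional unfolding finite_dimensional_def by blast
  have "\<exists>N. (?D ^^ N) b = 0" if "b \<in> S" for b
    using L0_nilpotent[of b "- \<beta>" n] that cvec.span_base[of b S] S(2) by blast
  then obtain N where N: "\<And>b. b \<in> S \<Longrightarrow> (?D ^^ N b) b = 0" by metis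
  define M where "M = Max (insert 0 (N ` S))"
  have NM: "N b \<le> M" if "b \<in> S" for b unfolding M_def by (rule Max_ge) (use S(1) that in auto)
  have Slin: "(?D ^^ M) b = 0 \<and> b \<in> mspace W" if "b \<in> S" for b
    using funpow_eq_zero_mono[OF clinear_on_minus_scaleC[OF mod_L_linear mod_subspace] mod_subspace N[OF that] NM[OF that]]
      that cvec.span_base[of b S] S(2) bihom_subset_mspace by blast
  have DM: "(?D ^^ M) w = 0" if "w \<in> bihom W (- \<beta>) n" for w
  proof -
    have "w \<in> cvec.span S" using that S(2) by simp
    then have "(?D ^^ M) w = 0 \<and> w \<in> mspace W"
    proof (induction rule: cvec.span_induct_alt)
      case base
      then show ?case using clinear_on_zero[OF L0_part_linear mod_subspace] cvec.subspace_0[OF mod_subspace] by simp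
    next
      case (step c x y)
      then show ?case
        using Slin[of x] clinear_onD(2,3)[OF L0_part_linear[where n = n and m = M]]
          cvec.subspace_add[OF mod_subspace] cvec.subspace_scale[OF mod_subspace] by simp
    qed
    then show ?thesis by simp
  qed
  have pow: "(?D' ^^ k) f \<in> dual_component W \<beta> n \<and> (\<forall>w\<in>mspace W. (?D' ^^ k) f w = f ((?D ^^ k) w))" for k
  proof (induction k)
    case 0
    then show ?case using f by simp
  next
    case (Suc k)
    let ?g = "(?D' ^^ k) f"
    have g: "?g \<in> dual_component W \<beta> n" using Suc by blast
    have "L_mod W' 0 ?g \<in> dual_component W \<beta> n" using dual_L_mod[OF _ g, of 0] by simp
    then have "?D' ?g \<in> dual_component W \<beta> n"
      by (intro cvec.subspace_diff[OF subspace_dual_component] cvec.subspace_scale[OF subspace_dual_component] g)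
    moreover have "?D' ?g w = f ((?D ^^ Suc k) w)" if w: "w \<in> mspace W" for w
    proof -
      have L0: "L_mod W 0 w \<in> mspace W" using clinear_onD(1)[OF mod_L_linear w] by simp
      have Dw: "?D w \<in> mspace W"
        by (rule cvec.subspace_diff[OF mod_subspace L0 cvec.subspace_scale[OF mod_subspace w]])
      note gl = dual_componentD(1)[OF g]
      have "?D' ?g w = ?g (L_mod W 0 w) - n * ?g w" using w by (simp add: contragredient_simps)
      also have "\<dots> = ?g (?D w)"
        using clinear_on_diff[OF gl mod_subspace L0 cvec.subspace_scale[OF mod_subspace w]] clinear_onD(3)[OF gl w]
        by simp
      also have "\<dots> = f ((?D ^^ k) (?D w))" using Suc Dw by blast
      finally show ?thesis by (simp only: funpow_Suc_right o_apply)
    qed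
    ultimately show ?case unfolding funpow.simps o_apply by blast
  qed
  have "(?D' ^^ M) f = 0"
  proof (rule dual_component_eqI[OF conjunct1[OF pow] cvec.subspace_0[OF subspace_dual_component]])
    fix w assume w: "w \<in> bihom W (- \<beta>) n"
    have "(?D' ^^ M) f w = f ((?D ^^ M) w)" using pow[of M] bihom_mspace[OF w] by blast
    then show "(?D' ^^ M) f w = 0 w"
      using DM[OF w] clinear_on_zero[OF dual_componentD(1)[OF f] mod_subspace] by simp
  qed
  then show ?thesis by blast
qed

lemma contragredient_premodule: "premodule W'"
proof
  show "cvec.subspace (mspace W')" by (simp add: contragredient_simps)
  show "mspace W' = cvec.span (\<Union>\<beta> n. bihom W' \<beta> n)" "grade_mod W' \<beta> = cvec.span (\<Union>n. bihom W' \<beta> n)" for \<beta>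
    unfolding bihom_contragredient by (simp_all add: contragredient_simps)
  show "clinear_on UNIV (mspace W') (\<lambda>v. module_op W' v f e)" if f: "f \<in> mspace W'" for f e
    using clinear_onD(1)[OF dual_op_linear f] clinear_onD(3)[OF contragredient_mspaceD(1)[OF f]] dual_op_add[OF f]
      clinear_onD[OF opposite_op_linear_left]
    by (auto simp: clinear_on_def fun_eq_iff contragredient_simps(4))
qed (use subspace_dual_component dual_truncated dual_component_finite_dimensional dual_L_linear
    dual_L0_nilpotent dual_op_linear dual_op_truncated in \<open>simp_all add: bihom_contragredient\<close>)

section \<open>Reflexivity and the two pairings\<close>

lemma grade_pairing:
  assumes "f \<in> grade_mod W' \<beta>" "w \<in> grade_mod W \<gamma>" "\<gamma> \<noteq> - \<beta>"
  shows "f w = 0"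
proof -
  have fm: "f \<in> mspace W'"
    using assms(1) cvec.span_mono[of "\<Union>n. dual_component W \<beta> n" "\<Union>\<beta> n. dual_component W \<beta> n"]
    unfolding contragredient_simps by blast
  have hom: "grade_mod W' \<beta> \<subseteq> {f. \<forall>w\<in>(\<Union>m. bihom W \<gamma> m). f w = 0}"
    unfolding contragredient_simps
    by (rule cvec.span_minimal[OF _ subspace_vanishing]) (use assms(3) dual_componentD(3) in blast)
  from assms(2) show ?thesis
  proof (induction w rule: grade_induct)
    case (hom n w)
    then show ?case using hom assms(1) \<open>grade_mod W' \<beta> \<subseteq> _\<close> by blast
  next
    case (add u w)
    have "u \<in> mspace W" "w \<in> mspace W" using add(1,2) grade_subset_mspace by blast+
    from clinear_onD(2)[OF contragredient_mspaceD(1)[OF fm] this] add(3,4) show ?case by simp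
  qed
qed

text \<open>Reflexivity of a finite-dimensional component: a functional on W' that sees only one
  dual component is determined by its values on a dual basis there.\<close>

lemma functional_representable:
  assumes \<phi>: "clinear_on (mspace W') UNIV \<phi>"
    and z: "\<And>\<gamma> m f. (\<gamma>, m) \<noteq> (\<beta>, l) \<Longrightarrow> f \<in> dual_component W \<gamma> m \<Longrightarrow> \<phi> f = 0"
  shows "\<exists>w\<in>bihom W (- \<beta>) l. \<forall>f\<in>mspace W'. f w = \<phi> f"
proof -
  have sub: "cvec.subspace (mspace W')" by (simp add: contragredient_simps)
  obtain S F where S: "finite S" "S \<subseteq> bihom W (- \<beta>) l" "\<And>b. F b \<in> dual_component W (- (- \<beta>)) l"
    "\<And>w. w \<in> mspace W \<Longrightarrow> proj (- \<beta>) l w = (\<Sum>b\<in>S. F b w *\<^sub>C b)"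
    using dual_basis by blast
  have Sm: "b \<in> mspace W" if "b \<in> S" for b using that S(2) bihom_subset_mspace by blast
  have Fm: "F b \<in> mspace W'" for b using S(3) dual_component_subset(1) by blast
  \<comment> \<open>The combination of the basis vectors whose coordinates are the prescribed values
    on the dual basis.\<close>
  define w where "w = (\<Sum>b\<in>S. \<phi> (F b) *\<^sub>C b)"
  have w: "w \<in> bihom W (- \<beta>) l"
    unfolding w_def using S(2) by (intro cvec.subspace_sum[OF subspace_bihom] bihom_scaleC) auto
  have "f w = \<phi> f" if "f \<in> mspace W'" for f
    using that
  proof (induction f rule: contragredient_induct)
    case (hom \<gamma> m f)
    show ?case
    proof (cases "(\<gamma>, m) = (\<beta>, l)")
      case True
      then have f: "f \<in> dual_component W (- (- \<beta>)) l" using hom by simp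
      have "\<phi> f = \<phi> (\<Sum>b\<in>S. f b *\<^sub>C F b)"
        using dual_component_expand[OF f S(2-4)] by simp
      also have "\<dots> = (\<Sum>b\<in>S. \<phi> (f b *\<^sub>C F b))"
        by (rule clinear_on_sum[OF \<phi> sub]) (rule cvec.subspace_scale[OF sub Fm])
      also have "\<dots> = (\<Sum>b\<in>S. f (\<phi> (F b) *\<^sub>C b))"
        using clinear_onD(3)[OF \<phi> Fm] clinear_onD(3)[OF dual_componentD(1)[OF f] Sm] by (simp add: mult.commute)
      also have "\<dots> = f w"
        unfolding w_def
        by (rule clinear_on_sum[OF dual_componentD(1)[OF f] mod_subspace, symmetric])
          (use Sm cvec.subspace_scale[OF mod_subspace] in auto)
      finally show ?thesis by simp
    next
      case False
      have "(- \<beta>, l) \<noteq> (- \<gamma>, m)" using False by auto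
      then show ?thesis using z[OF False hom] dual_componentD(3)[OF hom _ w] by simp
    qed
  next
    case (add f g)
    have "(f + g) w = f w + g w" by simp
    also have "\<dots> = \<phi> (f + g)" by (simp only: add(3,4) clinear_onD(2)[OF \<phi> add(1,2)])
    finally show ?case .
  qed
  with w show ?thesis by blast
qed

lemma functionals_separate:
  assumes w: "w \<in> mspace W" and z: "\<And>f. f \<in> mspace W' \<Longrightarrow> f w = 0"
  shows "w = 0"
proof (rule proj_separates[OF w])
  fix \<beta> n
  obtain S F where S: "finite S" "S \<subseteq> bihom W \<beta> n" "\<And>b. F b \<in> dual_component W (- \<beta>) n"
    "\<And>w. w \<in> mspace W \<Longrightarrow> proj \<beta> n w = (\<Sum>b\<in>S. F b w *\<^sub>C b)"
    using dual_basis by blast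
  have "F b w = 0" for b using z S(3) dual_component_subset(1) by blast
  then show "proj \<beta> n w = 0" using S(4)[OF w] by simp
qed

lemma pairing_contragredient: "pairing A V W W' (\<lambda>w f. f w)"
proof -
  interpret W': premodule W' by (rule contragredient_premodule)
  show ?thesis
  proof
    show "\<exists>f\<in>grade_mod W' (- \<beta>). \<forall>w\<in>mspace W. f w = \<phi> w"
      if \<phi>: "clinear_on (mspace W) UNIV \<phi>"
        and z: "\<And>\<gamma> m w. (\<gamma>, m) \<noteq> (\<beta>, l) \<Longrightarrow> w \<in> bihom W \<gamma> m \<Longrightarrow> \<phi> w = 0" for \<phi> \<beta> l
    proof -
      define f where "f w = (if w \<in> mspace W then \<phi> w else 0)" for w
      have "f \<in> dual_component W (- \<beta>) l"
      proof (rule dual_componentI)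
        show "clinear_on (mspace W) UNIV f"
          using \<phi> cvec.subspace_add[OF mod_subspace] cvec.subspace_scale[OF mod_subspace]
          by (auto simp: clinear_on_def f_def)
        show "f w = 0" if "(\<gamma>, m) \<noteq> (- (- \<beta>), l)" "w \<in> bihom W \<gamma> m" for \<gamma> m w
          using z[of \<gamma> m w] that by (simp add: f_def)
      qed (simp add: f_def)
      then have "f \<in> grade_mod W' (- \<beta>)" using dual_component_subset(2) by blast
      moreover have "\<forall>w\<in>mspace W. f w = \<phi> w" by (simp add: f_def)
      ultimately show ?thesis by blast
    qed
    show "f = 0" if "f \<in> mspace W'" "\<And>y. y \<in> mspace W \<Longrightarrow> f y = 0" for f
      using that contragredient_mspaceD(2)[OF that(1)] by (auto simp: fun_eq_iff)
    show "f w = 0" if "w \<in> grade_mod W \<beta>" "f \<in> grade_mod W' \<gamma>" "\<gamma> \<noteq> - \<beta>" for w f \<beta> \<gamma>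
    proof -
      have "\<beta> \<noteq> - \<gamma>" using that(3) by (metis minus_minus)
      then show ?thesis by (rule grade_pairing[OF that(2,1)])
    qed
  qed (use contragredient_mspaceD in \<open>auto simp: contragredient_simps(4,5) clinear_on_def\<close>)
qed

text \<open>In this direction the adjointness of modes is not the definition of W' but the
  involutivity of the opposite operator. Nondegeneracy and representability rest on the dual
  bases.\<close>

lemma pairing_contragredient': "pairing A V W' W (\<lambda>f w. f w)"
proof -
  interpret W': premodule W' by (rule contragredient_premodule)
  interpret W': sg_premodule A V W' ..
  show ?thesis
  proof
    show "\<exists>w\<in>grade_mod W (- \<beta>). \<forall>f\<in>mspace W'. f w = \<phi> f"
      if "clinear_on (mspace W') UNIV \<phi>"
        and "\<And>\<gamma> m f. (\<gamma>, m) \<noteq> (\<beta>, l) \<Longrightarrow> f \<in> bihom W' \<gamma> m \<Longrightarrow> \<phi> f = 0" for \<phi> \<beta> l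
      using functional_representable[of \<phi> \<beta> l] that bihom_subset_grade unfolding bihom_contragredient by blast
    show "f (module_op W v w n) = opposite_op V W' v f n w"
      if v: "\<alpha> \<in> A" "v \<in> grade_alg V \<alpha>" "v \<in> weight_alg V h" and f: "f \<in> mspace W'" and w: "w \<in> mspace W"
      for \<alpha> v h f w n
    proof -
      obtain N where N: "\<And>i. i \<ge> N \<Longrightarrow> (L_alg V 1 ^^ i) v = 0" using L1_alg_nilpotent by blast
      note fl = contragredient_mspaceD(1)[OF f]
      have opm: "opposite_op V W u w e \<in> mspace W" for u e by (rule clinear_onD(1)[OF opposite_op_linear w])
      have "opposite_op V W' v f n = (\<Sum>i<N. ((-1) powi h / fact i) *\<^sub>C
          module_op W' ((L_alg V 1 ^^ i) v) f (int i - 2 * h - n))"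
        by (rule W'.opposite_op_hom[OF v(3) _ f]) (rule N)
      then have "opposite_op V W' v f n w = (\<Sum>i<N. ((-1) powi h / fact i) *
          f (opposite_op V W ((L_alg V 1 ^^ i) v) w (int i - 2 * h - n)))"
        using w by (simp add: sum_fun_apply contragredient_simps(4))
      also have "\<dots> = (\<Sum>i<N. f (((-1) powi h / fact i) *\<^sub>C
          opposite_op V W ((L_alg V 1 ^^ i) v) w (int i - 2 * h - n)))"
        using clinear_onD(3)[OF fl opm] by simp
      also have "\<dots> = f (\<Sum>i<N. ((-1) powi h / fact i) *\<^sub>C
          opposite_op V W ((L_alg V 1 ^^ i) v) w (int i - 2 * h - n))"
        by (rule clinear_on_sum[OF fl mod_subspace, symmetric]) (rule cvec.subspace_scale[OF mod_subspace opm])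
      also have "(\<Sum>i<N. ((-1) powi h / fact i) *\<^sub>C
          opposite_op V W ((L_alg V 1 ^^ i) v) w (int i - 2 * h - n)) = module_op W v w n"
        by (rule opposite_op_opposite_op[OF v(3) _ w]) (rule N)
      finally show ?thesis by simp
    qed
    show "w = 0" if "w \<in> mspace W" "\<And>f. f \<in> mspace W' \<Longrightarrow> f w = 0" for w
      by (rule functionals_separate) (use that in auto)
    show "f w = 0" if "f \<in> grade_mod W' \<beta>" "w \<in> grade_mod W \<gamma>" "\<gamma> \<noteq> - \<beta>" for f w \<beta> \<gamma>
      by (rule grade_pairing[OF that])
  qed (use contragredient_mspaceD in \<open>auto simp: contragredient_simps(5) clinear_on_def\<close>)
qed

text \<open>Injective because W' separates points. Surjective because the image is a subspace
  containing each dual component of W', whose members are represented by vectors of W.\<close>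

lemma to_bidual_bij: "bij_betw (to_bidual V W) (mspace W) (mspace (contragredient V W'))"
proof -
  let ?b = "to_bidual V W" and ?W'' = "contragredient V W'"
  have sub: "cvec.subspace (mspace W')" by (simp add: contragredient_simps)
  have m'': "mspace ?W'' = cvec.span (\<Union>\<beta> n. dual_component W' \<beta> n)"
    by (simp add: contragredient_def)
  have add: "?b (u + w) = ?b u + ?b w" if "u \<in> mspace W" "w \<in> mspace W" for u w
    using that clinear_onD(2)[OF contragredient_mspaceD(1)] by (auto simp: to_bidual_def fun_eq_iff)
  have scale: "?b (c *\<^sub>C w) = c *\<^sub>C ?b w" if "w \<in> mspace W" for c w
    using that clinear_onD(3)[OF contragredient_mspaceD(1)] by (auto simp: to_bidual_def fun_eq_iff)
  have "?b w \<in> mspace ?W''" if "w \<in> mspace W" for w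
    using that
  proof (induction w rule: mspace_induct)
    case (hom \<beta> n w)
    have "?b w \<in> dual_component W' \<beta> n"
      unfolding dual_component_def
    proof (intro CollectI conjI allI impI ballI)
      show "clinear_on (mspace W') UNIV (?b w)"
        using cvec.subspace_add[OF sub] cvec.subspace_scale[OF sub]
        by (auto simp: clinear_on_def to_bidual_def)
      fix \<gamma> m f
      assume "(\<gamma>, m) \<noteq> (- \<beta>, n)" "f \<in> grade_mod W' \<gamma> \<inter> weight_mod W' m"
      then have f: "f \<in> dual_component W \<gamma> m" and ne: "(\<beta>, n) \<noteq> (- \<gamma>, m)"
        by (auto simp: bihom_contragredient[symmetric] bihom_def)
      show "?b w f = 0" using dual_componentD(3)[OF f ne hom] by (simp add: to_bidual_def)
    qed (simp add: to_bidual_def)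
    then show ?case unfolding m'' by (blast intro: cvec.span_base)
  next
    case (add u w)
    then show ?case using \<open>\<And>u w. u \<in> mspace W \<Longrightarrow> w \<in> mspace W \<Longrightarrow> ?b (u + w) = ?b u + ?b w\<close>
      unfolding m'' using add by (simp only: cvec.span_add)
  qed
  moreover have "inj_on ?b (mspace W)"
  proof (rule inj_onI)
    fix u w assume u: "u \<in> mspace W" and w: "w \<in> mspace W" and eq: "?b u = ?b w"
    have "u - w = 0"
    proof (rule functionals_separate[OF cvec.subspace_diff[OF mod_subspace u w]])
      fix f assume f: "f \<in> mspace W'"
      have "f u = f w" using fun_cong[OF eq, of f] f by (simp add: to_bidual_def)
      then show "f (u - w) = 0"
        using clinear_on_diff[OF contragredient_mspaceD(1)[OF f] mod_subspace u w] by simp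
    qed
    then show "u = w" by simp
  qed
  moreover have "mspace ?W'' \<subseteq> ?b ` mspace W"
    unfolding m''
  proof (rule cvec.span_minimal)
    show "cvec.subspace (?b ` mspace W)"
    proof (rule cvec.subspaceI)
      have "?b 0 = 0" using add[OF cvec.subspace_0[OF mod_subspace] cvec.subspace_0[OF mod_subspace]] by simp
      then show "0 \<in> ?b ` mspace W" using cvec.subspace_0[OF mod_subspace] by (metis imageI)
    next
      fix x y assume "x \<in> ?b ` mspace W" "y \<in> ?b ` mspace W"
      then obtain u w where "u \<in> mspace W" "w \<in> mspace W" "x = ?b u" "y = ?b w" by blast
      then show "x + y \<in> ?b ` mspace W" using add cvec.subspace_add[OF mod_subspace] by (metis imageI)
    next
      fix c x assume "x \<in> ?b ` mspace W"
      then obtain w where "w \<in> mspace W" "x = ?b w" by blast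
      then show "c *\<^sub>C x \<in> ?b ` mspace W" using scale cvec.subspace_scale[OF mod_subspace] by (metis imageI)
    qed
    show "(\<Union>\<beta> n. dual_component W' \<beta> n) \<subseteq> ?b ` mspace W"
    proof clarify
      fix \<beta> n \<phi> assume \<phi>: "\<phi> \<in> dual_component W' \<beta> n"
      then have lin: "clinear_on (mspace W') UNIV \<phi>" and out: "\<And>f. f \<notin> mspace W' \<Longrightarrow> \<phi> f = 0"
        and van: "\<And>\<gamma> m f. (\<gamma>, m) \<noteq> (- \<beta>, n) \<Longrightarrow> f \<in> dual_component W \<gamma> m \<Longrightarrow> \<phi> f = 0"
        unfolding dual_component_def[of W'] bihom_def[symmetric] bihom_contragredient by blast+
      obtain w where w: "w \<in> bihom W (- (- \<beta>)) n" "\<forall>f\<in>mspace W'. f w = \<phi> f"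
        using functional_representable[OF lin, of "- \<beta>" n] van by blast
      then have "\<phi> = ?b w" by (auto simp: to_bidual_def fun_eq_iff out)
      then show "\<phi> \<in> ?b ` mspace W" using w(1) bihom_subset_mspace by blast
    qed
  qed
  ultimately show ?thesis unfolding bij_betw_def by blast
qed

end

subsection \<open>Dimensions\<close>

lemma obtain_basis:
  assumes "cvec.subspace S"
  obtains B where "B \<subseteq> S" "cvec.independent B" "cvec.span B = S"
  by (metis assms cvec.maximal_independent_subset cvec.span_minimal subset_antisym)

text \<open>\<open>f\<close> is linear only on \<open>S\<close>, whereas images of independent sets
  and spans are controlled for maps linear on the whole type; a linear extension from the basis
  agrees with \<open>f\<close> on \<open>S\<close> and supplies this.\<close>

lemma clinear_bij_basis:
  fixes f :: "'a::complex_vector \<Rightarrow> 'b::complex_vector"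
  assumes lin: "clinear_on S T f" and bij: "bij_betw f S T" and S: "cvec.subspace S"
    and B: "B \<subseteq> S" "cvec.independent B" "cvec.span B = S"
  shows "cvec.independent (f ` B)" "cvec.span (f ` B) = T"
proof -
  interpret vector_space_pair "scaleC :: complex \<Rightarrow> 'a \<Rightarrow> 'a" "scaleC :: complex \<Rightarrow> 'b \<Rightarrow> 'b" ..
  obtain g where g: "Vector_Spaces.linear scaleC scaleC g" "\<forall>x\<in>B. g x = f x"
    using linear_independent_extend[OF B(2), of f] by blast
  have eq: "g x = f x \<and> x \<in> S" if "x \<in> S" for x
    using that unfolding B(3)[symmetric]
  proof (induction rule: cvec.span_induct_alt)
    case base
    then show ?case using clinear_on_zero[OF lin S] linear_0[OF g(1)] cvec.span_zero by metis
  next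
    case (step c x y)
    then have x: "x \<in> S" and y: "y \<in> S" and gy: "g y = f y" using B(1,3) by blast+
    have "g (c *\<^sub>C x + y) = c *\<^sub>C f x + f y"
      using g(2) step(1) gy by (simp add: linear_add[OF g(1)] linear_scale[OF g(1)])
    also have "\<dots> = f (c *\<^sub>C x + y)"
      using clinear_onD(2)[OF lin cvec.subspace_scale[OF S x] y] clinear_onD(3)[OF lin x] by simp
    finally show ?case
      using cvec.subspace_add[OF S cvec.subspace_scale[OF S x] y] B(3) by blast
  qed
  have "inj_on g S" using bij eq by (auto simp: bij_betw_def inj_on_def)
  then have "cvec.independent (g ` B)"
    by (intro linear_independent_injective_image[OF g(1) B(2)]) (simp add: B(3))
  moreover have "g ` B = f ` B" using g(2) by auto
  moreover have "cvec.span (g ` B) = g ` S"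
    using linear_span_image[OF g(1), of B] B(3) by simp
  moreover have "g ` S = T" using bij eq by (force simp: bij_betw_def)
  ultimately show "cvec.independent (f ` B)" "cvec.span (f ` B) = T" by simp_all
qed

lemma cardinal_dim_ordIso:
  fixes f :: "'a::complex_vector \<Rightarrow> 'b::complex_vector"
  assumes lin: "clinear_on S T f" and bij: "bij_betw f S T" and S: "cvec.subspace S" and T: "cvec.subspace T"
  shows "(cardinal_dim S, cardinal_dim T) \<in> ordIso"
proof -
  define B where "B = (SOME B. B \<subseteq> S \<and> cvec.independent B \<and> cvec.span B = S)"
  define C where "C = (SOME B. B \<subseteq> T \<and> cvec.independent B \<and> cvec.span B = T)"
  have B: "B \<subseteq> S \<and> cvec.independent B \<and> cvec.span B = S"
    unfolding B_def by (rule someI_ex) (metis obtain_basis[OF S])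
  have C: "C \<subseteq> T \<and> cvec.independent C \<and> cvec.span C = T"
    unfolding C_def by (rule someI_ex) (metis obtain_basis[OF T])
  have "cvec.independent (f ` B)" "cvec.span (f ` B) = T"
    using clinear_bij_basis[OF lin bij S] B by blast+
  then obtain g where "bij_betw g (f ` B) C"
    using cvec.bij_if_span_eq_span_bases[of "f ` B" C] C by auto
  moreover have "bij_betw f B (f ` B)"
    using bij B by (meson bij_betw_def inj_on_subset)
  ultimately have "bij_betw (g \<circ> f) B C" by (rule bij_betw_trans[rotated])
  then show ?thesis
    unfolding cardinal_dim_def B_def[symmetric] C_def[symmetric] by (auto intro: card_of_ordIsoI)
qed

subsection \<open>The space of intertwining operators\<close>

lemma log_intertwining_operatorD:
  assumes "log_intertwining_operator V W1 X Z I"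
  shows "w \<notin> mspace W1 \<or> x \<notin> mspace X \<Longrightarrow> I w x = 0"
    and "w \<in> mspace W1 \<Longrightarrow> clinear_on (mspace X) (mspace Z) (\<lambda>x. I w x e)"
    and "x \<in> mspace X \<Longrightarrow> clinear_on (mspace W1) (mspace Z) (\<lambda>w. I w x e)"
    and "w \<in> mspace W1 \<Longrightarrow> x \<in> mspace X \<Longrightarrow> finite {k. I w x (n, k) \<noteq> 0}"
    and "w \<in> mspace W1 \<Longrightarrow> x \<in> mspace X \<Longrightarrow> \<exists>M. \<forall>m\<ge>M. \<forall>k. I w x (n - of_nat m, k) = 0"
    and "w \<in> mspace W1 \<Longrightarrow> x \<in> mspace X \<Longrightarrow>
      jacobi_identity (module_op W1) (module_op X) (module_op Z) (\<lambda>a b n. I a b (n, k)) v w x"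
    and "w \<in> mspace W1 \<Longrightarrow> x \<in> mspace X \<Longrightarrow> I (L_mod W1 (-1) w) x = deriv_log (I w x)"
    and "w \<in> mspace W1 \<Longrightarrow> x \<in> mspace X \<Longrightarrow>
      sl2_bracket (L_mod W1) (L_mod X) (L_mod Z) (\<lambda>a b n. I a b (n, k)) w x"
  using assms unfolding log_intertwining_operator_def by blast+

text \<open>\<open>Sum_any\<close> is additive only for finite supports; this is what the Jacobi
  identity of a linear combination of operators requires. The first sum ends by truncation of the
  operator, the others by truncation on the vectors.\<close>

lemma jacobi_terms_finite:
  assumes "premodule W1" "premodule X" "premodule Z" and I: "log_intertwining_operator V W1 X Z I"
    and w: "w \<in> mspace W1" and x: "x \<in> mspace X"
  shows "finite {c. ((-1) ^ c * (of_int n gchoose c)) *\<^sub>C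
      module_op Z v (I w x (s - of_nat c, k)) (int c - m - n - 1) \<noteq> 0}"
    and "finite {b. ((-1) powi n * (-1) ^ b * (of_int n gchoose b)) *\<^sub>C
      I w (module_op X v x (- m - 1 - int b)) (s - of_int n + of_nat b, k) \<noteq> 0}"
    and "finite {a. (of_int m gchoose a) *\<^sub>C
      I (module_op W1 v w (- n - 1 - int a)) x (s - of_int m + of_nat a, k) \<noteq> 0}"
proof -
  interpret W1: premodule W1 by fact
  interpret X: premodule X by fact
  interpret Z: premodule Z by fact
  obtain M where M: "\<forall>m\<ge>M. \<forall>k. I w x (s - of_nat m, k) = 0"
    using I w x unfolding log_intertwining_operator_def by blast
  show "finite {c. ((-1) ^ c * (of_int n gchoose c)) *\<^sub>C
      module_op Z v (I w x (s - of_nat c, k)) (int c - m - n - 1) \<noteq> 0}"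
    by (rule finite_support_lessThan[of M])
      (use M clinear_on_zero[OF Z.op_linear Z.subspace_mspace] in simp)
  obtain e2 where e2: "\<forall>e<e2. module_op X v x e = 0" using X.op_truncated[OF x] by blast
  have lin2: "clinear_on (mspace X) (mspace Z) (\<lambda>x. I w x e)"
    and lin1: "clinear_on (mspace W1) (mspace Z) (\<lambda>w. I w x e)" for e
    using I w x unfolding log_intertwining_operator_def by blast+
  show "finite {b. ((-1) powi n * (-1) ^ b * (of_int n gchoose b)) *\<^sub>C
      I w (module_op X v x (- m - 1 - int b)) (s - of_int n + of_nat b, k) \<noteq> 0}"
  proof (rule finite_support_lessThan)
    fix b assume "b \<ge> nat (- m - e2)"
    then have "- m - 1 - int b < e2" by linarith
    then have "module_op X v x (- m - 1 - int b) = 0" using e2 by blast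
    then show "((-1) powi n * (-1) ^ b * (of_int n gchoose b)) *\<^sub>C
      I w (module_op X v x (- m - 1 - int b)) (s - of_int n + of_nat b, k) = 0"
      using clinear_on_zero[OF lin2 X.subspace_mspace] by simp
  qed
  obtain e3 where e3: "\<forall>e<e3. module_op W1 v w e = 0" using W1.op_truncated[OF w] by blast
  show "finite {a. (of_int m gchoose a) *\<^sub>C
      I (module_op W1 v w (- n - 1 - int a)) x (s - of_int m + of_nat a, k) \<noteq> 0}"
  proof (rule finite_support_lessThan)
    fix a assume "a \<ge> nat (- n - e3)"
    then have "- n - 1 - int a < e3" by linarith
    then have "module_op W1 v w (- n - 1 - int a) = 0" using e3 by blast
    then show "(of_int m gchoose a) *\<^sub>C
      I (module_op W1 v w (- n - 1 - int a)) x (s - of_int m + of_nat a, k) = 0"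
      using clinear_on_zero[OF lin1 W1.subspace_mspace] by simp
  qed
qed

lemma Sum_any_linear_combination:
  fixes f g :: "'i \<Rightarrow> 'a::complex_vector"
  assumes "finite {i. f i \<noteq> 0}" "finite {i. g i \<noteq> 0}" "\<And>i. h i = f i + c *\<^sub>C g i"
  shows "Sum_any h = Sum_any f + c *\<^sub>C Sum_any g"
proof -
  have "h = (\<lambda>i. f i + c *\<^sub>C g i)" using assms(3) by blast
  moreover have "finite {i. c *\<^sub>C g i \<noteq> 0}" by (rule finite_subset[OF _ assms(2)]) auto
  ultimately show ?thesis using assms(1,2) by (simp add: Sum_any.distrib Sum_any_scaleC)
qed

text \<open>One statement for both closure properties: c = 1 gives sums, and a zero first summand
  gives multiples.\<close>

lemma intertwining_space_combination:
  fixes Z :: "('v::complex_vector, 'z::complex_vector, 'g::ab_group_add) module_structure"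
  assumes "premodule W1" "premodule X" "premodule Z"
    and I: "I \<in> intertwining_space V W1 X Z" and J: "J \<in> intertwining_space V W1 X Z"
  shows "I + c *\<^sub>C J \<in> intertwining_space V W1 X Z"
proof -
  interpret W1: premodule W1 by fact
  interpret X: premodule X by fact
  interpret Z: premodule Z by fact
  let ?K = "I + c *\<^sub>C J"
  have I': "log_intertwining_operator V W1 X Z I" and J': "log_intertwining_operator V W1 X Z J"
    using I J by (auto simp: intertwining_space_def)
  note DI = log_intertwining_operatorD[OF I'] and DJ = log_intertwining_operatorD[OF J']
  have K: "?K w x e = I w x e + c *\<^sub>C J w x e" for w x e by simp
  note sub = cvec.subspace_add[OF Z.subspace_mspace] cvec.subspace_scale[OF Z.subspace_mspace]
  have "log_intertwining_operator V W1 X Z ?K"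
    unfolding log_intertwining_operator_def
  proof (intro conjI allI ballI impI)
    show "?K w x = 0" if "w \<notin> mspace W1 \<or> x \<notin> mspace X" for w x
      using DI(1) DJ(1) that by simp
    show "clinear_on (mspace X) (mspace Z) (\<lambda>x. ?K w x e)" if "w \<in> mspace W1" for w e
    proof -
      have "clinear_on (mspace X) (mspace Z) (\<lambda>x. I w x e)" "clinear_on (mspace X) (mspace Z) (\<lambda>x. J w x e)"
        by (rule DI(2)[OF that], rule DJ(2)[OF that])
      then show ?thesis
        unfolding K clinear_on_def using sub by (simp add: scaleC_add_right scaleC_scaleC mult.commute add_ac)
    qed
    show "clinear_on (mspace W1) (mspace Z) (\<lambda>w. ?K w x e)" if "x \<in> mspace X" for x e
    proof -
      have "clinear_on (mspace W1) (mspace Z) (\<lambda>w. I w x e)" "clinear_on (mspace W1) (mspace Z) (\<lambda>w. J w x e)"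
        by (rule DI(3)[OF that], rule DJ(3)[OF that])
      then show ?thesis
        unfolding K clinear_on_def using sub by (simp add: scaleC_add_right scaleC_scaleC mult.commute add_ac)
    qed
    fix w x assume w: "w \<in> mspace W1" and x: "x \<in> mspace X"
    have IJ: "I w x e \<in> mspace Z" "J w x e \<in> mspace Z" for e
      by (rule clinear_onD(1)[OF DI(2)[OF w] x], rule clinear_onD(1)[OF DJ(2)[OF w] x])
    show "finite {k. ?K w x (n, k) \<noteq> 0}" for n
    proof -
      have "finite {k. I w x (n, k) \<noteq> 0}" "finite {k. J w x (n, k) \<noteq> 0}"
        by (rule DI(4)[OF w x], rule DJ(4)[OF w x])
      then show ?thesis
        by (rule finite_subset[rotated, OF finite_UnI]) auto
    qed
    show "\<exists>M. \<forall>m\<ge>M. \<forall>k. ?K w x (n - of_nat m, k) = 0" for n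
    proof -
      obtain M N where "\<forall>m\<ge>M. \<forall>k. I w x (n - of_nat m, k) = 0" "\<forall>m\<ge>N. \<forall>k. J w x (n - of_nat m, k) = 0"
        using DI(5)[OF w x, of n] DJ(5)[OF w x, of n] by blast
      then have "\<forall>m\<ge>max M N. \<forall>k. ?K w x (n - of_nat m, k) = 0" by simp
      then show ?thesis by blast
    qed
    show "?K (L_mod W1 (-1) w) x = deriv_log (?K w x)"
    proof -
      have "I (L_mod W1 (-1) w) x = deriv_log (I w x)" "J (L_mod W1 (-1) w) x = deriv_log (J w x)"
        by (rule DI(7)[OF w x], rule DJ(7)[OF w x])
      then show ?thesis
        by (auto simp: fun_eq_iff deriv_log_def scaleC_add_right scaleC_scaleC mult.commute add_ac)
    qed
    show "sl2_bracket (L_mod W1) (L_mod X) (L_mod Z) (\<lambda>a b n. ?K a b (n, k)) w x" for k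
      unfolding sl2_bracket_def
    proof (intro ballI allI)
      fix j n assume j: "j \<in> {-1, 0, 1 :: int}"
      have "L_mod Z j (?K w x (n, k)) - ?K w (L_mod X j x) (n, k)
        = (L_mod Z j (I w x (n, k)) - I w (L_mod X j x) (n, k))
          + c *\<^sub>C (L_mod Z j (J w x (n, k)) - J w (L_mod X j x) (n, k))"
        unfolding K clinear_onD(2)[OF Z.L_linear[OF j] IJ(1) sub(2)[OF IJ(2)]]
          clinear_onD(3)[OF Z.L_linear[OF j] IJ(2)] by (simp add: cvec.scale_right_diff_distrib)
      also have "\<dots> = (\<Sum>i\<le>nat (j + 1). of_nat (nat (j + 1) choose i) *\<^sub>C ?K (L_mod W1 (j - int i) w) x (n - of_nat i, k))"
        unfolding DI(8)[OF w x, unfolded sl2_bracket_def, rule_format, OF j]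
          DJ(8)[OF w x, unfolded sl2_bracket_def, rule_format, OF j]
        by (simp add: scaleC_add_right sum.distrib cvec.scale_sum_right scaleC_scaleC mult.commute)
      finally show "L_mod Z j (?K w x (n, k)) - ?K w (L_mod X j x) (n, k)
        = (\<Sum>i\<le>nat (j + 1). of_nat (nat (j + 1) choose i) *\<^sub>C ?K (L_mod W1 (j - int i) w) x (n - of_nat i, k))" .
    qed
    show "jacobi_identity (module_op W1) (module_op X) (module_op Z) (\<lambda>a b n. ?K a b (n, k)) v w x" for v k
      unfolding jacobi_identity_iff
    proof (intro allI)
      fix m n s
      note fI = jacobi_terms_finite[OF assms(1-3) I' w x] and fJ = jacobi_terms_finite[OF assms(1-3) J' w x]
      have "jacobi_identity (module_op W1) (module_op X) (module_op Z) (\<lambda>a b n. I a b (n, k)) v w x"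
        "jacobi_identity (module_op W1) (module_op X) (module_op Z) (\<lambda>a b n. J a b (n, k)) v w x"
        by (rule DI(6)[OF w x], rule DJ(6)[OF w x])
      note jac = this[unfolded jacobi_identity_iff, rule_format, of n s m]
      have op: "module_op Z v (?K w x e) i = module_op Z v (I w x e) i + c *\<^sub>C module_op Z v (J w x e) i" for e i
        unfolding K clinear_onD(2)[OF Z.op_linear IJ(1) sub(2)[OF IJ(2)]] clinear_onD(3)[OF Z.op_linear IJ(2)] ..
      have lc: "b *\<^sub>C (p + c *\<^sub>C q) = b *\<^sub>C p + c *\<^sub>C (b *\<^sub>C q)" for b and p q :: 'z
        by (simp add: scaleC_add_right scaleC_scaleC mult.commute)
      show "Sum_any (\<lambda>i. ((-1) ^ i * (of_int n gchoose i)) *\<^sub>C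
            module_op Z v (?K w x (s - of_nat i, k)) (int i - m - n - 1))
          - Sum_any (\<lambda>b. ((-1) powi n * (-1) ^ b * (of_int n gchoose b)) *\<^sub>C
            ?K w (module_op X v x (- m - 1 - int b)) (s - of_int n + of_nat b, k))
          = Sum_any (\<lambda>a. (of_int m gchoose a) *\<^sub>C
            ?K (module_op W1 v w (- n - 1 - int a)) x (s - of_int m + of_nat a, k))"
        unfolding op
        unfolding K lc Sum_any_linear_combination[OF fI(1) fJ(1) refl]
          Sum_any_linear_combination[OF fI(2) fJ(2) refl] Sum_any_linear_combination[OF fI(3) fJ(3) refl]
          jac[symmetric] by (simp add: cvec.scale_right_diff_distrib)
    qed
  qed
  moreover have "grading_compatible W1 X Z ?K"
    unfolding grading_compatible_def
  proof (intro allI ballI)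
    fix \<beta> \<gamma> w x e assume "w \<in> grade_mod W1 \<beta>" "x \<in> grade_mod X \<gamma>"
    then have "I w x e \<in> grade_mod Z (\<beta> + \<gamma>)" "J w x e \<in> grade_mod Z (\<beta> + \<gamma>)"
      using I J unfolding intertwining_space_def grading_compatible_def by blast+
    then show "?K w x e \<in> grade_mod Z (\<beta> + \<gamma>)"
      unfolding K by (intro cvec.subspace_add[OF Z.subspace_grade] cvec.subspace_scale[OF Z.subspace_grade])
  qed
  ultimately show ?thesis by (simp add: intertwining_space_def)
qed

lemma zero_in_intertwining_space:
  assumes "premodule X" "premodule Z"
  shows "0 \<in> intertwining_space V W1 X Z"
proof -
  interpret X: premodule X by fact
  interpret Z: premodule Z by fact
  note z = clinear_on_zero[OF Z.L_linear Z.subspace_mspace] clinear_on_zero[OF Z.op_linear Z.subspace_mspace]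
    cvec.subspace_0[OF Z.subspace_mspace] cvec.subspace_0[OF Z.subspace_grade]
  show ?thesis
    by (simp add: intertwining_space_def grading_compatible_def log_intertwining_operator_def z clinear_on_def
        jacobi_identity_def sl2_bracket_def deriv_log_def fun_eq_iff case_prod_beta)
qed

lemma subspace_intertwining_space:
  assumes "premodule W1" "premodule X" "premodule Z"
  shows "cvec.subspace (intertwining_space V W1 X Z)"
proof (rule cvec.subspaceI)
  note z = zero_in_intertwining_space[OF assms(2,3)] and c = intertwining_space_combination[OF assms]
  show "0 \<in> intertwining_space V W1 X Z" by (rule z)
  show "I + J \<in> intertwining_space V W1 X Z"
    if "I \<in> intertwining_space V W1 X Z" "J \<in> intertwining_space V W1 X Z" for I J
    using c[OF that, of 1] by (simp only: scaleC_one)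
  show "c *\<^sub>C J \<in> intertwining_space V W1 X Z" if "J \<in> intertwining_space V W1 X Z" for c J
    using c[OF z that, of c] by (simp only: add_0)
qed

subsection \<open>Contragredient operators\<close>

locale module_triple = W1: sg_module A V W1 + W2: sg_module A V W2 + W3: sg_module A V W3
  for A :: "'g::ab_group_add set" and V :: "('v::complex_vector, 'g) vertex_structure"
    and W1 :: "('v, 'a::complex_vector, 'g) module_structure"
    and W2 :: "('v, 'b::complex_vector, 'g) module_structure"
    and W3 :: "('v, 'c::complex_vector, 'g) module_structure"
begin

abbreviation (input) "W2' \<equiv> contragredient V W2"
abbreviation (input) "W3' \<equiv> contragredient V W3"
abbreviation (input) "S \<equiv> intertwining_space V W1 W2 W3"
abbreviation (input) "S' \<equiv> intertwining_space V W1 W3' W2'"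
abbreviation (input) "Acon \<equiv> contragredient_operator V W1 W2 W3"
abbreviation (input) "Acon' \<equiv> contragredient_operator V W1 W3' W2'"

lemma adjoint_intertwiner_contragredient:
  assumes "Y \<in> S"
  shows "adjoint_intertwiner A V W1 W2 W2' W3' W3 (\<lambda>f w. f w) (\<lambda>w f. f w) Y"
proof -
  interpret P: pairing A V W2 W2' "\<lambda>w f. f w" by (rule W2.pairing_contragredient)
  interpret Q: pairing A V W3' W3 "\<lambda>f w. f w" by (rule W3.pairing_contragredient')
  show ?thesis by unfold_locales (use assms in \<open>auto simp: intertwining_space_def\<close>)
qed

lemma adjoint_intertwiner_contragredient':
  assumes "Z \<in> S'"
  shows "adjoint_intertwiner A V W1 W3' W3 W2 W2' (\<lambda>w f. f w) (\<lambda>f w. f w) Z"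
proof -
  interpret P: pairing A V W2 W2' "\<lambda>w f. f w" by (rule W2.pairing_contragredient)
  interpret Q: pairing A V W3' W3 "\<lambda>f w. f w" by (rule W3.pairing_contragredient')
  show ?thesis by unfold_locales (use assms in \<open>auto simp: intertwining_space_def\<close>)
qed

lemma contragredient_operator_eqI:
  assumes "\<And>w f e. w \<in> mspace W1 \<Longrightarrow> f \<in> mspace W3' \<Longrightarrow> Z w f e \<in> mspace W2'"
    and "\<And>w f. w \<notin> mspace W1 \<or> f \<notin> mspace W3' \<Longrightarrow> Z w f = 0"
    and "\<And>w f x e. w \<in> mspace W1 \<Longrightarrow> f \<in> mspace W3' \<Longrightarrow> x \<in> mspace W2 \<Longrightarrow>
      Z w f e x = f (apply_series (\<lambda>u. invert_x_log (Y u x)) (twisted_argument r W1 w) e)"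
  shows "Acon r Y = Z"
proof (intro ext)
  fix w f e x
  show "Acon r Y w f e x = Z w f e x"
    unfolding contragredient_operator_def
    using assms(1)[of w f e] assms(2)[of w f] assms(3)[of w f x e] W2.contragredient_mspaceD(2)[of "Z w f e" x]
    by (cases "w \<in> mspace W1 \<and> f \<in> mspace W3'"; cases "x \<in> mspace W2") auto
qed

lemma
  assumes Y: "Y \<in> S"
  shows contragredient_operator_in: "Acon r Y \<in> S'"
    and contragredient_operator_inverse: "w \<in> mspace W1 \<Longrightarrow> x \<in> mspace W2 \<Longrightarrow> f \<in> mspace W3' \<Longrightarrow>
      apply_series (\<lambda>u. invert_x_log (Acon r Y u f)) (twisted_argument (- r - 1) W1 w) e x = f (Y w x e)"
proof -
  interpret J: adjoint_intertwiner A V W1 W2 W2' W3' W3 "\<lambda>f w. f w" "\<lambda>w f. f w" Y r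
    by (rule adjoint_intertwiner_contragredient[OF Y])
  have eq: "Acon r Y = J.adjoint"
    by (rule contragredient_operator_eqI)
      (simp_all add: J.adjoint_mspace J.adjoint_outside J.adjoint_spec J.adj_coef_def J.adj_def)
  show "Acon r Y \<in> S'"
    unfolding eq using J.adjoint_intertwining J.adjoint_compatible by (simp add: intertwining_space_def)
  show "apply_series (\<lambda>u. invert_x_log (Acon r Y u f)) (twisted_argument (- r - 1) W1 w) e x = f (Y w x e)"
    if "w \<in> mspace W1" "x \<in> mspace W2" "f \<in> mspace W3'"
    unfolding eq by (rule J.adjoint_adjoint[OF that])
qed

text \<open>The preimage is built from \<open>Z\<close> with the pairs exchanged and r replaced by
  -r-1. Its values lie in W3 itself and not in a second contragredient, so it belongs to the
  required space directly.\<close>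

lemma contragredient_operator_surj:
  assumes Z: "Z \<in> S'"
  shows "Z \<in> Acon r ` S"
proof -
  interpret J: adjoint_intertwiner A V W1 W3' W3 W2 W2' "\<lambda>w f. f w" "\<lambda>f w. f w" Z "- r - 1"
    by (rule adjoint_intertwiner_contragredient'[OF Z])
  have eq: "Acon r J.adjoint = Z"
  proof (rule contragredient_operator_eqI)
    show "Z w f e x = f (apply_series (\<lambda>u. invert_x_log (J.adjoint u x)) (twisted_argument r W1 w) e)"
      if "w \<in> mspace W1" "f \<in> mspace W3'" "x \<in> mspace W2" for w f x e
      using J.adjoint_adjoint[OF that] by simp
  qed (use J.I_mspace J.I_outside in auto)
  have "J.adjoint \<in> S"
    by (simp only: intertwining_space_def mem_Collect_eq J.adjoint_intertwining J.adjoint_compatible simp_thms)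
  then show ?thesis by (subst eq[symmetric]) (rule imageI)
qed

lemma contragredient_operator_bidual:
  assumes Y: "Y \<in> S"
  shows "Acon' (- r - 1) (Acon r Y) = bidual_operator V W2 W3 Y"
proof (intro ext)
  fix w \<phi> e f
  interpret J: adjoint_intertwiner A V W1 W2 W2' W3' W3 "\<lambda>f w. f w" "\<lambda>w f. f w" Y r
    by (rule adjoint_intertwiner_contragredient[OF Y])
  interpret K: adjoint_intertwiner A V W1 W3' W3 W2 W2' "\<lambda>w f. f w" "\<lambda>f w. f w" "Acon r Y" "- r - 1"
    by (rule adjoint_intertwiner_contragredient'[OF contragredient_operator_in[OF Y]])
  show "Acon' (- r - 1) (Acon r Y) w \<phi> e f = bidual_operator V W2 W3 Y w \<phi> e f"
  proof (cases "w \<in> mspace W1 \<and> \<phi> \<in> mspace (contragredient V W2') \<and> f \<in> mspace W3'")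
    case True
    then obtain x where x: "x \<in> mspace W2" "\<phi> = to_bidual V W2 x"
      using W2.to_bidual_bij by (auto simp: bij_betw_def)
    have inv: "inv_into (mspace W2) (to_bidual V W2) \<phi> = x"
      unfolding x(2) by (rule bij_betw_inv_into_left[OF W2.to_bidual_bij x(1)])
    \<comment> \<open>Membership in W2' is needed to unfold \<open>to_bidual\<close>, which would
      otherwise take its default value 0 at this functional.\<close>
    have "apply_series (\<lambda>u. invert_x_log (Acon r Y u f)) (twisted_argument (- r - 1) W1 w) e \<in> mspace W2'"
      using K.adj_mspace[of w f e] True by (simp add: K.adj_def)
    then have "\<phi> (apply_series (\<lambda>u. invert_x_log (Acon r Y u f)) (twisted_argument (- r - 1) W1 w) e)
      = f (Y w x e)"
      using contragredient_operator_inverse[OF Y, of w x f r e] True x(1)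
      by (simp add: x(2) to_bidual_def)
    then show ?thesis
      using True by (simp add: contragredient_operator_def[of V W1 W3'] bidual_operator_def to_bidual_def inv)
  next
    case False
    then have "bidual_operator V W2 W3 Y w \<phi> e f = 0"
      using J.I_outside[of w "inv_into (mspace W2) (to_bidual V W2) \<phi>"] clinear_on_zero[OF W3.contragredient_mspaceD(1) W3.mod_subspace]
      by (auto simp: bidual_operator_def to_bidual_def)
    then show ?thesis using False by (auto simp: contragredient_operator_def[of V W1 W3'])
  qed
qed

text \<open>By the inversion formula the contragredient operator determines all values f (Y w x e),
  and W3' separates the points of W3.\<close>

lemma contragredient_operator_inj: "inj_on (Acon r) S"
proof (rule inj_onI)
  fix Y Z assume Y: "Y \<in> S" and Z: "Z \<in> S" and eq: "Acon r Y = Acon r Z"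
  interpret Y: adjoint_intertwiner A V W1 W2 W2' W3' W3 "\<lambda>f w. f w" "\<lambda>w f. f w" Y r
    by (rule adjoint_intertwiner_contragredient[OF Y])
  interpret Z: adjoint_intertwiner A V W1 W2 W2' W3' W3 "\<lambda>f w. f w" "\<lambda>w f. f w" Z r
    by (rule adjoint_intertwiner_contragredient[OF Z])
  have "Y w x e = Z w x e" if w: "w \<in> mspace W1" and x: "x \<in> mspace W2" for w x e
  proof (rule Y.B_eqI)
    show "Y w x e \<in> mspace W3" "Z w x e \<in> mspace W3" by (rule Y.I_mspace[OF w x], rule Z.I_mspace[OF w x])
    show "f (Y w x e) = f (Z w x e)" if "f \<in> mspace W3'" for f
      using contragredient_operator_inverse[OF Y w x that, of r e] contragredient_operator_inverse[OF Z w x that, of r e]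
      by (simp add: eq)
  qed
  then have "Y w x = Z w x" for w x
    using Y.I_outside[of w x] Z.I_outside[of w x] by (cases "w \<in> mspace W1 \<and> x \<in> mspace W2") auto
  then show "Y = Z" by blast
qed

lemma contragredient_operator_combination:
  assumes Y: "Y \<in> S" and Z: "Z \<in> S"
  shows "Acon r (Y + c *\<^sub>C Z) = Acon r Y + c *\<^sub>C Acon r Z"
proof (intro ext)
  fix w f e x
  interpret Y: adjoint_intertwiner A V W1 W2 W2' W3' W3 "\<lambda>f w. f w" "\<lambda>w f. f w" Y r
    by (rule adjoint_intertwiner_contragredient[OF Y])
  interpret Z: adjoint_intertwiner A V W1 W2 W2' W3' W3 "\<lambda>f w. f w" "\<lambda>w f. f w" Z r
    by (rule adjoint_intertwiner_contragredient[OF Z])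
  interpret YZ: adjoint_intertwiner A V W1 W2 W2' W3' W3 "\<lambda>f w. f w" "\<lambda>w f. f w" "Y + c *\<^sub>C Z" r
    by (rule adjoint_intertwiner_contragredient)
      (rule intertwining_space_combination[OF W1.premodule_axioms W2.premodule_axioms W3.premodule_axioms Y Z])
  show "Acon r (Y + c *\<^sub>C Z) w f e x = (Acon r Y + c *\<^sub>C Acon r Z) w f e x"
  proof (cases "w \<in> mspace W1 \<and> f \<in> mspace W3' \<and> x \<in> mspace W2")
    case True
    then have w: "w \<in> mspace W1" and f: "f \<in> mspace W3'" and x: "x \<in> mspace W2" by auto
    have "shift_series i (invert_x_log ((Y + c *\<^sub>C Z) u x)) e
      = shift_series i (invert_x_log (Y u x)) e + c *\<^sub>C shift_series i (invert_x_log (Z u x)) e" for i u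
    proof -
      have "invert_x_log ((Y + c *\<^sub>C Z) u x) = (\<lambda>e. invert_x_log (Y u x) e + c *\<^sub>C invert_x_log (Z u x) e)"
        by (auto simp: fun_eq_iff invert_x_log_def scaleC_add_right scaleC_scaleC mult.commute)
      then show ?thesis
        by (simp only: shift_series_plus shift_series_map[where h = "\<lambda>z. c *\<^sub>C z", OF cvec.scale_zero_right])
    qed
    then have "YZ.adj w x e = Y.adj w x e + c *\<^sub>C Z.adj w x e"
      unfolding YZ.adj_eq_sum[OF w x] Y.adj_eq_sum[OF w x] Z.adj_eq_sum[OF w x]
      by (simp add: sum.distrib cvec.scale_sum_right)
    then have "f (YZ.adj w x e) = f (Y.adj w x e) + c * f (Z.adj w x e)"
      using clinear_onD(2,3)[OF W3.contragredient_mspaceD(1)[OF f]] Y.adj_mspace[OF w x] Z.adj_mspace[OF w x]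
        cvec.subspace_scale[OF W3.mod_subspace] by simp
    then show ?thesis
      using True by (simp add: contragredient_operator_def Y.adj_def Z.adj_def YZ.adj_def)
  qed (auto simp: contragredient_operator_def)
qed

lemma contragredient_operator_linear: "clinear_on S S' (Acon r)"
  unfolding clinear_on_def
proof (intro conjI ballI allI)
  note z = zero_in_intertwining_space[OF W2.premodule_axioms W3.premodule_axioms]
  show "Acon r Y \<in> S'" if "Y \<in> S" for Y by (rule contragredient_operator_in[OF that])
  show add: "Acon r (Y + Z) = Acon r Y + Acon r Z" if "Y \<in> S" "Z \<in> S" for Y Z
    using contragredient_operator_combination[OF that, of r 1] by (simp only: scaleC_one)
  have zero: "Acon r 0 = 0"
    using add[OF z z] unfolding add_0 add_cancel_right_right .
  show "Acon r (c *\<^sub>C Z) = c *\<^sub>C Acon r Z" if "Z \<in> S" for c Z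
    using contragredient_operator_combination[OF z that, of r c] unfolding zero add_0 .
qed

lemma contragredient_operator_bij: "bij_betw (Acon r) S S'"
  unfolding bij_betw_def
  using contragredient_operator_inj contragredient_operator_in contragredient_operator_surj by blast

lemma fusion_rule_ordIso: "(fusion_rule V W1 W2 W3, fusion_rule V W1 W3' W2') \<in> ordIso"
  unfolding fusion_rule_def
  by (intro cardinal_dim_ordIso[OF contragredient_operator_linear contragredient_operator_bij[of 0]]
      subspace_intertwining_space W1.premodule_axioms W2.premodule_axioms W3.premodule_axioms
      W2.contragredient_premodule W3.contragredient_premodule)

end

theorem proposition3p46:
  fixes A :: "'g::ab_group_add set"
    and V :: "('v::complex_vector, 'g) vertex_structure"
    and W1 :: "('v, 'a::complex_vector, 'g) module_structure"
    and W2 :: "('v, 'b::complex_vector, 'g) module_structure"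
    and W3 :: "('v, 'c::complex_vector, 'g) module_structure"
    and r :: int
  assumes "is_subgroup A"
    and "strongly_graded_vertex_algebra A V"
    and "strongly_graded_module A V W1"
    and "strongly_graded_module A V W2"
    and "strongly_graded_module A V W3"
  defines "W2' \<equiv> contragredient V W2"
    and "W3' \<equiv> contragredient V W3"
  shows
    "(\<forall>\<Y>. log_intertwining_operator V W1 W2 W3 \<Y> \<and> grading_compatible W1 W2 W3 \<Y> \<longrightarrow>
        log_intertwining_operator V W1 W3' W2' (contragredient_operator V W1 W2 W3 r \<Y>) \<and>
        grading_compatible W1 W3' W2' (contragredient_operator V W1 W2 W3 r \<Y>) \<and>
        contragredient_operator V W1 W3' W2' (- r - 1) (contragredient_operator V W1 W2 W3 r \<Y>)
          = bidual_operator V W2 W3 \<Y> \<and>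
        contragredient_operator V W1 W3' W2' r (contragredient_operator V W1 W2 W3 (- r - 1) \<Y>)
          = bidual_operator V W2 W3 \<Y>) \<and>
     clinear_on (intertwining_space V W1 W2 W3) (intertwining_space V W1 W3' W2')
       (contragredient_operator V W1 W2 W3 r) \<and>
     bij_betw (contragredient_operator V W1 W2 W3 r)
       (intertwining_space V W1 W2 W3) (intertwining_space V W1 W3' W2') \<and>
     (fusion_rule V W1 W2 W3, fusion_rule V W1 W3' W2') \<in> ordIso"
proof -
  interpret module_triple A V W1 W2 W3 by unfold_locales (use assms in auto)
  \<comment> \<open>The second equality is the first one for -r-1 in place of r, since -(-r-1)-1 =
    r.\<close>
  have bidual: "contragredient_operator V W1 W3' W2' r (contragredient_operator V W1 W2 W3 (- r - 1) \<Y>)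
      = bidual_operator V W2 W3 \<Y>" if "\<Y> \<in> intertwining_space V W1 W2 W3" for \<Y>
    using contragredient_operator_bidual[OF that, of "- r - 1"] by (simp add: W2'_def W3'_def)
  show ?thesis
    using contragredient_operator_in contragredient_operator_bidual bidual contragredient_operator_linear
      contragredient_operator_bij fusion_rule_ordIso
    unfolding W2'_def W3'_def intertwining_space_def by (intro conjI allI impI) blast+
qed

end
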